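(* Let $X\subset\mathbb{P}^N$ be a decomposable scroll generated by $C_1,\dots,C_n$ with $\Phi_2(X)\ne X$, and let $d_i=\deg C_i$ for $i=1,\dots,n$. Suppose that $G$ is an irreducible component of type (2) of $\Phi_2(X)$. Then $\mathcal{D}_G$ is a rational normal scroll if and only if, up to reordering the curves, $d_1=\dots=d_s=1$ and $d_{s+1}=\dots=d_n=2$ for some $s\ge 1$.
   Context: We work over $\mathbb{C}$. For a vector space $W$, $\mathbb{P}(W)$ is the set of codimension-one subspaces of $W$; $\langle\cdot\rangle$ denotes linear span. Scroll. A scroll is an embedded smooth projective variety $Y\subset\mathbb{P}^M$ of dimension $\ge 1$ endowed with a morphism $\pi:Y\to B$ over a smooth curve $B$ such that $(f,\mathcal{O}_{\mathbb{P}^M}(1)|_f)=(\mathbb{P}^{\dim Y-1},\mathcal{O}(1))$ for every fibre $f$ of $\pi$ (and $Y=B$ if $\dim Y=1$). It is rational if $B\cong\mathbb{P}^1$, and a rational normal scroll if moreover it is linearly normally embedded in its linear span (equivalently, its degree equals its codimension in its linear span plus one). Decomposable scroll. Let $C$ be a smooth projective curve. For $i=1,\dots,n$ let $\mathcal{L}_i$ be a very ample line bundle on $C$ and $V_i\subseteq H^0(C,\mathcal{L}_i)$ a subspace such that $|V_i|$ gives an embedding $\varphi_i:C\to\mathbb{P}^{r_i}=\mathbb{P}(V_i)$; put $C_i=\varphi_i(C)$. Let $V=\bigoplus_i V_i$, $\mathcal{E}=\bigoplus_i\mathcal{L}_i$, $P=\mathbb{P}(\mathcal{E})$ and let $L$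 be the tautological line bundle on $P$. Identifying $V$ with a subspace of $H^0(P,L)$ one gets an embedding $\varphi:P\to\mathbb{P}^N=\mathbb{P}(V)$, $N=\sum_i r_i+n-1$. Its image $X=\varphi(P)$ is called the decomposable scroll generated by $C_1,\dots,C_n$. For $p\in C$ put $p_i=\varphi_i(p)\in C_i\subset\mathbb{P}^{r_i}\subset \mathbb{P}^N$, the $\mathbb{P}^{r_i}$ being embedded as linearly independent subspaces spanning $\mathbb{P}^N$; the fibre of $X$ over $p$ is $f_p=\langle p_1,\dots,p_n\rangle\cong\mathbb{P}^{n-1}$. Osculating spaces and inflectional loci. For a smooth $Y\subset\mathbb{P}(W)$ with hyperplane bundle $L$ and $y\in Y$, let $j_{k,y}:W\to (J_kL)_y$ be the map sending a section to its $k$-th jet at $y$ ($J_kL$ the $k$-th jet bundle). The $k$-th osculating space is $\mathrm{Osc}^k_y(Y)=\mathbb{P}(\mathrm{Im}\, j_{k,y})\subseteq\mathbb{P}(W)$, a linear subspace of dimension $\mathrm{rk}(j_{k,y})-1$. If $Y$ is a scroll of dimension $n$ (a curve if $n=1$), then $\dim\mathrm{Osc}^k_y(Y)\le nk$, and $\Phi_k(Y)=\{y\in Y:\dim\mathrm{Osc}^k_y(Y)<nk\}$. Components of type (2). An irreducible component $G$ of $\Phi_2(X)$ is of type (2) if $C\cong\mathbb{P}^1$ and, up to reordering the curves, $C_1,\dots,C_s$ ($s\ge1$) are lines, $\deg C_i\ge2$ for $i>s$, and $G=\bigcup_{p\in C}\langle p_1,\dots,p_s\rangle\cong\mathbb{P}^1\times\mathbb{P}^{s-1}$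 is the sub-scroll generated by $C_1,\dots,C_s$. (The other possible components, of type (1), are linear subspaces $\langle p_{i_1},\dots,p_{i_s}\rangle$ of a single fibre $f_p$.) The set $\mathcal{D}_G$. $\mathcal{D}_G=\{H\in\mathbb{P}^{N\vee}: H\supseteq\mathrm{Osc}^2_x(X)\text{ for some }x\in G\}$, where $\mathbb{P}^{N\vee}$ is the dual projective space of hyperplanes. *)

theory Defs
  imports "HOL-Analysis.Analysis" "HOL-Library.Function_Algebras" "HOL-Combinatorics.Permutations"
begin

(* Vectors are functions 'i => complex that vanish outside a finite index set I, so that projective
   spaces of varying dimension, and direct sums of them, live in one type.  A point of projective
   space is a one-dimensional subspace, hence itself a set of vectors. *)

type_synonym 'i vec = "'i \<Rightarrow> complex"
type_synonym 'i point = "'i vec set"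

definition cscale :: "complex \<Rightarrow> 'i vec \<Rightarrow> 'i vec" where
  "cscale c v = (\<lambda>i. c * v i)"

global_interpretation cv: vector_space "cscale :: complex \<Rightarrow> 'i vec \<Rightarrow> 'i vec"
  by unfold_locales (auto simp: cscale_def algebra_simps plus_fun_def)

definition vecs :: "'i set \<Rightarrow> 'i vec set" where
  "vecs I = {v. \<forall>i. i \<notin> I \<longrightarrow> v i = 0}"

definition pair :: "'i set \<Rightarrow> 'i vec \<Rightarrow> 'i vec \<Rightarrow> complex" where
  "pair I h v = (\<Sum>i\<in>I. h i * v i)"

(* The linear subspace of projective space defined by a vector subspace U. *)
definition PP :: "'i vec set \<Rightarrow> 'i point set" where
  "PP U = {cv.span {v} | v. v \<in> U \<and> v \<noteq> 0}"

abbreviation proj_space :: "'i set \<Rightarrow> 'i point set" where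
  "proj_space I \<equiv> PP (vecs I)"

(* Homogeneous coordinates of a point.  Everything below is independent of the choice: only
   vanishing of forms and quotients of forms of equal degree are evaluated at rep q. *)
definition rep :: "'i point \<Rightarrow> 'i vec" where
  "rep q = (SOME v. v \<in> q \<and> v \<noteq> 0)"

definition lspan :: "'i point set \<Rightarrow> 'i point set" where
  "lspan S = PP (cv.span (\<Union>S))"

definition ldim :: "'i point set \<Rightarrow> int" where
  "ldim S = int (cv.dim (\<Union>S)) - 1"

definition is_line :: "'i point set \<Rightarrow> bool" where
  "is_line Y \<longleftrightarrow> (\<exists>U. cv.subspace U \<and> cv.dim U = 2 \<and> Y = PP U)"


section \<open>Projective varieties\<close>

(* Homogeneous polynomial of degree d in the coordinates I (the zero form has every degree). *)
definition hform :: "'i set \<Rightarrow> nat \<Rightarrow> ('i vec \<Rightarrow> complex) \<Rightarrow> bool" where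
  "hform I d f \<longleftrightarrow> (\<exists>c :: ('i \<Rightarrow> nat) \<Rightarrow> complex. \<forall>v.
     f v = (\<Sum>\<alpha> | (\<forall>i. i \<notin> I \<longrightarrow> \<alpha> i = 0) \<and> sum \<alpha> I = d. c \<alpha> * (\<Prod>i\<in>I. v i ^ \<alpha> i)))"

definition zclosed :: "'i set \<Rightarrow> 'i point set \<Rightarrow> bool" where
  "zclosed I A \<longleftrightarrow> (\<exists>F. (\<forall>f\<in>F. \<exists>d. hform I d f) \<and> A = {q \<in> proj_space I. \<forall>f\<in>F. f (rep q) = 0})"

definition zirreducible :: "'i set \<Rightarrow> 'i point set \<Rightarrow> bool" where
  "zirreducible I Z \<longleftrightarrow> Z \<noteq> {} \<and> Z \<subseteq> proj_space I \<and>
     (\<forall>A B. zclosed I A \<and> zclosed I B \<and> Z \<subseteq> A \<union> B \<longrightarrow> Z \<subseteq> A \<or> Z \<subseteq> B)"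

definition irreducible_component :: "'i set \<Rightarrow> 'i point set \<Rightarrow> 'i point set \<Rightarrow> bool" where
  "irreducible_component I Y G \<longleftrightarrow> zirreducible I G \<and> G \<subseteq> Y \<and>
     (\<forall>Z. zirreducible I Z \<and> G \<subseteq> Z \<and> Z \<subseteq> Y \<longrightarrow> Z = G)"

definition projective_variety :: "'i set \<Rightarrow> 'i point set \<Rightarrow> bool" where
  "projective_variety I Y \<longleftrightarrow> finite I \<and> zclosed I Y \<and> zirreducible I Y"

(* Krull dimension. *)
definition vdim :: "'i set \<Rightarrow> 'i point set \<Rightarrow> nat" where
  "vdim I Y = (GREATEST m. \<exists>Z :: nat \<Rightarrow> 'i point set.
     (\<forall>j\<le>m. zclosed I (Z j) \<and> zirreducible I (Z j) \<and> Z j \<subseteq> Y) \<and> (\<forall>j<m. Z j \<subset> Z (Suc j)))"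

(* Affine cone over the embedded Zariski tangent space. *)
definition tangent_cone :: "'i set \<Rightarrow> 'i point set \<Rightarrow> 'i point \<Rightarrow> 'i vec set" where
  "tangent_cone I Y y = {w \<in> vecs I. \<forall>d f. hform I d f \<and> (\<forall>q\<in>Y. f (rep q) = 0) \<longrightarrow>
     deriv (\<lambda>t. f (rep y + cscale t w)) 0 = 0}"

definition smooth_variety :: "'i set \<Rightarrow> 'i point set \<Rightarrow> bool" where
  "smooth_variety I Y \<longleftrightarrow> projective_variety I Y \<and>
     (\<forall>y\<in>Y. cv.dim (tangent_cone I Y y) = vdim I Y + 1)"

definition smooth_curve :: "'i set \<Rightarrow> 'i point set \<Rightarrow> bool" where
  "smooth_curve I Y \<longleftrightarrow> smooth_variety I Y \<and> vdim I Y = 1"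

(* P holds on a Zariski neighbourhood of y in Y. *)
definition nearby :: "'i set \<Rightarrow> 'i point set \<Rightarrow> 'i point \<Rightarrow> ('i point \<Rightarrow> bool) \<Rightarrow> bool" where
  "nearby I Y y P \<longleftrightarrow> (\<exists>A. zclosed I A \<and> y \<notin> A \<and> (\<forall>q\<in>Y - A. P q))"

definition morphism :: "'i set \<Rightarrow> 'i point set \<Rightarrow> 'k set \<Rightarrow> 'k point set \<Rightarrow> ('i point \<Rightarrow> 'k point) \<Rightarrow> bool" where
  "morphism I Y K Z \<phi> \<longleftrightarrow> \<phi> ` Y \<subseteq> Z \<and>
     (\<forall>y\<in>Y. \<exists>d F. (\<forall>k\<in>K. hform I d (F k)) \<and> (\<exists>k\<in>K. F k (rep y) \<noteq> 0) \<and>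
        nearby I Y y (\<lambda>q. \<phi> q = cv.span {\<lambda>k. if k \<in> K then F k (rep q) else 0}))"

definition isomorphism :: "'i set \<Rightarrow> 'i point set \<Rightarrow> 'k set \<Rightarrow> 'k point set \<Rightarrow> ('i point \<Rightarrow> 'k point) \<Rightarrow> bool" where
  "isomorphism I Y K Z \<phi> \<longleftrightarrow> morphism I Y K Z \<phi> \<and>
     (\<exists>\<psi>. morphism K Z I Y \<psi> \<and> (\<forall>y\<in>Y. \<psi> (\<phi> y) = y) \<and> (\<forall>z\<in>Z. \<phi> (\<psi> z) = z))"

definition closed_embedding :: "'i set \<Rightarrow> 'i point set \<Rightarrow> 'k set \<Rightarrow> ('i point \<Rightarrow> 'k point) \<Rightarrow> bool" where
  "closed_embedding I Y K \<phi> \<longleftrightarrow> projective_variety K (\<phi> ` Y) \<and> isomorphism I Y K (\<phi> ` Y) \<phi>"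

definition is_P1 :: "'i set \<Rightarrow> 'i point set \<Rightarrow> bool" where
  "is_P1 I Y \<longleftrightarrow> (\<exists>\<phi>. isomorphism I Y {..1::nat} (proj_space {..1}) \<phi>)"

(* The hyperplane with coordinate vector rep \<eta>, for a point \<eta> of the dual projective space. *)
definition hyperplane :: "'i set \<Rightarrow> 'i point \<Rightarrow> 'i point set" where
  "hyperplane I \<eta> = {q \<in> proj_space I. pair I (rep \<eta>) (rep q) = 0}"

(* Degree of a curve: number of points on a general hyperplane section. *)
definition curve_degree :: "'i set \<Rightarrow> 'i point set \<Rightarrow> nat" where
  "curve_degree I Y = (THE d. \<exists>A. zclosed I A \<and> A \<noteq> proj_space I \<and>
     (\<forall>\<eta>\<in>proj_space I - A. finite (Y \<inter> hyperplane I \<eta>) \<and> card (Y \<inter> hyperplane I \<eta>) = d))"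


section \<open>Local rings, jets and osculating spaces\<close>

(* Elements of the local ring of Y at y are represented by functions on points that are
   quotients of forms of equal degree near y; their values away from y are irrelevant. *)
definition regular_at :: "'i set \<Rightarrow> 'i point set \<Rightarrow> 'i point \<Rightarrow> ('i point \<Rightarrow> complex) \<Rightarrow> bool" where
  "regular_at I Y y g \<longleftrightarrow> (\<exists>d a b. hform I d a \<and> hform I d b \<and> b (rep y) \<noteq> 0 \<and>
     nearby I Y y (\<lambda>q. g q = a (rep q) / b (rep q)))"

(* k-th power of the maximal ideal of the local ring (the whole ring for k = 0). *)
definition max_ideal_pow :: "'i set \<Rightarrow> 'i point set \<Rightarrow> 'i point \<Rightarrow> nat \<Rightarrow> ('i point \<Rightarrow> complex) set" where
  "max_ideal_pow I Y y k = {g. \<exists>(m::nat) (c :: nat \<Rightarrow> 'i point \<Rightarrow> complex) (u :: nat \<Rightarrow> nat \<Rightarrow> 'i point \<Rightarrow> complex).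
     (\<forall>i<m. regular_at I Y y (c i)) \<and>
     (\<forall>i<m. \<forall>j<k. regular_at I Y y (u i j) \<and> u i j y = 0) \<and>
     nearby I Y y (\<lambda>q. g q = (\<Sum>i<m. c i q * (\<Prod>j<k. u i j q)))}"

(* Kernel of the k-th jet map j_{k,y} on linear forms (given by coefficient vectors h).  The fibre of
   the jet bundle is L \<otimes> O/m^(k+1); a linear form l not vanishing at y trivialises L near y and turns
   the section h into the function h/l. *)
definition jet_kernel :: "'i set \<Rightarrow> 'i point set \<Rightarrow> nat \<Rightarrow> 'i point \<Rightarrow> 'i vec set" where
  "jet_kernel I Y k y = {h \<in> vecs I. \<exists>l\<in>vecs I. pair I l (rep y) \<noteq> 0 \<and>
     (\<lambda>q. pair I h (rep q) / pair I l (rep q)) \<in> max_ideal_pow I Y y (Suc k)}"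

(* P(Im j_{k,y}): hyperplanes of the image of the jet map are the hyperplanes of the space of linear
   forms containing its kernel, i.e. the points at which the kernel vanishes. *)
definition Osc :: "'i set \<Rightarrow> 'i point set \<Rightarrow> nat \<Rightarrow> 'i point \<Rightarrow> 'i point set" where
  "Osc I Y k y = PP {v \<in> vecs I. \<forall>h\<in>jet_kernel I Y k y. pair I h v = 0}"

definition inflectional_locus :: "'i set \<Rightarrow> 'i point set \<Rightarrow> nat \<Rightarrow> 'i point set" where
  "inflectional_locus I Y k = {y \<in> Y. ldim (Osc I Y k y) < int (vdim I Y * k)}"

definition osculating_hyperplanes :: "'i set \<Rightarrow> 'i point set \<Rightarrow> 'i point set \<Rightarrow> 'i point set" where
  "osculating_hyperplanes I X G = {\<eta> \<in> proj_space I. \<exists>x\<in>G. Osc I X 2 x \<subseteq> hyperplane I \<eta>}"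


section \<open>Scrolls\<close>

(* The ideal of the fibre of \<pi> over b in the local ring at each of its points is generated by the
   pullback of the maximal ideal of b, i.e. the scheme-theoretic fibre is reduced. *)
definition reduced_fibre ::
  "'i set \<Rightarrow> 'i point set \<Rightarrow> 'k set \<Rightarrow> 'k point set \<Rightarrow> ('i point \<Rightarrow> 'k point) \<Rightarrow> 'k point \<Rightarrow> bool" where
  "reduced_fibre I Y K B \<pi> b \<longleftrightarrow> (\<forall>y\<in>Y. \<pi> y = b \<longrightarrow>
     (\<forall>g. regular_at I Y y g \<and> nearby I Y y (\<lambda>q. \<pi> q = b \<longrightarrow> g q = 0) \<longrightarrow>
        (\<exists>(m::nat) c u. (\<forall>i<m. regular_at I Y y (c i) \<and> regular_at K B b (u i) \<and> u i b = 0) \<and>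
           nearby I Y y (\<lambda>q. g q = (\<Sum>i<m. c i q * u i (\<pi> q))))))"

definition scroll_over ::
  "'i set \<Rightarrow> 'i point set \<Rightarrow> 'k set \<Rightarrow> 'k point set \<Rightarrow> ('i point \<Rightarrow> 'k point) \<Rightarrow> bool" where
  "scroll_over I Y K B \<pi> \<longleftrightarrow> smooth_variety I Y \<and> vdim I Y \<ge> 1 \<and> smooth_curve K B \<and> morphism I Y K B \<pi> \<and>
     (\<forall>b\<in>B. reduced_fibre I Y K B \<pi> b \<and>
        (\<exists>U. cv.subspace U \<and> cv.dim U = vdim I Y \<and> {y \<in> Y. \<pi> y = b} = PP U)) \<and>
     (vdim I Y = 1 \<longrightarrow> isomorphism I Y K B \<pi>)"

(* Global sections of O_Y(1), as functions on the punctured affine cone over Y that are locally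
   quotients of forms whose degrees differ by one. *)
definition section_O1 :: "'i set \<Rightarrow> 'i point set \<Rightarrow> ('i vec \<Rightarrow> complex) \<Rightarrow> bool" where
  "section_O1 I Y \<sigma> \<longleftrightarrow> (\<forall>y\<in>Y. \<exists>d a b. hform I (Suc d) a \<and> hform I d b \<and> b (rep y) \<noteq> 0 \<and>
     nearby I Y y (\<lambda>q. \<forall>v\<in>q - {0}. \<sigma> v = a v / b v))"

(* Every section of O_Y(1) is cut out by a linear form.  Linear forms on the ambient space and on the
   linear span of Y have the same restrictions, so this is linear normality in the linear span. *)
definition linearly_normal :: "'i set \<Rightarrow> 'i point set \<Rightarrow> bool" where
  "linearly_normal I Y \<longleftrightarrow> (\<forall>\<sigma>. section_O1 I Y \<sigma> \<longrightarrow>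
     (\<exists>h\<in>vecs I. \<forall>q\<in>Y. \<forall>v\<in>q - {0}. \<sigma> v = pair I h v))"

definition rational_normal_scroll :: "'i set \<Rightarrow> 'i point set \<Rightarrow> bool" where
  "rational_normal_scroll I Y \<longleftrightarrow>
     (\<exists>(K :: nat set) B \<pi>. scroll_over I Y K B \<pi> \<and> is_P1 K B) \<and> linearly_normal I Y"


section \<open>Decomposable scrolls\<close>

(* Coordinates of P^(r_i) are indexed by pairs (i,j) with j \<le> r i; their union over i < n indexes
   P^N, which makes the P^(r_i) independent linear subspaces spanning P^N. *)
definition blk :: "(nat \<Rightarrow> nat) \<Rightarrow> nat \<Rightarrow> (nat \<times> nat) set" where
  "blk r i = {i} \<times> {..r i}"

definition amb :: "nat \<Rightarrow> (nat \<Rightarrow> nat) \<Rightarrow> (nat \<times> nat) set" where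
  "amb n r = (\<Union>i<n. blk r i)"

(* An embedding given by a space V_i of sections of a line bundle is a closed embedding
   with nondegenerate image (sections in V_i correspond to linear forms on P(V_i)). *)
definition decomposable_scroll_data ::
  "nat set \<Rightarrow> nat point set \<Rightarrow> nat \<Rightarrow> (nat \<Rightarrow> nat) \<Rightarrow> (nat \<Rightarrow> nat point \<Rightarrow> (nat \<times> nat) point) \<Rightarrow> bool" where
  "decomposable_scroll_data K C n r \<phi> \<longleftrightarrow> n \<ge> 1 \<and> smooth_curve K C \<and>
     (\<forall>i<n. closed_embedding K C (blk r i) (\<phi> i) \<and> lspan (\<phi> i ` C) = proj_space (blk r i))"

(* The scroll generated by the curves \<phi> i ` C, i \<in> S. *)
definition generated_scroll ::
  "nat point set \<Rightarrow> (nat \<Rightarrow> nat point \<Rightarrow> (nat \<times> nat) point) \<Rightarrow> nat set \<Rightarrow> (nat \<times> nat) point set" where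
  "generated_scroll C \<phi> S = (\<Union>p\<in>C. lspan ((\<lambda>i. \<phi> i p) ` S))"

definition type2_component ::
  "nat set \<Rightarrow> nat point set \<Rightarrow> nat \<Rightarrow> (nat \<Rightarrow> nat) \<Rightarrow> (nat \<Rightarrow> nat point \<Rightarrow> (nat \<times> nat) point)
    \<Rightarrow> (nat \<times> nat) point set \<Rightarrow> bool" where
  "type2_component K C n r \<phi> G \<longleftrightarrow>
     irreducible_component (amb n r) (inflectional_locus (amb n r) (generated_scroll C \<phi> {..<n}) 2) G \<and>
     is_P1 K C \<and>
     (\<exists>\<tau> s. \<tau> permutes {..<n} \<and> 1 \<le> s \<and> s \<le> n \<and>
        (\<forall>i<s. is_line (\<phi> (\<tau> i) ` C)) \<and>
        (\<forall>i\<in>{s..<n}. curve_degree (blk r (\<tau> i)) (\<phi> (\<tau> i) ` C) \<ge> 2) \<and>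
        G = generated_scroll C \<phi> (\<tau> ` {..<s}))"

end

theory Submission
  imports Defs "HOL-Complex_Analysis.Complex_Analysis"
begin

text \<open>
  Since \<open>C\<close> is a projective line, \<open>C\<^sub>i\<close> is parametrized by binary forms of degree \<open>d\<^sub>i\<close> without common zero,
  and a hyperplane \<open>h\<close> pulls back to a binary form \<open>h\<^sub>i\<close> of degree \<open>d\<^sub>i\<close> for each \<open>i\<close>. The hyperplane contains
  the second osculating space at some point of \<open>G\<close> over \<open>p\<close> if and only if every \<open>h\<^sub>i\<close> has a double root at \<open>p\<close>.
  So the dual set is the union over \<open>p\<close> of linear spaces of dimension \<open>\<Sum>(r\<^sub>i - 1) - 1\<close>.

  If some \<open>d\<^sub>i \<ge> 3\<close>, there is a nonzero \<open>h\<close> supported on block \<open>i\<close> with a triple root at some \<open>p\<close>. Every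
  vector satisfying the double root condition at \<open>p\<close> in the blocks other than \<open>i\<close> is tangent to the dual set at \<open>h\<close>,
  which makes the tangent space larger than the dimension allows, so the dual set is singular. If all \<open>d\<^sub>i \<le> 2\<close>, then
  \<open>h\<^sub>i = 0\<close> for lines and \<open>h\<^sub>i\<close> is a multiple of \<open>(a y - b x)\<^sup>2\<close> for conics, \<open>p = (a : b)\<close>, so the dual set is
  the decomposable scroll generated by conics. The case without conics is excluded because a scroll generated by
  lines only is equal to its inflectional locus.
\<close>

text \<open>Dimension means Krull dimension, so a parameter count has to become a bound on chains. A
  chain of length M gives binomial(k + M, M) independent forms in degree proportional to k, while a
  set covered by finitely many polynomial maps in m parameters carries at most a constant times k^m
  of them; hence M \<le> m. The singular case rests on this upper bound: the 2 (n - 1) double root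
  conditions on the other blocks leave tangent vectors of dimension at least \<Sum>(r_i - 1) + 2,
  one more than smoothness permits. The triple root exists by counting conditions if r_i \<ge> 3. If
  r_i = 2, the determinant of the second derivatives of the three coordinates is a binary form of
  degree 3 (d_i - 2) > 0 and has a root. Jets, tangent spaces and sections of O(1) are defined
  through Zariski neighbourhoods and local rings. Conditions that they must satisfy are obtained by
  restriction to polynomial curves, where one complex variable remains; membership is witnessed by
  explicit forms.\<close>

declare plus_fun_apply [simp del] zero_fun_apply [simp del]

section \<open>Vectors, the coordinate pairing and linear subspaces as sets of points\<close>

lemma cscale_apply: "cscale c v i = c * v i"
  by (simp add: cscale_def)

lemmas vec_apply = plus_fun_apply zero_fun_apply cscale_apply

lemma subspace_vecs: "cv.subspace (vecs I)"
  by (auto simp: cv.subspace_def vecs_def vec_apply)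

lemma pair_add_right: "pair I h (v + w) = pair I h v + pair I h w"
  by (simp add: pair_def plus_fun_apply algebra_simps sum.distrib)

lemma pair_scale_right: "pair I h (cscale c v) = c * pair I h v"
  by (simp add: pair_def sum_distrib_left mult_ac cscale_apply)

lemma pair_add_left: "pair I (h + k) v = pair I h v + pair I k v"
  by (simp add: pair_def plus_fun_apply algebra_simps sum.distrib)

lemma pair_scale_left: "pair I (cscale c h) v = c * pair I h v"
  by (simp add: pair_def sum_distrib_left mult_ac cscale_apply)

lemma pair_zero [simp]: "pair I 0 v = 0" "pair I h 0 = 0"
  by (simp_all add: pair_def zero_fun_apply)

lemma pair_sum_right: "pair I h (\<Sum>x\<in>A. f x) = (\<Sum>x\<in>A. pair I h (f x))"
  by (induction A rule: infinite_finite_induct) (simp_all add: pair_add_right)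

lemma pair_sum_left: "pair I (\<Sum>x\<in>A. f x) v = (\<Sum>x\<in>A. pair I (f x) v)"
  by (induction A rule: infinite_finite_induct) (simp_all add: pair_add_left)

lemma pair_commute: "pair I h v = pair I v h"
  by (simp add: pair_def mult_ac)

lemma sum_fun_apply: "(\<Sum>x\<in>A. f x) i = (\<Sum>x\<in>A. f x i :: complex)"
  by (induction A rule: infinite_finite_induct) (simp_all add: plus_fun_apply zero_fun_apply)

lemma span_single: "cv.span {v} = range (\<lambda>c. cscale c v)"
  by (rule cv.span_singleton)

lemma span_single_scale:
  assumes "c \<noteq> 0" shows "cv.span {cscale c v} = cv.span {v}"
proof -
  have "v = cscale (inverse c) (cscale c v)"
    using assms by (simp add: fun_eq_iff cscale_apply)
  then have "v \<in> cv.span {cscale c v}"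
    by (metis cv.span_base cv.span_scale insertI1)
  moreover have "cscale c v \<in> cv.span {v}"
    by (simp add: cv.span_base cv.span_scale)
  ultimately show ?thesis
    by (simp add: cv.span_minimal subset_antisym)
qed

lemma span_single_eqD:
  assumes "cv.span {v} = cv.span {w}" "w \<noteq> 0"
  obtains c where "c \<noteq> 0" "w = cscale c v"
proof -
  have "w \<in> cv.span {v}" using assms cv.span_base by auto
  then obtain c where "w = cscale c v" by (auto simp: span_single)
  moreover from this assms have "c \<noteq> 0" by auto
  ultimately show ?thesis using that by blast
qed

text \<open>\<open>rep\<close> is a choice, known only up to the nonzero factor \<open>c\<close>;
  homogeneity of forms removes this factor where \<open>rep\<close> occurs.\<close>

lemma rep_span:
  assumes "v \<noteq> 0"
  obtains c where "c \<noteq> 0" "rep (cv.span {v}) = cscale c v"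
proof -
  have "\<exists>w. w \<in> cv.span {v} \<and> w \<noteq> 0" using assms cv.span_base by blast
  then have "rep (cv.span {v}) \<in> cv.span {v} \<and> rep (cv.span {v}) \<noteq> 0"
    unfolding rep_def by (rule someI_ex)
  then show ?thesis using that by (fastforce simp: span_single)
qed

lemma PP_I: "v \<in> U \<Longrightarrow> v \<noteq> 0 \<Longrightarrow> cv.span {v} \<in> PP U"
  by (auto simp: PP_def)

lemma PP_rep:
  assumes "q \<in> PP U" "cv.subspace U"
  shows "rep q \<in> U" "rep q \<noteq> 0" "q = cv.span {rep q}"
proof -
  obtain v where v: "v \<in> U" "v \<noteq> 0" "q = cv.span {v}"
    using assms by (auto simp: PP_def)
  obtain c where c: "c \<noteq> 0" "rep q = cscale c v" using rep_span v by metis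
  show "rep q \<in> U" using c v assms cv.subspace_scale by metis
  show "rep q \<noteq> 0" using c v by simp
  show "q = cv.span {rep q}" using c v span_single_scale by metis
qed

lemmas proj_rep = PP_rep[OF _ subspace_vecs]

lemma PP_span_iff:
  assumes "cv.subspace U" "v \<noteq> 0"
  shows "cv.span {v} \<in> PP U \<longleftrightarrow> v \<in> U"
proof
  assume "cv.span {v} \<in> PP U"
  then obtain w where w: "w \<in> U" "w \<noteq> 0" "cv.span {v} = cv.span {w}" by (auto simp: PP_def)
  have "v \<in> cv.span {w}" using w(3) cv.span_base by blast
  then show "v \<in> U" using w(1) assms(1) by (auto simp: span_single cv.subspace_scale)
qed (use assms PP_I in blast)

lemma PP_mono: "U \<subseteq> W \<Longrightarrow> PP U \<subseteq> PP W"
  by (auto simp: PP_def)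

text \<open>\<open>PP {0}\<close> is empty, so its union would miss the zero vector; any other
  \<open>U\<close> has a point, and that point, being a line, contains 0.\<close>

lemma Union_PP:
  assumes "cv.subspace U" "U \<noteq> {0}" shows "\<Union>(PP U) = U"
proof
  show "\<Union>(PP U) \<subseteq> U"
    using assms by (auto simp: PP_def span_single cv.subspace_scale)
  obtain u where u: "u \<in> U" "u \<noteq> 0" using assms cv.subspace_0 by blast
  show "U \<subseteq> \<Union>(PP U)"
  proof
    fix x assume "x \<in> U"
    show "x \<in> \<Union>(PP U)"
    proof (cases "x = 0")
      case True then show ?thesis using u PP_I cv.span_zero by blast
    next
      case False then show ?thesis using \<open>x \<in> U\<close> PP_I cv.span_base by blast
    qed
  qed
qed

lemma PP_inj:
  assumes "cv.subspace U" "cv.subspace W" "PP U = PP W" shows "U = W"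
proof -
  have *: "v \<in> W" if "v \<in> U" "cv.subspace U" "cv.subspace W" "PP U = PP W" for v U and W :: "'a vec set"
    using that by (metis PP_I PP_span_iff cv.subspace_0)
  show ?thesis using *[of _ U W] *[of _ W U] assms by auto
qed

section \<open>Finite-dimensional linear algebra\<close>

text \<open>The vectors live in a type of possibly infinite dimension, where \<open>cv.dim\<close>
  is 0 for sets whose span has no finite basis. The finite set \<open>W\<close> makes
  \<open>cv.dim\<close> meaningful.\<close>

lemma card_le_dim:
  assumes "V \<subseteq> cv.span W" "finite W" "B \<subseteq> V" "cv.independent B"
  shows "finite B" "card B \<le> cv.dim V"
proof -
  show fB: "finite B"
    using assms cv.independent_span_bound by blast
  obtain B' where B': "B' \<subseteq> V" "cv.independent B'" "V \<subseteq> cv.span B'" "card B' = cv.dim V"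
    using cv.basis_exists by blast
  have "finite B'" using B' assms cv.independent_span_bound by blast
  then show "card B \<le> cv.dim V"
    using cv.independent_span_bound[of B' B] B' assms by (metis subset_trans)
qed

definition unitv :: "'i \<Rightarrow> 'i vec" where
  "unitv i = (\<lambda>j. if j = i then 1 else 0)"

lemma unitv_apply: "unitv i j = (if j = i then 1 else 0)"
  by (simp add: unitv_def)

lemma unitv_nonzero [simp]: "unitv i \<noteq> 0"
  by (metis unitv_apply zero_fun_apply zero_neq_one)

lemma unitv_in_vecs: "i \<in> I \<Longrightarrow> unitv i \<in> vecs I"
  by (auto simp: vecs_def unitv_def)

lemma inj_unitv: "inj unitv"
  by (rule injI) (metis unitv_apply zero_neq_one)

lemma vecs_expand:
  assumes "finite I" "v \<in> vecs I" shows "v = (\<Sum>i\<in>I. cscale (v i) (unitv i))"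
proof
  fix j
  have "(\<Sum>i\<in>I. cscale (v i) (unitv i)) j = (\<Sum>i\<in>I. if i = j then v i else 0)"
    unfolding sum_fun_apply by (rule sum.cong) (auto simp: unitv_def cscale_apply)
  also have "\<dots> = v j" using assms by (auto simp: sum.delta vecs_def)
  finally show "v j = (\<Sum>i\<in>I. cscale (v i) (unitv i)) j" by simp
qed

lemma vecs_span: assumes "finite I" shows "vecs I = cv.span (unitv ` I)"
proof
  show "vecs I \<subseteq> cv.span (unitv ` I)"
  proof
    fix v assume "v \<in> vecs I"
    show "v \<in> cv.span (unitv ` I)"
      by (subst vecs_expand[OF assms \<open>v \<in> vecs I\<close>]) (intro cv.span_sum cv.span_scale cv.span_base imageI)
  qed
  show "cv.span (unitv ` I) \<subseteq> vecs I"
    by (rule cv.span_minimal) (auto simp: unitv_in_vecs subspace_vecs)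
qed

lemma pair_unitv: "finite I \<Longrightarrow> i \<in> I \<Longrightarrow> pair I h (unitv i) = h i"
  by (simp add: pair_def unitv_def if_distrib cong: if_cong)

text \<open>Independence is tested on an indexed family, which yields injectivity as well: two equal
  members would satisfy the relation with coefficients 1 and -1.\<close>

lemma independent_family:
  assumes "finite A" "\<And>c. (\<Sum>a\<in>A. cscale (c a) (f a)) = 0 \<Longrightarrow> \<forall>a\<in>A. c a = 0"
  shows "inj_on f A" "cv.independent (f ` A)"
proof -
  show inj: "inj_on f A"
  proof (rule inj_onI, rule ccontr)
    fix a b assume ab: "a \<in> A" "b \<in> A" "f a = f b" "a \<noteq> b"
    let ?c = "\<lambda>x. if x = a then 1 else if x = b then -1 else (0::complex)"
    have "(\<Sum>x\<in>A. cscale (?c x) (f x)) = (\<Sum>x\<in>{a,b}. cscale (?c x) (f x))"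
      using assms(1) ab by (intro sum.mono_neutral_right) auto
    also have "\<dots> = 0" using ab by (simp add: fun_eq_iff vec_apply)
    finally have "?c a = 0" using assms(2)[of ?c] ab by blast
    then show False by simp
  qed
  show "cv.independent (f ` A)"
  proof (rule cv.independent_if_scalars_zero)
    show "finite (f ` A)" using assms by simp
    fix g x assume g: "(\<Sum>x\<in>f ` A. cscale (g x) x) = 0" and x: "x \<in> f ` A"
    have "(\<Sum>a\<in>A. cscale (g (f a)) (f a)) = 0"
      using g sum.reindex[OF inj, of "\<lambda>x. cscale (g x) x"] by simp
    then show "g x = 0" using assms(2)[of "\<lambda>a. g (f a)"] x by blast
  qed
qed

lemma dim_span_family:
  assumes "finite A" "\<And>c. (\<Sum>a\<in>A. cscale (c a) (f a)) = 0 \<Longrightarrow> \<forall>a\<in>A. c a = 0"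
  shows "cv.dim (cv.span (f ` A)) = card A"
  using independent_family[of A f] assms by (simp add: cv.dim_eq_card_independent card_image)

lemma independent_unitv: "finite I \<Longrightarrow> cv.independent (unitv ` I)"
proof (rule independent_family(2))
  fix c :: "'a \<Rightarrow> complex" assume "finite I" "(\<Sum>a\<in>I. cscale (c a) (unitv a)) = 0"
  then have "(\<Sum>a\<in>I. cscale (c a) (unitv a)) j = 0" for j by (simp add: zero_fun_apply)
  moreover have "(\<Sum>a\<in>I. cscale (c a) (unitv a)) j = (\<Sum>a\<in>I. if a = j then c a else 0)" for j
    unfolding sum_fun_apply by (rule sum.cong) (auto simp: unitv_def cscale_apply)
  ultimately have "(if j \<in> I then c j else 0) = 0" for j using \<open>finite I\<close> by (simp add: sum.delta)
  then show "\<forall>a\<in>I. c a = 0" by metis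
qed

lemma dim_vecs: "finite I \<Longrightarrow> cv.dim (vecs I) = card I"
  by (metis card_image cv.dim_span_eq_card_independent independent_unitv inj_unitv inj_on_subset subset_UNIV vecs_span)

lemma card_le_dim_vecs:
  assumes "finite I" "V \<subseteq> vecs I" "B \<subseteq> V" "cv.independent B"
  shows "finite B" "card B \<le> cv.dim V"
  using card_le_dim[of V "unitv ` I" B] assms vecs_span[of I] by auto

lemma dim_mono_vecs:
  assumes "finite I" "W \<subseteq> vecs I" "V \<subseteq> W" shows "cv.dim V \<le> cv.dim W"
proof -
  obtain B where "B \<subseteq> V" "cv.independent B" "V \<subseteq> cv.span B" "card B = cv.dim V"
    using cv.basis_exists by blast
  then show ?thesis using card_le_dim_vecs[OF assms(1,2), of B] assms by auto
qed

text \<open>A single vector \<open>w\<close> outside the kernel completes a basis of the kernel to a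
  spanning set of \<open>V\<close>: subtracting from \<open>v\<close> the multiple of
  \<open>w\<close> with the same value leaves a vector of the kernel.\<close>

lemma dim_kernel_step:
  assumes "finite I" "cv.subspace V" "V \<subseteq> vecs I"
  shows "cv.dim V \<le> Suc (cv.dim {h\<in>V. pair I a h = 0})"
proof (cases "\<exists>w\<in>V. pair I a w \<noteq> 0")
  case True
  then obtain w where w: "w \<in> V" "pair I a w \<noteq> 0" by blast
  let ?K = "{h\<in>V. pair I a h = 0}"
  obtain B where B: "B \<subseteq> ?K" "cv.independent B" "?K \<subseteq> cv.span B" "card B = cv.dim ?K"
    using cv.basis_exists by blast
  have fB: "finite B" using card_le_dim_vecs[of I V B] B assms by blast
  have "V \<subseteq> cv.span (insert w B)"
  proof
    fix v assume v: "v \<in> V"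
    let ?t = "pair I a v / pair I a w"
    have "v - cscale ?t w \<in> ?K"
      using v w assms(2) pair_add_right[of I a "v - cscale ?t w" "cscale ?t w"]
      by (auto simp: cv.subspace_diff cv.subspace_scale pair_scale_right)
    then have "v - cscale ?t w \<in> cv.span (insert w B)"
      using B cv.span_mono[of B "insert w B"] by blast
    moreover have "cscale ?t w \<in> cv.span (insert w B)"
      by (simp add: cv.span_base cv.span_scale)
    ultimately show "v \<in> cv.span (insert w B)"
      by (metis cv.span_add diff_add_cancel)
  qed
  then have "cv.dim V \<le> card (insert w B)" using fB cv.dim_le_card by blast
  also have "\<dots> \<le> Suc (card B)" using fB by (simp add: card_insert_if)
  finally show ?thesis using B by simp
next
  case False
  then have "{h\<in>V. pair I a h = 0} = V" by auto
  then show ?thesis by simp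
qed

lemma subspace_annihilator:
  "cv.subspace V \<Longrightarrow> cv.subspace {h\<in>V. \<forall>a\<in>S. pair I a h = 0}"
  by (auto simp: cv.subspace_def pair_add_right pair_scale_right)

lemma dim_annihilator_ge:
  assumes "finite I" "finite S"
  shows "card I \<le> cv.dim {h\<in>vecs I. \<forall>a\<in>S. pair I a h = 0} + card S"
  using assms(2)
proof (induction S rule: finite_induct)
  case empty then show ?case using dim_vecs[OF assms(1)] by simp
next
  case (insert x F)
  let ?V = "{h\<in>vecs I. \<forall>a\<in>F. pair I a h = 0}"
  have "{h\<in>vecs I. \<forall>a\<in>insert x F. pair I a h = 0} = {h\<in>?V. pair I x h = 0}" by auto
  then show ?case
    using insert dim_kernel_step[OF assms(1), of ?V x] subspace_annihilator[OF subspace_vecs, of I F I]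
    by fastforce
qed

text \<open>Extend a basis of \<open>U\<close> by \<open>w\<close>, take the linear functional that
  is 1 at \<open>w\<close> and 0 on the basis, and read off its coefficient vector at the unit
  vectors.\<close>

lemma linear_form_separates:
  assumes "finite I" "cv.subspace U" "U \<subseteq> vecs I" "w \<in> vecs I" "w \<notin> U"
  obtains h where "h \<in> vecs I" "\<forall>u\<in>U. pair I h u = 0" "pair I h w = 1"
proof -
  interpret pr: vector_space_pair "cscale :: complex \<Rightarrow> 'a vec \<Rightarrow> 'a vec" "(*) :: complex \<Rightarrow> _"
    by unfold_locales (auto simp: algebra_simps)
  obtain B where B: "B \<subseteq> U" "cv.independent B" "U \<subseteq> cv.span B" "card B = cv.dim U"
    using cv.basis_exists by blast
  have sB: "cv.span B \<subseteq> U" using B assms by (simp add: cv.span_minimal)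
  then have ind: "cv.independent (insert w B)" using B assms by (auto simp: cv.independent_insert)
  obtain g where g: "Vector_Spaces.linear cscale (*) g" "\<forall>x\<in>insert w B. g x = (if x = w then 1 else 0)"
    using pr.linear_independent_extend[OF ind, of "\<lambda>x. if x = w then 1 else 0"]
    by (elim exE conjE) (rule that)
  interpret lg: Vector_Spaces.linear cscale "(*)" g by (rule g)
  define h where "h = (\<lambda>i. if i \<in> I then g (unitv i) else 0)"
  have gp: "g v = pair I h v" if "v \<in> vecs I" for v
  proof -
    have "g v = g (\<Sum>i\<in>I. cscale (v i) (unitv i))" using vecs_expand[OF assms(1) that] by simp
    also have "\<dots> = (\<Sum>i\<in>I. v i * g (unitv i))" by (simp add: lg.sum lg.scale)
    also have "\<dots> = pair I h v" by (simp add: pair_def h_def mult_ac)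
    finally show ?thesis .
  qed
  have "w \<notin> B" using sB cv.span_base assms by blast
  then have g0: "g b = 0" if "b \<in> B" for b using g that by auto
  have "g u = 0" if "u \<in> U" for u
  proof -
    have "u \<in> cv.span B" using that B by blast
    then show ?thesis
      by (induction rule: cv.span_induct_alt) (auto simp: lg.zero lg.add lg.scale g0)
  qed
  moreover have "h \<in> vecs I" by (simp add: h_def vecs_def)
  moreover have "g w = 1" using g by simp
  ultimately show ?thesis using that[of h] gp assms(3,4) by (metis subsetD)
qed

section \<open>Homogeneous forms\<close>

definition midx :: "'i set \<Rightarrow> nat \<Rightarrow> ('i \<Rightarrow> nat) set" where
  "midx I d = {\<alpha>. (\<forall>i. i \<notin> I \<longrightarrow> \<alpha> i = 0) \<and> sum \<alpha> I = d}"

lemma hform_iff: "hform I d f \<longleftrightarrow> (\<exists>c. \<forall>v. f v = (\<Sum>\<alpha>\<in>midx I d. c \<alpha> * (\<Prod>i\<in>I. v i ^ \<alpha> i)))"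
  by (simp add: hform_def midx_def)

lemma finite_midx: assumes "finite I" shows "finite (midx I d)"
proof (rule finite_subset)
  show "midx I d \<subseteq> {\<alpha>. \<forall>i. (i \<in> I \<longrightarrow> \<alpha> i \<in> {..d}) \<and> (i \<notin> I \<longrightarrow> \<alpha> i = 0)}"
    using assms by (auto simp: midx_def member_le_sum)
  show "finite {\<alpha>. \<forall>i. (i \<in> I \<longrightarrow> \<alpha> i \<in> {..d}) \<and> (i \<notin> I \<longrightarrow> \<alpha> i = 0)}"
    by (rule finite_set_of_finite_funs) (use assms in auto)
qed

lemma hform_zero: "hform I d (\<lambda>_. 0)"
  unfolding hform_iff by (rule exI[of _ "\<lambda>_. 0"]) simp

lemma hform_add:
  assumes "hform I d f" "hform I d g" shows "hform I d (\<lambda>v. f v + g v)"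
proof -
  obtain a b where "\<forall>v. f v = (\<Sum>\<alpha>\<in>midx I d. a \<alpha> * (\<Prod>i\<in>I. v i ^ \<alpha> i))"
    "\<forall>v. g v = (\<Sum>\<alpha>\<in>midx I d. b \<alpha> * (\<Prod>i\<in>I. v i ^ \<alpha> i))"
    using assms by (auto simp: hform_iff)
  then show ?thesis unfolding hform_iff
    by (intro exI[of _ "\<lambda>\<alpha>. a \<alpha> + b \<alpha>"]) (simp add: algebra_simps sum.distrib)
qed

lemma hform_cmult:
  assumes "hform I d f" shows "hform I d (\<lambda>v. c * f v)"
proof -
  obtain a where "\<forall>v. f v = (\<Sum>\<alpha>\<in>midx I d. a \<alpha> * (\<Prod>i\<in>I. v i ^ \<alpha> i))"
    using assms by (auto simp: hform_iff)
  then show ?thesis unfolding hform_iff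
    by (intro exI[of _ "\<lambda>\<alpha>. c * a \<alpha>"]) (simp add: sum_distrib_left mult_ac)
qed

lemma hform_sum:
  assumes "\<And>x. x \<in> A \<Longrightarrow> hform I d (f x)" shows "hform I d (\<lambda>v. \<Sum>x\<in>A. f x v)"
  using assms by (induction A rule: infinite_finite_induct) (auto intro: hform_zero hform_add)

lemma hform_const: assumes "finite I" shows "hform I 0 (\<lambda>_. c)"
proof -
  have "midx I 0 = {\<lambda>_. 0}" using assms by (auto simp: midx_def fun_eq_iff)
  then show ?thesis unfolding hform_iff by (intro exI[of _ "\<lambda>_. c"]) simp
qed

lemma hform_var_mult:
  assumes "finite I" "i \<in> I" "hform I d f" shows "hform I (Suc d) (\<lambda>v. v i * f v)"
proof -
  obtain c where c: "\<forall>v. f v = (\<Sum>\<alpha>\<in>midx I d. c \<alpha> * (\<Prod>i\<in>I. v i ^ \<alpha> i))"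
    using assms by (auto simp: hform_iff)
  \<comment> \<open>The coefficient at \<alpha> is that of the monomial with one factor
    \<open>v i\<close> less; monomials free of \<open>v i\<close> get 0.\<close>
  let ?c = "\<lambda>\<alpha>. if \<alpha> i > 0 then c (\<alpha>(i := \<alpha> i - 1)) else 0"
  have sum_upd: "sum (\<alpha>(i := k)) I + \<alpha> i = sum \<alpha> I + k" for \<alpha> and k :: nat
    using assms(1,2) by (simp add: sum.remove[of I i])
  have "v i * f v = (\<Sum>\<alpha>\<in>midx I (Suc d). ?c \<alpha> * (\<Prod>i\<in>I. v i ^ \<alpha> i))" for v
  proof -
    have "v i * f v = (\<Sum>\<alpha>\<in>midx I d. c \<alpha> * (v i * (\<Prod>i\<in>I. v i ^ \<alpha> i)))"
      using c by (simp add: sum_distrib_left mult_ac)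
    also have "\<dots> = (\<Sum>\<alpha>\<in>{\<alpha>\<in>midx I (Suc d). \<alpha> i > 0}. ?c \<alpha> * (\<Prod>i\<in>I. v i ^ \<alpha> i))"
    proof (rule sum.reindex_bij_witness[of _ "\<lambda>\<alpha>. \<alpha>(i := \<alpha> i - 1)" "\<lambda>\<alpha>. \<alpha>(i := Suc (\<alpha> i))"])
      fix \<alpha> assume a: "\<alpha> \<in> midx I d"
      show "\<alpha>(i := Suc (\<alpha> i)) \<in> {\<alpha>\<in>midx I (Suc d). \<alpha> i > 0}"
        using a assms sum_upd[of \<alpha> "Suc (\<alpha> i)"] by (auto simp: midx_def)
      have "v i * (\<Prod>j\<in>I. v j ^ \<alpha> j) = (\<Prod>j\<in>I. v j ^ (\<alpha>(i := Suc (\<alpha> i))) j)"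
        using assms by (simp add: prod.remove[of I i] mult.assoc)
      then show "?c (\<alpha>(i := Suc (\<alpha> i))) * (\<Prod>j\<in>I. v j ^ (\<alpha>(i := Suc (\<alpha> i))) j) =
          c \<alpha> * (v i * (\<Prod>i\<in>I. v i ^ \<alpha> i))" by simp
    next
      fix \<alpha> assume a: "\<alpha> \<in> {\<alpha>\<in>midx I (Suc d). \<alpha> i > 0}"
      show "\<alpha>(i := \<alpha> i - 1) \<in> midx I d"
        using a assms sum_upd[of \<alpha> "\<alpha> i - 1"] by (auto simp: midx_def)
    qed auto
    also have "\<dots> = (\<Sum>\<alpha>\<in>midx I (Suc d). ?c \<alpha> * (\<Prod>i\<in>I. v i ^ \<alpha> i))"
      by (rule sum.mono_neutral_left) (auto simp: finite_midx[OF assms(1)])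
    finally show ?thesis .
  qed
  then show ?thesis unfolding hform_iff by (intro exI[of _ ?c]) simp
qed

text \<open>Forms are generated from constants by multiplication with variables, sums and scalar
  multiples, so later proofs avoid multi-indices. The zero form is a base case in every degree, as
  the start of the sum over monomials.\<close>

lemma hform_induct [consumes 2, case_names zero one var add cmult]:
  assumes I: "finite I" and f: "hform I d f"
    and zero: "\<And>d. P d (\<lambda>_. 0)" and one: "P 0 (\<lambda>_. 1)"
    and var: "\<And>d f i. i \<in> I \<Longrightarrow> hform I d f \<Longrightarrow> P d f \<Longrightarrow> P (Suc d) (\<lambda>v. v i * f v)"
    and add: "\<And>d f g. hform I d f \<Longrightarrow> hform I d g \<Longrightarrow> P d f \<Longrightarrow> P d g \<Longrightarrow> P d (\<lambda>v. f v + g v)"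
    and cmult: "\<And>d f c. hform I d f \<Longrightarrow> P d f \<Longrightarrow> P d (\<lambda>v. c * f v)"
  shows "P d f"
proof -
  have mon: "hform I d (\<lambda>v. \<Prod>i\<in>I. v i ^ \<alpha> i) \<and> P d (\<lambda>v. \<Prod>i\<in>I. v i ^ \<alpha> i)" if "\<alpha> \<in> midx I d" for \<alpha> d
    using that
  proof (induction d arbitrary: \<alpha>)
    case 0
    then have "\<alpha> = (\<lambda>_. 0)" using I by (auto simp: midx_def fun_eq_iff)
    then show ?case using one hform_const[OF I] by simp
  next
    case (Suc d)
    then have "sum \<alpha> I \<noteq> 0" by (simp add: midx_def)
    then obtain i where i: "i \<in> I" "\<alpha> i > 0" by (metis sum.neutral gr0I)
    let ?b = "\<alpha>(i := \<alpha> i - 1)"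
    have "sum ?b I + \<alpha> i = sum \<alpha> I + (\<alpha> i - 1)"
      using I i by (simp add: sum.remove[of I i])
    then have b: "?b \<in> midx I d" using Suc i by (auto simp: midx_def)
    have "(\<Prod>j\<in>I. v j ^ \<alpha> j) = v i * (\<Prod>j\<in>I. v j ^ ?b j)" for v :: "'a vec"
    proof -
      have "v i ^ \<alpha> i = v i * v i ^ (\<alpha> i - 1)" using i by (simp add: power_eq_if)
      then show ?thesis using I i by (simp add: prod.remove[of I i] mult.assoc)
    qed
    then show ?case using Suc.IH[OF b] var[OF i(1)] hform_var_mult[OF I i(1)] by simp
  qed
  obtain c where c: "\<forall>v. f v = (\<Sum>\<alpha>\<in>midx I d. c \<alpha> * (\<Prod>i\<in>I. v i ^ \<alpha> i))"
    using f by (auto simp: hform_iff)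
  have "finite A \<Longrightarrow> A \<subseteq> midx I d \<Longrightarrow> hform I d (\<lambda>v. \<Sum>\<alpha>\<in>A. c \<alpha> * (\<Prod>i\<in>I. v i ^ \<alpha> i)) \<and>
      P d (\<lambda>v. \<Sum>\<alpha>\<in>A. c \<alpha> * (\<Prod>i\<in>I. v i ^ \<alpha> i))" for A
  proof (induction A rule: finite_induct)
    case empty then show ?case using zero hform_zero by simp
  next
    case (insert a A)
    then have m: "hform I d (\<lambda>v. \<Prod>i\<in>I. v i ^ a i)" "P d (\<lambda>v. \<Prod>i\<in>I. v i ^ a i)"
      using mon[of a d] by auto
    have "hform I d (\<lambda>v. c a * (\<Prod>i\<in>I. v i ^ a i))" "P d (\<lambda>v. c a * (\<Prod>i\<in>I. v i ^ a i))"
      using hform_cmult[OF m(1)] cmult[OF m] by auto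
    then show ?case using insert hform_add[of I d "\<lambda>v. c a * (\<Prod>i\<in>I. v i ^ a i)"]
      add[of d "\<lambda>v. c a * (\<Prod>i\<in>I. v i ^ a i)"] by simp
  qed
  then show ?thesis using c finite_midx[OF I] by (metis (no_types, lifting) ext subset_refl)
qed

lemma hform_mult:
  assumes "finite I" "hform I d f" "hform I e g" shows "hform I (d + e) (\<lambda>v. f v * g v)"
  using assms(1,2)
proof (induction rule: hform_induct)
  case (zero d) then show ?case by (simp add: hform_zero)
next
  case one then show ?case using assms by simp
next
  case (var d f i) then show ?case using hform_var_mult[OF assms(1) var(1,3)] by (simp add: mult.assoc)
next
  case (add d f g) then show ?case using hform_add[OF add(3,4)] by (simp add: algebra_simps)
next
  case (cmult d f c) then show ?case using hform_cmult[OF cmult(2)] by (simp add: algebra_simps)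
qed

lemma hform_var: "finite I \<Longrightarrow> i \<in> I \<Longrightarrow> hform I 1 (\<lambda>v. v i)"
  using hform_var_mult[of I i 0 "\<lambda>_. 1"] hform_const[of I 1] by simp

lemma hform_power:
  assumes "finite I" "hform I d f" shows "hform I (k * d) (\<lambda>v. f v ^ k)"
  by (induction k) (use assms hform_const hform_mult in auto)

lemma hform_prod:
  assumes "finite I" "\<And>x. x \<in> A \<Longrightarrow> hform I (d x) (f x)"
  shows "hform I (\<Sum>x\<in>A. d x) (\<lambda>v. \<Prod>x\<in>A. f x v)"
  using assms by (induction A rule: infinite_finite_induct) (auto intro: hform_const hform_mult)

lemma hform_uminus: "hform I d f \<Longrightarrow> hform I d (\<lambda>v. - f v)"
  using hform_cmult[of I d f "-1"] by simp

lemma hform_diff: "hform I d f \<Longrightarrow> hform I d g \<Longrightarrow> hform I d (\<lambda>v. f v - g v)"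
  using hform_add[of I d f "\<lambda>v. - g v"] hform_uminus[of I d g] by simp

lemma hform_pair: assumes "finite I" shows "hform I 1 (pair I h)"
proof -
  have "hform I 1 (\<lambda>v. \<Sum>i\<in>I. h i * v i)"
    by (intro hform_sum hform_cmult hform_var assms)
  then show ?thesis by (simp add: pair_def[abs_def])
qed

lemma hform_cong:
  assumes "hform I d f" "\<And>i. i \<in> I \<Longrightarrow> v i = w i" shows "f v = f w"
proof -
  obtain c where c: "\<forall>v. f v = (\<Sum>\<alpha>\<in>midx I d. c \<alpha> * (\<Prod>i\<in>I. v i ^ \<alpha> i))"
    using assms by (auto simp: hform_iff)
  then show ?thesis using assms(2) by simp
qed

lemma hform_homogeneous:
  assumes "finite I" "hform I d f" shows "f (cscale c v) = c ^ d * f v"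
  using assms by (induction arbitrary: v rule: hform_induct) (auto simp: algebra_simps cscale_apply)

lemma hform_compose:
  assumes "finite I" "finite J" "hform I d f" "\<And>i. i \<in> I \<Longrightarrow> hform J e (F i)"
  shows "hform J (d * e) (\<lambda>v. f (\<lambda>i. if i \<in> I then F i v else 0))"
  using assms(1,3)
proof (induction rule: hform_induct)
  case (zero d) then show ?case by (simp add: hform_zero)
next
  case one then show ?case using hform_const[OF assms(2)] by simp
next
  case (var d f i) then show ?case using hform_mult[OF assms(2) assms(4)[OF var(1)] var(3)] by simp
next
  case (add d f g) then show ?case using hform_add[OF add(3,4)] by simp
next
  case (cmult d f c) then show ?case using hform_cmult[OF cmult(2)] by simp
qed

lemma hform_zero_iff_scale:
  assumes "finite I" "hform I d f" "c \<noteq> 0" shows "f (cscale c v) = 0 \<longleftrightarrow> f v = 0"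
  using hform_homogeneous[OF assms(1,2), of c v] assms(3) by simp

lemma hform_rep_span:
  assumes "finite I" "hform I d f" "v \<noteq> 0" shows "f (rep (cv.span {v})) = 0 \<longleftrightarrow> f v = 0"
  using rep_span[OF assms(3)] hform_zero_iff_scale[OF assms(1,2)] by metis

section \<open>Polynomial curves and closed sets\<close>

definition polyfun :: "(complex \<Rightarrow> complex) \<Rightarrow> bool" where
  "polyfun f \<longleftrightarrow> (\<exists>p. \<forall>z. f z = poly p z)"

lemma polyfun_const [simp]: "polyfun (\<lambda>_. c)"
  unfolding polyfun_def by (rule exI[of _ "[:c:]"]) simp

lemma polyfun_id [simp]: "polyfun (\<lambda>z. z)"
  unfolding polyfun_def by (rule exI[of _ "[:0, 1:]"]) simp

lemma polyfun_add: "polyfun f \<Longrightarrow> polyfun g \<Longrightarrow> polyfun (\<lambda>z. f z + g z)"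
  unfolding polyfun_def by (metis poly_add)

lemma polyfun_diff: "polyfun f \<Longrightarrow> polyfun g \<Longrightarrow> polyfun (\<lambda>z. f z - g z)"
  unfolding polyfun_def by (metis poly_diff)

lemma polyfun_mult: "polyfun f \<Longrightarrow> polyfun g \<Longrightarrow> polyfun (\<lambda>z. f z * g z)"
  unfolding polyfun_def by (metis poly_mult)

lemma polyfun_power: "polyfun f \<Longrightarrow> polyfun (\<lambda>z. f z ^ n)"
  by (induction n) (auto intro: polyfun_mult)

lemma polyfun_sum: "(\<And>x. x \<in> A \<Longrightarrow> polyfun (f x)) \<Longrightarrow> polyfun (\<lambda>z. \<Sum>x\<in>A. f x z)"
  by (induction A rule: infinite_finite_induct) (auto intro: polyfun_add)

lemmas polyfun_intros = polyfun_const polyfun_id polyfun_add polyfun_diff polyfun_mult polyfun_power polyfun_sum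

lemma polyfun_holomorphic: assumes "polyfun f" shows "f holomorphic_on S"
proof -
  obtain p where "f = poly p" using assms by (auto simp: polyfun_def fun_eq_iff)
  then have "(f has_field_derivative poly (pderiv p) z) (at z within S)" for z
    using poly_DERIV has_field_derivative_at_within by blast
  then show ?thesis by (auto simp: holomorphic_on_def field_differentiable_def)
qed

lemma polyfun_isCont: "polyfun f \<Longrightarrow> isCont f z"
  by (metis UNIV_I continuous_on_eq_continuous_at holomorphic_on_imp_continuous_on open_UNIV polyfun_holomorphic)

lemma polyfun_finite_zeros:
  assumes "polyfun f" "f a \<noteq> 0" shows "finite {z. f z = 0}"
proof -
  obtain p where p: "\<forall>z. f z = poly p z" using assms polyfun_def by blast
  then have "p \<noteq> 0" using assms by auto
  then show ?thesis using p poly_roots_finite by simp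
qed

lemma polyfun_eventually_nonzero:
  assumes "polyfun f" "f a \<noteq> 0" shows "\<forall>\<^sub>F z in nhds a. f z \<noteq> 0"
  using assms polyfun_isCont[of f a] tendsto_imp_eventually_ne[of f "f a" "at a" 0]
  by (simp add: isCont_def eventually_nhds_conv_at)

text \<open>Polynomial curves are the test objects for closed sets, local rings and tangent spaces:
  every form becomes a polynomial in one variable along them.\<close>

definition polycurve :: "(complex \<Rightarrow> 'i vec) \<Rightarrow> bool" where
  "polycurve \<gamma> \<longleftrightarrow> (\<forall>i. polyfun (\<lambda>z. \<gamma> z i))"

lemma hform_polycurve:
  assumes "finite I" "hform I d f" "polycurve \<gamma>" shows "polyfun (\<lambda>z. f (\<gamma> z))"
  using assms(1,2)
  by (induction rule: hform_induct) (use assms(3) in \<open>auto simp: polycurve_def intro: polyfun_intros\<close>)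

lemma pair_polycurve: "polycurve \<gamma> \<Longrightarrow> polyfun (\<lambda>z. pair I h (\<gamma> z))"
  unfolding pair_def polycurve_def by (intro polyfun_intros) auto

lemma polycurve_line: "polycurve (\<lambda>z. v + cscale z w)"
  by (auto simp: polycurve_def vec_apply intro!: polyfun_intros)

lemma polycurve_nonzero:
  assumes "polycurve \<gamma>" "\<gamma> a \<noteq> 0"
  shows "\<forall>\<^sub>F z in nhds a. \<gamma> z \<noteq> 0" "finite {z. \<gamma> z = 0}"
proof -
  obtain i where i: "\<gamma> a i \<noteq> 0" using assms(2) by (auto simp: fun_eq_iff vec_apply)
  have p: "polyfun (\<lambda>z. \<gamma> z i)" using assms by (simp add: polycurve_def)
  show "\<forall>\<^sub>F z in nhds a. \<gamma> z \<noteq> 0"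
    using polyfun_eventually_nonzero[OF p i] by eventually_elim (auto simp: vec_apply)
  show "finite {z. \<gamma> z = 0}"
    by (rule finite_subset[OF _ polyfun_finite_zeros[OF p i]]) (auto simp: vec_apply)
qed

text \<open>The definition tests the chosen vector \<open>rep q\<close>; homogeneity allows any
  nonzero vector of the point instead.\<close>

lemma zclosedE:
  assumes "zclosed I A" "finite I"
  obtains F where "\<And>f. f \<in> F \<Longrightarrow> \<exists>d. hform I d f"
    "\<And>v. v \<in> vecs I \<Longrightarrow> v \<noteq> 0 \<Longrightarrow> cv.span {v} \<in> A \<longleftrightarrow> (\<forall>f\<in>F. f v = 0)"
proof -
  obtain F where F: "\<forall>f\<in>F. \<exists>d. hform I d f" "A = {q \<in> proj_space I. \<forall>f\<in>F. f (rep q) = 0}"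
    using assms by (auto simp: zclosed_def)
  have "cv.span {v} \<in> A \<longleftrightarrow> (\<forall>f\<in>F. f v = 0)" if "v \<in> vecs I" "v \<noteq> 0" for v
  proof -
    have "f (rep (cv.span {v})) = 0 \<longleftrightarrow> f v = 0" if "f \<in> F" for f
      using F(1) that hform_rep_span[OF assms(2) _ \<open>v \<noteq> 0\<close>] by blast
    then show ?thesis using F(2) PP_I[OF that] by simp
  qed
  then show ?thesis using that F(1) by blast
qed

lemma zclosedI:
  assumes "finite I" "A \<subseteq> proj_space I" "\<And>f. f \<in> F \<Longrightarrow> \<exists>d. hform I d f"
    "\<And>v. v \<in> vecs I \<Longrightarrow> v \<noteq> 0 \<Longrightarrow> cv.span {v} \<in> A \<longleftrightarrow> (\<forall>f\<in>F. f v = 0)"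
  shows "zclosed I A"
proof -
  have "A = {q \<in> proj_space I. \<forall>f\<in>F. f (rep q) = 0}"
  proof (rule set_eqI)
    fix q
    show "q \<in> A \<longleftrightarrow> q \<in> {q \<in> proj_space I. \<forall>f\<in>F. f (rep q) = 0}"
    proof (cases "q \<in> proj_space I")
      case True
      then show ?thesis using proj_rep[OF True] assms(4)[of "rep q"] by simp
    next
      case False then show ?thesis using assms(2) by auto
    qed
  qed
  then show ?thesis using assms(3) unfolding zclosed_def by blast
qed

lemma zclosed_zero_set:
  assumes "finite I" "hform I d f" shows "zclosed I {q \<in> proj_space I. f (rep q) = 0}"
  using assms unfolding zclosed_def by (intro exI[of _ "{f}"]) auto

lemma not_in_zclosed:
  assumes "zclosed I A" "finite I" "v \<in> vecs I" "v \<noteq> 0" "cv.span {v} \<notin> A"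
  obtains d f where "hform I d f" "f v \<noteq> 0" "\<And>w. w \<in> vecs I \<Longrightarrow> w \<noteq> 0 \<Longrightarrow> cv.span {w} \<in> A \<Longrightarrow> f w = 0"
  using zclosedE[OF assms(1,2)] assms(3-5) by metis

lemma nearbyI_form:
  assumes "finite I" "hform I d f" "y \<in> proj_space I" "f (rep y) \<noteq> 0" "\<And>q. q \<in> Y \<Longrightarrow> f (rep q) \<noteq> 0 \<Longrightarrow> P q"
    "Y \<subseteq> proj_space I"
  shows "nearby I Y y P"
  unfolding nearby_def
  by (rule exI[of _ "{q \<in> proj_space I. f (rep q) = 0}"])
    (use assms zclosed_zero_set in auto)

lemma nearbyI_always:
  assumes "finite I" "y \<in> proj_space I" "\<And>q. q \<in> Y \<Longrightarrow> P q" "Y \<subseteq> proj_space I"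
  shows "nearby I Y y P"
  by (rule nearbyI_form[OF assms(1) hform_const[OF assms(1), of 1] assms(2)]) (use assms in auto)

lemma nearby_self: "nearby I Y y P \<Longrightarrow> y \<in> Y \<Longrightarrow> P y"
  unfolding nearby_def by blast

text \<open>Passage from the Zariski to the classical topology: a form that vanishes on the excluded
  closed set, but not at the given point, restricts to a polynomial that is nonzero for parameters
  close to \<open>a\<close>.\<close>

lemma nearby_curve:
  assumes "nearby I Y (cv.span {\<gamma> a}) P" "finite I" "polycurve \<gamma>" "\<And>z. \<gamma> z \<in> vecs I" "\<gamma> a \<noteq> 0"
    "\<And>z. \<gamma> z \<noteq> 0 \<Longrightarrow> cv.span {\<gamma> z} \<in> Y"
  shows "\<forall>\<^sub>F z in nhds a. \<gamma> z \<noteq> 0 \<and> P (cv.span {\<gamma> z})"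
proof -
  obtain A where A: "zclosed I A" "cv.span {\<gamma> a} \<notin> A" "\<forall>q\<in>Y - A. P q"
    using assms by (auto simp: nearby_def)
  obtain d f where f: "hform I d f" "f (\<gamma> a) \<noteq> 0"
    "\<And>w. w \<in> vecs I \<Longrightarrow> w \<noteq> 0 \<Longrightarrow> cv.span {w} \<in> A \<Longrightarrow> f w = 0"
    using not_in_zclosed[OF A(1) assms(2) assms(4,5) A(2)] by metis
  show ?thesis
    using polyfun_eventually_nonzero[OF hform_polycurve[OF assms(2) f(1) assms(3)] f(2)]
      polycurve_nonzero(1)[OF assms(3,5)]
    by eventually_elim (use assms A f in blast)
qed

text \<open>Along a polynomial curve in Y through two given points, two forms with vanishing product on Y become
  polynomials with vanishing product.\<close>

lemma zirreducible_if_curves: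
  assumes "finite I" "Y \<subseteq> proj_space I" "Y \<noteq> {}"
    and curve: "\<And>u v. u \<in> Y \<Longrightarrow> v \<in> Y \<Longrightarrow> \<exists>\<gamma>. polycurve \<gamma> \<and> (\<forall>z. \<gamma> z \<in> vecs I) \<and> \<gamma> 0 \<noteq> 0 \<and> \<gamma> 1 \<noteq> 0 \<and>
      u = cv.span {\<gamma> 0} \<and> v = cv.span {\<gamma> 1} \<and> (\<forall>z. \<gamma> z \<noteq> 0 \<longrightarrow> cv.span {\<gamma> z} \<in> Y)"
  shows "zirreducible I Y"
  unfolding zirreducible_def
proof (intro conjI allI impI; (fact | elim conjE)?)
  fix A B assume AB: "zclosed I A" "zclosed I B" "Y \<subseteq> A \<union> B"
  show "Y \<subseteq> A \<or> Y \<subseteq> B"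
  proof (rule ccontr)
    assume "\<not> ?thesis"
    then obtain u v where uv: "u \<in> Y" "u \<notin> A" "v \<in> Y" "v \<notin> B" by blast
    obtain \<gamma> where \<gamma>: "polycurve \<gamma>" "\<forall>z. \<gamma> z \<in> vecs I" "\<gamma> 0 \<noteq> 0" "\<gamma> 1 \<noteq> 0"
      "u = cv.span {\<gamma> 0}" "v = cv.span {\<gamma> 1}" "\<forall>z. \<gamma> z \<noteq> 0 \<longrightarrow> cv.span {\<gamma> z} \<in> Y"
      using curve[OF uv(1,3)] by blast
    obtain d f where f: "hform I d f" "f (\<gamma> 0) \<noteq> 0"
      "\<And>w. w \<in> vecs I \<Longrightarrow> w \<noteq> 0 \<Longrightarrow> cv.span {w} \<in> A \<Longrightarrow> f w = 0"
      using not_in_zclosed[OF AB(1) assms(1)] \<gamma> uv by metis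
    obtain e g where g: "hform I e g" "g (\<gamma> 1) \<noteq> 0"
      "\<And>w. w \<in> vecs I \<Longrightarrow> w \<noteq> 0 \<Longrightarrow> cv.span {w} \<in> B \<Longrightarrow> g w = 0"
      using not_in_zclosed[OF AB(2) assms(1)] \<gamma> uv by metis
    have fin: "finite ({z. f (\<gamma> z) = 0} \<union> {z. g (\<gamma> z) = 0} \<union> {z. \<gamma> z = 0})"
      using polyfun_finite_zeros[OF hform_polycurve[OF assms(1) f(1) \<gamma>(1)] f(2)]
        polyfun_finite_zeros[OF hform_polycurve[OF assms(1) g(1) \<gamma>(1)] g(2)]
        polycurve_nonzero(2)[OF \<gamma>(1,3)] by simp
    then obtain z where "z \<notin> {z. f (\<gamma> z) = 0} \<union> {z. g (\<gamma> z) = 0} \<union> {z. \<gamma> z = 0}"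
      using ex_new_if_finite[OF infinite_UNIV_char_0 fin] by blast
    then have "f (\<gamma> z) \<noteq> 0" "g (\<gamma> z) \<noteq> 0" "\<gamma> z \<noteq> 0" by auto
    then show False using f(3) g(3) \<gamma>(2,7) AB(3) by blast
  qed
qed

lemma zclosed_PP:
  assumes "finite I" "cv.subspace U" "U \<subseteq> vecs I" shows "zclosed I (PP U)"
proof (rule zclosedI[OF assms(1)])
  show "PP U \<subseteq> proj_space I" using assms PP_mono by blast
  let ?F = "{pair I h | h. h \<in> vecs I \<and> (\<forall>u\<in>U. pair I h u = 0)}"
  show "\<exists>d. hform I d f" if "f \<in> ?F" for f using that hform_pair[OF assms(1)] by blast
  show "cv.span {v} \<in> PP U \<longleftrightarrow> (\<forall>f\<in>?F. f v = 0)" if "v \<in> vecs I" "v \<noteq> 0" for v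
    unfolding PP_span_iff[OF assms(2) that(2)]
  proof
    assume *: "\<forall>f\<in>?F. f v = 0"
    show "v \<in> U"
    proof (rule ccontr)
      assume "v \<notin> U"
      then obtain h where "h \<in> vecs I" "\<forall>u\<in>U. pair I h u = 0" "pair I h v = 1"
        using linear_form_separates[OF assms \<open>v \<in> vecs I\<close>] by metis
      then show False using * by fastforce
    qed
  qed auto
qed

lemma zirreducible_PP:
  assumes "finite I" "cv.subspace U" "U \<subseteq> vecs I" "U \<noteq> {0}" shows "zirreducible I (PP U)"
proof (rule zirreducible_if_curves[OF assms(1)])
  show "PP U \<subseteq> proj_space I" using assms PP_mono by blast
  show "PP U \<noteq> {}" using assms cv.subspace_0 by (auto simp: PP_def)
  fix a b assume "a \<in> PP U" "b \<in> PP U"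
  then obtain u v where uv: "u \<in> U" "v \<in> U" "u \<noteq> 0" "v \<noteq> 0" "a = cv.span {u}" "b = cv.span {v}"
    by (auto simp: PP_def)
  let ?g = "\<lambda>z. u + cscale z (v - u)"
  have U: "?g z \<in> U" for z using uv assms(2) by (simp add: cv.subspace_add cv.subspace_diff cv.subspace_scale)
  show "\<exists>\<gamma>. polycurve \<gamma> \<and> (\<forall>z. \<gamma> z \<in> vecs I) \<and> \<gamma> 0 \<noteq> 0 \<and> \<gamma> 1 \<noteq> 0 \<and>
      a = cv.span {\<gamma> 0} \<and> b = cv.span {\<gamma> 1} \<and> (\<forall>z. \<gamma> z \<noteq> 0 \<longrightarrow> cv.span {\<gamma> z} \<in> PP U)"
    by (rule exI[of _ ?g]) (use uv U assms(3) in \<open>auto intro: polycurve_line PP_I\<close>)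
qed

section \<open>Dimension\<close>

definition proj_chain :: "'i set \<Rightarrow> 'i point set \<Rightarrow> nat \<Rightarrow> (nat \<Rightarrow> 'i point set) \<Rightarrow> bool" where
  "proj_chain I Y m Z \<longleftrightarrow> (\<forall>j\<le>m. zclosed I (Z j) \<and> zirreducible I (Z j) \<and> Z j \<subseteq> Y) \<and> (\<forall>j<m. Z j \<subset> Z (Suc j))"

lemma vdim_alt: "vdim I Y = (GREATEST m. \<exists>Z. proj_chain I Y m Z)"
  by (simp add: vdim_def proj_chain_def)

lemma vdim_eqI:
  assumes "proj_chain I Y m Z" "\<And>k Z. proj_chain I Y k Z \<Longrightarrow> k \<le> m" shows "vdim I Y = m"
  unfolding vdim_alt by (rule Greatest_equality) (use assms in auto)

text \<open>\<open>GREATEST\<close> is an attained value once some chain exists and the lengths are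
  bounded; the chain consisting of \<open>Y\<close> alone provides the first.\<close>

lemma vdim_leI:
  assumes "zclosed I Y" "zirreducible I Y" "\<And>k Z. proj_chain I Y k Z \<Longrightarrow> k \<le> m" shows "vdim I Y \<le> m"
proof -
  have "proj_chain I Y 0 (\<lambda>_. Y)" using assms by (simp add: proj_chain_def)
  then have "\<exists>Z. proj_chain I Y 0 Z" by blast
  then have "\<exists>Z. proj_chain I Y (vdim I Y) Z"
    unfolding vdim_alt by (rule GreatestI_nat[where b = m]) (use assms(3) in blast)
  then show ?thesis using assms(3) by blast
qed

lemma proj_chain_extend:
  assumes "proj_chain I Y m Z" "Z m \<subset> W" "zclosed I W" "zirreducible I W" "W \<subseteq> Y'" "Y \<subseteq> Y'"
  shows "proj_chain I Y' (Suc m) (Z(Suc m := W))"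
proof -
  have "zclosed I ((Z(Suc m := W)) j) \<and> zirreducible I ((Z(Suc m := W)) j) \<and> (Z(Suc m := W)) j \<subseteq> Y'"
    if "j \<le> Suc m" for j
  proof (cases "j = Suc m")
    case False
    then have "j \<le> m" using that by simp
    then have "zclosed I (Z j) \<and> zirreducible I (Z j) \<and> Z j \<subseteq> Y" using assms(1) unfolding proj_chain_def by blast
    then show ?thesis using False assms(6) by auto
  qed (use assms in simp)
  moreover have "(Z(Suc m := W)) j \<subset> (Z(Suc m := W)) (Suc j)" if "j < Suc m" for j
    using assms(1,2) that by (cases "j = m") (auto simp: proj_chain_def)
  ultimately show ?thesis unfolding proj_chain_def by blast
qed

lemma dim_singleton_zero: "cv.dim {0} = 0"
  by (metis card.empty cv.dim_span_eq_card_independent cv.independent_empty cv.span_empty)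

text \<open>Removing basis vectors one at a time gives a flag; strict inclusions of subspaces stay
  strict for \<open>PP\<close> by \<open>PP_inj\<close>.\<close>

lemma linear_chain:
  assumes "finite I" "cv.subspace U" "U \<subseteq> vecs I" "cv.dim U = Suc D"
  shows "\<exists>Z. proj_chain I (PP U) D Z \<and> Z D = PP U"
  using assms(2-4)
proof (induction D arbitrary: U)
  case 0
  have "U \<noteq> {0}" using 0 by (auto simp: dim_singleton_zero)
  then show ?case using 0 zclosed_PP[OF assms(1)] zirreducible_PP[OF assms(1)]
    by (intro exI[of _ "\<lambda>_. PP U"]) (auto simp: proj_chain_def)
next
  case (Suc D)
  have "U \<noteq> {0}" using Suc.prems by (auto simp: dim_singleton_zero)
  obtain B where B: "B \<subseteq> U" "cv.independent B" "U \<subseteq> cv.span B" "card B = Suc (Suc D)"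
    using cv.basis_exists Suc by metis
  have fB: "finite B" by (rule card_ge_0_finite) (simp add: B(4))
  obtain b where b: "b \<in> B" using B(4) by (metis card.empty ex_in_conv nat.distinct(1))
  let ?V = "cv.span (B - {b})"
  have i: "cv.independent (B - {b})" using B cv.independent_mono by blast
  have dV: "cv.dim ?V = Suc D" using cv.dim_span_eq_card_independent[OF i] B fB b by simp
  have VU: "?V \<subseteq> U" using B Suc.prems by (intro cv.span_minimal) auto
  have "b \<notin> ?V" using B b by (auto simp: cv.dependent_def)
  then have "?V \<subset> U" using VU b B by blast
  then have "PP ?V \<subset> PP U" using PP_mono PP_inj Suc.prems cv.subspace_span by blast
  obtain Z where Z: "proj_chain I (PP ?V) D Z" "Z D = PP ?V"
    using Suc.IH[OF cv.subspace_span _ dV] VU Suc.prems(2) by (metis order_trans)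
  have "proj_chain I (PP U) (Suc D) (Z(Suc D := PP U))"
    by (rule proj_chain_extend[OF Z(1)])
      (use Z \<open>PP ?V \<subset> PP U\<close> Suc.prems zclosed_PP[OF assms(1)] zirreducible_PP[OF assms(1)] \<open>U \<noteq> {0}\<close> in auto)
  then show ?case by (metis fun_upd_same)
qed

text \<open>States that the Hilbert function of \<open>Y\<close> in degree \<open>d\<close> is at
  least \<open>N\<close>, without forming the coordinate ring.\<close>

definition indep_forms :: "'i set \<Rightarrow> 'i point set \<Rightarrow> nat \<Rightarrow> nat \<Rightarrow> (nat \<Rightarrow> 'i vec \<Rightarrow> complex) \<Rightarrow> bool" where
  "indep_forms I Y d N b \<longleftrightarrow> (\<forall>i<N. hform I d (b i)) \<and>
     (\<forall>c. (\<forall>y\<in>Y. (\<Sum>i<N. c i * b i (rep y)) = 0) \<longrightarrow> (\<forall>i<N. c i = 0))"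

lemma zirreducible_mult_zero:
  assumes "finite I" "zirreducible I Z" "hform I d f" "hform I e g" "\<forall>y\<in>Z. f (rep y) * g (rep y) = 0"
    "y0 \<in> Z" "f (rep y0) \<noteq> 0" "y \<in> Z"
  shows "g (rep y) = 0"
proof -
  have "Z \<subseteq> {q \<in> proj_space I. f (rep q) = 0} \<union> {q \<in> proj_space I. g (rep q) = 0}"
    using assms(2,5) by (auto simp: zirreducible_def)
  then show ?thesis
    using assms(2,6-8) zclosed_zero_set[OF assms(1,3)] zclosed_zero_set[OF assms(1,4)]
    unfolding zirreducible_def by blast
qed

lemma sum_lessThan_add: "(\<Sum>i<a + b. f i) = (\<Sum>i<a. f i) + (\<Sum>i<b. f (a + i) :: complex)" for a b :: nat
  by (induction b) (simp_all add: add.assoc)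

text \<open>A proper inclusion of irreducible closed sets adds one algebraically independent form:
  multiples of a form vanishing on the smaller set are independent of lifts from the smaller set.\<close>

lemma indep_forms_chain:
  assumes fin: "finite I"
    and irr: "\<And>j. j \<le> M \<Longrightarrow> zirreducible I (Z j)" and mono: "\<And>j. j < M \<Longrightarrow> Z j \<subseteq> Z (Suc j)"
    and g: "\<And>j. j \<le> M \<Longrightarrow> hform I e (g j)" "\<And>j. j < M \<Longrightarrow> \<forall>y\<in>Z j. g (Suc j) (rep y) = 0"
      "\<And>j. j \<le> M \<Longrightarrow> \<exists>y\<in>Z j. g j (rep y) \<noteq> 0"
    and "m \<le> M"
  shows "\<exists>b. indep_forms I (Z m) (k * e) ((k + m) choose m) b"
  using \<open>m \<le> M\<close>
proof (induction m arbitrary: k)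
  case 0
  obtain y where "y \<in> Z 0" "g 0 (rep y) \<noteq> 0" using g(3)[of 0] by auto
  then have "indep_forms I (Z 0) (k * e) 1 (\<lambda>_ v. g 0 v ^ k)"
    using hform_power[OF fin g(1)[of 0]] by (auto simp: indep_forms_def)
  then show ?case by auto
next
  case (Suc m)
  note IHm = Suc.IH
  obtain y0 where y0: "y0 \<in> Z (Suc m)" "g (Suc m) (rep y0) \<noteq> 0" using g(3)[of "Suc m"] Suc by auto
  show ?case using Suc.prems
  proof (induction k)
    case 0
    have "indep_forms I (Z (Suc m)) 0 1 (\<lambda>_ _. 1)"
      using y0 hform_const[OF fin] by (auto simp: indep_forms_def)
    then show ?case by auto
  next
    case (Suc k)
    define N1 where "N1 = (k + Suc m choose Suc m)"
    define N2 where "N2 = (Suc k + m choose m)"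
    \<comment> \<open>Pascal's rule: \<open>N2\<close> forms lifted from the smaller set in the full
      degree, and \<open>N1\<close> multiples of \<open>g (Suc m)\<close> by forms whose degree is
      lower by \<open>e\<close>.\<close>
    have N12: "Suc k + Suc m choose Suc m = N2 + N1" by (simp add: N1_def N2_def)
    obtain b1 where b1: "indep_forms I (Z (Suc m)) (k * e) N1 b1" using Suc unfolding N1_def by blast
    obtain b2 where b2: "indep_forms I (Z m) (Suc k * e) N2 b2"
      using Suc.prems IHm[of "Suc k"] unfolding N2_def by auto
    let ?b = "\<lambda>i v. if i < N2 then b2 i v else g (Suc m) v * b1 (i - N2) v"
    have hf: "hform I (Suc k * e) (?b i)" if "i < N2 + N1" for i
    proof (cases "i < N2")
      case True then show ?thesis using b2 by (simp add: indep_forms_def)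
    next
      case False
      then have "i - N2 < N1" using that by linarith
      then show ?thesis using False b1 hform_mult[OF fin g(1)[of "Suc m"], of "k * e" "b1 (i - N2)"] Suc.prems
        by (simp add: indep_forms_def)
    qed
    have split: "(\<Sum>i<N2 + N1. c i * ?b i v) = (\<Sum>i<N2. c i * b2 i v) + g (Suc m) v * (\<Sum>i<N1. c (N2 + i) * b1 i v)" for c v
      by (simp add: sum_lessThan_add sum_distrib_left mult_ac)
    have "\<forall>i<N2 + N1. c i = 0" if c: "\<forall>y\<in>Z (Suc m). (\<Sum>i<N2 + N1. c i * ?b i (rep y)) = 0" for c
    proof -
      have "(\<Sum>i<N2. c i * b2 i (rep y)) = 0" if "y \<in> Z m" for y
      proof -
        have "y \<in> Z (Suc m)" using that mono[of m] Suc.prems by auto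
        then show ?thesis using c split[of c "rep y"] g(2)[of m] Suc.prems that by simp
      qed
      then have c2: "\<forall>i<N2. c i = 0" using b2 unfolding indep_forms_def by blast
      have prod0: "\<forall>y\<in>Z (Suc m). g (Suc m) (rep y) * (\<Sum>i<N1. c (N2 + i) * b1 i (rep y)) = 0"
        using c split c2 by simp
      have "hform I (k * e) (\<lambda>v. \<Sum>i<N1. c (N2 + i) * b1 i v)"
        using b1 by (intro hform_sum hform_cmult) (simp add: indep_forms_def)
      \<comment> \<open>Irreducibility of \<open>Z (Suc m)\<close> cancels the factor
        \<open>g (Suc m)\<close>, which is not identically zero there.\<close>
      then have "(\<Sum>i<N1. c (N2 + i) * b1 i (rep y)) = 0" if "y \<in> Z (Suc m)" for y
        using zirreducible_mult_zero[OF fin irr[of "Suc m"] g(1)[of "Suc m"] _ prod0 y0 that] Suc.prems by blast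
      then have "\<forall>i<N1. c (N2 + i) = 0"
        using b1[unfolded indep_forms_def, THEN conjunct2, THEN spec, of "\<lambda>i. c (N2 + i)"] by blast
      then show ?thesis using c2
        by (metis add_less_cancel_left le_add_diff_inverse not_less)
    qed
    then have "indep_forms I (Z (Suc m)) (Suc k * e) (N2 + N1) ?b"
      using hf unfolding indep_forms_def by blast
    then show ?case unfolding N12 by blast
  qed
qed

text \<open>Consecutive members of the chain are separated by forms of possibly different degrees.
  The common degree \<open>e\<close> is the product of these degrees, and suitable powers of the
  forms reach it without changing their zeros.\<close>

lemma proj_chain_indep_forms:
  assumes "finite I" "proj_chain I Y M Z"
  obtains e where "\<And>k. \<exists>b. indep_forms I (Z M) (k * e) ((k + M) choose M) b"
proof -
  have irr: "zirreducible I (Z j)" and cl: "zclosed I (Z j)" if "j \<le> M" for j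
    using assms(2) that by (auto simp: proj_chain_def)
  have sub: "Z j \<subset> Z (Suc j)" if "j < M" for j using assms(2) that by (auto simp: proj_chain_def)
  have "\<exists>d f. hform I d f \<and> d > 0 \<and> (j > 0 \<longrightarrow> (\<forall>y\<in>Z (j - 1). f (rep y) = 0)) \<and> (\<exists>y\<in>Z j. f (rep y) \<noteq> 0)"
    if j: "j \<le> M" for j
  proof (cases "j = 0")
    case True
    obtain y where y: "y \<in> Z 0" "y \<in> proj_space I" using irr[of 0] by (auto simp: zirreducible_def)
    have "rep y \<noteq> 0" "rep y \<in> vecs I" using proj_rep[OF y(2)] by auto
    then obtain i where "i \<in> I" "rep y i \<noteq> 0" by (auto simp: fun_eq_iff vecs_def vec_apply)
    then show ?thesis using True y hform_var[OF assms(1), of i] by (intro exI[of _ 1] exI[of _ "\<lambda>v. v i"]) auto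
  next
    case False
    then obtain y where y: "y \<in> Z j" "y \<notin> Z (j - 1)" using sub[of "j - 1"] j by (metis One_nat_def Suc_pred gr0I less_le_trans lessI psubset_imp_ex_mem Diff_iff)
    have yp: "y \<in> proj_space I" using y irr[OF j] by (auto simp: zirreducible_def)
    obtain d f where f: "hform I d f" "f (rep y) \<noteq> 0"
      "\<And>w. w \<in> vecs I \<Longrightarrow> w \<noteq> 0 \<Longrightarrow> cv.span {w} \<in> Z (j - 1) \<Longrightarrow> f w = 0"
      using not_in_zclosed[OF cl[of "j - 1"] assms(1) proj_rep(1,2)[OF yp]] proj_rep(3)[OF yp] y j
      by (metis diff_le_self le_trans)
    have van: "f (rep x) = 0" if "x \<in> Z (j - 1)" for x
    proof -
      have "x \<in> proj_space I" using that irr[of "j - 1"] j unfolding zirreducible_def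
        by (metis diff_le_self le_trans subsetD)
      then show ?thesis using f(3)[of "rep x"] proj_rep[of x I] that by auto
    qed
    \<comment> \<open>A form of degree 0 is constant, yet this one vanishes on the nonempty set
      \<open>Z (j - 1)\<close> and not at \<open>y\<close>.\<close>
    have "d > 0"
    proof (rule ccontr)
      assume "\<not> d > 0"
      then have "f (rep y) = f (cscale 0 (rep y))" using hform_homogeneous[OF assms(1) f(1), of 0 "rep y"] by simp
      moreover obtain x where "x \<in> Z (j - 1)" using irr[of "j - 1"] j unfolding zirreducible_def
        by (metis diff_le_self ex_in_conv le_trans)
      ultimately have "f (rep y) = f (rep x)" using \<open>\<not> d > 0\<close>
        hform_homogeneous[OF assms(1) f(1), of 0 "rep x"] by (simp add: cscale_def)
      then show False using van[OF \<open>x \<in> Z (j - 1)\<close>] f by simp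
    qed
    then show ?thesis using f(1,2) van y(1) by (intro exI[of _ d] exI[of _ f] conjI impI ballI bexI[of _ y]) auto
  qed
  then obtain d f where df: "\<And>j. j \<le> M \<Longrightarrow> hform I (d j) (f j) \<and> (d j :: nat) > 0 \<and>
      (j > 0 \<longrightarrow> (\<forall>y\<in>Z (j - 1). f j (rep y) = 0)) \<and> (\<exists>y\<in>Z j. f j (rep y) \<noteq> 0)"
    by metis
  define e where "e = (\<Prod>j\<le>M. d j)"
  have ed: "e = (e div d j) * d j" "e div d j > 0" if "j \<le> M" for j
  proof -
    have "d j dvd e" unfolding e_def using that by (intro dvd_prodI) auto
    moreover have "e > 0" unfolding e_def using df by (intro prod_pos) auto
    ultimately show "e = (e div d j) * d j" "e div d j > 0" using df[OF that]
      by (simp_all add: dvd_imp_le div_greater_zero_iff)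
  qed
  let ?g = "\<lambda>j v. f j v ^ (e div d j)"
  have "\<exists>b. indep_forms I (Z M) (k * e) (k + M choose M) b" for k
  proof (rule indep_forms_chain[OF assms(1), where M = M and g = ?g])
    show "hform I e (?g j)" if "j \<le> M" for j
      using hform_power[OF assms(1), of "d j" "f j" "e div d j"] df[OF that] ed(1)[OF that] by metis
    show "\<forall>y\<in>Z j. ?g (Suc j) (rep y) = 0" if "j < M" for j
      using df[of "Suc j"] ed(2)[of "Suc j"] that by simp
    show "\<exists>y\<in>Z j. ?g j (rep y) \<noteq> 0" if "j \<le> M" for j using df[OF that] by auto
  qed (use irr sub in auto)
  then show ?thesis using that by blast
qed

section \<open>Upper bounds on dimension from polynomial parametrizations\<close>

definition bdpoly :: "nat \<Rightarrow> nat \<Rightarrow> ((nat \<Rightarrow> complex) \<Rightarrow> complex) set" where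
  "bdpoly m E = cv.span ((\<lambda>\<beta> z. \<Prod>i<m. z i ^ \<beta> i) ` {\<beta>. \<forall>i. (i \<in> {..<m} \<longrightarrow> \<beta> i \<in> {..E}) \<and> (i \<notin> {..<m} \<longrightarrow> \<beta> i = 0)})"

lemma bdpoly_mono: "E \<le> E' \<Longrightarrow> bdpoly m E \<subseteq> bdpoly m E'"
  unfolding bdpoly_def by (rule cv.span_mono, rule image_mono) auto

lemma bdpoly_add: "f \<in> bdpoly m E \<Longrightarrow> g \<in> bdpoly m E \<Longrightarrow> (\<lambda>z. f z + g z) \<in> bdpoly m E"
  using cv.span_add[of f _ g] by (simp add: bdpoly_def plus_fun_def)

lemma bdpoly_cmult: "f \<in> bdpoly m E \<Longrightarrow> (\<lambda>z. c * f z) \<in> bdpoly m E"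
  using cv.span_scale[of f _ c] by (simp add: bdpoly_def cscale_def)

lemma bdpoly_const: "(\<lambda>_. c) \<in> bdpoly m E"
proof -
  have "(\<lambda>_. 1) \<in> bdpoly m E" unfolding bdpoly_def
    by (intro cv.span_base image_eqI[of _ _ "\<lambda>_. 0"]) auto
  then show ?thesis using bdpoly_cmult[of "\<lambda>_. 1" m E c] by simp
qed

lemma bdpoly_var: assumes "i < m" shows "(\<lambda>z. z i) \<in> bdpoly m 1"
proof -
  have "(\<lambda>z. z i) = (\<lambda>z :: nat \<Rightarrow> complex. \<Prod>j<m. z j ^ (if j = i then 1 else 0))"
    using assms by (intro ext) (simp add: prod.delta if_distrib cong: if_cong)
  then show ?thesis unfolding bdpoly_def using assms
    by (intro cv.span_base image_eqI[of _ _ "\<lambda>j. if j = i then 1 else 0"]) auto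
qed

lemma bdpoly_mult:
  assumes "f \<in> bdpoly m E" "g \<in> bdpoly m E'" shows "(\<lambda>z. f z * g z) \<in> bdpoly m (E + E')"
  using assms(1) unfolding bdpoly_def[of m E]
proof (induction rule: cv.span_induct_alt)
  case base then show ?case using bdpoly_const[of 0] by (simp add: vec_apply)
next
  case (step c x y)
  obtain \<alpha> where \<alpha>: "\<forall>i. (i \<in> {..<m} \<longrightarrow> \<alpha> i \<in> {..E}) \<and> (i \<notin> {..<m} \<longrightarrow> \<alpha> i = 0)"
    "x = (\<lambda>z. \<Prod>i<m. z i ^ \<alpha> i)" using step(1) by auto
  have "(\<lambda>z. x z * g z) \<in> bdpoly m (E + E')"
    using assms(2) unfolding bdpoly_def[of m E']
  proof (induction rule: cv.span_induct_alt)
    case base then show ?case using bdpoly_const[of 0] by (simp add: vec_apply)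
  next
    case (step c' x' y')
    obtain \<beta> where \<beta>: "\<forall>i. (i \<in> {..<m} \<longrightarrow> \<beta> i \<in> {..E'}) \<and> (i \<notin> {..<m} \<longrightarrow> \<beta> i = 0)"
      "x' = (\<lambda>z. \<Prod>i<m. z i ^ \<beta> i)" using step(1) by auto
    have "(\<lambda>z. x z * x' z) \<in> bdpoly m (E + E')"
      unfolding bdpoly_def using \<alpha>(1) \<beta>(1)
      by (intro cv.span_base image_eqI[of _ _ "\<lambda>i. \<alpha> i + \<beta> i"])
        (auto simp: \<alpha>(2) \<beta>(2) power_add prod.distrib intro!: add_mono)
    then have "(\<lambda>z. c' * (x z * x' z) + x z * y' z) \<in> bdpoly m (E + E')"
      using step by (intro bdpoly_add bdpoly_cmult) auto
    then show ?case by (simp add: vec_apply algebra_simps)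
  qed
  then have "(\<lambda>z. c * (x z * g z) + y z * g z) \<in> bdpoly m (E + E')"
    using step by (intro bdpoly_add bdpoly_cmult) auto
  then show ?case by (simp add: vec_apply algebra_simps)
qed

lemma bdpoly_hform:
  assumes "finite I" "hform I d f" "\<And>i. i \<in> I \<Longrightarrow> (\<lambda>z. G z i) \<in> bdpoly m E"
  shows "(\<lambda>z. f (G z)) \<in> bdpoly m (d * E)"
  using assms(1,2)
proof (induction rule: hform_induct)
  case (var d f i) then show ?case using bdpoly_mult[OF assms(3)[OF var(1)] var(3)] by simp
qed (auto intro: bdpoly_const bdpoly_add bdpoly_cmult)

text \<open>The maps must cover \<open>Y\<close> but may take values outside it; hence the property
  passes to every subset of \<open>Y\<close>, in particular to the top of a chain inside
  \<open>Y\<close>.\<close>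

definition patched :: "'i set \<Rightarrow> 'i point set \<Rightarrow> nat \<Rightarrow> nat \<Rightarrow> 'p set \<Rightarrow> ('p \<Rightarrow> (nat \<Rightarrow> complex) \<Rightarrow> 'i vec) \<Rightarrow> bool" where
  "patched I Y m E A G \<longleftrightarrow> finite A \<and> (\<forall>a\<in>A. \<forall>i\<in>I. (\<lambda>z. G a z i) \<in> bdpoly m E) \<and>
     (\<forall>y\<in>Y. \<exists>a\<in>A. \<exists>z. G a z \<noteq> 0 \<and> y = cv.span {G a z})"

text \<open>A form of degree \<open>d\<close> pulls back on each patch to a polynomial of degree at
  most \<open>d * E\<close> in each of the \<open>m\<close> parameters. Since the patches cover
  \<open>Y\<close>, a relation between the pullbacks is a relation on \<open>Y\<close>.\<close>

lemma patched_indep_forms_bound: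
  assumes fin: "finite I" and "patched I Y m E A G" "indep_forms I Y d N b"
  shows "N \<le> card A * (d * E + 1) ^ m"
proof -
  let ?X = "{\<beta>. \<forall>i. (i \<in> {..<m} \<longrightarrow> \<beta> i \<in> {..d * E}) \<and> (i \<notin> {..<m} \<longrightarrow> \<beta> i = 0)}"
  \<comment> \<open>The pullbacks live on the disjoint union of the patches, encoded as pairs of a
    patch and a parameter; \<open>?h a\<close> extends a function on patch \<open>a\<close> by
    zero.\<close>
  let ?h = "\<lambda>a f p. if fst p = a then f (snd p) else (0::complex)"
  let ?S = "\<Union>a\<in>A. (\<lambda>\<beta>. ?h a (\<lambda>z. \<Prod>i<m. z i ^ \<beta> i)) ` ?X"
  let ?B = "\<lambda>i p. if fst p \<in> A then b i (G (fst p) (snd p)) else 0"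
  have finA: "finite A" using assms by (simp add: patched_def)
  have cX: "finite ?X" "card ?X = (d * E + 1) ^ m"
  proof -
    show "finite ?X" by (rule finite_set_of_finite_funs) auto
    have "bij_betw (\<lambda>\<beta>. restrict \<beta> {..<m}) ?X ({..<m} \<rightarrow>\<^sub>E {..d * E})"
    proof (rule bij_betwI[of _ _ _ "\<lambda>\<beta> i. if i < m then \<beta> i else 0"])
      show "(\<lambda>i. if i < m then restrict \<beta> {..<m} i else 0) = \<beta>" if "\<beta> \<in> ?X" for \<beta> using that by (auto simp: fun_eq_iff)
      show "restrict (\<lambda>i. if i < m then \<beta> i else 0) {..<m} = \<beta>" if "\<beta> \<in> {..<m} \<rightarrow>\<^sub>E {..d * E}" for \<beta>
        using that by (auto simp: fun_eq_iff PiE_def extensional_def)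
      show "(\<lambda>\<beta>. restrict \<beta> {..<m}) \<in> ?X \<rightarrow> {..<m} \<rightarrow>\<^sub>E {..d * E}" by (auto simp: PiE_def Pi_def)
      show "(\<lambda>\<beta> i. if i < m then \<beta> i else 0) \<in> ({..<m} \<rightarrow>\<^sub>E {..d * E}) \<rightarrow> ?X" by (auto simp: PiE_def Pi_def)
    qed
    then show "card ?X = (d * E + 1) ^ m" by (simp add: bij_betw_same_card card_PiE)
  qed
  have fS: "finite ?S" using finA cX by blast
  have "card ?S \<le> (\<Sum>a\<in>A. card ((\<lambda>\<beta>. ?h a (\<lambda>z. \<Prod>i<m. z i ^ \<beta> i)) ` ?X))" using finA by (rule card_UN_le)
  also have "\<dots> \<le> (\<Sum>a\<in>A. (d * E + 1) ^ m)" unfolding cX(2)[symmetric] by (intro sum_mono card_image_le cX(1))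
  finally have cS: "card ?S \<le> card A * (d * E + 1) ^ m" by simp
  have lift: "?h a f \<in> cv.span ?S" if "f \<in> bdpoly m (d * E)" "a \<in> A" for a f
    using that(1) unfolding bdpoly_def
  proof (induction rule: cv.span_induct_alt)
    case base
    have "?h a 0 = 0" by (simp add: fun_eq_iff vec_apply)
    then show ?case by (metis cv.span_zero)
  next
    case (step c x y)
    have "?h a (cscale c x + y) = cscale c (?h a x) + ?h a y" by (auto simp: fun_eq_iff vec_apply)
    moreover have "?h a x \<in> cv.span ?S" using step(1) that(2) by (intro cv.span_base) blast
    ultimately show ?case using cv.span_add[OF cv.span_scale step(2), of "?h a x" c] by simp
  qed
  have Bin: "?B i \<in> cv.span ?S" if "i < N" for i
  proof -
    have *: "(\<lambda>z. b i (G a z)) \<in> bdpoly m (d * E)" if "a \<in> A" for a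
      using bdpoly_hform[OF fin, of d "b i" "G a" m E] assms(2,3) that \<open>i < N\<close>
      by (simp add: patched_def indep_forms_def)
    have "?B i = (\<Sum>a\<in>A. ?h a (\<lambda>z. b i (G a z)))"
      by (rule ext) (use finA in \<open>auto simp: sum_fun_apply sum.delta' sum.delta\<close>)
    then show ?thesis using lift[OF *] by (simp add: cv.span_sum)
  qed
  have "\<forall>i\<in>{..<N}. c i = 0" if c: "(\<Sum>i<N. cscale (c i) (?B i)) = 0" for c
  proof -
    have "(\<Sum>i<N. c i * b i (rep y)) = 0" if y: "y \<in> Y" for y
    proof -
      obtain a z where az: "a \<in> A" "G a z \<noteq> 0" "y = cv.span {G a z}" using assms(2) y unfolding patched_def by blast
      obtain t where t: "t \<noteq> 0" "rep y = cscale t (G a z)" using rep_span[OF az(2)] az(3) by metis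
      have "(\<Sum>i<N. cscale (c i) (?B i)) (a, z) = 0" by (simp only: c zero_fun_apply)
      then have "(\<Sum>i<N. c i * b i (G a z)) = 0" using az by (simp add: sum_fun_apply cscale_apply)
      moreover have "(\<Sum>i<N. c i * b i (rep y)) = (\<Sum>i<N. t ^ d * (c i * b i (G a z)))"
        unfolding t(2) using assms(3) hform_homogeneous[OF fin]
        by (intro sum.cong) (auto simp: indep_forms_def)
      ultimately show ?thesis by (simp add: sum_distrib_left[symmetric])
    qed
    then show ?thesis using assms(3) unfolding indep_forms_def by blast
  qed
  then have ind: "inj_on ?B {..<N}" "cv.independent (?B ` {..<N})"
    using independent_family[of "{..<N}" ?B] by auto
  have "card (?B ` {..<N}) \<le> card ?S"
    using cv.independent_span_bound[OF fS ind(2)] Bin by blast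
  then show ?thesis using cS card_image[OF ind(1)] by simp
qed

text \<open>The binomial coefficient grows at least like (k / M)^M, the number of monomials at most
  like k^m, so \<open>m < M\<close> fails for large \<open>k\<close>.\<close>

lemma patched_growth_bound:
  assumes fin: "finite I" and "patched I Y m E A G"
    and "\<And>k. \<exists>b. indep_forms I Y (k * e) ((k + M) choose M) b"
  shows "M \<le> m"
proof (rule ccontr)
  assume "\<not> M \<le> m"
  then have M: "m < M" by simp
  \<comment> \<open>Everything independent of \<open>k\<close> in the two bounds is collected here;
    M^M stems from the denominator in (k / M)^M.\<close>
  define c where "c = real (card A) * real (e * E + 1) ^ m * real M ^ M"
  have bound: "real k \<le> c" if "k \<ge> 1" for k
  proof -
    obtain b where "indep_forms I Y (k * e) ((k + M) choose M) b" using assms(3) by blast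
    then have "((k + M) choose M) \<le> card A * (k * e * E + 1) ^ m"
      using patched_indep_forms_bound[OF fin assms(2)] by blast
    also have "\<dots> \<le> card A * (k * (e * E + 1)) ^ m"
      using that by (intro mult_left_mono power_mono) (auto simp: algebra_simps)
    finally have "real ((k + M) choose M) \<le> real (card A * (k * (e * E + 1)) ^ m)"
      using of_nat_mono by blast
    moreover have "(real (k + M) / real M) ^ M \<le> real ((k + M) choose M)"
      by (rule binomial_ge_n_over_k_pow_k) simp
    moreover have "(real k / real M) ^ M \<le> (real (k + M) / real M) ^ M"
      by (intro power_mono divide_right_mono) auto
    ultimately have "(real k / real M) ^ M \<le> real (card A) * real (k * (e * E + 1)) ^ m"
      by simp
    then have "(real k / real M) ^ M \<le> real (card A) * (real k ^ m * real (e * E + 1) ^ m)"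
      by (metis of_nat_mult power_mult_distrib)
    then have "real k ^ M \<le> c * real k ^ m"
      using M by (simp add: c_def power_divide divide_simps algebra_simps split: if_splits)
    moreover have "real k ^ (Suc m) \<le> real k ^ M" using M that by (intro power_increasing) auto
    ultimately have "real k * real k ^ m \<le> c * real k ^ m" by simp
    then show ?thesis using that by simp
  qed
  obtain k :: nat where "c < real k" using reals_Archimedean2 by blast
  then show False using bound[of "Suc k"] by simp
qed

lemma patched_chain_bound:
  assumes "finite I" "patched I Y m E A G" "proj_chain I Y M Z"
  shows "M \<le> m"
proof -
  have "Z M \<subseteq> Y" using assms by (simp add: proj_chain_def)
  then have "patched I (Z M) m E A G" using assms(2) unfolding patched_def by blast
  then show ?thesis using proj_chain_indep_forms[OF assms(1,3)] patched_growth_bound[OF assms(1)] by metis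
qed

text \<open>Otherwise forms independent on the whole projective space would remain independent on
  \<open>Y\<close>, and the flag of linear subspaces of length \<open>card I - 1\<close> would
  contradict the growth bound for \<open>m\<close> parameters.\<close>

lemma patched_vanishing_form:
  assumes "finite I" "patched I Y m E A G" "m + 1 < card I" "Y \<subseteq> proj_space I"
  obtains d f where "hform I d f" "\<forall>y\<in>Y. f (rep y) = 0" "\<exists>y\<in>proj_space I. f (rep y) \<noteq> 0"
proof (rule ccontr)
  assume "\<not> thesis"
  then have nothesis: "\<not> (\<exists>d f. hform I d f \<and> (\<forall>y\<in>Y. f (rep y) = 0) \<and> (\<exists>y\<in>proj_space I. f (rep y) \<noteq> 0))"
    using that by blast
  then have no: "f (rep y) = 0" if "hform I d f" "\<forall>y\<in>Y. f (rep y) = 0" "y \<in> proj_space I" for d f y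
    using that nothesis by blast
  obtain M where M: "card I = Suc M" using assms(3) by (cases "card I") auto
  obtain Z where Z: "proj_chain I (proj_space I) M Z" "Z M = proj_space I"
    using linear_chain[OF assms(1) subspace_vecs subset_refl] dim_vecs[OF assms(1)] M by metis
  obtain e where e: "\<And>k. \<exists>b. indep_forms I (proj_space I) (k * e) ((k + M) choose M) b"
    using proj_chain_indep_forms[OF assms(1) Z(1)] Z(2) by metis
  have "indep_forms I Y d N b" if "indep_forms I (proj_space I) d N b" for d N b
    unfolding indep_forms_def
  proof (intro conjI allI impI)
    show "hform I d (b i)" if "i < N" for i using \<open>indep_forms I (proj_space I) d N b\<close> that by (simp add: indep_forms_def)
    fix c i assume c: "\<forall>y\<in>Y. (\<Sum>i<N. c i * b i (rep y)) = 0" and i: "i < N"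
    have "hform I d (\<lambda>v. \<Sum>i<N. c i * b i v)"
      using that by (intro hform_sum hform_cmult) (simp add: indep_forms_def)
    then have "\<forall>y\<in>proj_space I. (\<Sum>i<N. c i * b i (rep y)) = 0" using no c by blast
    then show "c i = 0" using that i unfolding indep_forms_def by blast
  qed
  then have "M \<le> m" using patched_growth_bound[OF assms(1,2)] e by metis
  then show False using M assms(3) by simp
qed

section \<open>Morphisms\<close>

lemma nearbyE_form:
  assumes "nearby I Y y P" "finite I" "y \<in> proj_space I" "Y \<subseteq> proj_space I"
  obtains d f where "hform I d f" "f (rep y) \<noteq> 0" "\<And>q. q \<in> Y \<Longrightarrow> f (rep q) \<noteq> 0 \<Longrightarrow> P q"
proof -
  obtain A where A: "zclosed I A" "y \<notin> A" "\<forall>q\<in>Y - A. P q" using assms by (auto simp: nearby_def)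
  obtain d f where f: "hform I d f" "f (rep y) \<noteq> 0"
    "\<And>w. w \<in> vecs I \<Longrightarrow> w \<noteq> 0 \<Longrightarrow> cv.span {w} \<in> A \<Longrightarrow> f w = 0"
    using not_in_zclosed[OF A(1) assms(2) proj_rep(1,2)[OF assms(3)]] proj_rep(3)[OF assms(3)] A(2) by metis
  have "P q" if q: "q \<in> Y" "f (rep q) \<noteq> 0" for q
  proof -
    have "q \<in> proj_space I" using q assms by blast
    then have "q \<notin> A" using f(3)[of "rep q"] proj_rep[of q I] q by metis
    then show ?thesis using A q by blast
  qed
  then show ?thesis using that f by blast
qed

lemma nearby_conj:
  assumes "nearby I Y y P" "nearby I Y y Q" "finite I" "y \<in> proj_space I" "Y \<subseteq> proj_space I"
  shows "nearby I Y y (\<lambda>q. P q \<and> Q q)"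
proof -
  obtain d f where f: "hform I d f" "f (rep y) \<noteq> 0" "\<And>q. q \<in> Y \<Longrightarrow> f (rep q) \<noteq> 0 \<Longrightarrow> P q"
    using nearbyE_form[OF assms(1,3,4,5)] by metis
  obtain e g where g: "hform I e g" "g (rep y) \<noteq> 0" "\<And>q. q \<in> Y \<Longrightarrow> g (rep q) \<noteq> 0 \<Longrightarrow> Q q"
    using nearbyE_form[OF assms(2,3,4,5)] by metis
  show ?thesis
    by (rule nearbyI_form[OF assms(3) hform_mult[OF assms(3) f(1) g(1)] assms(4) _ _ assms(5)])
      (use f g in auto)
qed

definition restr :: "'k set \<Rightarrow> ('k \<Rightarrow> 'i vec \<Rightarrow> complex) \<Rightarrow> 'i vec \<Rightarrow> 'k vec" where
  "restr K F v = (\<lambda>k. if k \<in> K then F k v else 0)"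

lemma restr_scale:
  assumes "finite I" "\<And>k. k \<in> K \<Longrightarrow> hform I d (F k)"
  shows "restr K F (cscale c v) = cscale (c ^ d) (restr K F v)"
  using assms hform_homogeneous[OF assms(1) assms(2)] by (auto simp: restr_def fun_eq_iff cscale_apply)

lemma morphism_at:
  assumes "morphism I Y K Z \<phi>" "y \<in> Y"
  obtains d F k where "\<And>k. k \<in> K \<Longrightarrow> hform I d (F k)" "k \<in> K" "F k (rep y) \<noteq> 0"
    "nearby I Y y (\<lambda>q. \<phi> q = cv.span {restr K F (rep q)})"
  using assms unfolding morphism_def restr_def by meson

text \<open>Shows later that a tuple of forms is nonzero as soon as its span is a value of a
  morphism: the span of 0 is {0}, while a point contains a nonzero vector.\<close>

lemma span_zero_notin_proj: "cv.span {0} \<notin> proj_space (I :: 'a set)"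
proof
  assume z: "cv.span {0} \<in> proj_space I"
  let ?r = "rep (cv.span {0 :: 'a vec})"
  have "?r \<in> cv.span {?r}" by (simp add: cv.span_base)
  then have "?r \<in> cv.span {0}" using proj_rep(3)[OF z] by metis
  then show False using proj_rep(2)[OF z] by simp
qed

lemma morphism_compose:
  assumes fin: "finite I" "finite K" "finite J" and sub: "Y \<subseteq> proj_space I" "Z \<subseteq> proj_space K"
    and "morphism I Y K Z \<phi>" "morphism K Z J W \<psi>"
  shows "morphism I Y J W (\<psi> \<circ> \<phi>)"
  unfolding morphism_def
proof (intro conjI ballI)
  show "(\<psi> \<circ> \<phi>) ` Y \<subseteq> W" using assms unfolding morphism_def by fastforce
  fix y assume y: "y \<in> Y"
  then have yp: "y \<in> proj_space I" using sub by blast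
  obtain d F k where F: "\<And>k. k \<in> K \<Longrightarrow> hform I d (F k)" "k \<in> K" "F k (rep y) \<noteq> 0"
    "nearby I Y y (\<lambda>q. \<phi> q = cv.span {restr K F (rep q)})"
    by (rule morphism_at[OF assms(6) y]) (rule that; blast)
  have \<phi>y: "\<phi> y \<in> Z" using assms(6) y by (auto simp: morphism_def)
  then have \<phi>yp: "\<phi> y \<in> proj_space K" using sub by blast
  obtain e G j where G: "\<And>j. j \<in> J \<Longrightarrow> hform K e (G j)" "j \<in> J" "G j (rep (\<phi> y)) \<noteq> 0"
    "nearby K Z (\<phi> y) (\<lambda>q. \<psi> q = cv.span {restr J G (rep q)})"
    by (rule morphism_at[OF assms(7) \<phi>y]) (rule that; blast)
  obtain d1 f1 where f1: "hform I d1 f1" "f1 (rep y) \<noteq> 0"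
    "\<And>q. q \<in> Y \<Longrightarrow> f1 (rep q) \<noteq> 0 \<Longrightarrow> \<phi> q = cv.span {restr K F (rep q)}"
    using nearbyE_form[OF F(4) fin(1) yp sub(1)] by metis
  obtain d2 f2 where f2: "hform K d2 f2" "f2 (rep (\<phi> y)) \<noteq> 0"
    "\<And>q. q \<in> Z \<Longrightarrow> f2 (rep q) \<noteq> 0 \<Longrightarrow> \<psi> q = cv.span {restr J G (rep q)}"
    using nearbyE_form[OF G(4) fin(2) \<phi>yp sub(2)] by metis
  have comp: "hform I (m * d) (\<lambda>v. g (restr K F v))" if "hform K m g" for m g
    using hform_compose[OF fin(2,1) that F(1)] by (simp add: restr_def[abs_def])
  have rep\<phi>: "\<exists>c\<noteq>0. rep (\<phi> q) = cscale c (restr K F (rep q)) \<and> restr K F (rep q) \<noteq> 0"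
    if "q \<in> Y" "f1 (rep q) \<noteq> 0" for q
  proof -
    have "\<phi> q \<in> proj_space K" using assms(6) that sub by (auto simp: morphism_def)
    then have "restr K F (rep q) \<noteq> 0" using f1(3)[OF that] span_zero_notin_proj by metis
    then show ?thesis using rep_span f1(3)[OF that] by metis
  qed
  \<comment> \<open>The tuple of forms and \<open>rep (\<phi> q)\<close> differ by an unknown
    factor, so vanishing is compared rather than values.\<close>
  have nz: "g (restr K F (rep q)) = 0 \<longleftrightarrow> g (rep (\<phi> q)) = 0"
    if "q \<in> Y" "f1 (rep q) \<noteq> 0" "hform K m g" for q m g
    using rep\<phi>[OF that(1,2)] hform_zero_iff_scale[OF fin(2) that(3)] by metis
  have "nearby I Y y (\<lambda>q. (\<psi> \<circ> \<phi>) q = cv.span {restr J (\<lambda>j v. G j (restr K F v)) (rep q)})"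
  proof (rule nearbyI_form[OF fin(1) hform_mult[OF fin(1) f1(1) comp[OF f2(1)]] yp _ _ sub(1)])
    show "f1 (rep y) * f2 (restr K F (rep y)) \<noteq> 0" using f1(2) nz[OF y f1(2) f2(1)] f2(2) by simp
    fix q assume q: "q \<in> Y" "f1 (rep q) * f2 (restr K F (rep q)) \<noteq> 0"
    then have q1: "f1 (rep q) \<noteq> 0" "f2 (rep (\<phi> q)) \<noteq> 0" using nz[OF q(1) _ f2(1)] by auto
    obtain c where c: "c \<noteq> 0" "rep (\<phi> q) = cscale c (restr K F (rep q))" using rep\<phi>[OF q(1) q1(1)] by blast
    have "\<phi> q \<in> Z" using assms(6) q by (auto simp: morphism_def)
    then have "\<psi> (\<phi> q) = cv.span {restr J G (cscale c (restr K F (rep q)))}" using f2(3) q1 c by metis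
    also have "\<dots> = cv.span {restr J G (restr K F (rep q))}"
    proof -
      have "restr J G (cscale c w) = cscale (c ^ e) (restr J G w)" for w
        by (rule restr_scale[OF fin(2)]) (rule G(1))
      then show ?thesis by (simp add: span_single_scale c(1))
    qed
    also have "restr J G (restr K F (rep q)) = restr J (\<lambda>j v. G j (restr K F v)) (rep q)"
      by (simp add: restr_def)
    finally show "(\<psi> \<circ> \<phi>) q = cv.span {restr J (\<lambda>j v. G j (restr K F v)) (rep q)}" by simp
  qed
  moreover have "G j (restr K F (rep y)) \<noteq> 0" using nz[OF y f1(2) G(1)[OF G(2)]] G(3) by simp
  ultimately show "\<exists>d F. (\<forall>k\<in>J. hform I d (F k)) \<and> (\<exists>k\<in>J. F k (rep y) \<noteq> 0) \<and>
      nearby I Y y (\<lambda>q. (\<psi> \<circ> \<phi>) q = cv.span {\<lambda>k. if k \<in> J then F k (rep q) else 0})"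
    using comp[OF G(1)] G(2) unfolding restr_def[of J]
    by (intro exI[of _ "e * d"] exI[of _ "\<lambda>j v. G j (restr K F v)"]) blast
qed

section \<open>Binary forms\<close>

definition bv :: "complex \<Rightarrow> complex \<Rightarrow> nat vec" where
  "bv a b = (\<lambda>i. if i = 0 then a else if i = 1 then b else 0)"

text \<open>Curried functions of two complex numbers make partial derivatives and restriction to
  lines immediate.\<close>

definition bform :: "nat \<Rightarrow> (complex \<Rightarrow> complex \<Rightarrow> complex) \<Rightarrow> bool" where
  "bform d f \<longleftrightarrow> hform {..1::nat} d (\<lambda>v. f (v 0) (v 1))"

lemma bv_simps [simp]: "bv a b 0 = a" "bv a b (Suc 0) = b"
  by (simp_all add: bv_def)

lemma bv_in_vecs [simp]: "bv a b \<in> vecs {..1}"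
  by (auto simp: bv_def vecs_def)

lemma bv_eta: "v \<in> vecs {..1} \<Longrightarrow> bv (v 0) (v (Suc 0)) = v"
  by (auto simp: bv_def vecs_def fun_eq_iff)

lemma bv_eq_0 [simp]: "bv a b = 0 \<longleftrightarrow> a = 0 \<and> b = 0"
  by (auto simp: bv_def fun_eq_iff vec_apply)

lemma bv_scale: "cscale c (bv a b) = bv (c * a) (c * b)"
  by (auto simp: bv_def fun_eq_iff vec_apply)

lemma bv_inj [simp]: "bv a b = bv c d \<longleftrightarrow> a = c \<and> b = d"
  by (metis bv_simps)

lemma proj1_points: "proj_space {..1} = {cv.span {bv a b} | a b. a \<noteq> 0 \<or> b \<noteq> 0}"
proof (intro set_eqI iffI)
  fix q assume "q \<in> proj_space {..1::nat}"
  then obtain v where v: "v \<in> vecs {..1::nat}" "v \<noteq> 0" "q = cv.span {v}" by (auto simp: PP_def)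
  then show "q \<in> {cv.span {bv a b} | a b. a \<noteq> 0 \<or> b \<noteq> 0}"
    using bv_eta[OF v(1)] bv_eq_0[of "v 0" "v (Suc 0)"] by (metis (mono_tags, lifting) mem_Collect_eq)
next
  fix q assume "q \<in> {cv.span {bv a b} | a b. a \<noteq> 0 \<or> b \<noteq> 0}"
  then obtain a b where "a \<noteq> 0 \<or> b \<noteq> 0" "q = cv.span {bv a b}" by blast
  then show "q \<in> proj_space {..1::nat}" using PP_I[OF bv_in_vecs, of a b] by simp
qed

lemma span_bv_eq_iff:
  assumes "a \<noteq> 0 \<or> b \<noteq> 0" "c \<noteq> 0 \<or> d \<noteq> 0"
  shows "cv.span {bv a b} = cv.span {bv c d} \<longleftrightarrow> a * d = b * c"
proof
  assume *: "cv.span {bv a b} = cv.span {bv c d}"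
  obtain t where "t \<noteq> 0" "bv c d = cscale t (bv a b)"
    using span_single_eqD[OF *] assms by (metis bv_eq_0)
  then show "a * d = b * c" by (simp add: bv_scale)
next
  assume *: "a * d = b * c"
  have "\<exists>t. t \<noteq> 0 \<and> c = t * a \<and> d = t * b"
  proof (cases "a = 0")
    case True
    then show ?thesis using * assms by (intro exI[of _ "d / b"]) auto
  next
    case False
    then show ?thesis using * assms by (intro exI[of _ "c / a"]) (auto simp: field_simps)
  qed
  then show "cv.span {bv a b} = cv.span {bv c d}"
    using span_single_scale bv_scale by metis
qed

lemma bform_of_hform: assumes "hform {..1::nat} d f" shows "bform d (\<lambda>a b. f (bv a b))"
proof -
  have "f (bv (v 0) (v 1)) = f v" for v
    by (rule hform_cong[OF assms]) (auto simp: bv_def le_Suc_eq)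
  then show ?thesis using assms by (simp add: bform_def)
qed

lemma bform_zero: "bform d (\<lambda>_ _. 0)" by (simp add: bform_def hform_zero)
lemma bform_const: "bform 0 (\<lambda>_ _. c)" by (simp add: bform_def hform_const)
lemma bform_fst: "bform 1 (\<lambda>a b. a)" unfolding bform_def by (rule hform_var) auto
lemma bform_snd: "bform 1 (\<lambda>a b. b)" unfolding bform_def by (rule hform_var) auto
lemma bform_add: "bform d f \<Longrightarrow> bform d g \<Longrightarrow> bform d (\<lambda>a b. f a b + g a b)"
  by (simp add: bform_def hform_add)
lemma bform_diff: "bform d f \<Longrightarrow> bform d g \<Longrightarrow> bform d (\<lambda>a b. f a b - g a b)"
  by (simp add: bform_def hform_diff)
lemma bform_cmult: "bform d f \<Longrightarrow> bform d (\<lambda>a b. c * f a b)"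
  by (simp add: bform_def hform_cmult)
lemma bform_mult: "bform d f \<Longrightarrow> bform e g \<Longrightarrow> bform (d + e) (\<lambda>a b. f a b * g a b)"
  by (simp add: bform_def hform_mult)
lemma bform_sum: "(\<And>x. x \<in> A \<Longrightarrow> bform d (f x)) \<Longrightarrow> bform d (\<lambda>a b. \<Sum>x\<in>A. f x a b)"
  by (simp add: bform_def hform_sum)
lemma bform_monom: "bform (m + n) (\<lambda>a b. a ^ m * b ^ n)"
  using hform_mult[OF _ hform_power[OF _ hform_var, of "{..1::nat}" 0 m] hform_power[OF _ hform_var, of "{..1::nat}" 1 n]]
  by (simp add: bform_def)

lemma bform_coeffs: "bform d f \<longleftrightarrow> (\<exists>c. \<forall>a b. f a b = (\<Sum>j\<le>d. c j * a ^ (d - j) * b ^ j))"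
proof
  assume "bform d f"
  then have *: "hform {..1::nat} d (\<lambda>v. f (v 0) (v 1))" by (simp add: bform_def)
  have "\<exists>c. \<forall>v. g v = (\<Sum>j\<le>d. c j * v 0 ^ (d - j) * v 1 ^ j)" if "hform {..1::nat} d g" for g d
    using finite_atMost that
  proof (induction rule: hform_induct)
    case (zero d) show ?case by (rule exI[of _ "\<lambda>_. 0"]) simp
  next
    case one show ?case by (rule exI[of _ "\<lambda>_. 1"]) simp
  next
    case (var d f i)
    obtain c where c: "\<forall>v. f v = (\<Sum>j\<le>d. c j * v 0 ^ (d - j) * v 1 ^ j)" using var by blast
    show ?case
    proof (cases "i = 0")
      case True
      have "v i * f v = (\<Sum>j\<le>Suc d. (if j \<le> d then c j else 0) * v 0 ^ (Suc d - j) * v 1 ^ j)" for v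
        using c True by (auto simp: sum_distrib_left Suc_diff_le intro!: sum.cong)
      then show ?thesis by (intro exI[of _ "\<lambda>j. if j \<le> d then c j else 0"]) simp
    next
      case False
      then have i: "i = 1" using var(1) by auto
      have "v i * f v = (\<Sum>j\<le>Suc d. (case j of 0 \<Rightarrow> 0 | Suc k \<Rightarrow> c k) * v 0 ^ (Suc d - j) * v 1 ^ j)" for v
        unfolding sum.atMost_Suc_shift using c i by (auto simp: sum_distrib_left intro!: sum.cong)
      then show ?thesis by (intro exI[of _ "\<lambda>j. case j of 0 \<Rightarrow> 0 | Suc k \<Rightarrow> c k"]) simp
    qed
  next
    case (add d f g)
    then obtain c c' where "\<forall>v. f v = (\<Sum>j\<le>d. c j * v 0 ^ (d - j) * v 1 ^ j)"
      "\<forall>v. g v = (\<Sum>j\<le>d. c' j * v 0 ^ (d - j) * v 1 ^ j)" by blast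
    then show ?case by (intro exI[of _ "\<lambda>j. c j + c' j"]) (simp add: sum.distrib algebra_simps)
  next
    case (cmult d f k)
    then obtain c where "\<forall>v. f v = (\<Sum>j\<le>d. c j * v 0 ^ (d - j) * v 1 ^ j)" by blast
    then show ?case by (intro exI[of _ "\<lambda>j. k * c j"]) (simp add: sum_distrib_left mult_ac)
  qed
  from this[OF *] obtain c where c: "\<forall>v :: nat vec. f (v 0) (v 1) = (\<Sum>j\<le>d. c j * v 0 ^ (d - j) * v 1 ^ j)" by blast
  have "f a b = (\<Sum>j\<le>d. c j * a ^ (d - j) * b ^ j)" for a b
    using c[rule_format, of "bv a b"] by simp
  then show "\<exists>c. \<forall>a b. f a b = (\<Sum>j\<le>d. c j * a ^ (d - j) * b ^ j)" by blast
next
  assume "\<exists>c. \<forall>a b. f a b = (\<Sum>j\<le>d. c j * a ^ (d - j) * b ^ j)"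
  then obtain c where c: "f = (\<lambda>a b. \<Sum>j\<le>d. c j * (a ^ (d - j) * b ^ j))" by (auto simp: fun_eq_iff mult_ac)
  have "bform d (\<lambda>a b. a ^ (d - j) * b ^ j)" if "j \<le> d" for j using bform_monom[of "d - j" j] that by simp
  then show "bform d f" unfolding c by (intro bform_sum bform_cmult) auto
qed

lemma bform_homogeneous: "bform d f \<Longrightarrow> f (c * a) (c * b) = c ^ d * f a b"
  using hform_homogeneous[of "{..1::nat}" d "\<lambda>v. f (v 0) (v 1)" c "bv a b"]
  by (simp add: bform_def cscale_apply)

lemma bform_swap: assumes "bform d f" shows "bform d (\<lambda>a b. f b a)"
proof -
  obtain c where c: "\<forall>a b. f a b = (\<Sum>j\<le>d. c j * a ^ (d - j) * b ^ j)" using assms bform_coeffs by blast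
  have "bform d (\<lambda>a b. \<Sum>j\<le>d. c j * (a ^ j * b ^ (d - j)))"
  proof (intro bform_sum bform_cmult)
    fix j assume "j \<in> {..d}" then show "bform d (\<lambda>a b. a ^ j * b ^ (d - j))" using bform_monom[of j "d - j"] by simp
  qed
  then show ?thesis using c by (simp add: mult_ac)
qed

lemma polyfun_if: "polyfun f \<Longrightarrow> polyfun g \<Longrightarrow> polyfun (\<lambda>z. if P then f z else g z)"
  by (cases P) simp_all

lemma bform_polyfun:
  assumes "bform d f" "polyfun x" "polyfun y" shows "polyfun (\<lambda>z. f (x z) (y z))"
proof -
  have "polycurve (\<lambda>z. bv (x z) (y z))" unfolding polycurve_def bv_def using assms by (auto intro!: polyfun_if)
  then show ?thesis using hform_polycurve[of "{..1::nat}" d "\<lambda>v. f (v 0) (v 1)" "\<lambda>z. bv (x z) (y z)"] assms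
    by (simp add: bform_def)
qed

text \<open>In \<open>\<alpha> ^ Suc d * f a b - a ^ Suc d * f \<alpha> \<beta>\<close> every
  monomial contributes a multiple of the difference of the powers \<open>(\<alpha> * b) ^ j\<close>
  and \<open>(\<beta> * a) ^ j\<close>, which is divisible by the linear form. The witness
  \<open>?g\<close> collects the quotients.\<close>

lemma bform_root_factor_aux:
  assumes "bform (Suc d) f" "f \<alpha> \<beta> = 0" "\<alpha> \<noteq> 0"
  shows "\<exists>g. bform d g \<and> (\<forall>a b. f a b = (\<alpha> * b - \<beta> * a) * g a b)"
proof -
  let ?D = "Suc d"
  obtain c where c: "\<forall>a b. f a b = (\<Sum>j\<le>?D. c j * a ^ (?D - j) * b ^ j)" using assms bform_coeffs by blast
  let ?g = "\<lambda>a b. \<Sum>j\<le>?D. c j * (\<Sum>l<j. (\<alpha> * a) ^ (?D - j) * ((\<beta> * a) ^ (j - Suc l) * (\<alpha> * b) ^ l))"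
  have g: "bform d ?g"
  proof (intro bform_sum bform_cmult)
    fix j l assume jl: "j \<in> {..?D}" "l \<in> {..<j}"
    have "(?D - j) + (j - Suc l) + l = d" using jl by auto
    then have "bform d (\<lambda>a b. (\<alpha> ^ (?D - j) * \<beta> ^ (j - Suc l) * \<alpha> ^ l) * (a ^ ((?D - j) + (j - Suc l)) * b ^ l))"
      using bform_cmult[OF bform_monom[of "(?D - j) + (j - Suc l)" l]] by simp
    then show "bform d (\<lambda>a b. (\<alpha> * a) ^ (?D - j) * ((\<beta> * a) ^ (j - Suc l) * (\<alpha> * b) ^ l))"
      by (simp add: power_mult_distrib power_add mult_ac)
  qed
  have "\<alpha> ^ ?D * f a b = (\<alpha> * b - \<beta> * a) * ?g a b" for a b
  proof -
    have "\<alpha> ^ ?D * f a b = \<alpha> ^ ?D * f a b - a ^ ?D * f \<alpha> \<beta>" using assms by simp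
    also have "\<dots> = (\<Sum>j\<le>?D. c j * (\<alpha> ^ ?D * a ^ (?D - j) * b ^ j - a ^ ?D * \<alpha> ^ (?D - j) * \<beta> ^ j))"
      unfolding c[rule_format] sum_distrib_left sum_subtractf[symmetric] by (rule sum.cong) (auto simp: algebra_simps)
    also have "\<dots> = (\<Sum>j\<le>?D. c j * ((\<alpha> * a) ^ (?D - j) * ((\<alpha> * b) ^ j - (\<beta> * a) ^ j)))"
    proof (rule sum.cong)
      fix j assume "j \<in> {..?D}"
      then have "x ^ ?D = x ^ (?D - j) * x ^ j" for x :: complex by (simp add: power_add[symmetric] del: power_Suc)
      then show "c j * (\<alpha> ^ ?D * a ^ (?D - j) * b ^ j - a ^ ?D * \<alpha> ^ (?D - j) * \<beta> ^ j) =
          c j * ((\<alpha> * a) ^ (?D - j) * ((\<alpha> * b) ^ j - (\<beta> * a) ^ j))"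
        by (simp only: power_mult_distrib) (simp add: algebra_simps del: power_Suc)
    qed simp
    also have "\<dots> = (\<alpha> * b - \<beta> * a) * ?g a b"
      unfolding sum_distrib_left power_diff_sumr2 by (intro sum.cong refl) (simp add: mult_ac)
    finally show ?thesis .
  qed
  moreover have "f a b = inverse (\<alpha> ^ ?D) * (\<alpha> ^ ?D * f a b)" for a b
    using assms(3) by (simp del: power_Suc)
  ultimately have "f a b = (\<alpha> * b - \<beta> * a) * (inverse (\<alpha> ^ ?D) * ?g a b)" for a b
    by (metis (no_types, lifting) mult.left_commute)
  then show ?thesis using bform_cmult[OF g, of "inverse (\<alpha> ^ ?D)"] by blast
qed

lemma bform_root_factor:
  assumes "bform (Suc d) f" "f \<alpha> \<beta> = 0" "\<alpha> \<noteq> 0 \<or> \<beta> \<noteq> 0"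
  obtains g where "bform d g" "\<And>a b. f a b = (\<alpha> * b - \<beta> * a) * g a b"
proof (cases "\<alpha> = 0")
  case False then show ?thesis using bform_root_factor_aux[OF assms(1,2)] that by blast
next
  case True
  then have "\<beta> \<noteq> 0" using assms(3) by simp
  obtain g where g: "bform d g" "\<forall>a b. f b a = (\<beta> * b - \<alpha> * a) * g a b"
    using bform_root_factor_aux[OF bform_swap[OF assms(1)] assms(2) \<open>\<beta> \<noteq> 0\<close>] by blast
  \<comment> \<open>Exchanging the variables changes the sign of the linear form.\<close>
  have "bform d (\<lambda>a b. - 1 * g b a)" by (rule bform_cmult[OF bform_swap[OF g(1)]])
  moreover have "f a b = (\<alpha> * b - \<beta> * a) * (- 1 * g b a)" for a b
    using g(2)[rule_format, of a b] g(2)[rule_format, of b a] by (simp add: algebra_simps)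
  ultimately show ?thesis using that by blast
qed

text \<open>If the coefficient of b^d vanishes, (0 : 1) is a root; otherwise the fundamental theorem
  of algebra applies to f(1, z).\<close>

lemma bform_has_root:
  assumes "bform d f" "d > 0" obtains \<alpha> \<beta> where "\<alpha> \<noteq> 0 \<or> \<beta> \<noteq> 0" "f \<alpha> \<beta> = 0"
proof -
  obtain c where c: "\<forall>a b. f a b = (\<Sum>j\<le>d. c j * a ^ (d - j) * b ^ j)" using assms bform_coeffs by blast
  show ?thesis
  proof (cases "c d = 0")
    case True
    have "f 0 1 = (\<Sum>j\<le>d. if j = d then c d else 0)" unfolding c[rule_format] by (rule sum.cong) auto
    then show ?thesis using True that[of 0 1] by simp
  next
    case False
    then have "c 0 = 0 \<or> (\<exists>i\<in>{1..d}. c i \<noteq> 0)" using assms(2) by auto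
    then obtain z where "(\<Sum>j\<le>d. c j * z ^ j) = 0" by (rule fundamental_theorem_of_algebra)
    then show ?thesis using that[of 1 z] c by simp
  qed
qed

section \<open>Partial derivatives and double roots of binary forms\<close>

definition D0 :: "(complex \<Rightarrow> complex \<Rightarrow> complex) \<Rightarrow> complex \<Rightarrow> complex \<Rightarrow> complex" where
  "D0 f a b = deriv (\<lambda>z. f z b) a"

definition D1 :: "(complex \<Rightarrow> complex \<Rightarrow> complex) \<Rightarrow> complex \<Rightarrow> complex \<Rightarrow> complex" where
  "D1 f a b = deriv (\<lambda>z. f a z) b"

lemma D_coeffs:
  assumes "\<forall>a b. f a b = (\<Sum>j\<le>Suc d. c j * a ^ (Suc d - j) * b ^ j)"
  shows "D0 f a b = (\<Sum>j\<le>Suc d. c j * (of_nat (Suc d - j) * a ^ (Suc d - j - 1)) * b ^ j)"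
    "D1 f a b = (\<Sum>j\<le>Suc d. c j * a ^ (Suc d - j) * (of_nat j * b ^ (j - 1)))"
proof -
  show "D0 f a b = (\<Sum>j\<le>Suc d. c j * (of_nat (Suc d - j) * a ^ (Suc d - j - 1)) * b ^ j)"
    unfolding D0_def assms[rule_format]
    by (rule DERIV_imp_deriv, rule DERIV_sum) (auto intro!: derivative_eq_intros simp: mult_ac)
  show "D1 f a b = (\<Sum>j\<le>Suc d. c j * a ^ (Suc d - j) * (of_nat j * b ^ (j - 1)))"
    unfolding D1_def assms[rule_format]
    by (rule DERIV_imp_deriv, rule DERIV_sum) (auto intro!: derivative_eq_intros simp: mult_ac)
qed

lemma bform_D0: assumes "bform (Suc d) f" shows "bform d (D0 f)"
proof -
  obtain c where c: "\<forall>a b. f a b = (\<Sum>j\<le>Suc d. c j * a ^ (Suc d - j) * b ^ j)" using assms bform_coeffs by blast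
  have "bform d (\<lambda>a b. \<Sum>j\<le>Suc d. (c j * of_nat (Suc d - j)) * (a ^ (Suc d - j - 1) * b ^ j))"
  proof (rule bform_sum)
    fix j assume "j \<in> {..Suc d}"
    show "bform d (\<lambda>a b. (c j * of_nat (Suc d - j)) * (a ^ (Suc d - j - 1) * b ^ j))"
    proof (cases "j = Suc d")
      case True then show ?thesis using bform_zero by simp
    next
      case False
      then show ?thesis using \<open>j \<in> _\<close> bform_cmult[OF bform_monom[of "d - j" j]] by simp
    qed
  qed
  then show ?thesis unfolding D_coeffs(1)[OF c, abs_def] by (simp only: mult.assoc)
qed

lemma bform_D1: assumes "bform (Suc d) f" shows "bform d (D1 f)"
proof -
  obtain c where c: "\<forall>a b. f a b = (\<Sum>j\<le>Suc d. c j * a ^ (Suc d - j) * b ^ j)" using assms bform_coeffs by blast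
  have "bform d (\<lambda>a b. \<Sum>j\<le>Suc d. (c j * of_nat j) * (a ^ (Suc d - j) * b ^ (j - 1)))"
  proof (rule bform_sum)
    fix j assume "j \<in> {..Suc d}"
    show "bform d (\<lambda>a b. (c j * of_nat j) * (a ^ (Suc d - j) * b ^ (j - 1)))"
    proof (cases j)
      case 0 then show ?thesis using bform_zero by simp
    next
      case (Suc k)
      then show ?thesis using \<open>j \<in> _\<close> bform_cmult[OF bform_monom[of "d - k" k]] by simp
    qed
  qed
  then show ?thesis unfolding D_coeffs(2)[OF c, abs_def] by (simp only: mult_ac)
qed

lemma bform_deriv_aux:
  assumes "bform d f"
  shows "((\<lambda>z. f z b) has_field_derivative D0 f a b) (at a)" "((\<lambda>z. f a z) has_field_derivative D1 f a b) (at b)"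
  using polyfun_holomorphic[OF bform_polyfun[OF assms polyfun_id polyfun_const[of b]], of UNIV]
    polyfun_holomorphic[OF bform_polyfun[OF assms polyfun_const[of a] polyfun_id], of UNIV]
  by (auto simp: D0_def D1_def intro!: holomorphic_derivI)

lemma bform_has_derivative:
  assumes "bform d f"
  shows "((\<lambda>z. f (\<alpha> + z * r) (\<beta> + z * s)) has_field_derivative r * D0 f \<alpha> \<beta> + s * D1 f \<alpha> \<beta>) (at 0)"
proof (cases d)
  case 0
  then obtain c where "f = (\<lambda>_ _. c)" using assms bform_coeffs[of 0 f] by (auto simp: fun_eq_iff)
  then show ?thesis by (simp add: D0_def D1_def)
next
  case (Suc d')
  obtain c where c: "\<forall>a b. f a b = (\<Sum>j\<le>Suc d'. c j * a ^ (Suc d' - j) * b ^ j)"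
    using assms Suc bform_coeffs by blast
  have "((\<lambda>z. \<Sum>j\<le>Suc d'. c j * (\<alpha> + z * r) ^ (Suc d' - j) * (\<beta> + z * s) ^ j) has_field_derivative
      (\<Sum>j\<le>Suc d'. r * (c j * (of_nat (Suc d' - j) * \<alpha> ^ (Suc d' - j - 1)) * \<beta> ^ j) +
        s * (c j * \<alpha> ^ (Suc d' - j) * (of_nat j * \<beta> ^ (j - 1))))) (at 0)"
    by (rule DERIV_sum) (auto intro!: derivative_eq_intros simp: algebra_simps)
  then show ?thesis unfolding D_coeffs[OF c] unfolding c[rule_format]
    by (simp only: sum.distrib sum_distrib_left)
qed

text \<open>Euler's identity, from differentiating f((1 + z) \<alpha>, (1 + z) \<beta>) = (1 + z)^(d
  + 1) f(\<alpha>, \<beta>) at z = 0; the degree \<open>Suc d\<close> is the factor that gets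
  cancelled.\<close>

lemma bform_euler:
  assumes "bform (Suc d) f" "D0 f \<alpha> \<beta> = 0" "D1 f \<alpha> \<beta> = 0" shows "f \<alpha> \<beta> = 0"
proof -
  have "((\<lambda>z. f (\<alpha> + z * \<alpha>) (\<beta> + z * \<beta>)) has_field_derivative 0) (at 0)"
    using bform_has_derivative[OF assms(1), of \<alpha> \<alpha> \<beta> \<beta>] assms by simp
  moreover have "f (\<alpha> + z * \<alpha>) (\<beta> + z * \<beta>) = (1 + z) ^ Suc d * f \<alpha> \<beta>" for z
    using bform_homogeneous[OF assms(1), of "1 + z" \<alpha> \<beta>] by (simp add: algebra_simps)
  moreover have "((\<lambda>z. (1 + z) ^ Suc d * f \<alpha> \<beta>) has_field_derivative of_nat (Suc d) * f \<alpha> \<beta>) (at 0)"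
    by (rule derivative_eq_intros refl | simp)+
  ultimately have "of_nat (Suc d) * f \<alpha> \<beta> = 0" using DERIV_unique by fastforce
  then show ?thesis by (metis mult_eq_0_iff of_nat_eq_0_iff nat.distinct(1))
qed

lemma complementary_vector:
  fixes \<alpha> \<beta> :: complex
  assumes "\<alpha> \<noteq> 0 \<or> \<beta> \<noteq> 0" shows "\<exists>r s. \<alpha> * s - \<beta> * r = 1"
proof (cases "\<alpha> = 0")
  case True
  then show ?thesis using assms by (intro exI[of _ "- 1 / \<beta>"] exI[of _ 0]) simp
next
  case False
  then show ?thesis by (intro exI[of _ 0] exI[of _ "1 / \<alpha>"]) simp
qed

text \<open>The value is listed beside the derivatives because a nonzero constant has vanishing
  derivatives too.\<close>

definition droot :: "(complex \<Rightarrow> complex \<Rightarrow> complex) \<Rightarrow> complex \<Rightarrow> complex \<Rightarrow> bool" where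
  "droot f \<alpha> \<beta> \<longleftrightarrow> f \<alpha> \<beta> = 0 \<and> D0 f \<alpha> \<beta> = 0 \<and> D1 f \<alpha> \<beta> = 0"

text \<open>Subtraction in \<open>d - 2\<close> is truncated: for \<open>d < 2\<close> a double root
  forces \<open>f\<close> to be zero, and the cofactor is then zero.\<close>

lemma droot_factor:
  assumes "bform d f" "droot f \<alpha> \<beta>" "\<alpha> \<noteq> 0 \<or> \<beta> \<noteq> 0"
  obtains g where "bform (d - 2) g" "\<And>a b. f a b = (\<alpha> * b - \<beta> * a)\<^sup>2 * g a b"
proof -
  consider "\<forall>a b. f a b = 0" | d' g where "d = Suc d'" "bform d' g" "\<And>a b. f a b = (\<alpha> * b - \<beta> * a) * g a b" "g \<alpha> \<beta> = 0"
  proof (cases d)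
    case 0
    then obtain c where "f = (\<lambda>_ _. c)" using assms bform_coeffs[of 0 f] by (auto simp: fun_eq_iff)
    then show ?thesis using assms that(1) by (auto simp: droot_def)
  next
    case (Suc d')
    then obtain g where g: "bform d' g" "\<And>a b. f a b = (\<alpha> * b - \<beta> * a) * g a b"
      using bform_root_factor[of d' f \<alpha> \<beta>] assms by (auto simp: droot_def)
    \<comment> \<open>Along a direction (r, s) transversal to the root the linear factor equals the
      parameter \<open>z\<close>, so the derivative of \<open>f\<close> is the value of the
      cofactor.\<close>
    obtain r s where rs: "\<alpha> * s - \<beta> * r = 1" using complementary_vector[OF assms(3)] by blast
    have "((\<lambda>z. f (\<alpha> + z * r) (\<beta> + z * s)) has_field_derivative 0) (at 0)"
      using bform_has_derivative[OF assms(1), of \<alpha> r \<beta> s] assms(2) by (simp add: droot_def)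
    moreover have "f (\<alpha> + z * r) (\<beta> + z * s) = z * (\<alpha> * s - \<beta> * r) * g (\<alpha> + z * r) (\<beta> + z * s)" for z
      unfolding g(2) by (simp add: algebra_simps)
    moreover have "((\<lambda>z. z * (\<alpha> * s - \<beta> * r) * g (\<alpha> + z * r) (\<beta> + z * s)) has_field_derivative (\<alpha> * s - \<beta> * r) * g \<alpha> \<beta>) (at 0)"
      by (rule derivative_eq_intros bform_has_derivative[OF g(1)] refl | simp)+
    ultimately have "(\<alpha> * s - \<beta> * r) * g \<alpha> \<beta> = 0" by (metis (no_types, lifting) DERIV_unique ext)
    then show ?thesis using rs g Suc that(2) by simp
  qed
  then show ?thesis
  proof cases
    case 1 then show ?thesis using that[of "\<lambda>_ _. 0"] bform_zero by simp
  next
    case (2 d' g)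
    show ?thesis
    proof (cases d')
      case 0
      then obtain c where "g = (\<lambda>_ _. c)" using 2 bform_coeffs[of 0 g] by (auto simp: fun_eq_iff)
      then show ?thesis using that[of "\<lambda>_ _. 0"] bform_zero 2 by simp
    next
      case (Suc d'')
      then obtain h where "bform d'' h" "\<And>a b. g a b = (\<alpha> * b - \<beta> * a) * h a b"
        using bform_root_factor[of d'' g \<alpha> \<beta>] 2 assms(3) by auto
      then show ?thesis using that[of h] 2 Suc by (simp add: power2_eq_square mult.assoc)
    qed
  qed
qed

lemma droot_of_factor:
  assumes "bform d g" "\<And>a b. f a b = (\<alpha> * b - \<beta> * a)\<^sup>2 * g a b" shows "droot f \<alpha> \<beta>"
proof -
  have "((\<lambda>z. f z \<beta>) has_field_derivative 0) (at \<alpha>)" "((\<lambda>z. f \<alpha> z) has_field_derivative 0) (at \<beta>)"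
    unfolding assms(2) by (rule derivative_eq_intros bform_deriv_aux[OF assms(1)] refl | simp)+
  then show ?thesis by (simp add: droot_def D0_def D1_def DERIV_imp_deriv assms(2))
qed

definition broots :: "(complex \<Rightarrow> complex \<Rightarrow> complex) \<Rightarrow> nat point set" where
  "broots f = {cv.span {bv a b} | a b. (a \<noteq> 0 \<or> b \<noteq> 0) \<and> f a b = 0}"

text \<open>Linear factors are split off one by one; a root met twice would be a double root of
  \<open>f\<close>.\<close>

lemma broots_count:
  assumes "bform d f" "\<exists>a b. f a b \<noteq> 0"
  shows "finite (broots f) \<and> ((\<forall>a b. (a \<noteq> 0 \<or> b \<noteq> 0) \<longrightarrow> \<not> droot f a b) \<longrightarrow> card (broots f) = d)"
  using assms
proof (induction d arbitrary: f)
  case 0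
  then obtain c where "f = (\<lambda>_ _. c)" using bform_coeffs[of 0 f] by (auto simp: fun_eq_iff)
  then have "broots f = {}" using 0 by (auto simp: broots_def)
  then show ?case by simp
next
  case (Suc d)
  obtain \<alpha> \<beta> where ab: "\<alpha> \<noteq> 0 \<or> \<beta> \<noteq> 0" "f \<alpha> \<beta> = 0" using bform_has_root[OF Suc.prems(1)] by auto
  obtain g where g: "bform d g" "\<And>a b. f a b = (\<alpha> * b - \<beta> * a) * g a b"
    using bform_root_factor[OF Suc.prems(1) ab(2,1)] by metis
  have gn: "\<exists>a b. g a b \<noteq> 0" using Suc.prems(2) g(2) by auto
  note IH = Suc.IH[OF g(1) gn]
  have eq: "broots f = insert (cv.span {bv \<alpha> \<beta>}) (broots g)"
  proof (rule set_eqI)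
    fix x
    have "x \<in> broots f \<longleftrightarrow> (\<exists>a b. (a \<noteq> 0 \<or> b \<noteq> 0) \<and> x = cv.span {bv a b} \<and> (\<alpha> * b = \<beta> * a \<or> g a b = 0))"
      by (auto simp: broots_def g(2))
    also have "\<dots> \<longleftrightarrow> (\<exists>a b. (a \<noteq> 0 \<or> b \<noteq> 0) \<and> x = cv.span {bv a b} \<and> (cv.span {bv \<alpha> \<beta>} = cv.span {bv a b} \<or> g a b = 0))"
      using span_bv_eq_iff[OF ab(1)] by metis
    also have "\<dots> \<longleftrightarrow> x \<in> insert (cv.span {bv \<alpha> \<beta>}) (broots g)" using ab(1) by (auto simp: broots_def)
    finally show "x \<in> broots f \<longleftrightarrow> x \<in> insert (cv.span {bv \<alpha> \<beta>}) (broots g)" .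
  qed
  have "card (broots f) = Suc d" if nd: "\<forall>a b. (a \<noteq> 0 \<or> b \<noteq> 0) \<longrightarrow> \<not> droot f a b"
  proof -
    have "\<not> droot g a b" if "a \<noteq> 0 \<or> b \<noteq> 0" for a b
    proof
      assume dg: "droot g a b"
      obtain h where h: "bform (d - 2) h" "\<And>x y. g x y = (a * y - b * x)\<^sup>2 * h x y"
        using droot_factor[OF g(1) dg \<open>a \<noteq> 0 \<or> b \<noteq> 0\<close>] by blast
      have "bform (1 + (d - 2)) (\<lambda>x y. (\<alpha> * y - \<beta> * x) * h x y)"
        by (intro bform_mult h bform_diff bform_cmult bform_fst bform_snd)
      then have "droot f a b" by (rule droot_of_factor) (simp add: g h)
      then show False using nd that by blast
    qed
    then have cg: "card (broots g) = d" using IH by blast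
    have "cv.span {bv \<alpha> \<beta>} \<notin> broots g"
    proof
      assume "cv.span {bv \<alpha> \<beta>} \<in> broots g"
      then obtain a b where c: "a \<noteq> 0 \<or> b \<noteq> 0" "g a b = 0" "cv.span {bv \<alpha> \<beta>} = cv.span {bv a b}" by (auto simp: broots_def)
      obtain t where t: "t \<noteq> 0" "bv a b = cscale t (bv \<alpha> \<beta>)" using span_single_eqD[OF c(3)] c(1) by (metis bv_eq_0)
      have "g a b = t ^ d * g \<alpha> \<beta>" using t bform_homogeneous[OF g(1)] by (simp add: bv_scale)
      then have "g \<alpha> \<beta> = 0" using c t by simp
      moreover obtain d' where "d = Suc d'"
        using bform_coeffs[of 0 g] g(1) gn \<open>g \<alpha> \<beta> = 0\<close> by (cases d) auto
      ultimately obtain h where h: "bform d' h" "\<And>a b. g a b = (\<alpha> * b - \<beta> * a) * h a b"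
        using bform_root_factor[of d' g \<alpha> \<beta>] ab g by metis
      then have "droot f \<alpha> \<beta>" by (intro droot_of_factor[OF h(1)]) (simp add: g h power2_eq_square)
      then show False using nd ab by blast
    qed
    then show ?thesis using eq cg IH by simp
  qed
  then show ?case using eq IH by simp
qed

section \<open>Morphisms from the projective line\<close>

definition bvec :: "'j set \<Rightarrow> ('j \<Rightarrow> complex \<Rightarrow> complex \<Rightarrow> complex) \<Rightarrow> complex \<Rightarrow> complex \<Rightarrow> 'j vec" where
  "bvec J F a b = (\<lambda>j. if j \<in> J then F j a b else 0)"

lemma bvec_in_vecs [simp]: "bvec J F a b \<in> vecs J"
  by (simp add: bvec_def vecs_def)

lemma bvec_polycurve:
  assumes "\<And>j. j \<in> J \<Longrightarrow> bform e (F j)"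
  shows "polycurve (\<lambda>z. bvec J F (\<alpha> + z * x) (\<beta> + z * y))"
  unfolding polycurve_def
proof
  fix j
  show "polyfun (\<lambda>z. bvec J F (\<alpha> + z * x) (\<beta> + z * y) j)"
  proof (cases "j \<in> J")
    case True
    have "polyfun (\<lambda>z. F j (\<alpha> + z * x) (\<beta> + z * y))"
      by (rule bform_polyfun[OF assms[OF True]]) (intro polyfun_intros)+
    then show ?thesis using True by (simp add: bvec_def)
  qed (simp add: bvec_def)
qed

lemma bvec_eq_0: "bvec J F a b = 0 \<longleftrightarrow> (\<forall>j\<in>J. F j a b = 0)"
  by (auto simp: bvec_def fun_eq_iff vec_apply)

lemma bform_nonzero_point:
  assumes "bform d f" "f a b \<noteq> 0" obtains x y where "x \<noteq> 0 \<or> y \<noteq> 0" "f x y \<noteq> 0"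
proof (cases "a = 0 \<and> b = 0")
  case True
  then have "f 1 0 \<noteq> 0" using bform_homogeneous[OF assms(1), of 0 1 0] assms(2) by auto
  then show ?thesis using that[of 1 0] by simp
qed (use assms that in blast)

text \<open>On the line joining a point with \<open>f\<close> nonzero to one with \<open>g\<close>
  nonzero, both have finitely many zeros. Starting at a point other than the origin ensures that the
  line meets the origin finitely often as well.\<close>

lemma bform_mult_zero:
  assumes f: "bform d f" "f a b \<noteq> 0" and g: "bform e g" "g a' b' \<noteq> 0"
  obtains x y where "x \<noteq> 0 \<or> y \<noteq> 0" "f x y \<noteq> 0" "g x y \<noteq> 0"
proof -
  obtain u v where uv: "u \<noteq> 0 \<or> v \<noteq> 0" "f u v \<noteq> 0" by (rule bform_nonzero_point[OF f])
  let ?x = "\<lambda>z. u + z * (a' - u)" and ?y = "\<lambda>z. v + z * (b' - v)"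
  have p: "polyfun ?x" "polyfun ?y" by (intro polyfun_intros)+
  have "finite {z. ?x z = 0 \<and> ?y z = 0}"
  proof (cases "u = 0")
    case True
    then have "finite {z. ?y z = 0}" using polyfun_finite_zeros[OF p(2), of 0] uv(1) by simp
    then show ?thesis by (rule rev_finite_subset) auto
  next
    case False
    then have "finite {z. ?x z = 0}" using polyfun_finite_zeros[OF p(1), of 0] by simp
    then show ?thesis by (rule rev_finite_subset) auto
  qed
  then have fin: "finite ({z. f (?x z) (?y z) = 0} \<union> {z. g (?x z) (?y z) = 0} \<union> {z. ?x z = 0 \<and> ?y z = 0})"
    using polyfun_finite_zeros[OF bform_polyfun[OF f(1) p], of 0]
      polyfun_finite_zeros[OF bform_polyfun[OF g(1) p], of 1] uv g by simp
  obtain z where "z \<notin> {z. f (?x z) (?y z) = 0} \<union> {z. g (?x z) (?y z) = 0} \<union> {z. ?x z = 0 \<and> ?y z = 0}"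
    using ex_new_if_finite[OF infinite_UNIV_char_0 fin] by blast
  then show ?thesis using that[of "?x z" "?y z"] by blast
qed

lemma span_eq_if_proportional:
  assumes "v \<noteq> 0" "w \<noteq> 0" "\<And>j k. v j * w k = v k * w j" shows "cv.span {v} = cv.span {w}"
proof -
  obtain j where j: "v j \<noteq> 0" using assms(1) by (auto simp: fun_eq_iff vec_apply)
  have "w = cscale (w j / v j) v"
    using assms(3)[of j] j by (auto simp: fun_eq_iff cscale_apply field_simps)
  then show ?thesis using assms(2) span_single_scale[of "w j / v j" v]
    by (metis cv.scale_eq_0_iff)
qed

lemma span_eq_proportional:
  assumes "v \<noteq> 0" "w \<noteq> 0" "cv.span {v} = cv.span {w}" shows "v j * w k = v k * w j"
proof -
  obtain c where "w = cscale c v" by (rule span_single_eqD[OF assms(3,2)])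
  then show ?thesis by (simp add: cscale_apply)
qed

definition plocal where
  "plocal J \<theta> d F g \<longleftrightarrow> (\<forall>j\<in>J. bform d (F j)) \<and> (\<exists>m. bform m g) \<and>
     (\<forall>a b. (a \<noteq> 0 \<or> b \<noteq> 0) \<longrightarrow> g a b \<noteq> 0 \<longrightarrow> \<theta> (cv.span {bv a b}) = cv.span {bvec J F a b})"

lemma morphism_plocal:
  assumes "morphism {..1::nat} (proj_space {..1}) J W \<theta>" "\<alpha> \<noteq> 0 \<or> \<beta> \<noteq> 0"
  obtains d F g where "plocal J \<theta> d F g" "bvec J F \<alpha> \<beta> \<noteq> 0" "g \<alpha> \<beta> \<noteq> 0"
proof -
  let ?P = "proj_space {..1::nat}"
  have y: "cv.span {bv \<alpha> \<beta>} \<in> ?P" using assms(2) proj1_points by blast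
  obtain d F k where F: "\<And>k. k \<in> J \<Longrightarrow> hform {..1::nat} d (F k)" "k \<in> J" "F k (rep (cv.span {bv \<alpha> \<beta>})) \<noteq> 0"
    "nearby {..1} ?P (cv.span {bv \<alpha> \<beta>}) (\<lambda>q. \<theta> q = cv.span {restr J F (rep q)})"
    by (rule morphism_at[OF assms(1) y]) (rule that; blast)
  obtain m g where g: "hform {..1::nat} m g" "g (rep (cv.span {bv \<alpha> \<beta>})) \<noteq> 0"
    "\<And>q. q \<in> ?P \<Longrightarrow> g (rep q) \<noteq> 0 \<Longrightarrow> \<theta> q = cv.span {restr J F (rep q)}"
    using nearbyE_form[OF F(4) finite_atMost y subset_refl] by metis
  let ?F = "\<lambda>k a b. F k (bv a b)"
  have r: "restr J F (bv a b) = bvec J ?F a b" for a b by (simp add: restr_def bvec_def)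
  have nz: "h (rep (cv.span {bv a b})) = 0 \<longleftrightarrow> h (bv a b) = 0" if "hform {..1::nat} l h" "a \<noteq> 0 \<or> b \<noteq> 0" for h l a b
    using hform_rep_span[OF finite_atMost that(1)] that(2) by (metis bv_eq_0)
  have "\<theta> (cv.span {bv a b}) = cv.span {bvec J ?F a b}" if ab: "a \<noteq> 0 \<or> b \<noteq> 0" "g (bv a b) \<noteq> 0" for a b
  proof -
    have "cv.span {bv a b} \<in> ?P" using ab(1) proj1_points by blast
    then have "\<theta> (cv.span {bv a b}) = cv.span {restr J F (rep (cv.span {bv a b}))}"
      using g(3) nz[OF g(1) ab(1)] ab(2) by blast
    moreover obtain c where "c \<noteq> 0" "rep (cv.span {bv a b}) = cscale c (bv a b)"
      using rep_span ab(1) by (metis bv_eq_0)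
    moreover have "restr J F (cscale c (bv a b)) = cscale (c ^ d) (restr J F (bv a b))"
      by (rule restr_scale[OF finite_atMost]) (rule F(1))
    ultimately show ?thesis using r span_single_scale by (metis power_not_zero)
  qed
  moreover have "bform d (?F k)" if "k \<in> J" for k using bform_of_hform[OF F(1)[OF that]] .
  moreover have "bform m (\<lambda>a b. g (bv a b))" using bform_of_hform[OF g(1)] .
  ultimately have "plocal J \<theta> d ?F (\<lambda>a b. g (bv a b))" unfolding plocal_def by blast
  moreover have "bvec J ?F \<alpha> \<beta> \<noteq> 0" using F(2,3) nz[OF F(1)[OF F(2)] assms(2)] by (auto simp: bvec_eq_0)
  moreover have "g (bv \<alpha> \<beta>) \<noteq> 0" using g(2) nz[OF g(1) assms(2)] by simp
  ultimately show ?thesis using that by blast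
qed

text \<open>A local representation by forms of minimal degree has no common factor, hence no common zero.\<close>

lemma morphism_P1_global:
  assumes "morphism {..1::nat} (proj_space {..1}) J W \<theta>"
  obtains e F where "\<And>j. j \<in> J \<Longrightarrow> bform e (F j)"
    "\<And>a b. a \<noteq> 0 \<or> b \<noteq> 0 \<Longrightarrow> bvec J F a b \<noteq> 0"
    "\<And>a b. a \<noteq> 0 \<or> b \<noteq> 0 \<Longrightarrow> \<theta> (cv.span {bv a b}) = cv.span {bvec J F a b}"
proof -
  \<comment> \<open>The description may hold on any nonempty open set, so the class is closed under
    removal of a common linear factor, which shrinks the set by the zero of that factor.\<close>
  define Q where "Q d \<longleftrightarrow> (\<exists>F g. plocal J \<theta> d F g \<and> (\<exists>a b. bvec J F a b \<noteq> 0) \<and> (\<exists>a b. g a b \<noteq> 0))" for d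
  obtain d0 F0 g0 where "plocal J \<theta> d0 F0 g0" "bvec J F0 1 0 \<noteq> 0" "g0 1 0 \<noteq> 0"
    using morphism_plocal[OF assms, of 1 0] by auto
  then have "\<exists>d. Q d" unfolding Q_def by blast
  then have QL: "Q (LEAST d. Q d)" by (rule LeastI_ex)
  define e where "e = (LEAST d. Q d)"
  obtain F g where Fg: "plocal J \<theta> e F g" "\<exists>a b. bvec J F a b \<noteq> 0" "\<exists>a b. g a b \<noteq> 0"
    using QL unfolding Q_def e_def by blast
  obtain m where m: "bform m g" using Fg(1) by (auto simp: plocal_def)
  have bf: "bform e (F j)" if "j \<in> J" for j using Fg(1) that by (auto simp: plocal_def)
  have nz: "bvec J F \<alpha> \<beta> \<noteq> 0" if ab: "\<alpha> \<noteq> 0 \<or> \<beta> \<noteq> 0" for \<alpha> \<beta>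
  proof
    assume z: "bvec J F \<alpha> \<beta> = 0"
    show False
    proof (cases e)
      case 0
      then have "\<exists>c. F j = (\<lambda>_ _. c)" if "j \<in> J" for j
        using bf[OF that] bform_coeffs[of 0 "F j"] by (auto simp: fun_eq_iff)
      then show False using z Fg(2) unfolding bvec_eq_0 by metis
    next
      case (Suc d)
      have "\<exists>h. bform d h \<and> (\<forall>a b. F j a b = (\<alpha> * b - \<beta> * a) * h a b)" if "j \<in> J" for j
        using bform_root_factor[of d "F j" \<alpha> \<beta>] bf[OF that] z ab Suc that unfolding bvec_eq_0 by metis
      then obtain H where H: "\<And>j. j \<in> J \<Longrightarrow> bform d (H j) \<and> (\<forall>a b. F j a b = (\<alpha> * b - \<beta> * a) * H j a b)"
        by metis
      let ?l = "\<lambda>a b. \<alpha> * b - \<beta> * a"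
      have bl: "bform 1 ?l" by (intro bform_diff bform_cmult bform_fst bform_snd)
      have FH: "bvec J F a b = cscale (?l a b) (bvec J H a b)" for a b
        using H by (auto simp: bvec_def fun_eq_iff cscale_apply)
      have "plocal J \<theta> d H (\<lambda>a b. g a b * ?l a b)"
        unfolding plocal_def
      proof (intro conjI allI impI ballI)
        show "bform d (H j)" if "j \<in> J" for j using H that by blast
        show "\<exists>m. bform m (\<lambda>a b. g a b * ?l a b)" using bform_mult[OF m bl] by blast
        fix a b assume "a \<noteq> 0 \<or> b \<noteq> 0" "g a b * ?l a b \<noteq> 0"
        then show "\<theta> (cv.span {bv a b}) = cv.span {bvec J H a b}"
          using Fg(1) FH span_single_scale unfolding plocal_def by (metis mult_eq_0_iff)
      qed
      moreover have "\<exists>a b. bvec J H a b \<noteq> 0" using Fg(2) FH by (metis cv.scale_eq_0_iff)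
      moreover have "\<exists>a b. g a b * ?l a b \<noteq> 0"
      proof -
        obtain x y where xy: "g x y \<noteq> 0" using Fg(3) by blast
        obtain r s where "?l r s = 1" using complementary_vector[OF ab] by blast
        then have "?l r s \<noteq> 0" by simp
        then obtain x' y' where "g x' y' \<noteq> 0" "?l x' y' \<noteq> 0" using bform_mult_zero[OF m xy bl] by metis
        then show ?thesis by (metis mult_eq_0_iff)
      qed
      ultimately have "Q d" unfolding Q_def by blast
      then have "e \<le> d" unfolding e_def by (rule Least_le)
      then show False using Suc by simp
    qed
  qed
  have "\<theta> (cv.span {bv \<alpha> \<beta>}) = cv.span {bvec J F \<alpha> \<beta>}" if ab: "\<alpha> \<noteq> 0 \<or> \<beta> \<noteq> 0" for \<alpha> \<beta>
  proof -
    obtain d' H g' where H: "plocal J \<theta> d' H g'" "bvec J H \<alpha> \<beta> \<noteq> 0" "g' \<alpha> \<beta> \<noteq> 0"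
      using morphism_plocal[OF assms ab] by metis
    obtain m' where m': "bform m' g'" using H(1) by (auto simp: plocal_def)
    \<comment> \<open>Both representations describe \<theta> where \<open>g\<close> and
      \<open>g'\<close> do not vanish. A minor that is not identically zero would be nonzero at one
      such point, although the two vectors are proportional there.\<close>
    have eq0: "F j a b * H k a b - F k a b * H j a b = 0" if jk: "j \<in> J" "k \<in> J" for j k a b
    proof (rule ccontr)
      assume *: "F j a b * H k a b - F k a b * H j a b \<noteq> 0"
      have bfH: "bform d' (H j)" "bform d' (H k)" using H(1) jk by (auto simp: plocal_def)
      let ?D = "\<lambda>a b. F j a b * H k a b - F k a b * H j a b"
      have bD: "bform (e + d') ?D" by (intro bform_diff bform_mult bf jk bfH)
      obtain x0 y0 where x0: "g x0 y0 \<noteq> 0" using Fg(3) by blast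
      obtain x1 y1 where "g x1 y1 \<noteq> 0" "g' x1 y1 \<noteq> 0" by (rule bform_mult_zero[OF m x0 m' H(3)])
      then have x1: "g x1 y1 * g' x1 y1 \<noteq> 0" by simp
      obtain x y where xy0: "x \<noteq> 0 \<or> y \<noteq> 0" and xy: "?D x y \<noteq> 0" "g x y * g' x y \<noteq> 0"
        by (rule bform_mult_zero[OF bD * bform_mult[OF m m'] x1])
      have s: "cv.span {bvec J F x y} = cv.span {bvec J H x y}"
        using Fg(1) H(1) xy xy0 unfolding plocal_def by (metis mult_eq_0_iff)
      have nF: "bvec J F x y \<noteq> 0" using nz xy0 by blast
      have nH: "bvec J H x y \<noteq> 0"
      proof
        assume "bvec J H x y = 0"
        then have "bvec J F x y \<in> cv.span {0}" using s cv.span_base[of "bvec J F x y" "{bvec J F x y}"] by simp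
        then show False using nF by simp
      qed
      have "F j x y * H k x y = F k x y * H j x y"
        using span_eq_proportional[OF nF nH s, of j k] jk by (simp add: bvec_def)
      then show False using xy by simp
    qed
    have "cv.span {bvec J F \<alpha> \<beta>} = cv.span {bvec J H \<alpha> \<beta>}"
      by (rule span_eq_if_proportional[OF nz[OF ab] H(2)]) (use eq0 in \<open>auto simp: bvec_def\<close>)
    moreover have "\<theta> (cv.span {bv \<alpha> \<beta>}) = cv.span {bvec J H \<alpha> \<beta>}"
      using H(1)[unfolded plocal_def] ab H(3) by blast
    ultimately show ?thesis by simp
  qed
  then show ?thesis using bf nz by (intro that[of e F]) auto
qed

lemma hform_deriv_zero:
  assumes "finite I" "hform I d f" "\<And>i. i \<in> I \<Longrightarrow> ((\<lambda>z. \<gamma> z i) has_field_derivative 0) (at a)"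
  shows "((\<lambda>z. f (\<gamma> z)) has_field_derivative 0) (at a)"
  using assms(1,2)
proof (induction rule: hform_induct)
  case (var d f i)
  then show ?case using DERIV_mult[OF assms(3)[OF var(1)] var(3)] by simp
next
  case (add d f g) then show ?case using DERIV_add[OF add(3,4)] by simp
next
  case (cmult d f c) then show ?case using DERIV_cmult[OF cmult(2)] by simp
qed auto

text \<open>The inverse morphism, written in forms, recovers the parameter from the curve; if the
  differential killed a tangent direction, so would the derivative of the recovered parameter.\<close>

lemma embedding_param:
  assumes fin: "finite K" "finite J" and C: "C \<subseteq> proj_space K"
    and \<xi>: "morphism K C {..1::nat} (proj_space {..1}) \<xi>" "morphism {..1} (proj_space {..1}) K C \<psi>"
      "\<And>y. y \<in> C \<Longrightarrow> \<psi> (\<xi> y) = y" "\<And>z. z \<in> proj_space {..1} \<Longrightarrow> \<xi> (\<psi> z) = z"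
    and emb: "closed_embedding K C J \<phi>" and nondeg: "lspan (\<phi> ` C) = proj_space J"
  obtains e F where "\<And>j. j \<in> J \<Longrightarrow> bform e (F j)"
    "\<And>a b. a \<noteq> 0 \<or> b \<noteq> 0 \<Longrightarrow> bvec J F a b \<noteq> 0"
    "\<And>a b. a \<noteq> 0 \<or> b \<noteq> 0 \<Longrightarrow> \<phi> (\<psi> (cv.span {bv a b})) = cv.span {bvec J F a b}"
    "\<And>a b c d. a \<noteq> 0 \<or> b \<noteq> 0 \<Longrightarrow> c \<noteq> 0 \<or> d \<noteq> 0 \<Longrightarrow> cv.span {bvec J F a b} = cv.span {bvec J F c d}
       \<Longrightarrow> cv.span {bv a b} = cv.span {bv c d}"
    "\<And>a b x y. a \<noteq> 0 \<or> b \<noteq> 0 \<Longrightarrow> (\<forall>j\<in>J. x * D0 (F j) a b + y * D1 (F j) a b = 0) \<Longrightarrow> x = 0 \<and> y = 0"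
    "\<And>h. (\<forall>a b. pair J h (bvec J F a b) = 0) \<Longrightarrow> \<forall>j\<in>J. h j = 0"
proof -
  let ?P = "proj_space {..1::nat}"
  have \<phi>: "morphism K C J (\<phi> ` C) \<phi>" and sub: "\<phi> ` C \<subseteq> proj_space J"
    using emb by (auto simp: closed_embedding_def isomorphism_def projective_variety_def zirreducible_def)
  obtain \<phi>' where \<phi>': "morphism J (\<phi> ` C) K C \<phi>'" "\<forall>y\<in>C. \<phi>' (\<phi> y) = y"
    using emb by (auto simp: closed_embedding_def isomorphism_def)
  have m1: "morphism {..1} ?P J (\<phi> ` C) (\<phi> \<circ> \<psi>)"
    by (rule morphism_compose[OF finite_atMost fin subset_refl C \<xi>(2) \<phi>])
  have m2: "morphism J (\<phi> ` C) {..1} ?P (\<xi> \<circ> \<phi>')"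
    by (rule morphism_compose[OF fin(2,1) finite_atMost sub C \<phi>'(1) \<xi>(1)])
  obtain e F where F: "\<And>j. j \<in> J \<Longrightarrow> bform e (F j)"
    "\<And>a b. a \<noteq> 0 \<or> b \<noteq> 0 \<Longrightarrow> bvec J F a b \<noteq> 0"
    "\<And>a b. a \<noteq> 0 \<or> b \<noteq> 0 \<Longrightarrow> (\<phi> \<circ> \<psi>) (cv.span {bv a b}) = cv.span {bvec J F a b}"
    using morphism_P1_global[OF m1] by metis
  have \<psi>C: "\<psi> z \<in> C" if "z \<in> ?P" for z using \<xi>(2) that by (auto simp: morphism_def)
  have inv: "(\<xi> \<circ> \<phi>') ((\<phi> \<circ> \<psi>) z) = z" if "z \<in> ?P" for z
    using that \<psi>C[OF that] \<phi>'(2) \<xi>(4) by simp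
  have pt: "cv.span {bv a b} \<in> ?P" if "a \<noteq> 0 \<or> b \<noteq> 0" for a b using that proj1_points by blast
  have inj: "cv.span {bv a b} = cv.span {bv c d}"
    if "a \<noteq> 0 \<or> b \<noteq> 0" "c \<noteq> 0 \<or> d \<noteq> 0" "cv.span {bvec J F a b} = cv.span {bvec J F c d}" for a b c d
    using inv[OF pt[OF that(1)]] inv[OF pt[OF that(2)]] F(3)[OF that(1)] F(3)[OF that(2)] that(3) by simp
  \<comment> \<open>Constant forms would send (1 : 0) and (0 : 1) to the same point.\<close>
  have e0: "e \<noteq> 0"
  proof
    assume "e = 0"
    then have "\<exists>c. F j = (\<lambda>_ _. c)" if "j \<in> J" for j
      using F(1)[OF that] bform_coeffs[of 0 "F j"] by (auto simp: fun_eq_iff)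
    then have "bvec J F 1 0 = bvec J F 0 1" unfolding bvec_def by (intro ext) (metis)
    then have "cv.span {bv 1 0} = cv.span {bv 0 1}" using inj[of 1 0 0 1] by simp
    then show False using span_bv_eq_iff[of 1 0 0 1] by simp
  qed
  have imm: "x = 0 \<and> y = 0"
    if ab: "\<alpha> \<noteq> 0 \<or> \<beta> \<noteq> 0" and xy: "\<forall>j\<in>J. x * D0 (F j) \<alpha> \<beta> + y * D1 (F j) \<alpha> \<beta> = 0" for \<alpha> \<beta> x y
  proof -
    define \<gamma> where "\<gamma> = (\<lambda>z. bvec J F (\<alpha> + z * x) (\<beta> + z * y))"
    have pc: "polycurve \<gamma>" unfolding \<gamma>_def by (rule bvec_polycurve[OF F(1)])
    have \<gamma>0: "\<gamma> 0 = bvec J F \<alpha> \<beta>" "\<gamma> 0 \<noteq> 0" using F(2)[OF ab] by (simp_all add: \<gamma>_def)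
    have y0: "cv.span {\<gamma> 0} \<in> \<phi> ` C"
      using F(3)[OF ab] \<psi>C[OF pt[OF ab]] \<gamma>0 by (metis comp_apply imageI)
    have near: "\<forall>\<^sub>F z in nhds 0. \<alpha> + z * x \<noteq> 0 \<or> \<beta> + z * y \<noteq> 0"
    proof (cases "\<alpha> = 0")
      case False
      then have "\<forall>\<^sub>F z in nhds 0. \<alpha> + z * x \<noteq> 0" by (intro polyfun_eventually_nonzero polyfun_intros) auto
      then show ?thesis by eventually_elim simp
    next
      case True
      then have "\<forall>\<^sub>F z in nhds 0. \<beta> + z * y \<noteq> 0" using ab by (intro polyfun_eventually_nonzero polyfun_intros) auto
      then show ?thesis by eventually_elim simp
    qed
    obtain d G k where G: "\<And>k. k \<in> {..1} \<Longrightarrow> hform J d (G k)" "k \<in> {..1::nat}" "G k (rep (cv.span {\<gamma> 0})) \<noteq> 0"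
      "nearby J (\<phi> ` C) (cv.span {\<gamma> 0}) (\<lambda>q. (\<xi> \<circ> \<phi>') q = cv.span {restr {..1} G (rep q)})"
      by (rule morphism_at[OF m2 y0]) (rule that; blast)
    obtain m g where g: "hform J m g" "g (rep (cv.span {\<gamma> 0})) \<noteq> 0"
      "\<And>q. q \<in> \<phi> ` C \<Longrightarrow> g (rep q) \<noteq> 0 \<Longrightarrow> (\<xi> \<circ> \<phi>') q = cv.span {restr {..1} G (rep q)}"
      using nearbyE_form[OF G(4) fin(2) _ sub] y0 sub by (metis subsetD)
    have g0: "g (\<gamma> 0) \<noteq> 0" "G k (\<gamma> 0) \<noteq> 0"
      using g(2) G(3) hform_rep_span[OF fin(2) g(1) \<gamma>0(2)] hform_rep_span[OF fin(2) G(1)[OF G(2)] \<gamma>0(2)] by auto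
    let ?A = "\<lambda>z. G 0 (\<gamma> z)" and ?B = "\<lambda>z. G 1 (\<gamma> z)"
    \<comment> \<open>Close to z = 0 the inverse morphism, written in forms, returns the parameter
      point, so (\<alpha> + z x : \<beta> + z y) = (?A z : ?B z).\<close>
    have key: "\<forall>\<^sub>F z in nhds 0. (\<alpha> + z * x) * ?B z = (\<beta> + z * y) * ?A z"
      using near polyfun_eventually_nonzero[OF hform_polycurve[OF fin(2) g(1) pc] g0(1)]
    proof eventually_elim
      case (elim z)
      have nz: "\<gamma> z \<noteq> 0" using F(2)[OF elim(1)] by (simp add: \<gamma>_def)
      let ?q = "cv.span {\<gamma> z}"
      have q: "?q \<in> \<phi> ` C" "(\<xi> \<circ> \<phi>') ?q = cv.span {bv (\<alpha> + z * x) (\<beta> + z * y)}"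
        using F(3)[OF elim(1)] \<psi>C[OF pt[OF elim(1)]] inv[OF pt[OF elim(1)]] unfolding \<gamma>_def
        by (metis comp_apply imageI)+
      have "g (rep ?q) \<noteq> 0" using elim(2) hform_rep_span[OF fin(2) g(1) nz] by simp
      then have s: "cv.span {bv (\<alpha> + z * x) (\<beta> + z * y)} = cv.span {restr {..1} G (rep ?q)}"
        using g(3)[OF q(1)] q(2) by simp
      obtain c where c: "c \<noteq> 0" "rep ?q = cscale c (\<gamma> z)" using rep_span[OF nz] by metis
      have "restr {..1} G (rep ?q) = cscale (c ^ d) (restr {..1} G (\<gamma> z))"
        unfolding c(2) by (rule restr_scale[OF fin(2) G(1)])
      also have "restr {..1} G (\<gamma> z) = bv (?A z) (?B z)"
        by (auto simp: restr_def bv_def fun_eq_iff le_Suc_eq)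
      finally have s2: "cv.span {bv (\<alpha> + z * x) (\<beta> + z * y)} = cv.span {bv (?A z) (?B z)}"
        using s span_single_scale c(1) by (metis power_not_zero)
      have "bv (?A z) (?B z) \<noteq> 0"
        using s2 span_zero_notin_proj pt[OF elim(1)] by metis
      then show ?case using span_bv_eq_iff[OF elim(1), of "?A z" "?B z"] s2 by simp
    qed
    have d\<gamma>: "((\<lambda>z. \<gamma> z j) has_field_derivative 0) (at 0)" if "j \<in> J" for j
      using bform_has_derivative[OF F(1)[OF that], of \<alpha> x \<beta> y] xy that by (simp add: \<gamma>_def bvec_def)
    have dA: "(?A has_field_derivative 0) (at 0)" and dB: "(?B has_field_derivative 0) (at 0)"
      using hform_deriv_zero[OF fin(2) G(1) d\<gamma>] by auto
    have "((\<lambda>z. (\<alpha> + z * x) * ?B z) has_field_derivative x * ?B 0) (at 0)"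
      by (rule derivative_eq_intros dB refl | simp)+
    moreover have "((\<lambda>z. (\<beta> + z * y) * ?A z) has_field_derivative y * ?A 0) (at 0)"
      by (rule derivative_eq_intros dA refl | simp)+
    ultimately have e1: "x * ?B 0 = y * ?A 0"
      using DERIV_cong_ev[OF refl key refl] DERIV_unique by blast
    have e2: "\<alpha> * ?B 0 = \<beta> * ?A 0" using eventually_nhds_x_imp_x[OF key] by simp
    have "?A 0 \<noteq> 0 \<or> ?B 0 \<noteq> 0" using g0(2) G(2) by (auto simp: le_Suc_eq)
    \<comment> \<open>Since \<open>?A\<close> and \<open>?B\<close> have derivative zero at 0,
      differentiating the relation gives \<open>e1\<close>; together with its value
      \<open>e2\<close> the direction (x, y) is proportional to (\<alpha>, \<beta>).\<close>
    then have par: "\<alpha> * y = \<beta> * x" using e1 e2 by algebra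
    have "\<exists>t. x = t * \<alpha> \<and> y = t * \<beta>"
    proof (cases "\<alpha> = 0")
      case True then show ?thesis using par ab by (intro exI[of _ "y / \<beta>"]) auto
    next
      case False then show ?thesis using par by (intro exI[of _ "x / \<alpha>"]) (auto simp: field_simps)
    qed
    then obtain t where t: "x = t * \<alpha>" "y = t * \<beta>" by blast
    \<comment> \<open>Only the radial direction remains: there the derivative is \<open>e\<close>
      times the coordinate by Euler's identity, and \<open>e\<close> is nonzero.\<close>
    have "t = 0"
    proof (rule ccontr)
      assume t0: "t \<noteq> 0"
      obtain j where j: "j \<in> J" "F j \<alpha> \<beta> \<noteq> 0" using F(2)[OF ab] by (auto simp: bvec_eq_0)
      have "\<alpha> * D0 (F j) \<alpha> \<beta> + \<beta> * D1 (F j) \<alpha> \<beta> = 0"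
      proof -
        have "t * (\<alpha> * D0 (F j) \<alpha> \<beta> + \<beta> * D1 (F j) \<alpha> \<beta>) = 0"
          using xy j(1) t by (simp add: algebra_simps)
        then show ?thesis using t0 by simp
      qed
      then have "((\<lambda>z. F j (\<alpha> + z * \<alpha>) (\<beta> + z * \<beta>)) has_field_derivative 0) (at 0)"
        using bform_has_derivative[OF F(1)[OF j(1)], of \<alpha> \<alpha> \<beta> \<beta>] by simp
      moreover have "F j (\<alpha> + z * \<alpha>) (\<beta> + z * \<beta>) = (1 + z) ^ e * F j \<alpha> \<beta>" for z
        using bform_homogeneous[OF F(1)[OF j(1)], of "1 + z" \<alpha> \<beta>] by (simp add: algebra_simps)
      moreover have "((\<lambda>z. (1 + z) ^ e * F j \<alpha> \<beta>) has_field_derivative of_nat e * F j \<alpha> \<beta>) (at 0)"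
        by (rule derivative_eq_intros refl | simp)+
      ultimately have "of_nat e * F j \<alpha> \<beta> = 0" using DERIV_unique by fastforce
      then show False using j e0 by simp
    qed
    then show ?thesis using t by simp
  qed
  \<comment> \<open>A linear form vanishing on the curve vanishes on its linear span, which is the
    whole space, hence at each unit vector.\<close>
  have nd: "\<forall>j\<in>J. h j = 0" if h: "\<forall>a b. pair J h (bvec J F a b) = 0" for h
  proof
    fix j assume j: "j \<in> J"
    let ?U = "{v\<in>vecs J. pair J h v = 0}"
    have sU: "cv.subspace ?U" using subspace_annihilator[OF subspace_vecs, of J "{h}" J] by simp
    have "x \<subseteq> ?U" if xC: "x \<in> \<phi> ` C" for x
    proof -
      obtain y where y: "y \<in> C" "x = \<phi> y" using xC by blast
      have "\<xi> y \<in> ?P" using \<xi>(1) y(1) by (auto simp: morphism_def)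
      then obtain a b where ab: "a \<noteq> 0 \<or> b \<noteq> 0" "\<xi> y = cv.span {bv a b}" using proj1_points by auto
      have "x = cv.span {bvec J F a b}" using F(3)[OF ab(1)] ab(2) \<xi>(3)[OF y(1)] y(2) by simp
      then show ?thesis using cv.span_minimal[OF _ sU, of "{bvec J F a b}"] h by auto
    qed
    then have "cv.span (\<Union>(\<phi> ` C)) \<subseteq> ?U" using sU by (intro cv.span_minimal) auto
    then have "proj_space J \<subseteq> PP ?U" using nondeg PP_mono unfolding lspan_def by metis
    moreover have "cv.span {unitv j} \<in> proj_space J" using j by (intro PP_I unitv_in_vecs) auto
    ultimately have "unitv j \<in> ?U" using PP_span_iff[OF sU unitv_nonzero] by blast
    then show "h j = 0" using pair_unitv[OF fin(2) j] by simp
  qed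
  have F3: "\<phi> (\<psi> (cv.span {bv a b})) = cv.span {bvec J F a b}" if "a \<noteq> 0 \<or> b \<noteq> 0" for a b
    using F(3)[OF that] by simp
  show ?thesis by (rule that[of e F, OF F(1,2) F3 inj imm nd])
qed

section \<open>Osculating spaces of decomposable rational scrolls\<close>

lemma bform_D_sum:
  assumes "finite A" "\<And>x. x \<in> A \<Longrightarrow> bform d (f x)"
  shows "D0 (\<lambda>a b. \<Sum>x\<in>A. c x * f x a b) a b = (\<Sum>x\<in>A. c x * D0 (f x) a b)"
    "D1 (\<lambda>a b. \<Sum>x\<in>A. c x * f x a b) a b = (\<Sum>x\<in>A. c x * D1 (f x) a b)"
  unfolding D0_def[of "\<lambda>a b. \<Sum>x\<in>A. c x * f x a b"] D1_def[of "\<lambda>a b. \<Sum>x\<in>A. c x * f x a b"]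
  using assms by (auto intro!: DERIV_imp_deriv DERIV_sum DERIV_cmult bform_deriv_aux)

text \<open>What is kept of the embedded curves: coordinates are binary forms of degree
  \<open>e i\<close> without common zero (\<open>nz\<close>) that give an injective
  (\<open>inj\<close>) and immersive (\<open>imm\<close>) parametrization of a nondegenerate curve
  (\<open>nd\<close>). \<open>imm\<close> concerns the map of affine cones, so it covers the radial
  direction too.\<close>

locale rational_curves =
  fixes n :: nat and r e :: "nat \<Rightarrow> nat" and F :: "nat \<times> nat \<Rightarrow> complex \<Rightarrow> complex \<Rightarrow> complex"
  assumes n_pos: "n \<ge> 1"
    and bf: "\<And>i j. i < n \<Longrightarrow> j \<le> r i \<Longrightarrow> bform (e i) (F (i, j))"
    and nz: "\<And>i a b. i < n \<Longrightarrow> a \<noteq> 0 \<or> b \<noteq> 0 \<Longrightarrow> \<exists>j\<le>r i. F (i, j) a b \<noteq> 0"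
    and inj: "\<And>i a b c d. i < n \<Longrightarrow> a \<noteq> 0 \<or> b \<noteq> 0 \<Longrightarrow> c \<noteq> 0 \<or> d \<noteq> 0 \<Longrightarrow>
      cv.span {bvec (blk r i) F a b} = cv.span {bvec (blk r i) F c d} \<Longrightarrow> cv.span {bv a b} = cv.span {bv c d}"
    and imm: "\<And>i a b x y. i < n \<Longrightarrow> a \<noteq> 0 \<or> b \<noteq> 0 \<Longrightarrow>
      (\<forall>j\<le>r i. x * D0 (F (i, j)) a b + y * D1 (F (i, j)) a b = 0) \<Longrightarrow> x = 0 \<and> y = 0"
    and nd: "\<And>i h. i < n \<Longrightarrow> (\<forall>a b. (\<Sum>j\<le>r i. h j * F (i, j) a b) = 0) \<Longrightarrow> \<forall>j\<le>r i. h j = 0"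
begin

abbreviation I where "I \<equiv> amb n r"

lemma in_I [simp]: "(i, j) \<in> I \<longleftrightarrow> i < n \<and> j \<le> r i"
  by (auto simp: amb_def blk_def)

lemma I_eq: "I = Sigma {..<n} (\<lambda>i. {..r i})"
  by (auto simp: amb_def blk_def)

lemma fin [simp]: "finite I"
  by (simp add: I_eq)

lemma card_I: "card I = (\<Sum>i<n. r i + 1)"
  by (simp add: I_eq)

lemma sum_I: "(\<Sum>x\<in>I. f x) = (\<Sum>i<n. \<Sum>j\<le>r i. f (i, j) :: complex)"
  unfolding I_eq by (subst sum.Sigma) auto

text \<open>Vector over the base point (a : b) with fibre coordinates \<open>u\<close>; the entries
  \<open>u i\<close> with \<open>i < n\<close> enter.\<close>

definition xv :: "(nat \<Rightarrow> complex) \<Rightarrow> complex \<Rightarrow> complex \<Rightarrow> (nat \<times> nat) vec" where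
  "xv u a b = (\<lambda>x. if x \<in> I then u (fst x) * F x a b else 0)"

text \<open>Pullback of the hyperplane \<open>h\<close> to the i-th curve.\<close>

definition pf :: "nat \<Rightarrow> (nat \<times> nat) vec \<Rightarrow> complex \<Rightarrow> complex \<Rightarrow> complex" where
  "pf i h a b = (\<Sum>j\<le>r i. h (i, j) * F (i, j) a b)"

lemma bform_pf: "i < n \<Longrightarrow> bform (e i) (pf i h)"
  unfolding pf_def[abs_def] by (intro bform_sum bform_cmult bf) auto

lemma D0_pf: "i < n \<Longrightarrow> D0 (pf i h) a b = (\<Sum>j\<le>r i. h (i, j) * D0 (F (i, j)) a b)"
  unfolding pf_def[abs_def] by (rule bform_D_sum) (auto intro: bf)

lemma D1_pf: "i < n \<Longrightarrow> D1 (pf i h) a b = (\<Sum>j\<le>r i. h (i, j) * D1 (F (i, j)) a b)"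
  unfolding pf_def[abs_def] by (rule bform_D_sum) (auto intro: bf)

lemma e_pos: assumes "i < n" shows "e i > 0"
proof (rule ccontr)
  assume "\<not> e i > 0"
  then have "\<exists>c. F (i, j) = (\<lambda>_ _. c)" if "j \<le> r i" for j
    using bf[OF assms that] bform_coeffs[of 0] by (auto simp: fun_eq_iff)
  then have "D0 (F (i, j)) 1 0 = 0 \<and> D1 (F (i, j)) 1 0 = 0" if "j \<le> r i" for j
  proof -
    obtain c where "F (i, j) = (\<lambda>_ _. c)" using \<open>\<And>j. j \<le> r i \<Longrightarrow> \<exists>c. F (i, j) = (\<lambda>_ _. c)\<close> \<open>j \<le> r i\<close> by blast
    then show ?thesis by (simp add: D0_def D1_def)
  qed
  then show False using imm[OF assms, of 1 0 1 0] by simp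
qed

lemma xv_in_vecs [simp]: "xv u a b \<in> vecs I"
  by (simp add: xv_def vecs_def)

lemma xv_apply: "i < n \<Longrightarrow> j \<le> r i \<Longrightarrow> xv u a b (i, j) = u i * F (i, j) a b"
  by (simp add: xv_def)

lemma pair_xv: "pair I h (xv u a b) = (\<Sum>i<n. u i * pf i h a b)"
  by (simp add: pair_def sum_I xv_apply pf_def sum_distrib_left mult_ac)

lemma xv_nonzero_point: assumes "xv u a b \<noteq> 0" shows "a \<noteq> 0 \<or> b \<noteq> 0"
proof (rule ccontr)
  assume ab: "\<not> ?thesis"
  have "xv u a b x = 0" for x
  proof (cases "x \<in> I")
    case True
    obtain i j where x: "x = (i, j)" by (cases x)
    then have ij: "i < n" "j \<le> r i" using True by auto
    have "F (i, j) a b = 0" using bform_homogeneous[OF bf[OF ij], of 0 0 0] e_pos[OF ij(1)] ab by (simp add: power_0_left)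
    then show ?thesis using x ij by (simp add: xv_apply)
  qed (simp add: xv_def)
  then show False using assms by (auto simp: fun_eq_iff vec_apply)
qed

lemma xv_eq_0_iff:
  assumes "a \<noteq> 0 \<or> b \<noteq> 0" shows "xv u a b = 0 \<longleftrightarrow> (\<forall>i<n. u i = 0)"
proof
  assume *: "xv u a b = 0"
  show "\<forall>i<n. u i = 0"
  proof (intro allI impI)
    fix i assume i: "i < n"
    obtain j where j: "j \<le> r i" "F (i, j) a b \<noteq> 0" using nz[OF i assms] by blast
    have "xv u a b (i, j) = 0" using * by (simp add: vec_apply)
    then show "u i = 0" using j i by (simp add: xv_apply)
  qed
qed (auto simp: xv_def fun_eq_iff vec_apply I_eq)

lemma xv_scale: "cscale c (xv u a b) = xv (\<lambda>i. c * u i) a b"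
  by (auto simp: xv_def fun_eq_iff cscale_apply)

lemma xv_add: "xv u a b + xv v a b = xv (\<lambda>i. u i + v i) a b"
  by (auto simp: xv_def fun_eq_iff plus_fun_apply algebra_simps)

lemma bvec_eq_xv: "i < n \<Longrightarrow> bvec (blk r i) F a b = xv (\<lambda>k. if k = i then 1 else 0) a b"
  by (auto simp: bvec_def blk_def xv_def fun_eq_iff)

definition sset :: "nat set \<Rightarrow> (nat \<times> nat) point set" where
  "sset S = {cv.span {xv u a b} | u a b. xv u a b \<noteq> 0 \<and> (\<forall>i. i \<notin> S \<longrightarrow> u i = 0)}"

lemma sset_subset_proj: "sset S \<subseteq> proj_space I"
  by (auto simp: sset_def intro: PP_I)

lemma lspan_fibre:
  assumes "S \<subseteq> {..<n}"
  shows "PP (cv.span (\<Union>i\<in>S. cv.span {bvec (blk r i) F a b})) = {cv.span {xv u a b} | u. xv u a b \<noteq> 0 \<and> (\<forall>i. i \<notin> S \<longrightarrow> u i = 0)}"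
proof -
  let ?U = "{xv u a b | u. \<forall>i. i \<notin> S \<longrightarrow> u i = 0}"
  have z: "xv (\<lambda>_. 0) a b = 0" by (simp add: xv_def fun_eq_iff vec_apply)
  have sub: "cv.subspace ?U"
    unfolding cv.subspace_def
  proof (intro conjI ballI allI)
    show "0 \<in> ?U" using z by (auto intro!: exI[of _ "\<lambda>_. 0"])
    fix x y assume "x \<in> ?U" "y \<in> ?U"
    then obtain u v where "x = xv u a b" "y = xv v a b" "\<forall>i. i \<notin> S \<longrightarrow> u i = 0" "\<forall>i. i \<notin> S \<longrightarrow> v i = 0" by blast
    then show "x + y \<in> ?U" by (auto simp: xv_add intro!: exI[of _ "\<lambda>i. u i + v i"])
  next
    fix c x assume "x \<in> ?U"
    then obtain u where "x = xv u a b" "\<forall>i. i \<notin> S \<longrightarrow> u i = 0" by blast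
    then show "cscale c x \<in> ?U" by (auto simp: xv_scale intro!: exI[of _ "\<lambda>i. c * u i"])
  qed
  have "cv.span (\<Union>i\<in>S. cv.span {bvec (blk r i) F a b}) = ?U"
  proof
    have "bvec (blk r i) F a b \<in> ?U" if "i \<in> S" for i
      using that assms bvec_eq_xv by (auto intro!: exI[of _ "\<lambda>k. if k = i then 1 else 0"])
    then show "cv.span (\<Union>i\<in>S. cv.span {bvec (blk r i) F a b}) \<subseteq> ?U"
      using sub by (intro cv.span_minimal UN_least) auto
    show "?U \<subseteq> cv.span (\<Union>i\<in>S. cv.span {bvec (blk r i) F a b})"
    proof
      fix x assume "x \<in> ?U"
      then obtain u where u: "x = xv u a b" "\<forall>i. i \<notin> S \<longrightarrow> u i = 0" by blast
      have "x = (\<Sum>i\<in>S. cscale (u i) (bvec (blk r i) F a b))"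
      proof
        fix y :: "nat \<times> nat"
        obtain i j where y: "y = (i, j)" by (cases y)
        have "finite S" using assms finite_subset by blast
        have "(\<Sum>i\<in>S. cscale (u i) (bvec (blk r i) F a b)) y = (\<Sum>k\<in>S. if k = i then (if j \<le> r i then u i * F (i, j) a b else 0) else 0)"
          unfolding sum_fun_apply by (rule sum.cong) (auto simp: y cscale_apply bvec_def blk_def)
        also have "\<dots> = x y" using \<open>finite S\<close> assms u by (auto simp: y xv_def)
        finally show "x y = (\<Sum>i\<in>S. cscale (u i) (bvec (blk r i) F a b)) y" by simp
      qed
      then show "x \<in> cv.span (\<Union>i\<in>S. cv.span {bvec (blk r i) F a b})"
        by (auto intro!: cv.span_sum cv.span_scale intro: cv.span_base)
    qed
  qed
  then have eq: "\<And>v. v \<in> cv.span (\<Union>i\<in>S. cv.span {bvec (blk r i) F a b}) \<longleftrightarrow> v \<in> ?U" by simp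
  show ?thesis unfolding PP_def eq by blast
qed

lemma generated_scroll_eq:
  assumes "S \<subseteq> {..<n}" "C = \<psi> ` proj_space {..1}"
    "\<And>i a b. i < n \<Longrightarrow> a \<noteq> 0 \<or> b \<noteq> 0 \<Longrightarrow> \<phi> i (\<psi> (cv.span {bv a b})) = cv.span {bvec (blk r i) F a b}"
  shows "generated_scroll C \<phi> S = sset S"
proof -
  have fib: "lspan ((\<lambda>i. \<phi> i (\<psi> (cv.span {bv a b}))) ` S) = {cv.span {xv u a b} | u. xv u a b \<noteq> 0 \<and> (\<forall>i. i \<notin> S \<longrightarrow> u i = 0)}"
    if ab: "a \<noteq> 0 \<or> b \<noteq> 0" for a b
  proof -
    have "(\<Union>i\<in>S. \<phi> i (\<psi> (cv.span {bv a b}))) = (\<Union>i\<in>S. cv.span {bvec (blk r i) F a b})"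
      using assms(1,3) ab by (intro SUP_cong) auto
    then show ?thesis unfolding lspan_def lspan_fibre[OF assms(1), symmetric] by simp
  qed
  have "generated_scroll C \<phi> S = (\<Union>p\<in>{cv.span {bv a b} | a b. a \<noteq> 0 \<or> b \<noteq> 0}. lspan ((\<lambda>i. \<phi> i (\<psi> p)) ` S))"
    unfolding generated_scroll_def assms(2) proj1_points by blast
  also have "\<dots> = {x. \<exists>a b. (a \<noteq> 0 \<or> b \<noteq> 0) \<and> x \<in> lspan ((\<lambda>i. \<phi> i (\<psi> (cv.span {bv a b}))) ` S)}" by blast
  also have "\<dots> = {x. \<exists>a b. (a \<noteq> 0 \<or> b \<noteq> 0) \<and> x \<in> {cv.span {xv u a b} | u. xv u a b \<noteq> 0 \<and> (\<forall>i. i \<notin> S \<longrightarrow> u i = 0)}}"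
    by (intro Collect_cong ex_cong1 conj_cong refl) (simp only: fib)
  also have "\<dots> = sset S" unfolding sset_def using xv_nonzero_point by blast
  finally show ?thesis .
qed

lemma bform_F_polyfun:
  assumes "i < n" "j \<le> r i" shows "polyfun (\<lambda>z. F (i, j) (a + z * x) (b + z * y))"
  by (rule bform_polyfun[OF bf[OF assms]]) (intro polyfun_intros)+

lemma xv_polycurve:
  assumes "\<And>i. polyfun (\<lambda>z. u z i)" shows "polycurve (\<lambda>z. xv (u z) (a + z * x) (b + z * y))"
  unfolding polycurve_def
proof
  fix k :: "nat \<times> nat"
  obtain i j where k: "k = (i, j)" by (cases k)
  show "polyfun (\<lambda>z. xv (u z) (a + z * x) (b + z * y) k)"
  proof (cases "i < n \<and> j \<le> r i")
    case True
    then show ?thesis using polyfun_mult[OF assms bform_F_polyfun[of i j a x b y]] by (simp add: k xv_apply)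
  qed (auto simp: k xv_def)
qed

end

section \<open>Jets along curves\<close>

text \<open>Order of vanishing at 0 for functions that are quotients of polynomials near 0. The
  denominator \<open>B\<close> is cleared to keep the relation polynomial, and values away from 0
  are free.\<close>

definition vanish_order :: "nat \<Rightarrow> (complex \<Rightarrow> complex) \<Rightarrow> bool" where
  "vanish_order k f \<longleftrightarrow> (\<exists>A B. polyfun A \<and> polyfun B \<and> B 0 \<noteq> 0 \<and> (\<forall>\<^sub>F z in nhds 0. f z * B z = z ^ k * A z))"

lemma vanish_order_const: "vanish_order 0 (\<lambda>_. c)"
  unfolding vanish_order_def by (rule exI[of _ "\<lambda>_. c"], rule exI[of _ "\<lambda>_. 1"]) simp

lemma vanish_order_zero: "vanish_order k (\<lambda>_. 0)"
  unfolding vanish_order_def by (rule exI[of _ "\<lambda>_. 0"], rule exI[of _ "\<lambda>_. 1"]) simp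

lemma vanish_order_mult:
  assumes "vanish_order k f" "vanish_order m g" shows "vanish_order (k + m) (\<lambda>z. f z * g z)"
proof -
  obtain A B where 1: "polyfun A" "polyfun B" "B 0 \<noteq> 0" "\<forall>\<^sub>F z in nhds 0. f z * B z = z ^ k * A z"
    using assms by (auto simp: vanish_order_def)
  obtain A' B' where 2: "polyfun A'" "polyfun B'" "B' 0 \<noteq> 0" "\<forall>\<^sub>F z in nhds 0. g z * B' z = z ^ m * A' z"
    using assms by (auto simp: vanish_order_def)
  have "\<forall>\<^sub>F z in nhds 0. (f z * g z) * (B z * B' z) = z ^ (k + m) * (A z * A' z)"
    using 1(4) 2(4)
  proof eventually_elim
    case (elim z)
    have "(f z * g z) * (B z * B' z) = (f z * B z) * (g z * B' z)" by (simp add: mult_ac)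
    then show ?case unfolding elim by (simp add: power_add mult_ac)
  qed
  then show ?thesis unfolding vanish_order_def using 1 2
    by (intro exI[of _ "\<lambda>z. A z * A' z"] exI[of _ "\<lambda>z. B z * B' z"]) (auto intro: polyfun_mult)
qed

lemma vanish_order_add:
  assumes "vanish_order k f" "vanish_order k g" shows "vanish_order k (\<lambda>z. f z + g z)"
proof -
  obtain A B where 1: "polyfun A" "polyfun B" "B 0 \<noteq> 0" "\<forall>\<^sub>F z in nhds 0. f z * B z = z ^ k * A z"
    using assms by (auto simp: vanish_order_def)
  obtain A' B' where 2: "polyfun A'" "polyfun B'" "B' 0 \<noteq> 0" "\<forall>\<^sub>F z in nhds 0. g z * B' z = z ^ k * A' z"
    using assms by (auto simp: vanish_order_def)
  have "\<forall>\<^sub>F z in nhds 0. (f z + g z) * (B z * B' z) = z ^ k * (A z * B' z + A' z * B z)"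
    using 1(4) 2(4)
  proof eventually_elim
    case (elim z)
    have "(f z + g z) * (B z * B' z) = (f z * B z) * B' z + (g z * B' z) * B z" by (simp add: algebra_simps)
    then show ?case unfolding elim by (simp add: algebra_simps)
  qed
  then show ?thesis unfolding vanish_order_def using 1 2
    by (intro exI[of _ "\<lambda>z. A z * B' z + A' z * B z"] exI[of _ "\<lambda>z. B z * B' z"]) (auto intro: polyfun_mult polyfun_add)
qed

lemma vanish_order_sum: "(\<And>x. x \<in> S \<Longrightarrow> vanish_order k (f x)) \<Longrightarrow> vanish_order k (\<lambda>z. \<Sum>x\<in>S. f x z)"
  by (induction S rule: infinite_finite_induct) (auto intro: vanish_order_zero vanish_order_add)

lemma vanish_order_prod:
  "finite S \<Longrightarrow> (\<And>x. x \<in> S \<Longrightarrow> vanish_order 1 (f x)) \<Longrightarrow> vanish_order (card S) (\<lambda>z. \<Prod>x\<in>S. f x z)"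
proof (induction S rule: finite_induct)
  case (insert x S)
  then show ?case using vanish_order_mult[of 1 "f x" "card S" "\<lambda>z. \<Prod>x\<in>S. f x z"] by simp
qed (simp add: vanish_order_const)

lemma vanish_order_cong:
  assumes "vanish_order k f" "\<forall>\<^sub>F z in nhds 0. f z = g z" shows "vanish_order k g"
proof -
  obtain A B where 1: "polyfun A" "polyfun B" "B 0 \<noteq> 0" "\<forall>\<^sub>F z in nhds 0. f z * B z = z ^ k * A z"
    using assms by (auto simp: vanish_order_def)
  have "\<forall>\<^sub>F z in nhds 0. g z * B z = z ^ k * A z" using 1(4) assms(2) by eventually_elim simp
  then show ?thesis unfolding vanish_order_def using 1 by blast
qed

lemma vanish_order_polyfun_mult:
  assumes "vanish_order k (\<lambda>z. f z / g z)" "polyfun g" "g 0 \<noteq> 0" shows "vanish_order k f"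
proof -
  have "vanish_order 0 g" unfolding vanish_order_def using assms by (intro exI[of _ g] exI[of _ "\<lambda>_. 1"]) auto
  then have "vanish_order (k + 0) (\<lambda>z. f z / g z * g z)" using assms(1) by (rule vanish_order_mult[rotated])
  moreover have "\<forall>\<^sub>F z in nhds 0. f z / g z * g z = f z"
    using polyfun_eventually_nonzero[OF assms(2,3)] by eventually_elim simp
  ultimately show ?thesis using vanish_order_cong by fastforce
qed

lemma poly_eq_if_eventually:
  assumes "\<forall>\<^sub>F z in nhds (0::complex). poly p z = poly q z" shows "p = q"
proof (rule ccontr)
  assume "p \<noteq> q"
  then have "finite {z. poly (p - q) z = 0}" by (intro poly_roots_finite) simp
  moreover obtain d where d: "d > 0" "\<forall>z. dist z 0 < d \<longrightarrow> poly p z = poly q z"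
    using assms by (auto simp: eventually_nhds_metric)
  then have "ball 0 d \<subseteq> {z. poly (p - q) z = 0}" by (auto simp: dist_commute)
  ultimately have "finite (ball (0::complex) d)" using finite_subset by blast
  then show False using d(1) by (metis countable_finite uncountable_ball)
qed

text \<open>The identity near 0 is one of polynomials, hence global; the denominator is prime to the
  power of z because it does not vanish at 0.\<close>

lemma vanish_order_poly:
  assumes "vanish_order k (poly p)" shows "[:0, 1:] ^ k dvd p"
proof -
  obtain A B where AB: "polyfun A" "polyfun B" "B 0 \<noteq> 0" "\<forall>\<^sub>F z in nhds 0. poly p z * B z = z ^ k * A z"
    using assms by (auto simp: vanish_order_def)
  obtain q s where q: "\<forall>z. A z = poly q z" "\<forall>z. B z = poly s z" using AB unfolding polyfun_def by blast
  have "p * s = [:0, 1:] ^ k * q"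
    by (rule poly_eq_if_eventually) (use AB(4) q in \<open>simp add: poly_power\<close>)
  then have "[:- 0, 1:] ^ k dvd p * s" by simp
  moreover have "poly s 0 \<noteq> 0" using AB(3) q(2) by simp
  then have "order 0 s = 0" "s \<noteq> 0" using order_root[of s 0] by auto
  ultimately have "p = 0 \<or> k \<le> order 0 p"
    using order_divides[of 0 k "p * s"] order_mult[of p s 0] by (cases "p = 0") auto
  then show ?thesis using order_divides[of 0 k p] by simp
qed

lemma vanish_order_coeff:
  assumes "vanish_order k (poly p)" "m < k" shows "coeff p m = 0"
proof -
  obtain q where "p = [:0, 1:] ^ k * q" using vanish_order_poly[OF assms(1)] by (elim dvdE)
  then have "p = monom 1 k * q" by (simp add: monom_altdef)
  then show ?thesis using assms(2) by (simp add: coeff_monom_mult)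
qed

lemma regular_at_curve:
  assumes "regular_at I Y (cv.span {\<gamma> 0}) g" "finite I" "polycurve \<gamma>" "\<And>z. \<gamma> z \<in> vecs I" "\<gamma> 0 \<noteq> 0"
    "\<And>z. \<gamma> z \<noteq> 0 \<Longrightarrow> cv.span {\<gamma> z} \<in> Y"
  shows "vanish_order 0 (\<lambda>z. g (cv.span {\<gamma> z}))"
    "g (cv.span {\<gamma> 0}) = 0 \<Longrightarrow> vanish_order 1 (\<lambda>z. g (cv.span {\<gamma> z}))"
proof -
  obtain d a b where ab: "hform I d a" "hform I d b" "b (rep (cv.span {\<gamma> 0})) \<noteq> 0"
    "nearby I Y (cv.span {\<gamma> 0}) (\<lambda>q. g q = a (rep q) / b (rep q))"
    using assms(1) by (auto simp: regular_at_def)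
  let ?A = "\<lambda>z. a (\<gamma> z)" and ?B = "\<lambda>z. b (\<gamma> z)"
  have AB: "polyfun ?A" "polyfun ?B" using hform_polycurve assms(2,3) ab by blast+
  have B0: "?B 0 \<noteq> 0" using ab(3) hform_rep_span[OF assms(2) ab(2) assms(5)] by simp
  have "\<forall>\<^sub>F z in nhds 0. \<gamma> z \<noteq> 0 \<and> g (cv.span {\<gamma> z}) = a (rep (cv.span {\<gamma> z})) / b (rep (cv.span {\<gamma> z}))"
    by (rule nearby_curve[OF ab(4) assms(2-6)])
  then have ev: "\<forall>\<^sub>F z in nhds 0. g (cv.span {\<gamma> z}) * ?B z = ?A z"
    using polyfun_eventually_nonzero[OF AB(2) B0]
  proof eventually_elim
    case (elim z)
    obtain c where c: "c \<noteq> 0" "rep (cv.span {\<gamma> z}) = cscale c (\<gamma> z)" using rep_span elim(1) by metis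
    show ?case using elim c by (simp add: hform_homogeneous[OF assms(2) ab(1)] hform_homogeneous[OF assms(2) ab(2)])
  qed
  show "vanish_order 0 (\<lambda>z. g (cv.span {\<gamma> z}))"
    unfolding vanish_order_def using AB B0 ev by (intro exI[of _ ?A] exI[of _ ?B]) auto
  assume "g (cv.span {\<gamma> 0}) = 0"
  then have A0: "?A 0 = 0" using eventually_nhds_x_imp_x[OF ev] by simp
  obtain p where p: "\<forall>z. ?A z = poly p z" using AB(1) unfolding polyfun_def by blast
  then have "[:0, 1:] dvd p" using A0 poly_eq_0_iff_dvd[of p 0] by auto
  then obtain q where "p = [:0, 1:] * q" by (elim dvdE)
  then have "?A z = z * poly q z" for z using p by simp
  then show "vanish_order 1 (\<lambda>z. g (cv.span {\<gamma> z}))"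
    unfolding vanish_order_def using AB B0 ev
    by (intro exI[of _ "poly q"] exI[of _ ?B]) (auto simp: polyfun_def)
qed

text \<open>Restriction to a curve through the point sends functions vanishing there to functions
  vanishing at 0, so a product of \<open>Suc k\<close> of them vanishes to order
  \<open>Suc k\<close>. The trivialising form \<open>l\<close> is nonzero along the curve near
  0.\<close>

lemma jet_kernel_curve:
  assumes "h \<in> jet_kernel I Y k (cv.span {\<gamma> 0})" "finite I" "polycurve \<gamma>" "\<And>z. \<gamma> z \<in> vecs I" "\<gamma> 0 \<noteq> 0"
    "\<And>z. \<gamma> z \<noteq> 0 \<Longrightarrow> cv.span {\<gamma> z} \<in> Y"
  shows "vanish_order (Suc k) (\<lambda>z. pair I h (\<gamma> z))"
proof -
  obtain l where l: "pair I l (rep (cv.span {\<gamma> 0})) \<noteq> 0"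
    "(\<lambda>q. pair I h (rep q) / pair I l (rep q)) \<in> max_ideal_pow I Y (cv.span {\<gamma> 0}) (Suc k)"
    using assms(1) by (auto simp: jet_kernel_def)
  obtain m :: nat and c u where cu: "\<forall>i<m. regular_at I Y (cv.span {\<gamma> 0}) (c i)"
    "\<forall>i<m. \<forall>j<Suc k. regular_at I Y (cv.span {\<gamma> 0}) (u i j) \<and> u i j (cv.span {\<gamma> 0}) = 0"
    "nearby I Y (cv.span {\<gamma> 0}) (\<lambda>q. pair I h (rep q) / pair I l (rep q) = (\<Sum>i<m. c i q * (\<Prod>j<Suc k. u i j q)))"
    using l(2) unfolding max_ideal_pow_def by blast
  have l0: "pair I l (\<gamma> 0) \<noteq> 0" using l(1) hform_rep_span[OF assms(2) hform_pair[OF assms(2)] assms(5)] by blast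
  have "vanish_order (0 + card {..<Suc k}) (\<lambda>z. c i (cv.span {\<gamma> z}) * (\<Prod>j<Suc k. u i j (cv.span {\<gamma> z})))" if "i < m" for i
    by (intro vanish_order_mult vanish_order_prod)
      (use regular_at_curve[OF _ assms(2-6)] cu that in auto)
  then have v1: "vanish_order (Suc k) (\<lambda>z. \<Sum>i<m. c i (cv.span {\<gamma> z}) * (\<Prod>j<Suc k. u i j (cv.span {\<gamma> z})))"
    by (intro vanish_order_sum) simp
  have near: "\<forall>\<^sub>F z in nhds 0. \<gamma> z \<noteq> 0 \<and> pair I h (rep (cv.span {\<gamma> z})) / pair I l (rep (cv.span {\<gamma> z})) =
      (\<Sum>i<m. c i (cv.span {\<gamma> z}) * (\<Prod>j<Suc k. u i j (cv.span {\<gamma> z})))"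
    by (rule nearby_curve[OF cu(3) assms(2-6)])
  have "\<forall>\<^sub>F z in nhds 0. (\<Sum>i<m. c i (cv.span {\<gamma> z}) * (\<Prod>j<Suc k. u i j (cv.span {\<gamma> z}))) = pair I h (\<gamma> z) / pair I l (\<gamma> z)"
    using near
  proof eventually_elim
    case (elim z)
    obtain t where "t \<noteq> 0" "rep (cv.span {\<gamma> z}) = cscale t (\<gamma> z)" using rep_span elim by metis
    then show ?case using elim by (simp add: pair_scale_right)
  qed
  with v1 have "vanish_order (Suc k) (\<lambda>z. pair I h (\<gamma> z) / pair I l (\<gamma> z))" by (rule vanish_order_cong)
  then show ?thesis using pair_polycurve[OF assms(3)] l0 by (rule vanish_order_polyfun_mult)
qed

lemma pair_diff_left: "pair I (h - k) v = pair I h v - pair I k v"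
  by (simp add: pair_def sum_subtractf algebra_simps)

lemma hform_bform_pair:
  assumes "finite I" "bform d f" shows "hform I d (\<lambda>v. f (pair I \<alpha> v) (pair I \<beta> v))"
proof -
  have "hform I (d * 1) (\<lambda>v. (\<lambda>w. f (w 0) (w 1)) (\<lambda>i. if i \<in> {..1::nat} then (if i = 0 then pair I \<alpha> else pair I \<beta>) v else 0))"
    using assms(2) unfolding bform_def
    by (rule hform_compose[OF finite_atMost assms(1)]) (use hform_pair[OF assms(1)] in auto)
  then show ?thesis by simp
qed

text \<open>The partial derivatives of a linear form are constant, so they vanish everywhere once
  they vanish at one point.\<close>

lemma droot_linear:
  assumes "bform 1 f" "droot f a b" shows "f x y = 0"
proof -
  have "bform 0 (D0 f)" "bform 0 (D1 f)" using bform_D0[of 0 f] bform_D1[of 0 f] assms(1) by auto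
  then obtain c d where "D0 f = (\<lambda>_ _. c)" "D1 f = (\<lambda>_ _. d)"
    using bform_coeffs[of 0 "D0 f"] bform_coeffs[of 0 "D1 f"] by (auto simp: fun_eq_iff)
  then have "D0 f x y = 0" "D1 f x y = 0" using assms(2) by (auto simp: droot_def)
  then show ?thesis using bform_euler[of 0 f] assms(1) by simp
qed

context rational_curves begin

lemma xv_cong: "(\<And>i. i < n \<Longrightarrow> u i = v i) \<Longrightarrow> xv u a b = xv v a b"
  by (auto simp: xv_def fun_eq_iff)

lemma pf_poly:
  assumes "i < n" shows "\<exists>P. \<forall>z. pf i h (a + z * x) (b + z * y) = poly P z"
proof -
  have "polyfun (\<lambda>z. pf i h (a + z * x) (b + z * y))"
    by (rule bform_polyfun[OF bform_pf[OF assms]]) (intro polyfun_intros)+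
  then show ?thesis unfolding polyfun_def .
qed

lemma sset_I: "xv u a b \<noteq> 0 \<Longrightarrow> (\<And>i. i \<notin> S \<Longrightarrow> u i = 0) \<Longrightarrow> cv.span {xv u a b} \<in> sset S"
  unfolding sset_def by blast

text \<open>Test curves move the base point along (x, y) and the fibre coordinates along \<mu>. The
  freedom in \<mu> isolates block \<open>k\<close>, even if \<open>u k\<close> is zero.\<close>

lemma jet_kernel_droot:
  assumes "xv u a b \<noteq> 0" "h \<in> jet_kernel I (sset {..<n}) 2 (cv.span {xv u a b})" "k < n"
  shows "droot (pf k h) a b"
proof -
  have *: "coeff P 0 = 0 \<and> coeff P 1 = 0" if P: "\<forall>z. pf k h (a + z * x) (b + z * y) = poly P z" for x y P
  proof -
    obtain Q where Q: "\<And>i. i < n \<Longrightarrow> \<forall>z. pf i h (a + z * x) (b + z * y) = poly (Q i) z"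
      using pf_poly[of _ h a x b y] by metis
    have "poly P = poly (Q k)" using P Q[OF assms(3)] by (auto simp: fun_eq_iff)
    then have PQ: "P = Q k" by (simp add: poly_eq_poly_eq_iff)
    \<comment> \<open>This is the coefficient of z^(m + 1) in the restriction of \<open>h\<close>,
      which vanishes to order 3.\<close>
    have van: "(\<Sum>i<n. u i * coeff (Q i) (Suc m)) + (\<Sum>i<n. \<mu> i * coeff (Q i) m) = 0" if "m < 2" for m \<mu>
    proof -
      \<comment> \<open>The fibre coordinates are cut off at \<open>n\<close> because
        \<open>sset {..<n}\<close> asks for zeros beyond.\<close>
      define \<gamma> where "\<gamma> = (\<lambda>z. xv (\<lambda>i. if i < n then u i + z * \<mu> i else 0) (a + z * x) (b + z * y))"
      have \<gamma>0: "\<gamma> 0 = xv u a b" unfolding \<gamma>_def using xv_cong[of "\<lambda>i. if i < n then u i + 0 * \<mu> i else 0" u a b] by simp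
      have "vanish_order (Suc 2) (\<lambda>z. pair I h (\<gamma> z))"
      proof (rule jet_kernel_curve[where Y = "sset {..<n}"])
        show "polycurve \<gamma>" unfolding \<gamma>_def by (rule xv_polycurve) (intro polyfun_if polyfun_intros)
        show "\<gamma> z \<in> vecs I" for z by (simp add: \<gamma>_def)
        show "cv.span {\<gamma> z} \<in> sset {..<n}" if "\<gamma> z \<noteq> 0" for z
          using that unfolding \<gamma>_def by (rule sset_I) simp
      qed (use assms \<gamma>0 in auto)
      moreover have "pair I h (\<gamma> z) = poly (\<Sum>i<n. [:u i, \<mu> i:] * Q i) z" for z
        unfolding \<gamma>_def pair_xv poly_sum poly_mult using Q by (intro sum.cong) auto
      ultimately have "vanish_order 3 (poly (\<Sum>i<n. [:u i, \<mu> i:] * Q i))" by (simp add: numeral_3_eq_3 numeral_2_eq_2)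
      then have "coeff (\<Sum>i<n. [:u i, \<mu> i:] * Q i) (Suc m) = 0" using that by (intro vanish_order_coeff) auto
      then show ?thesis by (simp add: coeff_sum sum.distrib)
    qed
    \<comment> \<open>Subtract the relation for \<mu> = 0 from the one in which \<mu> is the k-th
      unit vector.\<close>
    have "coeff (Q k) m = 0" if "m < 2" for m
      using van[OF that, of "\<lambda>_. 0"] van[OF that, of "\<lambda>i. if i = k then 1 else 0"] assms(3)
      by (simp add: if_distrib[of "\<lambda>c. c * _"] sum.delta cong: if_cong)
    then show ?thesis using PQ by simp
  qed
  have **: "pf k h a b = 0 \<and> x * D0 (pf k h) a b + y * D1 (pf k h) a b = 0" for x y
  proof -
    obtain P where P: "\<forall>z. pf k h (a + z * x) (b + z * y) = poly P z"
      using pf_poly[OF assms(3)] by metis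
    have "((\<lambda>z. pf k h (a + z * x) (b + z * y)) has_field_derivative poly (pderiv P) 0) (at 0)"
      using P poly_DERIV[of P 0] by simp
    then have "x * D0 (pf k h) a b + y * D1 (pf k h) a b = poly (pderiv P) 0"
      using bform_has_derivative[OF bform_pf[OF assms(3)]] DERIV_unique by blast
    also have "\<dots> = coeff P 1" by (simp add: poly_0_coeff_0 coeff_pderiv)
    finally show ?thesis using *[OF P] P[rule_format, of 0] by (simp add: poly_0_coeff_0)
  qed
  show ?thesis using **[of 1 0] **[of 0 1] by (simp add: droot_def)
qed

text \<open>The two coordinates of a line are linear in (p, q) with determinant \<open>t\<close>;
  immersivity makes \<open>t\<close> nonzero, and Cramer's rule recovers \<open>u i * p\<close> and
  \<open>u i * q\<close> as linear forms.\<close>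

lemma line_inverse:
  assumes i: "i < n" "r i = 1" "e i = 1"
  obtains \<alpha> \<beta> where "\<alpha> \<in> vecs I" "\<beta> \<in> vecs I"
    "\<And>u p q. pair I \<alpha> (xv u p q) = u i * p" "\<And>u p q. pair I \<beta> (xv u p q) = u i * q"
proof -
  have "\<exists>c d. \<forall>p q. F (i, j) p q = c * p + d * q" if "j \<le> 1" for j
  proof -
    have "bform 1 (F (i, j))" using bf[OF i(1), of j] that i by simp
    then obtain c where "\<forall>a b. F (i, j) a b = (\<Sum>k\<le>1. c k * a ^ (1 - k) * b ^ k)"
      unfolding bform_coeffs by blast
    then show ?thesis by (intro exI[of _ "c 0"] exI[of _ "c 1"]) simp
  qed
  then obtain c d where cd: "\<And>j p q. j \<le> 1 \<Longrightarrow> F (i, j) p q = c j * p + d j * q" by metis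
  have D: "D0 (F (i, j)) p q = c j \<and> D1 (F (i, j)) p q = d j" if "j \<le> 1" for j p q
    unfolding D0_def D1_def cd[OF that] by (auto intro!: DERIV_imp_deriv derivative_eq_intros)
  define t where "t = c 0 * d 1 - c 1 * d 0"
  \<comment> \<open>If \<open>t = 0\<close>, the directions (d 1, - c 1) and (d 0, - c 0) lie in the
    kernel of the differential, so all coefficients vanish and the differential is zero.\<close>
  have t: "t \<noteq> 0"
  proof
    assume t0: "t = 0"
    have "d 1 = 0 \<and> - c 1 = 0"
    proof (rule imm[OF i(1), of 1 0])
      show "\<forall>j\<le>r i. d 1 * D0 (F (i, j)) 1 0 + - c 1 * D1 (F (i, j)) 1 0 = 0"
        using t0 D i(2) by (auto simp: t_def le_Suc_eq algebra_simps)
    qed simp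
    moreover have "d 0 = 0 \<and> - c 0 = 0"
    proof (rule imm[OF i(1), of 1 0])
      show "\<forall>j\<le>r i. d 0 * D0 (F (i, j)) 1 0 + - c 0 * D1 (F (i, j)) 1 0 = 0"
        using t0 D i(2) by (auto simp: t_def le_Suc_eq algebra_simps)
    qed simp
    ultimately have "\<forall>j\<le>r i. 1 * D0 (F (i, j)) 1 0 + 0 * D1 (F (i, j)) 1 0 = 0"
      using D i(2) by (auto simp: le_Suc_eq)
    then show False using imm[OF i(1), of 1 0 1 0] by simp
  qed
  define \<alpha> where "\<alpha> = cscale (d 1 / t) (unitv (i, 0 :: nat)) + cscale (- d 0 / t) (unitv (i, 1))"
  define \<beta> where "\<beta> = cscale (- c 1 / t) (unitv (i, 0 :: nat)) + cscale (c 0 / t) (unitv (i, 1))"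
  have in_I': "(i, 0) \<in> I" "(i, 1) \<in> I" using i by auto
  have p: "pair I (unitv (i, j)) (xv u p q) = u i * (c j * p + d j * q)" if "j \<le> 1" for j u p q
    using pair_unitv[OF fin, of "(i, j)"] that i cd by (simp add: pair_commute[of I "unitv _"] xv_apply)
  have "pair I \<alpha> (xv u p q) = u i * p" for u p q
  proof -
    have "pair I \<alpha> (xv u p q) = (d 1 * (u i * (c 0 * p + d 0 * q)) - d 0 * (u i * (c 1 * p + d 1 * q))) / t"
      unfolding \<alpha>_def pair_add_left pair_scale_left by (simp add: p diff_divide_distrib del: One_nat_def)
    also have "\<dots> = (t * (u i * p)) / t" by (simp add: t_def algebra_simps)
    finally show ?thesis using t by simp
  qed
  moreover have "pair I \<beta> (xv u p q) = u i * q" for u p q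
  proof -
    have "pair I \<beta> (xv u p q) = (c 0 * (u i * (c 1 * p + d 1 * q)) - c 1 * (u i * (c 0 * p + d 0 * q))) / t"
      unfolding \<beta>_def pair_add_left pair_scale_left by (simp add: p diff_divide_distrib del: One_nat_def)
    also have "\<dots> = (t * (u i * q)) / t" by (simp add: t_def algebra_simps)
    finally show ?thesis using t by simp
  qed
  moreover have "\<alpha> \<in> vecs I" "\<beta> \<in> vecs I"
    unfolding \<alpha>_def \<beta>_def using in_I'
    by (auto intro!: cv.subspace_add cv.subspace_diff cv.subspace_scale subspace_vecs unitv_in_vecs)
  ultimately show ?thesis using that by blast
qed

text \<open>Near a point of the sub-scroll of lines, the line block of the coordinates recovers the parameter of
  the fibre; every other block vanishes at the point, which contributes the third factor in the maximal ideal.\<close>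

lemma droot_in_jet_kernel:
  assumes S: "S \<subseteq> {..<n}" "\<And>i. i \<in> S \<Longrightarrow> e i = 1 \<and> r i = 1" "\<And>i. i < n \<Longrightarrow> i \<notin> S \<Longrightarrow> e i \<ge> 2"
    and u: "xv u a b \<noteq> 0" "\<And>i. i \<notin> S \<Longrightarrow> u i = 0"
    and h: "h \<in> vecs I" "\<And>i. i < n \<Longrightarrow> droot (pf i h) a b"
  shows "h \<in> jet_kernel I (sset {..<n}) 2 (cv.span {xv u a b})"
proof -
  let ?x = "cv.span {xv u a b}" and ?X = "sset {..<n}"
  have ab: "a \<noteq> 0 \<or> b \<noteq> 0" using xv_nonzero_point[OF u(1)] .
  obtain i0 where i0: "i0 \<in> S" "u i0 \<noteq> 0" using u xv_eq_0_iff[OF ab] by blast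
  then have i0n: "i0 < n" using S(1) by auto
  obtain \<alpha> \<beta> where \<alpha>\<beta>: "\<alpha> \<in> vecs I" "\<beta> \<in> vecs I"
    "\<And>u p q. pair I \<alpha> (xv u p q) = u i0 * p" "\<And>u p q. pair I \<beta> (xv u p q) = u i0 * q"
    using line_inverse[OF i0n] S(2)[OF i0(1)] by metis
  obtain s s' where ss: "a * s - b * s' = 1" using complementary_vector[OF ab] by blast
  let ?lf = "\<lambda>p q. a * q - b * p" and ?m = "\<lambda>p q. p * s - q * s'"
  have blf: "bform 1 ?lf" by (intro bform_diff bform_cmult bform_fst bform_snd)
  have bm: "bform 1 ?m"
    using bform_diff[OF bform_cmult[OF bform_fst, of s] bform_cmult[OF bform_snd, of s']] by (simp add: mult.commute)
  have "\<exists>g. bform (e i - 2) g \<and> (\<forall>p q. pf i h p q = (?lf p q)\<^sup>2 * g p q)" if "i < n" for i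
    using droot_factor[OF bform_pf[OF that] h(2)[OF that] ab] by metis
  then obtain g where g: "\<And>i. i < n \<Longrightarrow> bform (e i - 2) (g i)" "\<And>i p q. i < n \<Longrightarrow> pf i h p q = (?lf p q)\<^sup>2 * g i p q"
    by metis
  obtain J where J: "\<And>i. i < n \<Longrightarrow> J i \<le> r i \<and> F (i, J i) a b \<noteq> 0" using nz[OF _ ab] by metis
  let ?A = "pair I \<alpha>" and ?B = "pair I \<beta>"
  let ?M = "\<lambda>v. ?m (?A v) (?B v)" and ?L = "\<lambda>v. ?lf (?A v) (?B v)"
  let ?F = "\<lambda>i v. F (i, J i) (?A v) (?B v)"
  \<comment> \<open>On the scroll this form is the fibre coordinate of block \<open>i0\<close> times
    a linear form in the base point with value 1 at (a, b), so it trivialises the bundle near the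
    point.\<close>
  define l where "l = cscale s \<alpha> + cscale (- s') \<beta>"
  have l: "l \<in> vecs I" "pair I l v = ?M v" for v
    unfolding l_def using \<alpha>\<beta>(1,2)
    by (auto intro!: cv.subspace_diff cv.subspace_scale subspace_vecs simp: pair_diff_left pair_scale_left mult.commute)
  have hM: "hform I 1 ?M" and hL: "hform I 1 ?L" by (rule hform_bform_pair[OF fin bm], rule hform_bform_pair[OF fin blf])
  have hF: "hform I (e i) (?F i)" if "i < n" for i by (rule hform_bform_pair[OF fin bf]) (use that J in auto)
  have hx: "hform I 1 (\<lambda>v. v (i, J i))" if "i < n" for i by (rule hform_var) (use that J in auto)
  obtain c0 where c0: "c0 \<noteq> 0" "rep ?x = cscale c0 (xv u a b)" using rep_span[OF u(1)] by metis
  then have repx: "rep ?x = xv (\<lambda>i. c0 * u i) a b" by (simp add: xv_scale)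
  have at: "?A (rep ?x) = c0 * u i0 * a" "?B (rep ?x) = c0 * u i0 * b" unfolding repx \<alpha>\<beta> by auto
  have Mx: "?M (rep ?x) \<noteq> 0"
  proof -
    have "?M (rep ?x) = c0 * u i0 * (a * s - b * s')" unfolding at by (simp add: algebra_simps)
    then show ?thesis using c0 i0 ss by simp
  qed
  have Lx: "?L (rep ?x) = 0" unfolding at by simp
  have Fx: "?F i (rep ?x) \<noteq> 0" if "i < n" for i
    unfolding at bform_homogeneous[OF bf[OF that J[OF that, THEN conjunct1]]] using c0 i0 J[OF that] by simp
  have xX: "?x \<in> ?X" using u S(1) unfolding sset_def by blast
  have xp: "?x \<in> proj_space I" using xX sset_subset_proj by blast
  have reg: "regular_at I ?X ?x (\<lambda>q. f (rep q) / f' (rep q))" if "hform I d f" "hform I d f'" "f' (rep ?x) \<noteq> 0" for d f f'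
    unfolding regular_at_def using that
    by (intro exI[of _ d] exI[of _ f] exI[of _ f'] conjI nearbyI_always[OF fin xp _ sset_subset_proj]) auto
  \<comment> \<open>On the scroll, block \<open>i\<close> contributes to \<open>h\<close> its fibre
    coordinate times \<open>pf i h\<close>, which is the square of \<open>?lf\<close> times
    \<open>g i\<close>. The two equal factors \<open>?L / ?M\<close> carry the double root; the
    third is a coordinate of block \<open>i\<close>, which vanishes at the point since
    \<open>u i = 0\<close>; \<open>C i\<close> restores the cofactor. Blocks in \<open>S\<close>
    contribute 0, because a linear form with a double root is zero.\<close>
  define C where "C = (\<lambda>i q. if i \<in> S then 0 else (g i (?A (rep q)) (?B (rep q)) * (?M (rep q))\<^sup>2) / ?F i (rep q))"
  define U where "U = (\<lambda>i (j::nat) q. if i \<in> S then 0 else if j < 2 then ?L (rep q) / ?M (rep q) else rep q (i, J i) / ?M (rep q))"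
  have reg0: "regular_at I ?X ?x (\<lambda>q. 0)" using reg[OF hform_zero hform_const[OF fin, of 1]] by simp
  have "(\<lambda>q. pair I h (rep q) / pair I l (rep q)) \<in> max_ideal_pow I ?X ?x (Suc 2)"
    unfolding max_ideal_pow_def mem_Collect_eq
  proof (intro exI conjI allI impI)
    show "regular_at I ?X ?x (C i)" if "i < n" for i
    proof (cases "i \<in> S")
      case True then show ?thesis using reg0 by (simp add: C_def)
    next
      case False
      then have "e i - 2 + 2 * 1 = e i" using S(3)[OF that] by simp
      then have "hform I (e i) (\<lambda>v. g i (?A v) (?B v) * (?M v)\<^sup>2)"
        using hform_mult[OF fin hform_bform_pair[OF fin g(1)[OF that]] hform_power[OF fin hM, of 2], of \<alpha> \<beta>] by simp
      from reg[OF this hF[OF that] Fx[OF that]] show ?thesis using False by (simp add: C_def)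
    qed
    show "regular_at I ?X ?x (U i j)" if "i < n" "j < Suc 2" for i j
      using reg0 reg[OF hL hM Mx] reg[OF hx[OF that(1)] hM Mx] by (cases "i \<in> S"; cases "j < 2") (simp_all add: U_def)
    show "U i j ?x = 0" if "i < n" "j < Suc 2" for i j
      using Lx u(2) repx J[OF that(1)] that by (simp add: U_def xv_apply)
    let ?\<Theta> = "\<lambda>v. ?M v * (\<Prod>i<n. ?F i v)"
    have h\<Theta>: "hform I (1 + (\<Sum>i<n. e i)) ?\<Theta>" by (intro hform_mult[OF fin] hM hform_prod[OF fin] hF) auto
    show "nearby I ?X ?x (\<lambda>q. pair I h (rep q) / pair I l (rep q) = (\<Sum>i<n. C i q * (\<Prod>j<Suc 2. U i j q)))"
    proof (rule nearbyI_form[OF fin h\<Theta> xp _ _ sset_subset_proj])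
      show "?\<Theta> (rep ?x) \<noteq> 0" using Mx Fx by simp
      fix q assume q: "q \<in> ?X" "?\<Theta> (rep q) \<noteq> 0"
      obtain w p p' where w: "q = cv.span {xv w p p'}" "xv w p p' \<noteq> 0" using q(1) unfolding sset_def by blast
      obtain t where "t \<noteq> 0" "rep q = cscale t (xv w p p')" using rep_span[OF w(2)] w(1) by metis
      then have rq: "rep q = xv (\<lambda>i. t * w i) p p'" by (simp add: xv_scale)
      define \<mu> where "\<mu> = (\<lambda>i. t * w i)"
      have rq: "rep q = xv \<mu> p p'" using rq by (simp add: \<mu>_def)
      have AB: "?A (rep q) = \<mu> i0 * p" "?B (rep q) = \<mu> i0 * p'" unfolding rq \<alpha>\<beta> by auto
      have M: "?M (rep q) = \<mu> i0 * ?m p p'" "?L (rep q) = \<mu> i0 * ?lf p p'" unfolding AB by (simp_all add: algebra_simps)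
      have nz0: "\<mu> i0 \<noteq> 0" "?m p p' \<noteq> 0" "?F i (rep q) \<noteq> 0" if "i < n" for i
        using q(2) M(1) that by auto
      have trm: "C i q * (\<Prod>j<Suc 2. U i j q) = \<mu> i * pf i h p p' / (\<mu> i0 * ?m p p')" if i: "i < n" for i
      proof (cases "i \<in> S")
        case True
        have "pf i h p p' = 0" using droot_linear[of "pf i h"] bform_pf[OF i] h(2)[OF i] S(2)[OF True] by simp
        then show ?thesis using True by (simp add: C_def)
      next
        case False
        have ei: "e i = (e i - 2) + 2" using S(3)[OF i False] by simp
        define E where "E = e i - 2"
        have gh: "g i (?A (rep q)) (?B (rep q)) = \<mu> i0 ^ E * g i p p'" unfolding AB E_def by (rule bform_homogeneous[OF g(1)[OF i]])
        have Fh: "?F i (rep q) = \<mu> i0 ^ E * (\<mu> i0)\<^sup>2 * F (i, J i) p p'"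
          unfolding AB bform_homogeneous[OF bf[OF i J[OF i, THEN conjunct1]]] E_def by (subst ei) (simp add: power_add power2_eq_square)
        have Fn: "F (i, J i) p p' \<noteq> 0" using nz0(3)[OF i] Fh by auto
        have co: "rep q (i, J i) = \<mu> i * F (i, J i) p p'" unfolding rq using i J[OF i] by (simp add: xv_apply)
        have U3: "(\<Prod>j<Suc 2. U i j q) = ?L (rep q) / ?M (rep q) * (?L (rep q) / ?M (rep q)) * (rep q (i, J i) / ?M (rep q))"
          using False by (simp add: U_def numeral_2_eq_2)
        have Cq: "C i q = (\<mu> i0 ^ E * g i p p' * (\<mu> i0 * ?m p p')\<^sup>2) / (\<mu> i0 ^ E * (\<mu> i0)\<^sup>2 * F (i, J i) p p')"
          using False unfolding C_def gh Fh M(1) by simp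
        have alg: "(x * y * (z * w)\<^sup>2) / (x * z\<^sup>2 * v) * (z * k / (z * w) * (z * k / (z * w)) * (u * v / (z * w))) =
            u * (k\<^sup>2 * y) / (z * w)" if "x \<noteq> 0" "z \<noteq> 0" "w \<noteq> 0" "v \<noteq> 0" for x y z w v k u :: complex
          using that by (simp add: divide_simps power2_eq_square)
        show ?thesis unfolding Cq U3 M co g(2)[OF i]
          by (rule alg) (use nz0[OF i] Fn in auto)
      qed
      have "pair I h (rep q) / pair I l (rep q) = (\<Sum>i<n. \<mu> i * pf i h p p' / (\<mu> i0 * ?m p p'))"
        unfolding l(2) M(1) by (simp add: rq pair_xv sum_divide_distrib)
      also have "\<dots> = (\<Sum>i<n. C i q * (\<Prod>j<Suc 2. U i j q))" using trm by (intro sum.cong) auto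
      finally show "pair I h (rep q) / pair I l (rep q) = (\<Sum>i<n. C i q * (\<Prod>j<Suc 2. U i j q))" .
    qed
  qed
  moreover have "pair I l (rep ?x) \<noteq> 0" using l(2) Mx by simp
  ultimately show ?thesis using h(1) l(1) unfolding jet_kernel_def by blast
qed

definition Dset :: "(nat \<times> nat) point set" where
  "Dset = {\<eta> \<in> proj_space I. \<exists>a b. (a \<noteq> 0 \<or> b \<noteq> 0) \<and> (\<forall>i<n. droot (pf i (rep \<eta>)) a b)}"

lemma droot_iff: "i < n \<Longrightarrow> droot (pf i h) a b \<longleftrightarrow> D0 (pf i h) a b = 0 \<and> D1 (pf i h) a b = 0"
  using bform_euler[of "e i - 1" "pf i h"] bform_pf[of i h] e_pos[of i] by (auto simp: droot_def)

text \<open>The jet kernel at a point of the sub-scroll depends only on its base point. A hyperplane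
  contains the osculating space when it lies in the double annihilator of this kernel, and the
  partial derivatives of the i-th curve are vectors of the annihilator that detect a double root in
  block \<open>i\<close>.\<close>

lemma osculating_hyperplanes_eq:
  assumes S: "S \<subseteq> {..<n}" "S \<noteq> {}" "\<And>i. i \<in> S \<Longrightarrow> e i = 1 \<and> r i = 1" "\<And>i. i < n \<Longrightarrow> i \<notin> S \<Longrightarrow> e i \<ge> 2"
  shows "osculating_hyperplanes I (sset {..<n}) (sset S) = Dset"
proof -
  have jk: "jet_kernel I (sset {..<n}) 2 (cv.span {xv u a b}) = {h\<in>vecs I. \<forall>i<n. droot (pf i h) a b}"
    if "xv u a b \<noteq> 0" "\<forall>i. i \<notin> S \<longrightarrow> u i = 0" for u a b
  proof (intro set_eqI iffI)
    fix h assume h: "h \<in> jet_kernel I (sset {..<n}) 2 (cv.span {xv u a b})"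
    then show "h \<in> {h\<in>vecs I. \<forall>i<n. droot (pf i h) a b}"
      using jet_kernel_droot[OF that(1) h] by (auto simp: jet_kernel_def)
  next
    fix h assume "h \<in> {h\<in>vecs I. \<forall>i<n. droot (pf i h) a b}"
    then show "h \<in> jet_kernel I (sset {..<n}) 2 (cv.span {xv u a b})"
      using that by (intro droot_in_jet_kernel[OF S(1,3,4)]) auto
  qed
  have osc: "Osc I (sset {..<n}) 2 (cv.span {xv u a b}) \<subseteq> hyperplane I \<eta> \<longleftrightarrow> (\<forall>i<n. droot (pf i (rep \<eta>)) a b)"
    if xu: "xv u a b \<noteq> 0" "\<forall>i. i \<notin> S \<longrightarrow> u i = 0" and \<eta>: "\<eta> \<in> proj_space I" for u a b \<eta>
  proof
    assume *: "\<forall>i<n. droot (pf i (rep \<eta>)) a b"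
    show "Osc I (sset {..<n}) 2 (cv.span {xv u a b}) \<subseteq> hyperplane I \<eta>"
    proof
      fix q assume "q \<in> Osc I (sset {..<n}) 2 (cv.span {xv u a b})"
      then obtain v where v: "q = cv.span {v}" "v \<noteq> 0" "v \<in> vecs I"
        "\<forall>h. h \<in> vecs I \<and> (\<forall>i<n. droot (pf i h) a b) \<longrightarrow> pair I h v = 0"
        unfolding Osc_def jk[OF xu] PP_def by auto
      have "pair I (rep \<eta>) v = 0" using v(4) * proj_rep(1)[OF \<eta>] by blast
      then have "pair I (rep \<eta>) (rep q) = 0" using hform_rep_span[OF fin hform_pair[OF fin] v(2)] v(1) by simp
      then show "q \<in> hyperplane I \<eta>" using v PP_I by (auto simp: hyperplane_def)
    qed
  next
    assume *: "Osc I (sset {..<n}) 2 (cv.span {xv u a b}) \<subseteq> hyperplane I \<eta>"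
    have test: "pair I (rep \<eta>) v = 0" if "v \<in> vecs I" "\<forall>h. h \<in> vecs I \<and> (\<forall>i<n. droot (pf i h) a b) \<longrightarrow> pair I h v = 0" for v
    proof (cases "v = 0")
      case False
      then have "cv.span {v} \<in> Osc I (sset {..<n}) 2 (cv.span {xv u a b})"
        unfolding Osc_def jk[OF xu] using that by (intro PP_I) auto
      then have "pair I (rep \<eta>) (rep (cv.span {v})) = 0" using * by (auto simp: hyperplane_def)
      then show ?thesis using hform_rep_span[OF fin hform_pair[OF fin] False] by simp
    qed simp
    show "\<forall>i<n. droot (pf i (rep \<eta>)) a b"
    proof (intro allI impI)
      fix i assume i: "i < n"
      \<comment> \<open>Pairing with the vector of partial derivatives of block \<open>i\<close>,
        extended by zero, yields the partial derivative of \<open>pf i h\<close>.\<close>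
      have pr: "pair I h (\<lambda>x. if x \<in> {i} \<times> {..r i} then D (F x) a b else 0) = (\<Sum>j\<le>r i. h (i, j) * D (F (i, j)) a b)"
        for h and D :: "(complex \<Rightarrow> complex \<Rightarrow> complex) \<Rightarrow> complex \<Rightarrow> complex \<Rightarrow> complex"
      proof -
        have "(\<Sum>j\<le>r k. h (k, j) * (if (k, j) \<in> {i} \<times> {..r i} then D (F (k, j)) a b else 0)) =
            (if k = i then (\<Sum>j\<le>r i. h (i, j) * D (F (i, j)) a b) else 0)" for k
          by (auto intro!: sum.cong)
        then show ?thesis using i by (simp only: pair_def sum_I) simp
      qed
      have vi: "(\<lambda>x. if x \<in> {i} \<times> {..r i} then D (F x) a b else 0) \<in> vecs I" for D :: "(complex \<Rightarrow> complex \<Rightarrow> complex) \<Rightarrow> complex \<Rightarrow> complex \<Rightarrow> complex"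
        using i by (auto simp: vecs_def)
      have p0: "pair I h (\<lambda>x. if x \<in> {i} \<times> {..r i} then D0 (F x) a b else 0) = D0 (pf i h) a b" for h
        unfolding pr[of h D0] D0_pf[OF i] ..
      have p1: "pair I h (\<lambda>x. if x \<in> {i} \<times> {..r i} then D1 (F x) a b else 0) = D1 (pf i h) a b" for h
        unfolding pr[of h D1] D1_pf[OF i] ..
      have "D0 (pf i (rep \<eta>)) a b = 0" "D1 (pf i (rep \<eta>)) a b = 0"
        using test[OF vi[of D0], unfolded p0] test[OF vi[of D1], unfolded p1] i unfolding droot_def by blast+
      then show "droot (pf i (rep \<eta>)) a b" using droot_iff[OF i] by simp
    qed
  qed
  obtain i0 where i0: "i0 \<in> S" "i0 < n" using S by auto
  let ?u = "\<lambda>i. if i = i0 then 1 else 0 :: complex"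
  have ex: "xv ?u a b \<noteq> 0" "\<forall>i. i \<notin> S \<longrightarrow> ?u i = 0" if "a \<noteq> 0 \<or> b \<noteq> 0" for a b
    using xv_eq_0_iff[OF that] i0 by auto
  show ?thesis
  proof (intro set_eqI iffI)
    fix \<eta> assume "\<eta> \<in> osculating_hyperplanes I (sset {..<n}) (sset S)"
    then obtain u a b where "\<eta> \<in> proj_space I" "xv u a b \<noteq> 0" "\<forall>i. i \<notin> S \<longrightarrow> u i = 0"
      "Osc I (sset {..<n}) 2 (cv.span {xv u a b}) \<subseteq> hyperplane I \<eta>"
      unfolding osculating_hyperplanes_def sset_def[of S] by blast
    then show "\<eta> \<in> Dset" using osc[of u a b \<eta>] xv_nonzero_point[of u a b] unfolding Dset_def by blast
  next
    fix \<eta> assume "\<eta> \<in> Dset"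
    then obtain a b where \<eta>: "\<eta> \<in> proj_space I" "a \<noteq> 0 \<or> b \<noteq> 0" "\<forall>i<n. droot (pf i (rep \<eta>)) a b"
      unfolding Dset_def by blast
    then have "Osc I (sset {..<n}) 2 (cv.span {xv ?u a b}) \<subseteq> hyperplane I \<eta>" using osc[OF ex[OF \<eta>(2)] \<eta>(1)] by blast
    moreover have "cv.span {xv ?u a b} \<in> sset S" unfolding sset_def using ex[OF \<eta>(2)] by blast
    ultimately show "\<eta> \<in> osculating_hyperplanes I (sset {..<n}) (sset S)"
      using \<eta>(1) unfolding osculating_hyperplanes_def by blast
  qed
qed

end

section \<open>The dual variety: parameter count and degree\<close>

lemma exists_nonzero_in_annihilator:
  assumes "finite J" "finite S" "card S < card J"
  obtains h where "h \<in> vecs J" "h \<noteq> 0" "\<forall>a\<in>S. pair J a h = 0"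
proof -
  let ?U = "{h\<in>vecs J. \<forall>a\<in>S. pair J a h = 0}"
  have "cv.dim ?U \<noteq> 0" using dim_annihilator_ge[OF assms(1,2)] assms(3) by linarith
  then have "\<not> ?U \<subseteq> {0}" using cv.dim_le_card[of ?U "{}"] by auto
  then show ?thesis using that by auto
qed

lemma droot_scale:
  assumes "bform d f" "c \<noteq> 0" "droot f a b" shows "droot f (c * a) (c * b)"
proof (cases d)
  case 0
  then obtain k where "f = (\<lambda>_ _. k)" using assms bform_coeffs[of 0 f] by (auto simp: fun_eq_iff)
  then show ?thesis using assms(3) by (simp add: droot_def D0_def D1_def)
next
  case (Suc d')
  then show ?thesis using assms bform_homogeneous[OF assms(1)] bform_homogeneous[OF bform_D0[of d' f]]
      bform_homogeneous[OF bform_D1[of d' f]] by (simp add: droot_def)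
qed

context rational_curves begin

text \<open>The 2 by 2 minors of the Jacobian matrix of the i-th affine cone, binary forms of degree
  2 (e_i - 1).\<close>

definition minor :: "nat \<Rightarrow> nat \<Rightarrow> nat \<Rightarrow> complex \<Rightarrow> complex \<Rightarrow> complex" where
  "minor i j k a b = D0 (F (i, j)) a b * D1 (F (i, k)) a b - D0 (F (i, k)) a b * D1 (F (i, j)) a b"

lemma bform_DF:
  assumes "i < n" "j \<le> r i" shows "bform (e i - 1) (D0 (F (i, j)))" "bform (e i - 1) (D1 (F (i, j)))"
  using bform_D0[of "e i - 1"] bform_D1[of "e i - 1"] bf[OF assms] e_pos[OF assms(1)] by simp_all

lemma bform_minor: "i < n \<Longrightarrow> j \<le> r i \<Longrightarrow> k \<le> r i \<Longrightarrow> bform (e i - 1 + (e i - 1)) (minor i j k)"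
  unfolding minor_def[abs_def] by (intro bform_diff bform_mult bform_DF)

lemma minor_nonzero:
  assumes "i < n" "a \<noteq> 0 \<or> b \<noteq> 0"
  obtains j k where "j \<le> r i" "k \<le> r i" "minor i j k a b \<noteq> 0"
proof -
  obtain j where j: "j \<le> r i" "D0 (F (i, j)) a b \<noteq> 0 \<or> D1 (F (i, j)) a b \<noteq> 0"
  proof (rule ccontr)
    assume "\<not> thesis"
    then have "\<forall>j\<le>r i. 1 * D0 (F (i, j)) a b + 0 * D1 (F (i, j)) a b = 0" using that by auto
    then show False using imm[OF assms, of 1 0] by simp
  qed
  have "\<exists>k\<le>r i. minor i j k a b \<noteq> 0"
  proof (rule ccontr)
    assume "\<not> ?thesis"
    then have "\<forall>k\<le>r i. D1 (F (i, j)) a b * D0 (F (i, k)) a b + - D0 (F (i, j)) a b * D1 (F (i, k)) a b = 0"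
      by (auto simp: minor_def algebra_simps)
    then show False using imm[OF assms, of "D1 (F (i, j)) a b" "- D0 (F (i, j)) a b"] j by simp
  qed
  then show ?thesis using that j by blast
qed

lemma r_pos: assumes "i < n" shows "r i \<ge> 1"
proof (rule ccontr)
  assume "\<not> ?thesis"
  then have "r i = 0" by simp
  then show False using minor_nonzero[OF assms, of 1 0] by (auto simp: minor_def)
qed

text \<open>With two coordinates every minor is 0 or, up to sign, one and the same binary form; in
  positive degree it has a root, where the parametrization is not immersive.\<close>

lemma r_eq_1: assumes "i < n" "r i = 1" shows "e i = 1"
proof (rule ccontr)
  assume "e i \<noteq> 1"
  then have "e i - 1 + (e i - 1) > 0" using e_pos[OF assms(1)] by simp
  then obtain a b where ab: "a \<noteq> 0 \<or> b \<noteq> 0" "minor i 0 1 a b = 0"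
    using bform_has_root[OF bform_minor[OF assms(1), of 0 1]] assms(2) by auto
  have "minor i j k a b = 0" if "j \<le> 1" "k \<le> 1" for j k
    using ab(2) that by (auto simp: minor_def le_Suc_eq)
  then show False using minor_nonzero[OF assms(1) ab(1)] assms(2) by metis
qed

text \<open>Binary forms of degree \<open>e i\<close> have \<open>e i + 1\<close> coefficients, so
  more than \<open>e i + 1\<close> coordinates satisfy a linear relation, against
  nondegeneracy.\<close>

lemma r_le_e: assumes "i < n" shows "r i \<le> e i"
proof (rule ccontr)
  assume "\<not> ?thesis"
  then have lt: "e i < r i" by simp
  have "\<exists>c. \<forall>a b. F (i, j) a b = (\<Sum>k\<le>e i. c k * a ^ (e i - k) * b ^ k)" if "j \<le> r i" for j
    using bf[OF assms that] bform_coeffs by blast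
  then obtain c where c: "\<And>j a b. j \<le> r i \<Longrightarrow> F (i, j) a b = (\<Sum>k\<le>e i. c j k * a ^ (e i - k) * b ^ k)" by metis
  let ?S = "(\<lambda>k j. c j k) ` {..e i}"
  have cS: "card ?S < card {..r i}" using card_image_le[of "{..e i}" "\<lambda>k j. c j k"] lt by simp
  have fS: "finite ?S" by simp
  obtain h where h: "h \<in> vecs {..r i}" "h \<noteq> 0" "\<forall>a\<in>?S. pair {..r i} a h = 0"
    by (rule exists_nonzero_in_annihilator[OF finite_atMost fS cS])
  have "(\<Sum>j\<le>r i. h j * F (i, j) a b) = 0" for a b
  proof -
    have "(\<Sum>j\<le>r i. h j * F (i, j) a b) = (\<Sum>j\<le>r i. \<Sum>k\<le>e i. (c j k * h j) * (a ^ (e i - k) * b ^ k))"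
      using c by (auto simp: sum_distrib_left mult_ac intro!: sum.cong)
    also have "\<dots> = (\<Sum>k\<le>e i. \<Sum>j\<le>r i. (c j k * h j) * (a ^ (e i - k) * b ^ k))" by (rule sum.swap)
    also have "\<dots> = (\<Sum>k\<le>e i. pair {..r i} (\<lambda>j. c j k) h * (a ^ (e i - k) * b ^ k))"
      by (simp add: pair_def sum_distrib_right)
    also have "\<dots> = 0" using h(3) by (intro sum.neutral) auto
    finally show ?thesis .
  qed
  then have "\<forall>j\<le>r i. h j = 0" using nd[OF assms] by blast
  then have "h = 0" using h(1) by (auto simp: vecs_def fun_eq_iff vec_apply)
  then show False using h by simp
qed

definition IT :: "nat set \<Rightarrow> (nat \<times> nat) set" where
  "IT T = Sigma T (\<lambda>i. {..r i})"

text \<open>The dual set built from the blocks in \<open>T\<close>: all blocks give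
  \<open>Dset\<close>, and a single block gives the hyperplanes tangent to one curve, as needed for
  its degree.\<close>

definition DT :: "nat set \<Rightarrow> (nat \<times> nat) point set" where
  "DT T = {\<eta> \<in> proj_space (IT T). \<exists>a b. (a \<noteq> 0 \<or> b \<noteq> 0) \<and> (\<forall>i\<in>T. droot (pf i (rep \<eta>)) a b)}"

lemma Dset_eq_DT: "Dset = DT {..<n}"
  by (auto simp: Dset_def DT_def IT_def I_eq)

end

definition polyparam :: "nat \<Rightarrow> ((nat \<Rightarrow> complex) \<Rightarrow> complex) \<Rightarrow> bool" where
  "polyparam m f \<longleftrightarrow> (\<exists>E. f \<in> bdpoly m E)"

lemma polyparam_const: "polyparam m (\<lambda>_. c)"
  using bdpoly_const polyparam_def by blast

lemma polyparam_var: "i < m \<Longrightarrow> polyparam m (\<lambda>z. z i)"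
  using bdpoly_var polyparam_def by blast

lemma polyparam_mult: "polyparam m f \<Longrightarrow> polyparam m g \<Longrightarrow> polyparam m (\<lambda>z. f z * g z)"
  unfolding polyparam_def by (blast intro: bdpoly_mult)

lemma polyparam_add: assumes "polyparam m f" "polyparam m g" shows "polyparam m (\<lambda>z. f z + g z)"
proof -
  obtain E E' where "f \<in> bdpoly m E" "g \<in> bdpoly m E'" using assms by (auto simp: polyparam_def)
  then have "f \<in> bdpoly m (max E E')" "g \<in> bdpoly m (max E E')"
    using bdpoly_mono[of E "max E E'" m] bdpoly_mono[of E' "max E E'" m] by auto
  then show ?thesis using bdpoly_add polyparam_def by blast
qed

lemma polyparam_uminus: "polyparam m f \<Longrightarrow> polyparam m (\<lambda>z. - f z)"
  using polyparam_mult[OF polyparam_const[of m "-1"]] by simp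

lemma polyparam_sum: "(\<And>x. x \<in> A \<Longrightarrow> polyparam m (f x)) \<Longrightarrow> polyparam m (\<lambda>z. \<Sum>x\<in>A. f x z)"
  by (induction A rule: infinite_finite_induct) (auto intro: polyparam_const polyparam_add)

lemma polyparam_power: "polyparam m f \<Longrightarrow> polyparam m (\<lambda>z. f z ^ k)"
  by (induction k) (auto intro: polyparam_const polyparam_mult)

lemma polyparam_if: "(P \<Longrightarrow> polyparam m f) \<Longrightarrow> (\<not> P \<Longrightarrow> polyparam m g) \<Longrightarrow> polyparam m (\<lambda>z. if P then f z else g z)"
  by (cases P) simp_all

lemma polyparam_bform:
  assumes "bform d f" "polyparam m x" "polyparam m y" shows "polyparam m (\<lambda>z. f (x z) (y z))"
proof -
  obtain c where "\<forall>a b. f a b = (\<Sum>j\<le>d. c j * a ^ (d - j) * b ^ j)" using assms(1) bform_coeffs by blast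
  then show ?thesis using assms(2,3)
    by (auto intro!: polyparam_sum polyparam_mult polyparam_power polyparam_const)
qed

text \<open>The finitely many individual degree bounds are replaced by their sum.\<close>

lemma patchedI:
  assumes "finite I" "finite A" "\<And>a i. a \<in> A \<Longrightarrow> i \<in> I \<Longrightarrow> polyparam m (\<lambda>z. G a z i)"
    "\<And>y. y \<in> Y \<Longrightarrow> \<exists>a\<in>A. \<exists>z. G a z \<noteq> 0 \<and> y = cv.span {G a z}"
  obtains E where "patched I Y m E A G"
proof -
  have "\<exists>E. (\<lambda>z. G (fst p) z (snd p)) \<in> bdpoly m E" if "p \<in> A \<times> I" for p
    using assms(3) that unfolding polyparam_def by auto
  then obtain E where E: "\<And>p. p \<in> A \<times> I \<Longrightarrow> (\<lambda>z. G (fst p) z (snd p)) \<in> bdpoly m (E p)" by metis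
  have "(\<lambda>z. G a z i) \<in> bdpoly m (\<Sum>p\<in>A \<times> I. E p)" if "a \<in> A" "i \<in> I" for a i
  proof -
    have "E (a, i) \<le> (\<Sum>p\<in>A \<times> I. E p)" using that assms(1,2) by (intro member_le_sum) auto
    then show ?thesis using E[of "(a, i)"] bdpoly_mono that by fastforce
  qed
  then show ?thesis using that assms(2,4) unfolding patched_def by blast
qed

context rational_curves begin

text \<open>The kernel of the two linear conditions on block i is parametrized, where the minor with indices
  j, k does not vanish, by Cramer's rule in terms of the remaining coordinates.\<close>

definition cramer :: "nat \<Rightarrow> nat \<Rightarrow> nat \<Rightarrow> (nat \<Rightarrow> complex) \<Rightarrow> complex \<Rightarrow> complex \<Rightarrow> nat \<Rightarrow> complex" where
  "cramer i j k c a b x = (if x = j then - (\<Sum>l\<in>{..r i} - {j, k}. c l * minor i l k a b)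
     else if x = k then - (\<Sum>l\<in>{..r i} - {j, k}. c l * minor i j l a b) else c x * minor i j k a b)"

lemma droot_cramer:
  assumes i: "i < n" and jk: "j \<le> r i" "k \<le> r i" "minor i j k a b \<noteq> 0" and d: "droot (pf i h) a b" and x: "x \<le> r i"
  shows "h (i, x) = cramer i j k (\<lambda>l. h (i, l) / minor i j k a b) a b x"
proof -
  have "j \<noteq> k" using jk(3) by (auto simp: minor_def)
  have z: "(\<Sum>x\<le>r i. h (i, x) * D0 (F (i, x)) a b) = 0" "(\<Sum>x\<le>r i. h (i, x) * D1 (F (i, x)) a b) = 0"
    using d D0_pf[OF i] D1_pf[OF i] by (auto simp: droot_def)
  have "(\<Sum>x\<le>r i. h (i, x) * minor i x k a b) =
      D1 (F (i, k)) a b * (\<Sum>x\<le>r i. h (i, x) * D0 (F (i, x)) a b) - D0 (F (i, k)) a b * (\<Sum>x\<le>r i. h (i, x) * D1 (F (i, x)) a b)"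
    unfolding sum_distrib_left sum_subtractf[symmetric] by (intro sum.cong) (auto simp: minor_def algebra_simps)
  then have s1: "(\<Sum>x\<le>r i. h (i, x) * minor i x k a b) = 0" using z by simp
  have "(\<Sum>x\<le>r i. h (i, x) * minor i j x a b) =
      D0 (F (i, j)) a b * (\<Sum>x\<le>r i. h (i, x) * D1 (F (i, x)) a b) - D1 (F (i, j)) a b * (\<Sum>x\<le>r i. h (i, x) * D0 (F (i, x)) a b)"
    unfolding sum_distrib_left sum_subtractf[symmetric] by (intro sum.cong) (auto simp: minor_def algebra_simps)
  then have s2: "(\<Sum>x\<le>r i. h (i, x) * minor i j x a b) = 0" using z by simp
  have split: "(\<Sum>x\<le>r i. g x) = g j + g k + (\<Sum>l\<in>{..r i} - {j, k}. g l)" for g :: "nat \<Rightarrow> complex"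
  proof -
    have "(\<Sum>x\<le>r i. g x) = (\<Sum>x\<in>{j, k}. g x) + (\<Sum>l\<in>{..r i} - {j, k}. g l)"
      using jk by (intro sum.subset_diff[of "{j,k}" "{..r i}" g, THEN trans]) (auto simp: add.commute)
    then show ?thesis using \<open>j \<noteq> k\<close> by simp
  qed
  have m0: "minor i k k a b = 0" "minor i j j a b = 0" by (simp_all add: minor_def)
  have e1: "h (i, j) = - (\<Sum>l\<in>{..r i} - {j, k}. h (i, l) / minor i j k a b * minor i l k a b)"
  proof -
    have "h (i, j) * minor i j k a b = - (\<Sum>l\<in>{..r i} - {j, k}. h (i, l) * minor i l k a b)"
      using s1 split[of "\<lambda>x. h (i, x) * minor i x k a b"] m0 by (simp add: eq_neg_iff_add_eq_0)
    then have "h (i, j) = - (\<Sum>l\<in>{..r i} - {j, k}. h (i, l) * minor i l k a b) / minor i j k a b"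
      using jk(3) by (metis nonzero_mult_div_cancel_right)
    then show ?thesis by (simp add: sum_divide_distrib)
  qed
  have e2: "h (i, k) = - (\<Sum>l\<in>{..r i} - {j, k}. h (i, l) / minor i j k a b * minor i j l a b)"
  proof -
    have "h (i, k) * minor i j k a b = - (\<Sum>l\<in>{..r i} - {j, k}. h (i, l) * minor i j l a b)"
      using s2 split[of "\<lambda>x. h (i, x) * minor i j x a b"] m0 by (simp add: eq_neg_iff_add_eq_0)
    then have "h (i, k) = - (\<Sum>l\<in>{..r i} - {j, k}. h (i, l) * minor i j l a b) / minor i j k a b"
      using jk(3) by (metis nonzero_mult_div_cancel_right)
    then show ?thesis by (simp add: sum_divide_distrib)
  qed
  show ?thesis using e1 e2 jk(3) by (simp add: cramer_def)
qed

text \<open>A patch fixes a nonzero minor in every block, a chart of the base and one free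
  coordinate scaled to 1. Each block has r_i + 1 - 2 free coordinates; scaling removes one of the
  total and the base point adds one, which leaves \<Sum>(r_i - 1) parameters.\<close>

lemma patched_DT:
  assumes T: "T \<subseteq> {..<n}"
  obtains E and A :: "((nat \<Rightarrow> nat \<times> nat) \<times> (nat \<times> nat) \<times> bool) set" and G
  where "patched (IT T) (DT T) (\<Sum>i\<in>T. r i - 1) E A G"
proof -
  have finT: "finite T" using T finite_subset by blast
  have finI: "finite (IT T)" using finT by (simp add: IT_def)
  define m where "m = (\<Sum>i\<in>T. r i - 1)"
  define N where "N J = {x \<in> IT T. snd x \<noteq> fst (J (fst x)) \<and> snd x \<noteq> snd (J (fst x))}" for J :: "nat \<Rightarrow> nat \<times> nat"
  define A where "A = {p \<in> (PiE T (\<lambda>i. {..r i} \<times> {..r i})) \<times> IT T \<times> (UNIV :: bool set).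
      (\<forall>i\<in>T. fst (fst p i) \<noteq> snd (fst p i)) \<and> fst (snd p) \<in> N (fst p)}"
  have finA: "finite A"
    unfolding A_def by (rule finite_subset[of _ "(PiE T (\<lambda>i. {..r i} \<times> {..r i})) \<times> IT T \<times> UNIV"])
      (auto intro!: finite_cartesian_product finite_PiE finT finI)
  have cardN: "card (N J) = m" if J: "J \<in> PiE T (\<lambda>i. {..r i} \<times> {..r i})" "\<forall>i\<in>T. fst (J i) \<noteq> snd (J i)" for J
  proof -
    have "N J = Sigma T (\<lambda>i. {..r i} - {fst (J i), snd (J i)})" by (auto simp: N_def IT_def)
    moreover have "card ({..r i} - {fst (J i), snd (J i)}) = r i - 1" if "i \<in> T" for i
    proof -
      have "{fst (J i), snd (J i)} \<subseteq> {..r i}" using J(1) that by (auto simp: PiE_def Pi_def mem_Times_iff)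
      moreover have "card {fst (J i), snd (J i)} = 2" using J(2) that by simp
      ultimately show ?thesis by (subst card_Diff_subset) auto
    qed
    ultimately show ?thesis using finT by (simp add: m_def)
  qed
  have "\<exists>f. inj_on f (N J - {x}) \<and> (\<forall>y\<in>N J - {x}. f y < card (N J - {x}))" for J x
  proof -
    have "finite (N J - {x})" using finI by (auto simp: N_def)
    from ex_bij_betw_finite_nat[OF this] obtain f where "bij_betw f (N J - {x}) {0..<card (N J - {x})}" by blast
    then show ?thesis by (intro exI[of _ f]) (auto simp: bij_betw_def)
  qed
  then obtain en where en: "\<And>J x. inj_on (en J x) (N J - {x})" "\<And>J x y. y \<in> N J - {x} \<Longrightarrow> en J x y < card (N J - {x})"
    by metis
  \<comment> \<open>Parameter 0 is reserved for the base point, hence the shift by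
    \<open>Suc\<close>; \<open>fst (snd p)\<close> is the coordinate scaled to 1.\<close>
  define cf where "cf p z y = (if y = fst (snd p) then 1 else if y \<in> N (fst p) then z (Suc (en (fst p) (fst (snd p)) y)) else 0)"
    for p :: "(nat \<Rightarrow> nat \<times> nat) \<times> (nat \<times> nat) \<times> bool" and z :: "nat \<Rightarrow> complex" and y
  define ca where "ca p z = (if snd (snd p) then 1 else z 0)" for p :: "(nat \<Rightarrow> nat \<times> nat) \<times> (nat \<times> nat) \<times> bool" and z :: "nat \<Rightarrow> complex"
  define cb where "cb p z = (if snd (snd p) then z 0 else 1)" for p :: "(nat \<Rightarrow> nat \<times> nat) \<times> (nat \<times> nat) \<times> bool" and z :: "nat \<Rightarrow> complex"
  define G where "G p z x = (if x \<in> IT T then cramer (fst x) (fst (fst p (fst x))) (snd (fst p (fst x)))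
      (\<lambda>l. cf p z (fst x, l)) (ca p z) (cb p z) (snd x) else 0)"
    for p :: "(nat \<Rightarrow> nat \<times> nat) \<times> (nat \<times> nat) \<times> bool" and z :: "nat \<Rightarrow> complex" and x
  have pp: "polyparam m (\<lambda>z. G p z x)" if p: "p \<in> A" and x: "x \<in> IT T" for p x
  proof -
    obtain J y0 ch where pe: "p = (J, y0, ch)" by (cases p) auto
    have J: "J \<in> PiE T (\<lambda>i. {..r i} \<times> {..r i})" "\<forall>i\<in>T. fst (J i) \<noteq> snd (J i)" "y0 \<in> N J" using p by (auto simp: A_def pe)
    have finN: "finite (N J)" using finI by (auto simp: N_def)
    have cN: "card (N J) = m" using cardN J by blast
    then have m1: "m \<ge> 1" using J(3) finN by (metis One_nat_def Suc_leI card_gt_0_iff empty_iff)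
    have c1: "card (N J - {y0}) = m - 1" using cN J(3) finN by simp
    have pcf: "polyparam m (\<lambda>z. cf p z y)" for y
    proof -
      have "polyparam m (\<lambda>z. z (Suc (en J y0 y)))" if "y \<in> N J" "y \<noteq> y0"
        using en(2)[of y J y0] that c1 m1 by (intro polyparam_var) auto
      then show ?thesis unfolding cf_def pe by (auto intro!: polyparam_if polyparam_const)
    qed
    have pab: "polyparam m (ca p)" "polyparam m (cb p)"
      unfolding ca_def[abs_def] cb_def[abs_def] using m1 by (auto intro!: polyparam_if polyparam_const polyparam_var)
    obtain i l where xe: "x = (i, l)" by (cases x)
    have i: "i \<in> T" "i < n" using x T by (auto simp: xe IT_def)
    have Jr: "fst (J i) \<le> r i" "snd (J i) \<le> r i" using J(1) i by (auto simp: PiE_def Pi_def mem_Times_iff)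
    have pm: "polyparam m (\<lambda>z. minor i j k (ca p z) (cb p z))" if "j \<le> r i" "k \<le> r i" for j k
      by (rule polyparam_bform[OF bform_minor[OF i(2) that] pab])
    have "polyparam m (\<lambda>z. cramer i (fst (J i)) (snd (J i)) (\<lambda>l. cf p z (i, l)) (ca p z) (cb p z) l)"
      unfolding cramer_def using Jr
      by (intro polyparam_if polyparam_uminus polyparam_sum polyparam_mult pcf pm) auto
    then show ?thesis using x by (simp add: G_def xe pe)
  qed
  have cover: "\<exists>p\<in>A. \<exists>z. G p z \<noteq> 0 \<and> y = cv.span {G p z}" if y: "y \<in> DT T" for y
  proof -
    have yp: "y \<in> proj_space (IT T)" using y by (simp add: DT_def)
    obtain a' b' where ab': "a' \<noteq> 0 \<or> b' \<noteq> 0" "\<forall>i\<in>T. droot (pf i (rep y)) a' b'" using y by (auto simp: DT_def)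
    obtain ch a b t where ab: "a = (if ch then 1 else t)" "b = (if ch then t else 1)" "\<forall>i\<in>T. droot (pf i (rep y)) a b"
    proof (cases "a' = 0")
      case True
      then have "b' \<noteq> 0" using ab' by simp
      have "droot (pf i (rep y)) 0 1" if "i \<in> T" for i
        using droot_scale[OF bform_pf, of i "inverse b'" "rep y" a' b'] ab'(2) that T True \<open>b' \<noteq> 0\<close> by auto
      then show ?thesis using that[of 0 False 0 1] by simp
    next
      case False
      have "droot (pf i (rep y)) 1 (b' / a')" if "i \<in> T" for i
        using droot_scale[OF bform_pf, of i "inverse a'" "rep y" a' b'] ab'(2) that T False
        by (auto simp: divide_inverse mult.commute)
      then show ?thesis using that[of 1 True "b' / a'" "b' / a'"] by simp
    qed
    have ab0: "a \<noteq> 0 \<or> b \<noteq> 0" using ab(1,2) by auto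
    have "\<exists>jk. jk \<in> {..r i} \<times> {..r i} \<and> minor i (fst jk) (snd jk) a b \<noteq> 0" if "i \<in> T" for i
      using minor_nonzero[OF _ ab0, of i] that T by (metis SigmaI atMost_iff fst_conv lessThan_iff snd_conv subsetD)
    then obtain J' where J': "\<And>i. i \<in> T \<Longrightarrow> J' i \<in> {..r i} \<times> {..r i} \<and> minor i (fst (J' i)) (snd (J' i)) a b \<noteq> 0" by metis
    define J where "J = restrict J' T"
    have J: "J \<in> PiE T (\<lambda>i. {..r i} \<times> {..r i})" using J' by (auto simp: J_def)
    have Jm: "minor i (fst (J i)) (snd (J i)) a b \<noteq> 0" "fst (J i) \<le> r i" "snd (J i) \<le> r i" if "i \<in> T" for i
      using J'[OF that] that by (auto simp: J_def mem_Times_iff)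
    have Jne: "\<forall>i\<in>T. fst (J i) \<noteq> snd (J i)" using Jm(1) by (force simp: minor_def)
    define h where "h = rep y"
    have h: "h \<noteq> 0" "h \<in> vecs (IT T)" "y = cv.span {h}" using proj_rep[OF yp] by (auto simp: h_def)
    have hc: "h (i, x) = cramer i (fst (J i)) (snd (J i)) (\<lambda>l. h (i, l) / minor i (fst (J i)) (snd (J i)) a b) a b x"
      if "i \<in> T" "x \<le> r i" for i x
      by (rule droot_cramer) (use that T Jm ab(3) in \<open>auto simp: h_def\<close>)
    \<comment> \<open>If all free coordinates vanish, Cramer's rule makes the remaining two of each
      block vanish as well.\<close>
    have "\<exists>y0\<in>N J. h y0 \<noteq> 0"
    proof (rule ccontr)
      assume "\<not> ?thesis"
      then have z: "h (i, l) = 0" if "i \<in> T" "l \<le> r i" "l \<noteq> fst (J i)" "l \<noteq> snd (J i)" for i l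
        using that by (auto simp: N_def IT_def)
      have "h (i, x) = 0" if ix: "i \<in> T" "x \<le> r i" for i x
      proof -
        have s1: "(\<Sum>l\<in>{..r i} - {fst (J i), snd (J i)}. h (i, l) / minor i (fst (J i)) (snd (J i)) a b * g l) = 0" for g
          using z ix by (intro sum.neutral) auto
        show ?thesis using hc[OF ix] z[OF ix] s1 unfolding cramer_def by (auto split: if_splits)
      qed
      then have "h = 0" using h(2) by (auto simp: vecs_def IT_def fun_eq_iff vec_apply)
      then show False using h(1) by simp
    qed
    then obtain y0 where y0: "y0 \<in> N J" "h y0 \<noteq> 0" by blast
    define w where "w i = minor i (fst (J i)) (snd (J i)) a b" for i
    have y0T: "fst y0 \<in> T" "y0 \<in> IT T" using y0(1) by (auto simp: N_def IT_def)
    \<comment> \<open>\<open>cramer\<close> multiplies a free coordinate by the minor of its block;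
      this scaling makes the parameter at \<open>y0\<close> equal to 1.\<close>
    define s where "s = w (fst y0) / h y0"
    have s0: "s \<noteq> 0" using Jm(1)[OF y0T(1)] y0(2) by (simp add: s_def w_def)
    let ?p = "(J, y0, ch)"
    have pA: "?p \<in> A" unfolding A_def using J Jne y0 y0T by simp
    define val where "val x = s * h x / w (fst x)" for x
    define z where "z k = (if k = 0 then t else val (the_inv_into (N J - {y0}) (en J y0) (k - 1)))" for k
    have zab: "ca ?p z = a" "cb ?p z = b" using ab(1,2) by (auto simp: ca_def cb_def z_def)
    have zc: "cf ?p z x = val x" if "x \<in> N J" for x
    proof (cases "x = y0")
      case True
      have "val y0 = 1" using y0(2) Jm(1)[OF y0T(1)] by (simp add: val_def s_def w_def)
      then show ?thesis using True by (simp add: cf_def)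
    next
      case False
      then show ?thesis using that the_inv_into_f_f[OF en(1)[of J y0], of x] by (simp add: cf_def z_def)
    qed
    have cr_cong: "cramer i j k c a b x = cramer i j k c' a b x"
      if "\<And>l. l \<le> r i \<Longrightarrow> l \<noteq> j \<Longrightarrow> l \<noteq> k \<Longrightarrow> c l = c' l" "x \<le> r i" for i j k c c' x
    proof -
      have "(\<Sum>l\<in>{..r i} - {j, k}. c l * g l) = (\<Sum>l\<in>{..r i} - {j, k}. c' l * g l)" for g
        using that(1) by (intro sum.cong) auto
      then show ?thesis using that by (simp add: cramer_def)
    qed
    have cr_scale: "cramer i j k (\<lambda>l. s * c l) a b x = s * cramer i j k c a b x" for i j k c x
      by (simp add: cramer_def sum_distrib_left mult.assoc)
    have "G ?p z = cscale s h"
    proof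
      fix x :: "nat \<times> nat"
      obtain i l where x: "x = (i, l)" by (cases x)
      show "G ?p z x = cscale s h x"
      proof (cases "x \<in> IT T")
        case True
        then have il: "i \<in> T" "l \<le> r i" by (auto simp: x IT_def)
        have "G ?p z x = cramer i (fst (J i)) (snd (J i)) (\<lambda>l. cf ?p z (i, l)) a b l"
          using True zab by (simp add: G_def x)
        also have "\<dots> = cramer i (fst (J i)) (snd (J i)) (\<lambda>l. s * (h (i, l) / w i)) a b l"
        proof (rule cr_cong[OF _ il(2)])
          fix l assume "l \<le> r i" "l \<noteq> fst (J i)" "l \<noteq> snd (J i)"
          then have "(i, l) \<in> N J" using il by (simp add: N_def IT_def)
          then show "cf ?p z (i, l) = s * (h (i, l) / w i)" using zc by (simp add: val_def)
        qed
        also have "\<dots> = s * h x" unfolding cr_scale x using hc[OF il] by (simp add: w_def)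
        finally show ?thesis by (simp add: cscale_apply)
      next
        case False
        then have "h x = 0" using h(2) unfolding vecs_def by blast
        then show ?thesis using False by (simp add: G_def cscale_apply)
      qed
    qed
    then have "G ?p z \<noteq> 0 \<and> y = cv.span {G ?p z}" using h s0 by (simp add: span_single_scale)
    then show ?thesis using pA by blast
  qed
  obtain E where "patched (IT T) (DT T) m E A G"
    using patchedI[OF finI finA pp cover] by blast
  then show ?thesis using that unfolding m_def by blast
qed

lemma Dset_chain_bound:
  assumes "proj_chain I Dset M Z" shows "M \<le> (\<Sum>i<n. r i - 1)"
proof -
  have IT: "IT {..<n} = I" by (auto simp: IT_def I_eq)
  obtain E and A :: "((nat \<Rightarrow> nat \<times> nat) \<times> (nat \<times> nat) \<times> bool) set" and G where
    p: "patched (IT {..<n}) (DT {..<n}) (\<Sum>i<n. r i - 1) E A G"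
    by (rule patched_DT[OF subset_refl])
  show ?thesis
    using patched_chain_bound[OF fin p[unfolded IT Dset_eq_DT[symmetric]] assms] .
qed

lemma IT_blk: "IT {i} = blk r i"
  by (auto simp: IT_def blk_def)

lemma pair_blk: "i < n \<Longrightarrow> pair (blk r i) h (bvec (blk r i) F a b) = pf i h a b"
proof -
  have "pair (blk r i) h (bvec (blk r i) F a b) = (\<Sum>x\<in>Pair i ` {..r i}. h x * F x a b)"
    unfolding pair_def by (rule sum.cong) (auto simp: blk_def bvec_def)
  then show ?thesis by (simp add: sum.reindex inj_on_def pf_def)
qed

text \<open>The dual set of one curve has r_i - 1 parameters, too few to fill the space of
  hyperplanes, so some form vanishes on it but not everywhere. Off the zeros of that form the pulled
  back binary form has \<open>e i\<close> simple roots, and injectivity turns them into as many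
  points.\<close>

lemma curve_degree_eq:
  assumes i: "i < n" and Y: "Y = {cv.span {bvec (blk r i) F a b} | a b. a \<noteq> 0 \<or> b \<noteq> 0}"
  shows "curve_degree (blk r i) Y = e i"
proof -
  let ?J = "blk r i"
  have finJ: "finite ?J" "card ?J = r i + 1" by (auto simp: blk_def)
  have bn: "bvec ?J F a b \<noteq> 0" if "a \<noteq> 0 \<or> b \<noteq> 0" for a b
    using nz[OF i that] by (auto simp: bvec_eq_0 blk_def)
  obtain E and A :: "((nat \<Rightarrow> nat \<times> nat) \<times> (nat \<times> nat) \<times> bool) set" and G where
    p: "patched (IT {i}) (DT {i}) (\<Sum>i\<in>{i}. r i - 1) E A G"
    by (rule patched_DT[of "{i}"]) (use i in auto)
  have "r i - 1 + 1 < card ?J" using finJ r_pos[OF i] by simp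
  then obtain d f where f: "hform ?J d f" "\<forall>y\<in>DT {i}. f (rep y) = 0" "\<exists>y\<in>proj_space ?J. f (rep y) \<noteq> 0"
    using patched_vanishing_form[OF finJ(1) p[unfolded IT_blk]] by (auto simp: DT_def IT_blk)
  let ?A = "{q \<in> proj_space ?J. f (rep q) = 0}"
  have A: "zclosed ?J ?A" "?A \<noteq> proj_space ?J" using zclosed_zero_set[OF finJ(1) f(1)] f(3) by auto
  have count: "finite (Y \<inter> hyperplane ?J \<eta>) \<and> card (Y \<inter> hyperplane ?J \<eta>) = e i" if \<eta>: "\<eta> \<in> proj_space ?J - ?A" for \<eta>
  proof -
    let ?h = "rep \<eta>"
    have hv: "?h \<in> vecs ?J" "?h \<noteq> 0" using proj_rep[of \<eta> ?J] \<eta> by auto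
    have nd: "\<not> droot (pf i ?h) a b" if "a \<noteq> 0 \<or> b \<noteq> 0" for a b
    proof
      assume "droot (pf i ?h) a b"
      then have "\<eta> \<in> DT {i}" using \<eta> that by (auto simp: DT_def IT_blk)
      then show False using f(2) \<eta> by auto
    qed
    have "\<exists>a b. pf i ?h a b \<noteq> 0"
    proof (rule ccontr)
      assume "\<not> ?thesis"
      then have "\<forall>j\<le>r i. ?h (i, j) = 0" using rational_curves.nd[OF rational_curves_axioms i, of "\<lambda>j. ?h (i, j)"] by (simp add: pf_def)
      moreover have "?h x = 0" if "x \<notin> ?J" for x using hv(1) that unfolding vecs_def by blast
      ultimately have "?h x = 0" for x by (cases "x \<in> ?J") (auto simp: blk_def)
      then have "?h = 0" by (simp add: fun_eq_iff zero_fun_apply)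
      then show False using hv by simp
    qed
    then have R: "finite (broots (pf i ?h))" "card (broots (pf i ?h)) = e i"
      using broots_count[OF bform_pf[OF i]] nd by auto
    define \<theta> where "\<theta> q = cv.span {bvec ?J F (rep q 0) (rep q 1)}" for q :: "nat point"
    have \<theta>: "\<theta> (cv.span {bv a b}) = cv.span {bvec ?J F a b}" if ab: "a \<noteq> 0 \<or> b \<noteq> 0" for a b
    proof -
      obtain c where c: "c \<noteq> 0" "rep (cv.span {bv a b}) = cscale c (bv a b)" using rep_span ab by (metis bv_eq_0)
      have "bvec ?J F (c * a) (c * b) = cscale (c ^ e i) (bvec ?J F a b)"
        using bform_homogeneous[OF bf[OF i]] by (auto simp: bvec_def fun_eq_iff cscale_apply blk_def)
      then show ?thesis using c by (simp add: \<theta>_def bv_scale span_single_scale)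
    qed
    have "inj_on \<theta> (broots (pf i ?h))"
    proof (rule inj_onI)
      fix p q assume pq: "p \<in> broots (pf i ?h)" "q \<in> broots (pf i ?h)" "\<theta> p = \<theta> q"
      obtain a b where p: "a \<noteq> 0 \<or> b \<noteq> 0" "p = cv.span {bv a b}" using pq(1) unfolding broots_def by blast
      obtain a' b' where q: "a' \<noteq> 0 \<or> b' \<noteq> 0" "q = cv.span {bv a' b'}" using pq(2) unfolding broots_def by blast
      show "p = q" unfolding p(2) q(2)
        by (rule inj[OF i p(1) q(1)]) (use pq(3) \<theta>[OF p(1)] \<theta>[OF q(1)] p(2) q(2) in simp)
    qed
    moreover have "\<theta> ` broots (pf i ?h) = Y \<inter> hyperplane ?J \<eta>"
    proof -
      have *: "cv.span {bvec ?J F a b} \<in> hyperplane ?J \<eta> \<longleftrightarrow> pf i ?h a b = 0" if "a \<noteq> 0 \<or> b \<noteq> 0" for a b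
        using PP_I[OF bvec_in_vecs bn[OF that]] hform_rep_span[OF finJ(1) hform_pair[OF finJ(1)] bn[OF that]] pair_blk[OF i]
        by (simp add: hyperplane_def)
      show ?thesis
      proof (intro set_eqI iffI)
        fix q assume "q \<in> \<theta> ` broots (pf i ?h)"
        then obtain a b where "a \<noteq> 0 \<or> b \<noteq> 0" "pf i ?h a b = 0" "q = \<theta> (cv.span {bv a b})" unfolding broots_def by blast
        then show "q \<in> Y \<inter> hyperplane ?J \<eta>" using * \<theta> unfolding Y by auto
      next
        fix q assume q: "q \<in> Y \<inter> hyperplane ?J \<eta>"
        then obtain a b where ab: "a \<noteq> 0 \<or> b \<noteq> 0" "q = cv.span {bvec ?J F a b}" unfolding Y by blast
        then have "pf i ?h a b = 0" using * q by auto
        then have "cv.span {bv a b} \<in> broots (pf i ?h)" using ab unfolding broots_def by blast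
        then show "q \<in> \<theta> ` broots (pf i ?h)" using \<theta>[OF ab(1)] ab(2) by (metis imageI)
      qed
    qed
    ultimately show ?thesis using R card_image finite_imageI by metis
  qed
  show ?thesis
    unfolding curve_degree_def
  proof (rule the_equality)
    show "\<exists>A. zclosed ?J A \<and> A \<noteq> proj_space ?J \<and> (\<forall>\<eta>\<in>proj_space ?J - A. finite (Y \<inter> hyperplane ?J \<eta>) \<and> card (Y \<inter> hyperplane ?J \<eta>) = e i)"
      using A count by blast
    fix d' assume "\<exists>A. zclosed ?J A \<and> A \<noteq> proj_space ?J \<and> (\<forall>\<eta>\<in>proj_space ?J - A. finite (Y \<inter> hyperplane ?J \<eta>) \<and> card (Y \<inter> hyperplane ?J \<eta>) = d')"
    then obtain A' where A': "zclosed ?J A'" "A' \<noteq> proj_space ?J" "\<forall>\<eta>\<in>proj_space ?J - A'. card (Y \<inter> hyperplane ?J \<eta>) = d'" by blast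
    have "unitv (i, 0) \<in> vecs ?J" by (rule unitv_in_vecs) (simp add: blk_def)
    then have "vecs ?J \<noteq> {0}" by (metis singletonD unitv_nonzero)
    \<comment> \<open>Two proper closed sets do not cover an irreducible space, so both degree
      counts apply to a common hyperplane.\<close>
    then have irr: "zirreducible ?J (proj_space ?J)" using zirreducible_PP[OF finJ(1) subspace_vecs] by auto
    have "A' \<subseteq> proj_space ?J" using A'(1) by (auto simp: zclosed_def)
    then have "\<not> proj_space ?J \<subseteq> ?A \<union> A'" using irr A(1,2) A'(1,2) unfolding zirreducible_def by (metis (no_types, lifting) mem_Collect_eq subsetI subset_antisym)
    then obtain \<eta> where "\<eta> \<in> proj_space ?J" "\<eta> \<notin> ?A" "\<eta> \<notin> A'" by blast
    then show "d' = e i" using count[of \<eta>] A'(3) by auto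
  qed
qed

end

section \<open>A triple root makes the dual variety singular\<close>

text \<open>The vector \<open>g\<close> is the gradient of \<open>f\<close> at \<open>h\<close>; the
  curve is only assumed to be differentiable at 0.\<close>

lemma hform_gradient:
  assumes "finite I" "hform I d f"
  shows "\<exists>g. \<forall>\<gamma> \<gamma>'. (\<forall>i\<in>I. \<gamma> 0 i = h i \<and> ((\<lambda>z. \<gamma> z i) has_field_derivative \<gamma>' i) (at 0)) \<longrightarrow>
    ((\<lambda>z. f (\<gamma> z)) has_field_derivative (\<Sum>i\<in>I. g i * \<gamma>' i)) (at 0)"
  using assms
proof (induction rule: hform_induct)
  case (zero d)
  then show ?case by (intro exI[of _ "\<lambda>_. 0"]) simp
next
  case one
  then show ?case by (intro exI[of _ "\<lambda>_. 0"]) simp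
next
  case (var d f i)
  then obtain g where g: "\<forall>\<gamma> \<gamma>'. (\<forall>i\<in>I. \<gamma> 0 i = h i \<and> ((\<lambda>z. \<gamma> z i) has_field_derivative \<gamma>' i) (at 0)) \<longrightarrow>
    ((\<lambda>z. f (\<gamma> z)) has_field_derivative (\<Sum>i\<in>I. g i * \<gamma>' i)) (at 0)" by blast
  show ?case
  proof (intro exI[of _ "\<lambda>k. (if k = i then f h else 0) + h i * g k"] allI impI)
    fix \<gamma> :: "complex \<Rightarrow> 'a vec" and \<gamma>' assume a: "\<forall>i\<in>I. \<gamma> 0 i = h i \<and> ((\<lambda>z. \<gamma> z i) has_field_derivative \<gamma>' i) (at 0)"
    have fh: "f (\<gamma> 0) = f h" using hform_cong[OF var(2)] a by blast
    have "((\<lambda>z. \<gamma> z i * f (\<gamma> z)) has_field_derivative (\<gamma>' i * f (\<gamma> 0) + (\<Sum>i\<in>I. g i * \<gamma>' i) * \<gamma> 0 i)) (at 0)"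
      using DERIV_mult[of "\<lambda>z. \<gamma> z i" "\<gamma>' i" 0 UNIV "\<lambda>z. f (\<gamma> z)"] a var(1) g by auto
    moreover have "(\<Sum>k\<in>I. ((if k = i then f h else 0) + h i * g k) * \<gamma>' k) = \<gamma>' i * f (\<gamma> 0) + (\<Sum>i\<in>I. g i * \<gamma>' i) * \<gamma> 0 i"
    proof -
      have "(\<Sum>k\<in>I. ((if k = i then f h else 0) + h i * g k) * \<gamma>' k) = (\<Sum>k\<in>I. (if k = i then f h * \<gamma>' i else 0) + h i * (g k * \<gamma>' k))"
        by (intro sum.cong) (auto simp: algebra_simps)
      then show ?thesis using assms(1) var(1) fh a by (simp add: sum.distrib sum_distrib_left mult.commute)
    qed
    ultimately show "((\<lambda>z. \<gamma> z i * f (\<gamma> z)) has_field_derivative (\<Sum>k\<in>I. ((if k = i then f h else 0) + h i * g k) * \<gamma>' k)) (at 0)"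
      by simp
  qed
next
  case (add d f1 f2)
  then obtain g1 g2 where "\<forall>\<gamma> \<gamma>'. (\<forall>i\<in>I. \<gamma> 0 i = h i \<and> ((\<lambda>z. \<gamma> z i) has_field_derivative \<gamma>' i) (at 0)) \<longrightarrow>
    ((\<lambda>z. f1 (\<gamma> z)) has_field_derivative (\<Sum>i\<in>I. g1 i * \<gamma>' i)) (at 0)"
    "\<forall>\<gamma> \<gamma>'. (\<forall>i\<in>I. \<gamma> 0 i = h i \<and> ((\<lambda>z. \<gamma> z i) has_field_derivative \<gamma>' i) (at 0)) \<longrightarrow>
    ((\<lambda>z. f2 (\<gamma> z)) has_field_derivative (\<Sum>i\<in>I. g2 i * \<gamma>' i)) (at 0)" by blast
  then show ?case
    by (intro exI[of _ "\<lambda>i. g1 i + g2 i"]) (auto simp: algebra_simps sum.distrib intro: DERIV_add)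
next
  case (cmult d f c)
  then obtain g where "\<forall>\<gamma> \<gamma>'. (\<forall>i\<in>I. \<gamma> 0 i = h i \<and> ((\<lambda>z. \<gamma> z i) has_field_derivative \<gamma>' i) (at 0)) \<longrightarrow>
    ((\<lambda>z. f (\<gamma> z)) has_field_derivative (\<Sum>i\<in>I. g i * \<gamma>' i)) (at 0)" by blast
  then show ?case
    by (intro exI[of _ "\<lambda>i. c * g i"]) (auto simp: mult.assoc sum_distrib_left[symmetric] intro: DERIV_cmult)
qed

text \<open>Taylor expansion to second order. The remainder has to stay continuous while both the
  scale and the vector vary with the parameter, because the direction of the later test curves is
  itself moving.\<close>

lemma hform_second_order:
  assumes "finite I" "hform I d f"
  shows "\<exists>g R. (\<forall>s v. f (h + cscale s v) = f h + s * (\<Sum>i\<in>I. g i * v i) + s\<^sup>2 * R s v) \<and>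
    (\<forall>s v. isCont s 0 \<longrightarrow> (\<forall>i\<in>I. isCont (\<lambda>z. v z i) 0) \<longrightarrow> isCont (\<lambda>z. R (s z) (v z)) (0::complex))"
  using assms
proof (induction rule: hform_induct)
  case (zero d)
  then show ?case by (intro exI[of _ "\<lambda>_. 0"] exI[of _ "\<lambda>_ _. 0"]) simp
next
  case one
  then show ?case by (intro exI[of _ "\<lambda>_. 0"] exI[of _ "\<lambda>_ _. 0"]) simp
next
  case (var d f i)
  then obtain g R where g: "\<forall>s v. f (h + cscale s v) = f h + s * (\<Sum>i\<in>I. g i * v i) + s\<^sup>2 * R s v"
    and R: "\<forall>s v. isCont s 0 \<longrightarrow> (\<forall>i\<in>I. isCont (\<lambda>z. v z i) 0) \<longrightarrow> isCont (\<lambda>z. R (s z) (v z)) (0::complex)" by blast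
  let ?g = "\<lambda>k. (if k = i then f h else 0) + h i * g k"
  let ?R = "\<lambda>s v. h i * R s v + v i * ((\<Sum>i\<in>I. g i * v i) + s * R s v)"
  have E1: "(\<Sum>k\<in>I. ?g k * v k) = f h * v i + h i * (\<Sum>i\<in>I. g i * v i)" for v
  proof -
    have "(\<Sum>k\<in>I. ?g k * v k) = (\<Sum>k\<in>I. (if k = i then f h * v i else 0) + h i * (g k * v k))"
      by (intro sum.cong) (auto simp: algebra_simps)
    then show ?thesis using assms(1) var(1) by (simp add: sum.distrib sum_distrib_left)
  qed
  have "(h + cscale s v) i * f (h + cscale s v) = h i * f h + s * (\<Sum>k\<in>I. ?g k * v k) + s\<^sup>2 * ?R s v" for s v
    unfolding g[rule_format] E1 by (simp add: vec_apply algebra_simps power2_eq_square)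
  moreover have "isCont (\<lambda>z. ?R (s z) (v z)) 0" if "isCont s 0" "\<forall>i\<in>I. isCont (\<lambda>z. v z i) 0" for s :: "complex \<Rightarrow> complex" and v
    using R that var(1) by (intro continuous_intros) auto
  ultimately show ?case by (intro exI[of _ ?g] exI[of _ ?R]) simp
next
  case (add d f1 f2)
  obtain g1 R1 where g1: "\<forall>s v. f1 (h + cscale s v) = f1 h + s * (\<Sum>i\<in>I. g1 i * v i) + s\<^sup>2 * R1 s v"
    "\<forall>s v. isCont s 0 \<longrightarrow> (\<forall>i\<in>I. isCont (\<lambda>z. v z i) 0) \<longrightarrow> isCont (\<lambda>z. R1 (s z) (v z)) (0::complex)"
    using add(3) by blast
  obtain g2 R2 where g2: "\<forall>s v. f2 (h + cscale s v) = f2 h + s * (\<Sum>i\<in>I. g2 i * v i) + s\<^sup>2 * R2 s v"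
    "\<forall>s v. isCont s 0 \<longrightarrow> (\<forall>i\<in>I. isCont (\<lambda>z. v z i) 0) \<longrightarrow> isCont (\<lambda>z. R2 (s z) (v z)) (0::complex)"
    using add(4) by blast
  show ?case
    by (intro exI[of _ "\<lambda>i. g1 i + g2 i"] exI[of _ "\<lambda>s v. R1 s v + R2 s v"])
      (use g1 g2 in \<open>auto simp: algebra_simps sum.distrib intro!: continuous_intros\<close>)
next
  case (cmult d f c)
  then obtain g R where g: "\<forall>s v. f (h + cscale s v) = f h + s * (\<Sum>i\<in>I. g i * v i) + s\<^sup>2 * R s v"
    and R: "\<forall>s v. isCont s 0 \<longrightarrow> (\<forall>i\<in>I. isCont (\<lambda>z. v z i) 0) \<longrightarrow> isCont (\<lambda>z. R (s z) (v z)) (0::complex)" by blast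
  show ?case
    by (intro exI[of _ "\<lambda>i. c * g i"] exI[of _ "\<lambda>s v. c * R s v"])
      (use g R in \<open>auto simp: algebra_simps sum_distrib_left intro!: continuous_intros\<close>)
qed

lemma bform_mixed_partials:
  assumes "bform (Suc d) f" shows "D1 (D0 f) a b = D0 (D1 f) a b"
proof -
  obtain c where c: "\<forall>a b. f a b = (\<Sum>j\<le>Suc d. c j * a ^ (Suc d - j) * b ^ j)" using assms bform_coeffs by blast
  have "D1 (D0 f) a b = (\<Sum>j\<le>Suc d. c j * (of_nat (Suc d - j) * a ^ (Suc d - j - 1)) * (of_nat j * b ^ (j - 1)))"
    unfolding D1_def[of "D0 f"] D_coeffs(1)[OF c]
    by (rule DERIV_imp_deriv, rule DERIV_sum) (auto intro!: derivative_eq_intros simp: mult_ac)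
  moreover have "D0 (D1 f) a b = (\<Sum>j\<le>Suc d. c j * (of_nat (Suc d - j) * a ^ (Suc d - j - 1)) * (of_nat j * b ^ (j - 1)))"
    unfolding D0_def[of "D1 f"] D_coeffs(2)[OF c]
    by (rule DERIV_imp_deriv, rule DERIV_sum) (auto intro!: derivative_eq_intros simp: mult_ac)
  ultimately show ?thesis by simp
qed

lemma bform_poly_deriv:
  assumes "bform d f" "\<forall>z. f (a + z * x) (b + z * y) = poly P z"
  shows "poly (pderiv P) z = x * D0 f (a + z * x) (b + z * y) + y * D1 f (a + z * x) (b + z * y)"
proof -
  have "((\<lambda>\<zeta>. f ((a + z * x) + \<zeta> * x) ((b + z * y) + \<zeta> * y)) has_field_derivative
      x * D0 f (a + z * x) (b + z * y) + y * D1 f (a + z * x) (b + z * y)) (at 0)"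
    by (rule bform_has_derivative[OF assms(1)])
  moreover have "f ((a + z * x) + \<zeta> * x) ((b + z * y) + \<zeta> * y) = poly P (\<zeta> + z)" for \<zeta>
    using assms(2)[rule_format, of "\<zeta> + z"] by (simp add: algebra_simps)
  moreover have "((\<lambda>\<zeta>. poly P (\<zeta> + z)) has_field_derivative poly (pderiv P) z) (at 0)"
    using DERIV_shift[of "poly P" "poly (pderiv P) z" 0 z] poly_DERIV[of P z] by simp
  ultimately show ?thesis using DERIV_unique by (simp add: DERIV_unique)
qed

text \<open>Euler's identity gives the derivative in the radial direction (p, q); with the
  independent direction (x, y) it determines both partial derivatives.\<close>

lemma droot_directional:
  assumes "bform d f" "d > 0" "f p q = 0" "x * D0 f p q + y * D1 f p q = 0" "p * y - q * x \<noteq> 0"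
  shows "droot f p q"
proof -
  have "((\<lambda>z. f (p + z * p) (q + z * q)) has_field_derivative p * D0 f p q + q * D1 f p q) (at 0)"
    by (rule bform_has_derivative[OF assms(1)])
  moreover have "f (p + z * p) (q + z * q) = 0" for z
    using bform_homogeneous[OF assms(1), of "1 + z" p q] assms(3) by (simp add: algebra_simps)
  ultimately have "p * D0 f p q + q * D1 f p q = 0" using DERIV_unique[OF _ DERIV_const[of 0 "at 0"]] by simp
  then have "(p * y - q * x) * D0 f p q = 0" "(p * y - q * x) * D1 f p q = 0" using assms(4) by algebra+
  then show ?thesis using assms(3,5) by (simp add: droot_def)
qed

context rational_curves begin

lemma pf_add: "pf i (h + k) a b = pf i h a b + pf i k a b"
  by (simp add: pf_def plus_fun_apply algebra_simps sum.distrib)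

lemma pf_scale: "pf i (cscale c h) a b = c * pf i h a b"
  by (simp add: pf_def cscale_apply sum_distrib_left mult_ac)

lemma D_pf_add: "i < n \<Longrightarrow> D0 (pf i (h + k)) a b = D0 (pf i h) a b + D0 (pf i k) a b"
  "i < n \<Longrightarrow> D1 (pf i (h + k)) a b = D1 (pf i h) a b + D1 (pf i k) a b"
  by (simp_all add: D0_pf D1_pf plus_fun_apply algebra_simps sum.distrib)

lemma D_pf_scale: "i < n \<Longrightarrow> D0 (pf i (cscale c h)) a b = c * D0 (pf i h) a b"
  "i < n \<Longrightarrow> D1 (pf i (cscale c h)) a b = c * D1 (pf i h) a b"
  by (simp_all add: D0_pf D1_pf cscale_apply sum_distrib_left mult_ac)

lemma pf_outside: "(\<And>j. j \<le> r i \<Longrightarrow> h (i, j) = 0) \<Longrightarrow> pf i h = (\<lambda>_ _. 0)"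
  by (simp add: pf_def fun_eq_iff)

lemma droot_pf_outside: "(\<And>j. j \<le> r i \<Longrightarrow> h (i, j) = 0) \<Longrightarrow> droot (pf i h) a b"
  using pf_outside[of i h] by (simp add: droot_def D0_def D1_def)

lemma droot_pf_add: "i < n \<Longrightarrow> droot (pf i h) a b \<Longrightarrow> droot (pf i k) a b \<Longrightarrow> droot (pf i (h + k)) a b"
  by (simp add: droot_def pf_add D_pf_add)

lemma droot_pf_scale: "i < n \<Longrightarrow> droot (pf i h) a b \<Longrightarrow> droot (pf i (cscale c h)) a b"
  by (simp add: droot_def pf_scale D_pf_scale)

lemma blk_subset: "i < n \<Longrightarrow> vecs (blk r i) \<subseteq> vecs I"
  by (auto simp: vecs_def blk_def)

text \<open>Cramer's rule with a nonzero minor, supported on two unit vectors of the block.\<close>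

lemma prescribed_jet:
  assumes i: "i < n" and ab: "a \<noteq> 0 \<or> b \<noteq> 0"
  obtains h where "h \<in> vecs (blk r i)" "D0 (pf i h) a b = u" "D1 (pf i h) a b = v"
proof -
  obtain j k where jk: "j \<le> r i" "k \<le> r i" "minor i j k a b \<noteq> 0" by (rule minor_nonzero[OF i ab])
  let ?m = "minor i j k a b"
  define s where "s = (u * D1 (F (i, k)) a b - v * D0 (F (i, k)) a b) / ?m"
  define t where "t = (v * D0 (F (i, j)) a b - u * D1 (F (i, j)) a b) / ?m"
  let ?h = "cscale s (unitv (i, j)) + cscale t (unitv (i, k))"
  have D: "D0 (pf i (unitv (i, l))) a b = D0 (F (i, l)) a b" "D1 (pf i (unitv (i, l))) a b = D1 (F (i, l)) a b" if "l \<le> r i" for l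
  proof -
    have "(\<Sum>x\<le>r i. unitv (i, l) (i, x) * g x) = g l" for g
    proof -
      have "(\<Sum>x\<le>r i. unitv (i, l) (i, x) * g x) = (\<Sum>x\<le>r i. if x = l then g x else 0)"
        by (intro sum.cong) (auto simp: unitv_def)
      then show ?thesis using \<open>l \<le> r i\<close> by simp
    qed
    then show "D0 (pf i (unitv (i, l))) a b = D0 (F (i, l)) a b" "D1 (pf i (unitv (i, l))) a b = D1 (F (i, l)) a b"
      unfolding D0_pf[OF i] D1_pf[OF i] by auto
  qed
  have "?h \<in> vecs (blk r i)" using jk
    by (auto intro!: cv.subspace_add cv.subspace_scale subspace_vecs unitv_in_vecs simp: blk_def)
  moreover have "D0 (pf i ?h) a b = u"
    unfolding D_pf_add[OF i] D_pf_scale[OF i] D[OF jk(1)] D[OF jk(2)] s_def t_def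
    using jk(3) by (simp add: divide_simps) (simp add: minor_def algebra_simps)
  moreover have "D1 (pf i ?h) a b = v"
    unfolding D_pf_add[OF i] D_pf_scale[OF i] D[OF jk(1)] D[OF jk(2)] s_def t_def
    using jk(3) by (simp add: divide_simps) (simp add: minor_def algebra_simps)
  ultimately show ?thesis using that by blast
qed

lemma in_Dset_iff:
  assumes "h \<in> vecs I" "h \<noteq> 0"
  shows "cv.span {h} \<in> Dset \<longleftrightarrow> (\<exists>a b. (a \<noteq> 0 \<or> b \<noteq> 0) \<and> (\<forall>i<n. droot (pf i h) a b))"
proof -
  obtain c where c: "c \<noteq> 0" "rep (cv.span {h}) = cscale c h" using rep_span[OF assms(2)] by metis
  have "droot (pf i (cscale c h)) a b \<longleftrightarrow> droot (pf i h) a b" if "i < n" for i a b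
    using c(1) that by (simp add: droot_def pf_scale D_pf_scale)
  then show ?thesis using c PP_I[OF assms] by (auto simp: Dset_def)
qed

text \<open>Let h have a root of order m \<ge> 3 at p in block i0, and let h0, h1 have jets 1 and z there.  The elements
  w h - A h0 - B h1 with a double root at p + z lie on the dual variety, with A and B of exact orders m and m - 1.
  Since 2 (m - 1) > m, second order terms do not interfere and h1, then h0, are tangent.\<close>

lemma triple_root_tangent:
  assumes i0: "i0 < n" and ab: "a \<noteq> 0 \<or> b \<noteq> 0" and axy: "a * y - b * x = 1"
    and h: "h \<in> vecs (blk r i0)" "h \<noteq> 0"
    and P: "\<forall>z. pf i0 h (a + z * x) (b + z * y) = poly P z" "coeff P 0 = 0" "coeff P 1 = 0" "coeff P 2 = 0"
    and h0: "h0 \<in> vecs (blk r i0)" "D0 (pf i0 h0) a b = of_nat (e i0) * y" "D1 (pf i0 h0) a b = - of_nat (e i0) * x"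
    and h1: "h1 \<in> vecs (blk r i0)" "D0 (pf i0 h1) a b = - b" "D1 (pf i0 h1) a b = a"
    and f: "hform I d f" "\<forall>q\<in>Dset. f (rep q) = 0"
    and g: "\<forall>s v. f (h + cscale s v) = f h + s * (\<Sum>i\<in>I. g i * v i) + s\<^sup>2 * R s v"
    and R: "\<forall>s v. isCont s 0 \<longrightarrow> (\<forall>i\<in>I. isCont (\<lambda>z. v z i) 0) \<longrightarrow> isCont (\<lambda>z. R (s z) (v z)) (0::complex)"
  shows "(\<Sum>i\<in>I. g i * h0 i) = 0" "(\<Sum>i\<in>I. g i * h1 i) = 0"
proof -
  let ?p = "\<lambda>z. a + z * x" and ?q = "\<lambda>z. b + z * y"
  have pq: "?p z * y - ?q z * x = 1" for z using axy by (simp add: algebra_simps)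
  have pq0: "?p z \<noteq> 0 \<or> ?q z \<noteq> 0" for z using pq[of z] by auto
  obtain P0 where P0: "\<forall>z. pf i0 h0 (?p z) (?q z) = poly P0 z" using pf_poly[OF i0] by metis
  obtain P1 where P1: "\<forall>z. pf i0 h1 (?p z) (?q z) = poly P1 z" using pf_poly[OF i0] by metis
  \<comment> \<open>Euler's identity translates the prescribed partial derivatives: along the line,
    \<open>h0\<close> has value 1 and derivative 0 at z = 0, and \<open>h1\<close> has value 0 and
    derivative 1.\<close>
  have euler: "of_nat (e i0) * pf i0 k a b = a * D0 (pf i0 k) a b + b * D1 (pf i0 k) a b" for k
  proof -
    have "((\<lambda>z. pf i0 k (a + z * a) (b + z * b)) has_field_derivative a * D0 (pf i0 k) a b + b * D1 (pf i0 k) a b) (at 0)"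
      by (rule bform_has_derivative[OF bform_pf[OF i0]])
    moreover have "pf i0 k (a + z * a) (b + z * b) = (1 + z) ^ e i0 * pf i0 k a b" for z
      using bform_homogeneous[OF bform_pf[OF i0], of k "1 + z" a b] by (simp add: algebra_simps)
    moreover have "((\<lambda>z. (1 + z) ^ e i0 * pf i0 k a b) has_field_derivative of_nat (e i0) * pf i0 k a b) (at 0)"
      by (rule derivative_eq_intros refl | simp)+
    ultimately show ?thesis using DERIV_unique by simp
  qed
  have e0: "of_nat (e i0) \<noteq> (0::complex)" using e_pos[OF i0] by simp
  have "of_nat (e i0) * pf i0 h0 a b = of_nat (e i0) * (a * y - b * x)" unfolding euler h0(2,3) by (simp add: algebra_simps)
  then have "pf i0 h0 a b = 1" using e0 axy by simp
  then have P00: "poly P0 0 = 1" using P0[rule_format, of 0] by simp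
  have "of_nat (e i0) * pf i0 h1 a b = 0" unfolding euler h1(2,3) by (simp add: algebra_simps)
  then have "pf i0 h1 a b = 0" using e0 by simp
  then have P10: "poly P1 0 = 0" using P1[rule_format, of 0] by simp
  have dP0: "poly (pderiv P0) 0 = 0" using bform_poly_deriv[OF bform_pf[OF i0] P0, of 0] h0(2,3) by (simp add: algebra_simps)
  have dP1: "poly (pderiv P1) 0 = 1" using bform_poly_deriv[OF bform_pf[OF i0] P1, of 0] h1(2,3) axy by (simp add: algebra_simps)
  have "[:0, 1:] dvd P1" using P10 poly_eq_0_iff_dvd[of P1 0] by simp
  then obtain Q1 where Q1: "P1 = [:0, 1:] * Q1" by (elim dvdE)
  have Q10: "poly Q1 0 = 1" using dP1 unfolding Q1 by (simp add: pderiv_mult pderiv_pCons)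
  \<comment> \<open>Every (u, v) with \<open>y * u - x * v\<close> nonzero is a multiple of a point
    of the line, so a form vanishing along the line is zero, and nondegeneracy gives h = 0.\<close>
  have Pn: "P \<noteq> 0"
  proof
    assume "P = 0"
    then have z0: "pf i0 h (?p z) (?q z) = 0" for z using P(1) by simp
    have "pf i0 h u v = 0" for u v
    proof (rule ccontr)
      assume nz: "pf i0 h u v \<noteq> 0"
      have ly: "bform 1 (\<lambda>u v. y * u - x * v)" by (intro bform_diff bform_cmult bform_fst bform_snd)
      have "y * y - x * (- x) \<noteq> 0 \<or> y * a - x * b \<noteq> 0" using axy by (simp add: algebra_simps)
      then obtain u1 v1 where "y * u1 - x * v1 \<noteq> 0" by metis
      from bform_mult_zero[OF bform_pf[OF i0] nz ly this] obtain u v where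
        uv: "pf i0 h u v \<noteq> 0" "y * u - x * v \<noteq> 0" by metis
      let ?t = "y * u - x * v" and ?z = "(a * v - b * u) / (y * u - x * v)"
      have "?t * ?p ?z = u" "?t * ?q ?z = v"
      proof -
        have "?t * ?p ?z = ?t * a + (a * v - b * u) * x" "?t * ?q ?z = ?t * b + (a * v - b * u) * y"
          using uv(2) by (simp_all add: distrib_left)
        then show "?t * ?p ?z = u" "?t * ?q ?z = v" using axy by algebra+
      qed
      then have "pf i0 h u v = ?t ^ e i0 * pf i0 h (?p ?z) (?q ?z)" using bform_homogeneous[OF bform_pf[OF i0], of h ?t "?p ?z" "?q ?z"] by simp
      then show False using z0[of ?z] uv(1) by (metis mult_zero_right)
    qed
    then have "\<forall>j\<le>r i0. h (i0, j) = 0" using nd[OF i0, of "\<lambda>j. h (i0, j)"] by (simp add: pf_def)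
    moreover have "h x = 0" if "x \<notin> blk r i0" for x using h(1) that unfolding vecs_def by blast
    ultimately have "h x = 0" for x by (cases "x \<in> blk r i0") (auto simp: blk_def)
    then show False using h(2) by (simp add: fun_eq_iff zero_fun_apply)
  qed
  define m where "m = order 0 P"
  obtain T where T: "P = [:0, 1:] ^ m * T" "\<not> [:0, 1:] dvd T"
    using order_decomp[OF Pn, of 0] by (auto simp: m_def)
  have T0: "poly T 0 \<noteq> 0" using T(2) poly_eq_0_iff_dvd[of T 0] by simp
  have m3: "m \<ge> 3"
  proof (rule ccontr)
    assume "\<not> ?thesis"
    then have "m = 0 \<or> m = 1 \<or> m = 2" by auto
    moreover have "P = monom 1 m * T" using T(1) by (simp add: monom_altdef)
    then have "coeff P m = coeff T 0" by (simp add: coeff_monom_mult)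
    ultimately show False using P(2-4) T0 by (auto simp: poly_0_coeff_0)
  qed
  define M where "M = m - 2"
  have mM: "m = Suc (Suc M)" "M > 0" using m3 by (auto simp: M_def)
  have PT: "poly P z = z ^ m * poly T z" for z using T(1) by (simp add: poly_power)
  have dP: "poly (pderiv P) z = z ^ (m - 1) * (of_nat m * poly T z + z * poly (pderiv T) z)" for z
  proof -
    have "P = monom 1 m * T" using T(1) by (simp add: monom_altdef)
    then have "poly (pderiv P) z = of_nat m * z ^ (m - 1) * poly T z + z ^ m * poly (pderiv T) z"
      by (simp add: pderiv_mult pderiv_monom poly_monom)
    moreover have "z ^ m = z * z ^ (m - 1)" using mM(1) by simp
    ultimately show ?thesis by (simp add: algebra_simps)
  qed
  \<comment> \<open>By Cramer's rule, the combination w P - A P0 - B P1 with coefficients frozen at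
    z vanishes at z together with its derivative.\<close>
  define w where "w = (\<lambda>z. poly P0 z * poly (pderiv P1) z - poly P1 z * poly (pderiv P0) z)"
  define A1 where "A1 = (\<lambda>z. poly T z * poly (pderiv P1) z - poly Q1 z * (of_nat m * poly T z + z * poly (pderiv T) z))"
  define B1 where "B1 = (\<lambda>z. poly P0 z * (of_nat m * poly T z + z * poly (pderiv T) z) - z * poly T z * poly (pderiv P0) z)"
  define A where "A = (\<lambda>z. poly P z * poly (pderiv P1) z - poly P1 z * poly (pderiv P) z)"
  define B where "B = (\<lambda>z. poly P0 z * poly (pderiv P) z - poly P z * poly (pderiv P0) z)"
  have AB: "A z = z ^ (m - 1) * (z * A1 z)" "B z = z ^ (m - 1) * B1 z" for z
    unfolding A_def B_def A1_def B1_def PT dP Q1 unfolding mM(1) by (simp_all add: algebra_simps)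
  have w0: "w 0 = 1" using P00 dP1 P10 by (simp add: w_def)
  have A10: "A1 0 = (1 - of_nat m) * poly T 0" using dP1 Q10 by (simp add: A1_def algebra_simps)
  have B10: "B1 0 = of_nat m * poly T 0" using P00 by (simp add: B1_def)
  define k where "k z = cscale (w z) h + (cscale (- A z) h0 + cscale (- B z) h1)" for z
  have kv: "k z \<in> vecs (blk r i0)" for z
    unfolding k_def by (intro cv.subspace_add[OF subspace_vecs] cv.subspace_scale[OF subspace_vecs] h h0 h1)
  have kd: "droot (pf i (k z)) (?p z) (?q z)" if i: "i < n" for i z
  proof (cases "i = i0")
    case False
    then have "(i, j) \<notin> blk r i0" for j by (auto simp: blk_def)
    then show ?thesis using kv[of z] by (intro droot_pf_outside) (auto simp: vecs_def)
  next
    case True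
    show ?thesis unfolding True
    proof (rule droot_directional[OF bform_pf[OF i0] e_pos[OF i0], of _ _ _ x y])
      show "pf i0 (k z) (?p z) (?q z) = 0"
        unfolding k_def pf_add pf_scale P(1)[rule_format] P0[rule_format] P1[rule_format] w_def A_def B_def
        by (simp add: algebra_simps)
      have "x * D0 (pf i0 (k z)) (?p z) (?q z) + y * D1 (pf i0 (k z)) (?p z) (?q z) =
          w z * poly (pderiv P) z + (- A z * poly (pderiv P0) z + - B z * poly (pderiv P1) z)"
        unfolding bform_poly_deriv[OF bform_pf[OF i0] P(1)] bform_poly_deriv[OF bform_pf[OF i0] P0] bform_poly_deriv[OF bform_pf[OF i0] P1]
          k_def D_pf_add[OF i0] D_pf_scale[OF i0] by (simp add: algebra_simps)
      also have "\<dots> = 0" unfolding w_def A_def B_def by (simp add: algebra_simps)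
      finally show "x * D0 (pf i0 (k z)) (?p z) (?q z) + y * D1 (pf i0 (k z)) (?p z) (?q z) = 0" .
      show "?p z * y - ?q z * x \<noteq> 0" using pq[of z] by simp
    qed
  qed
  have fk: "f (k z) = 0" if "k z \<noteq> 0" for z
  proof -
    have "k z \<in> vecs I" using kv blk_subset[OF i0] by blast
    then have "cv.span {k z} \<in> Dset" using in_Dset_iff[OF _ that] kd pq0 by blast
    then show ?thesis using f(2) hform_rep_span[OF fin f(1) that] by blast
  qed
  have cont: "isCont w 0" "isCont A1 0" "isCont B1 0"
    unfolding w_def A1_def B1_def by (intro continuous_intros)+
  obtain l where l: "h l \<noteq> 0" using h(2) by (auto simp: fun_eq_iff zero_fun_apply)
  \<comment> \<open>After division by \<open>w z\<close> the curve is h + z^(m - 1) times this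
    moving vector, whose \<open>h0\<close> part carries an extra factor z.\<close>
  let ?v = "\<lambda>z. cscale (- z * A1 z / w z) h0 + cscale (- B1 z / w z) h1"
  let ?s = "\<lambda>z :: complex. z ^ (m - 1)"
  have k0: "k 0 l \<noteq> 0" using w0 l mM by (simp add: k_def vec_apply AB)
  have contk: "isCont (\<lambda>z. k z l) 0"
    unfolding k_def vec_apply AB by (intro continuous_intros cont)
  have evk: "\<forall>\<^sub>F z in nhds 0. k z \<noteq> 0"
  proof -
    have "\<forall>\<^sub>F z in nhds 0. k z l \<noteq> 0"
      using contk k0 tendsto_imp_eventually_ne[of "\<lambda>z. k z l" "k 0 l" "at 0" 0] by (simp add: isCont_def eventually_nhds_conv_at)
    then show ?thesis by eventually_elim (auto simp: zero_fun_apply)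
  qed
  have evw: "\<forall>\<^sub>F z in nhds 0. w z \<noteq> 0"
    using cont(1) w0 tendsto_imp_eventually_ne[of w "w 0" "at 0" 0] by (simp add: isCont_def eventually_nhds_conv_at)
  have kh: "k z = cscale (w z) (h + cscale (?s z) (?v z))" if "w z \<noteq> 0" for z
    using that by (auto simp: k_def AB fun_eq_iff vec_apply field_simps)
  have fh: "f h = 0"
  proof -
    have "k 0 = h" using w0 mM by (simp add: k_def fun_eq_iff vec_apply AB)
    then show ?thesis using fk[of 0] h(2) by simp
  qed
  let ?g0 = "\<Sum>i\<in>I. g i * h0 i" and ?g1 = "\<Sum>i\<in>I. g i * h1 i"
  have lin: "(\<Sum>i\<in>I. g i * (cscale \<alpha> h0 + cscale \<beta> h1) i) = \<alpha> * ?g0 + \<beta> * ?g1" for \<alpha> \<beta>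
    by (simp add: vec_apply algebra_simps sum.distrib sum_distrib_left)
  define \<rho> where "\<rho> = (\<lambda>z. R (?s z) (?v z))"
  have contr: "isCont \<rho> 0"
    unfolding \<rho>_def
  proof (rule R[rule_format])
    show "isCont ?s 0" by (intro continuous_intros)
    show "isCont (\<lambda>z. ?v z i) 0" for i
      unfolding vec_apply using w0 by (intro continuous_intros cont) auto
  qed
  have main: "\<forall>\<^sub>F z in at 0. - z * A1 z * ?g0 - B1 z * ?g1 + ?s z * \<rho> z * w z = 0"
  proof -
    have "\<forall>\<^sub>F z in at 0. z \<noteq> (0::complex)" by (simp add: eventually_at_filter)
    moreover have "\<forall>\<^sub>F z in at 0. k z \<noteq> 0" "\<forall>\<^sub>F z in at 0. w z \<noteq> 0"
      using evk evw by (simp_all add: eventually_nhds_conv_at)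
    ultimately show ?thesis
    proof eventually_elim
      case (elim z)
      have f0: "f (h + cscale (?s z) (?v z)) = 0"
        using fk[OF elim(2)] kh[OF elim(3)] hform_zero_iff_scale[OF fin f(1) elim(3)] by simp
      have "f (h + cscale (?s z) (?v z)) = f h + ?s z * (\<Sum>i\<in>I. g i * ?v z i) + (?s z)\<^sup>2 * R (?s z) (?v z)"
        using g by blast
      then have "?s z * ((- z * A1 z / w z) * ?g0 + (- B1 z / w z) * ?g1) + (?s z)\<^sup>2 * \<rho> z = 0"
        unfolding f0 fh lin \<rho>_def by (simp only: add_0)
      then have "?s z * ((- z * A1 z / w z) * ?g0 + (- B1 z / w z) * ?g1 + ?s z * \<rho> z) = 0"
        by (simp add: algebra_simps power2_eq_square)
      then have "(- z * A1 z / w z) * ?g0 + (- B1 z / w z) * ?g1 + ?s z * \<rho> z = 0" using elim(1) by simp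
      then have k1: "w z * ((- z * A1 z / w z) * ?g0 + (- B1 z / w z) * ?g1 + ?s z * \<rho> z) = 0" by simp
      have "W * ((- x / W) * u + (- y / W) * v + t) = - x * u - y * v + t * W" if "W \<noteq> 0" for W x y u v t :: complex
        using that by (simp add: field_simps)
      from this[OF elim(3), of "z * A1 z" ?g0 "B1 z" ?g1 "?s z * \<rho> z"] have k2:
        "w z * ((- z * A1 z / w z) * ?g0 + (- B1 z / w z) * ?g1 + ?s z * \<rho> z) = - z * A1 z * ?g0 - B1 z * ?g1 + ?s z * \<rho> z * w z"
        by simp
      show ?case by (rule trans[OF k2[symmetric] k1])
    qed
  qed
  have lim_zero: "\<phi> 0 = 0" if "isCont \<phi> 0" "\<forall>\<^sub>F z in at 0. \<phi> z = 0" for \<phi> :: "complex \<Rightarrow> complex"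
  proof -
    have "(\<phi> \<longlongrightarrow> \<phi> 0) (at 0)" using that(1) by (simp add: isCont_def)
    moreover have "(\<phi> \<longlongrightarrow> 0) (at 0)" using that(2) by (simp add: tendsto_eventually)
    ultimately show ?thesis using LIM_unique by blast
  qed
  \<comment> \<open>In the limit only the \<open>h1\<close> term survives.\<close>
  have "- 0 * A1 0 * ?g0 - B1 0 * ?g1 + ?s 0 * \<rho> 0 * w 0 = 0"
    by (rule lim_zero[of "\<lambda>z. - z * A1 z * ?g0 - B1 z * ?g1 + ?s z * \<rho> z * w z"]) (intro continuous_intros cont contr main)+
  then have "B1 0 * ?g1 = 0" using mM by simp
  then show g1: "?g1 = 0" using B10 T0 m3 by simp
  \<comment> \<open>With the \<open>h1\<close> term gone, one more factor z can be cancelled. The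
    remainder still carries \<open>z ^ M\<close> with \<open>M = m - 2 > 0\<close> and vanishes at
    0: this is where a root of order at least 3 is used.\<close>
  have "\<forall>\<^sub>F z in at 0. - A1 z * ?g0 + z ^ M * \<rho> z * w z = 0"
  proof -
    have "\<forall>\<^sub>F z in at 0. z \<noteq> (0::complex)" by (simp add: eventually_at_filter)
    then show ?thesis using main
    proof eventually_elim
      case (elim z)
      have "z * (- A1 z * ?g0 + z ^ M * \<rho> z * w z) = 0" using elim(2) g1 mM by (simp add: algebra_simps)
      then show ?case using elim(1) by simp
    qed
  qed
  then have "- A1 0 * ?g0 + 0 ^ M * \<rho> 0 * w 0 = 0"
    by (intro lim_zero[of "\<lambda>z. - A1 z * ?g0 + z ^ M * \<rho> z * w z"] continuous_intros cont contr)
  then have "A1 0 * ?g0 = 0" using mM by (simp add: power_0_left)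
  moreover have "A1 0 \<noteq> 0"
  proof -
    have "(1 :: complex) - of_nat m \<noteq> 0" using m3 of_nat_eq_iff[of m 1, where ?'a = complex] by simp
    then show ?thesis using A10 T0 by simp
  qed
  ultimately show "?g0 = 0" by simp
qed

text \<open>For r_i \<ge> 3, three linear conditions on at least four coefficients have a nonzero
  solution at any point, here at (1 : 0). For r_i = 2, the three second derivatives have to vanish
  for some nonzero coefficient vector, which happens at a root of their determinant.\<close>

lemma exists_triple_root:
  assumes i: "i < n" and e: "e i \<ge> 3"
  obtains a b x y h P where "a \<noteq> 0 \<or> b \<noteq> 0" "a * y - b * x = 1" "h \<in> vecs (blk r i)" "h \<noteq> 0"
    "\<forall>z. pf i h (a + z * x) (b + z * y) = poly P z" "coeff P 0 = 0" "coeff P 1 = 0" "coeff P 2 = 0"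
proof -
  have r2: "r i \<ge> 2" using r_pos[OF i] r_eq_1[OF i] e by (cases "r i = 1") auto
  have bl: "finite (blk r i)" "card (blk r i) = r i + 1" by (auto simp: blk_def)
  show ?thesis
  proof (cases "r i \<ge> 3")
    case True
    have "\<exists>P. \<forall>z. F (i, j) (1 + z * 0) (0 + z * 1) = poly P z" if "j \<le> r i" for j
      using bform_F_polyfun[OF i that, of 1 0 0 1] unfolding polyfun_def by blast
    then obtain Q where Q: "\<And>j z. j \<le> r i \<Longrightarrow> F (i, j) (1 + z * 0) (0 + z * 1) = poly (Q j) z" by metis
    let ?S = "(\<lambda>k (x :: nat \<times> nat). coeff (Q (snd x)) k) ` {..2::nat}"
    have cS: "card ?S < card (blk r i)" using card_image_le[of "{..2::nat}" "\<lambda>k (x :: nat \<times> nat). coeff (Q (snd x)) k"] bl True by simp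
    have fS: "finite ?S" by simp
    obtain h where h: "h \<in> vecs (blk r i)" "h \<noteq> 0" "\<forall>a\<in>?S. pair (blk r i) a h = 0"
      by (rule exists_nonzero_in_annihilator[OF bl(1) fS cS])
    let ?P = "\<Sum>j\<le>r i. smult (h (i, j)) (Q j)"
    have "\<forall>z. pf i h (1 + z * 0) (0 + z * 1) = poly ?P z" using Q by (auto simp: pf_def poly_sum intro!: sum.cong)
    moreover have "coeff ?P k = 0" if "k \<le> 2" for k
    proof -
      have "coeff ?P k = (\<Sum>j\<le>r i. coeff (Q j) k * h (i, j))" by (simp add: coeff_sum mult.commute)
      also have "\<dots> = (\<Sum>x\<in>Pair i ` {..r i}. coeff (Q (snd x)) k * h x)" by (simp add: sum.reindex inj_on_def)
      also have "\<dots> = pair (blk r i) (\<lambda>x. coeff (Q (snd x)) k) h" unfolding pair_def by (rule sum.cong) (auto simp: blk_def)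
      also have "\<dots> = 0" using h(3) that by auto
      finally show ?thesis .
    qed
    ultimately show ?thesis using that[of 1 0 1 0 h ?P] h by simp
  next
    case False
    then have ri: "r i = 2" using r2 by simp
    define c where "c j k a b = (if k = 0 then D0 (D0 (F (i, j))) a b else if k = 1 then D1 (D0 (F (i, j))) a b else D1 (D1 (F (i, j))) a b)"
      for j k :: nat and a b
    have bc: "bform (e i - 2) (c j k)" if "j \<le> 2" for j k
    proof -
      have "bform (Suc (e i - 2)) (D0 (F (i, j)))" "bform (Suc (e i - 2)) (D1 (F (i, j)))"
        using bform_DF[OF i, of j] that ri e by (simp_all add: Suc_diff_le numeral_2_eq_2 Suc_diff_Suc)
      from bform_D0[OF this(1)] bform_D1[OF this(1)] bform_D1[OF this(2)]
      show ?thesis unfolding c_def[abs_def] by (cases "k = 0"; cases "k = 1") simp_all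
    qed
    \<comment> \<open>The 3 by 3 determinant of the second partial derivatives of the three
      coordinates.\<close>
    define W where "W a b = c 0 0 a b * (c 1 1 a b * c 2 2 a b) + (c 0 1 a b * (c 1 2 a b * c 2 0 a b) + c 0 2 a b * (c 1 0 a b * c 2 1 a b))
      - (c 0 0 a b * (c 1 2 a b * c 2 1 a b) + (c 0 1 a b * (c 1 0 a b * c 2 2 a b) + c 0 2 a b * (c 1 1 a b * c 2 0 a b)))" for a b
    have bW: "bform (e i - 2 + (e i - 2 + (e i - 2))) W"
      unfolding W_def[abs_def] by (intro bform_diff bform_add bform_mult bc) auto
    have pos: "e i - 2 + (e i - 2 + (e i - 2)) > 0" using e by simp
    obtain a b where ab: "a \<noteq> 0 \<or> b \<noteq> 0" "W a b = 0" by (rule bform_has_root[OF bW pos])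
    have "\<exists>u. (u 0 \<noteq> 0 \<or> u 1 \<noteq> 0 \<or> u 2 \<noteq> (0::complex)) \<and> (\<forall>k<3. u 0 * c 0 k a b + u 1 * c 1 k a b + u (2::nat) * c 2 k a b = 0)"
    proof -
      define Mt :: "complex^3^3" where "Mt = vector [vector [c 0 0 a b, c 1 0 a b, c 2 0 a b],
        vector [c 0 1 a b, c 1 1 a b, c 2 1 a b], vector [c 0 2 a b, c 1 2 a b, c 2 2 a b]]"
      have "det Mt = W a b" by (simp add: Mt_def det_3 W_def algebra_simps)
      then have "\<not> invertible Mt" using ab(2) by (simp add: invertible_det_nz)
      then have "\<not> (\<forall>x. Mt *v x = 0 \<longrightarrow> x = 0)"
        using matrix_left_invertible_ker[of Mt] invertible_left_inverse[of Mt] by blast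
      then obtain x where x: "Mt *v x = 0" "x \<noteq> 0" by blast
      have "(Mt *v x) $ 1 = 0" "(Mt *v x) $ 2 = 0" "(Mt *v x) $ 3 = 0" using x(1) by simp_all
      then have "x $ 1 * c 0 k a b + x $ 2 * c 1 k a b + x $ 3 * c 2 k a b = 0" if "k < 3" for k
        using that by (auto simp: Mt_def matrix_vector_mult_def sum_3 less_Suc_eq numeral_3_eq_3 mult.commute numeral_2_eq_2)
      moreover have "x $ 1 \<noteq> 0 \<or> x $ 2 \<noteq> 0 \<or> x $ 3 \<noteq> 0" using x(2) by (auto simp: vec_eq_iff forall_3)
      ultimately show ?thesis by (intro exI[of _ "\<lambda>j. if j = 0 then x $ 1 else if j = 1 then x $ 2 else x $ 3"]) simp
    qed
    then obtain u where u: "u 0 \<noteq> 0 \<or> u 1 \<noteq> 0 \<or> u 2 \<noteq> (0::complex)"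
      "\<And>k. k < 3 \<Longrightarrow> u 0 * c 0 k a b + u 1 * c 1 k a b + u (2::nat) * c 2 k a b = 0" by blast
    define h where "h x = (if x \<in> blk r i then u (snd x) else 0)" for x :: "nat \<times> nat"
    have hv: "h \<in> vecs (blk r i)" by (simp add: h_def vecs_def)
    have hi: "h (i, j) = u j" if "j \<le> 2" for j using that ri by (simp add: h_def blk_def)
    have h0: "h \<noteq> 0" using u(1) hi by (metis zero_fun_apply le0 one_le_numeral order_refl)
    obtain x' y' where xy: "a * y' - b * x' = 1" using complementary_vector[OF ab(1)] by blast
    obtain P where P: "\<forall>z. pf i h (a + z * x') (b + z * y') = poly P z" using pf_poly[OF i] by metis
    let ?f = "pf i h"
    have fD0: "D0 ?f = (\<lambda>p q. \<Sum>j\<le>2. h (i, j) * D0 (F (i, j)) p q)" "D1 ?f = (\<lambda>p q. \<Sum>j\<le>2. h (i, j) * D1 (F (i, j)) p q)"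
      using D0_pf[OF i] D1_pf[OF i] ri by (auto simp: fun_eq_iff)
    have bD: "bform (e i - 1) (D0 (F (i, j)))" "bform (e i - 1) (D1 (F (i, j)))" if "j \<in> {..2}" for j
      using bform_DF[OF i, of j] that ri by auto
    have dd: "D0 (D0 ?f) a b = 0" "D1 (D0 ?f) a b = 0" "D1 (D1 ?f) a b = 0"
    proof -
      have D: "D0 (\<lambda>p q. \<Sum>j\<le>2. h (i, j) * D0 (F (i, j)) p q) a b = (\<Sum>j\<le>2. h (i, j) * D0 (D0 (F (i, j))) a b)"
        "D1 (\<lambda>p q. \<Sum>j\<le>2. h (i, j) * D0 (F (i, j)) p q) a b = (\<Sum>j\<le>2. h (i, j) * D1 (D0 (F (i, j))) a b)"
        "D1 (\<lambda>p q. \<Sum>j\<le>2. h (i, j) * D1 (F (i, j)) p q) a b = (\<Sum>j\<le>2. h (i, j) * D1 (D1 (F (i, j))) a b)"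
        by (rule bform_D_sum[OF finite_atMost], rule bD, assumption)+
      show "D0 (D0 ?f) a b = 0" "D1 (D0 ?f) a b = 0" "D1 (D1 ?f) a b = 0"
        unfolding fD0 D using u(2)[of 0] u(2)[of 1] u(2)[of 2] hi by (auto simp: c_def numeral_2_eq_2)
    qed
    have be: "bform (Suc (e i - 1)) ?f" using bform_pf[OF i] e by simp
    have dd': "D0 (D1 ?f) a b = 0" using bform_mixed_partials[OF be] dd(2) by simp
    have b1: "bform (e i - 1) (D0 ?f)" "bform (e i - 1) (D1 ?f)" using bform_D0[OF be] bform_D1[OF be] by auto
    have e1: "e i - 1 = Suc (e i - 2)" using e by simp
    \<comment> \<open>Euler's identity descends from the second derivatives to the first ones, and
      then to the value.\<close>
    have d: "D0 ?f a b = 0" "D1 ?f a b = 0"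
      using bform_euler[of "e i - 2" "D0 ?f"] bform_euler[of "e i - 2" "D1 ?f"] b1 dd dd' unfolding e1 by auto
    have f0: "?f a b = 0" using bform_euler[OF be] d by simp
    have P': "poly (pderiv P) z = x' * D0 ?f (a + z * x') (b + z * y') + y' * D1 ?f (a + z * x') (b + z * y')" for z
      by (rule bform_poly_deriv[OF bform_pf[OF i] P])
    have bg: "bform (e i - 1) (\<lambda>p q. x' * D0 ?f p q + y' * D1 ?f p q)" by (intro bform_add bform_cmult b1)
    have "D0 (\<lambda>p q. x' * D0 ?f p q + y' * D1 ?f p q) a b = 0" "D1 (\<lambda>p q. x' * D0 ?f p q + y' * D1 ?f p q) a b = 0"
    proof -
      have "((\<lambda>z. x' * D0 ?f z b + y' * D1 ?f z b) has_field_derivative x' * D0 (D0 ?f) a b + y' * D0 (D1 ?f) a b) (at a)"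
        by (intro DERIV_add DERIV_cmult bform_deriv_aux[OF b1(1)] bform_deriv_aux[OF b1(2)])
      then show "D0 (\<lambda>p q. x' * D0 ?f p q + y' * D1 ?f p q) a b = 0" unfolding D0_def[of "\<lambda>p q. x' * D0 ?f p q + y' * D1 ?f p q"]
        using DERIV_imp_deriv dd dd' by fastforce
      have "((\<lambda>z. x' * D0 ?f a z + y' * D1 ?f a z) has_field_derivative x' * D1 (D0 ?f) a b + y' * D1 (D1 ?f) a b) (at b)"
        by (intro DERIV_add DERIV_cmult bform_deriv_aux[OF b1(1)] bform_deriv_aux[OF b1(2)])
      then show "D1 (\<lambda>p q. x' * D0 ?f p q + y' * D1 ?f p q) a b = 0" unfolding D1_def[of "\<lambda>p q. x' * D0 ?f p q + y' * D1 ?f p q"]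
        using DERIV_imp_deriv dd dd' by fastforce
    qed
    then have "poly (pderiv (pderiv P)) 0 = 0"
      using bform_poly_deriv[OF bg, of a x' b y' "pderiv P" 0] P' by simp
    then have "coeff P 2 = 0" by (simp add: poly_0_coeff_0 coeff_pderiv numeral_2_eq_2)
    moreover have "coeff P 1 = 0" using P'[of 0] d by (simp add: poly_0_coeff_0 coeff_pderiv)
    moreover have "coeff P 0 = 0" using P[rule_format, of 0] f0 by (simp add: poly_0_coeff_0)
    ultimately show ?thesis using that[OF ab(1) xy hv h0 P] by blast
  qed
qed

text \<open>The space \<open>?N\<close> imposes the double root condition on the blocks other than
  \<open>i0\<close> and nothing on block \<open>i0\<close>. It lies in the tangent cone at the
  hyperplane with a triple root because the missing jets, those of \<open>h0\<close> and
  \<open>h1\<close>, are tangent there.\<close>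

lemma smooth_Dset_imp_e_le_2:
  assumes "smooth_variety I Dset" "i0 < n" shows "e i0 \<le> 2"
proof (rule ccontr)
  assume "\<not> ?thesis"
  then have "e i0 \<ge> 3" by simp
  then obtain a b x y h' P' where 1: "a \<noteq> 0 \<or> b \<noteq> 0" "a * y - b * x = 1" "h' \<in> vecs (blk r i0)" "h' \<noteq> 0"
    "\<forall>z. pf i0 h' (a + z * x) (b + z * y) = poly P' z" "coeff P' 0 = 0" "coeff P' 1 = 0" "coeff P' 2 = 0"
    by (rule exists_triple_root[OF assms(2)])
  note i0 = assms(2)
  \<comment> \<open>The tangent cone is based at \<open>rep \<eta>\<close>, so \<open>h'\<close> is
    replaced by this multiple.\<close>
  define \<eta> where "\<eta> = cv.span {h'}"
  obtain c where c: "c \<noteq> 0" "rep \<eta> = cscale c h'" using rep_span[OF 1(4)] unfolding \<eta>_def by metis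
  define h where "h = rep \<eta>"
  have h: "h \<in> vecs (blk r i0)" "h \<noteq> 0" using c 1(3,4) subspace_vecs cv.subspace_scale by (auto simp: h_def)
  have hI: "h \<in> vecs I" using h(1) blk_subset[OF i0] by blast
  let ?P = "smult c P'"
  have P: "\<forall>z. pf i0 h (a + z * x) (b + z * y) = poly ?P z" "coeff ?P 0 = 0" "coeff ?P 1 = 0" "coeff ?P 2 = 0"
    using 1(5-8) c by (simp_all add: h_def pf_scale)
  have hd: "droot (pf i h) a b" if "i < n" for i
  proof (cases "i = i0")
    case False
    then have "(i, j) \<notin> blk r i0" for j by (auto simp: blk_def)
    then show ?thesis using h(1) by (intro droot_pf_outside) (auto simp: vecs_def)
  next
    case True
    show ?thesis unfolding True
    proof (rule droot_directional[OF bform_pf[OF i0] e_pos[OF i0], of _ _ _ x y])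
      show "pf i0 h a b = 0" using P(1)[rule_format, of 0] P(2) by (simp add: poly_0_coeff_0)
      show "x * D0 (pf i0 h) a b + y * D1 (pf i0 h) a b = 0"
        using bform_poly_deriv[OF bform_pf[OF i0] P(1), of 0] P(3) by (simp add: poly_0_coeff_0 coeff_pderiv)
      show "a * y - b * x \<noteq> 0" using 1(2) by simp
    qed
  qed
  have \<eta>: "\<eta> = cv.span {h}" using c(1) unfolding h_def c(2) by (simp add: \<eta>_def span_single_scale)
  then have \<eta>D: "\<eta> \<in> Dset" using in_Dset_iff[OF hI h(2)] hd 1(1) by blast
  obtain h0 where h0: "h0 \<in> vecs (blk r i0)" "D0 (pf i0 h0) a b = of_nat (e i0) * y" "D1 (pf i0 h0) a b = - of_nat (e i0) * x"
    by (rule prescribed_jet[OF i0 1(1)])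
  obtain h1 where h1: "h1 \<in> vecs (blk r i0)" "D0 (pf i0 h1) a b = - b" "D1 (pf i0 h1) a b = a"
    by (rule prescribed_jet[OF i0 1(1)])
  let ?vec = "\<lambda>D i. (\<lambda>x. if x \<in> {i} \<times> {..r i} then D (F x) a b else 0) :: (nat \<times> nat) vec"
  let ?S = "?vec D0 ` ({..<n} - {i0}) \<union> ?vec D1 ` ({..<n} - {i0})"
  let ?N = "{k\<in>vecs I. \<forall>v\<in>?S. pair I v k = 0}"
  have pr: "pair I (\<lambda>x. if x \<in> {i} \<times> {..r i} then D (F x) a b else 0) k = (\<Sum>j\<le>r i. k (i, j) * D (F (i, j)) a b)"
    if i: "i < n" for i k and D :: "(complex \<Rightarrow> complex \<Rightarrow> complex) \<Rightarrow> complex \<Rightarrow> complex \<Rightarrow> complex"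
  proof -
    have "(\<Sum>j\<le>r l. (if (l, j) \<in> {i} \<times> {..r i} then D (F (l, j)) a b else 0) * k (l, j)) =
        (if l = i then (\<Sum>j\<le>r i. k (i, j) * D (F (i, j)) a b) else 0)" for l
      by (auto intro!: sum.cong)
    then show ?thesis using i by (simp only: pair_def sum_I) simp
  qed
  have "?N \<subseteq> tangent_cone I Dset \<eta>"
  proof
    fix k assume k: "k \<in> ?N"
    have kI: "k \<in> vecs I" using k by simp
    have kd: "D0 (pf i k) a b = 0" "D1 (pf i k) a b = 0" if "i < n" "i \<noteq> i0" for i
    proof -
      have "pair I (?vec D0 i) k = 0" "pair I (?vec D1 i) k = 0" using k that by auto
      then show "D0 (pf i k) a b = 0" "D1 (pf i k) a b = 0" unfolding pr[OF that(1)] D0_pf[OF that(1)] D1_pf[OF that(1)] by auto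
    qed
    define d0 where "d0 = D0 (pf i0 k) a b"
    define d1 where "d1 = D1 (pf i0 k) a b"
    \<comment> \<open>By Euler's identity \<open>s\<close> is the value of \<open>k\<close> in block
      \<open>i0\<close>, and \<open>t\<close> is its derivative along (x, y). Removing s h0 + t h1
      leaves \<open>k'\<close> with a double root in every block, so the line from \<open>h\<close>
      in direction \<open>k'\<close> stays in the dual set.\<close>
    define s where "s = (a * d0 + b * d1) / of_nat (e i0)"
    define t where "t = x * d0 + y * d1"
    define k' where "k' = k + (cscale (- s) h0 + cscale (- t) h1)"
    have e0: "of_nat (e i0) \<noteq> (0::complex)" using e_pos[OF i0] by simp
    have se: "s * of_nat (e i0) = a * d0 + b * d1" using e0 by (simp add: s_def)
    have h01I: "h0 \<in> vecs I" "h1 \<in> vecs I" using h0(1) h1(1) blk_subset[OF i0] by auto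
    have k'I: "k' \<in> vecs I" unfolding k'_def using kI h01I by (intro cv.subspace_add cv.subspace_scale subspace_vecs)
    have k'd: "droot (pf i k') a b" if i: "i < n" for i
    proof (cases "i = i0")
      case True
      have "D0 (pf i0 k') a b = d0 - (s * of_nat (e i0)) * y + t * b"
        unfolding k'_def D_pf_add[OF i0] D_pf_scale[OF i0] h0 h1 by (simp add: d0_def)
      also have "\<dots> = 0" unfolding se t_def using 1(2) by algebra
      finally have "D0 (pf i0 k') a b = 0" .
      moreover have "D1 (pf i0 k') a b = d1 + (s * of_nat (e i0)) * x - t * a"
        unfolding k'_def D_pf_add[OF i0] D_pf_scale[OF i0] h0 h1 by (simp add: d1_def)
      then have "D1 (pf i0 k') a b = 0" unfolding se t_def using 1(2) by algebra
      ultimately show ?thesis using droot_iff[OF i0] True by simp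
    next
      case False
      then have "(i, j) \<notin> blk r i0" for j by (auto simp: blk_def)
      then have z: "droot (pf i h0) a b" "droot (pf i h1) a b" using h0(1) h1(1) by (auto intro!: droot_pf_outside simp: vecs_def)
      show ?thesis unfolding k'_def using kd[OF i False] z droot_iff[OF i]
        by (intro droot_pf_add[OF i] droot_pf_scale[OF i]) auto
    qed
    show "k \<in> tangent_cone I Dset \<eta>"
      unfolding tangent_cone_def mem_Collect_eq
    proof (intro conjI allI impI kI)
      fix d f assume "hform I d f \<and> (\<forall>q\<in>Dset. f (rep q) = 0)"
      then have f: "hform I d f" "\<forall>q\<in>Dset. f (rep q) = 0" by auto
      obtain g R where gR: "\<forall>s v. f (h + cscale s v) = f h + s * (\<Sum>i\<in>I. g i * v i) + s\<^sup>2 * R s v"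
        "\<forall>s v. isCont s 0 \<longrightarrow> (\<forall>i\<in>I. isCont (\<lambda>z. v z i) 0) \<longrightarrow> isCont (\<lambda>z. R (s z) (v z)) (0::complex)"
        using hform_second_order[OF fin f(1)] by blast
      have g01: "(\<Sum>i\<in>I. g i * h0 i) = 0" "(\<Sum>i\<in>I. g i * h1 i) = 0"
        using triple_root_tangent[OF i0 1(1,2) h P h0 h1 f gR] by auto
      have deriv: "((\<lambda>z. f (h + cscale z v)) has_field_derivative (\<Sum>i\<in>I. g i * v i)) (at 0)" for v
      proof -
        have "((\<lambda>z. z * R z v) has_field_derivative R 0 v) (at 0)"
        proof -
          have "isCont (\<lambda>z. R z v) 0" using gR(2)[rule_format, of "\<lambda>z. z" "\<lambda>_. v"] by simp
          then show ?thesis unfolding DERIV_def isCont_def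
            by (rule Lim_transform_eventually) (simp add: eventually_at_filter)
        qed
        from DERIV_mult[OF DERIV_ident this]
        have "((\<lambda>z. z\<^sup>2 * R z v) has_field_derivative 0) (at 0)" by (simp add: power2_eq_square mult.assoc)
        moreover have "((\<lambda>z. f h + z * (\<Sum>i\<in>I. g i * v i)) has_field_derivative (\<Sum>i\<in>I. g i * v i)) (at 0)"
          by (rule derivative_eq_intros refl | simp)+
        ultimately have "((\<lambda>z. f h + z * (\<Sum>i\<in>I. g i * v i) + z\<^sup>2 * R z v) has_field_derivative (\<Sum>i\<in>I. g i * v i) + 0) (at 0)"
          by (rule DERIV_add[rotated])
        then show ?thesis using gR(1) by simp
      qed
      have fz: "f (h + cscale z k') = 0" if "h + cscale z k' \<noteq> 0" for z
      proof -
        have "h + cscale z k' \<in> vecs I" using hI k'I by (intro cv.subspace_add cv.subspace_scale subspace_vecs)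
        moreover have "\<forall>i<n. droot (pf i (h + cscale z k')) a b" using hd k'd by (auto intro: droot_pf_add droot_pf_scale)
        ultimately have "cv.span {h + cscale z k'} \<in> Dset" using in_Dset_iff[OF _ that] 1(1) by blast
        then show ?thesis using f(2) hform_rep_span[OF fin f(1) that] by blast
      qed
      have "\<forall>\<^sub>F z in nhds 0. h + cscale z k' \<noteq> 0"
        using polycurve_nonzero(1)[OF polycurve_line, of h 0 k'] h(2) by simp
      then have "\<forall>\<^sub>F z in nhds 0. f (h + cscale z k') = 0" by (rule eventually_mono) (rule fz)
      then have "((\<lambda>z. f (h + cscale z k')) has_field_derivative 0) (at 0)"
        using DERIV_cong_ev[OF refl, of "\<lambda>z. f (h + cscale z k')" "\<lambda>_. 0" 0 0 0] by simp
      then have gk': "(\<Sum>i\<in>I. g i * k' i) = 0" using deriv DERIV_unique by blast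
      have "k = k' + (cscale s h0 + cscale t h1)" by (auto simp: k'_def fun_eq_iff vec_apply)
      then have "(\<Sum>i\<in>I. g i * k i) = (\<Sum>i\<in>I. g i * k' i) + s * (\<Sum>i\<in>I. g i * h0 i) + t * (\<Sum>i\<in>I. g i * h1 i)"
        by (simp add: vec_apply algebra_simps sum.distrib sum_distrib_left)
      then have "(\<Sum>i\<in>I. g i * k i) = 0" using g01 gk' by simp
      then show "deriv (\<lambda>t. f (rep \<eta> + cscale t k)) 0 = 0" using DERIV_imp_deriv[OF deriv[of k]] by (simp add: h_def)
    qed
  qed
  moreover have "tangent_cone I Dset \<eta> \<subseteq> vecs I" by (auto simp: tangent_cone_def)
  ultimately have "cv.dim ?N \<le> cv.dim (tangent_cone I Dset \<eta>)" using dim_mono_vecs[OF fin] by blast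
  moreover have "cv.dim (tangent_cone I Dset \<eta>) = vdim I Dset + 1" using assms(1) \<eta>D by (simp add: smooth_variety_def)
  moreover have "vdim I Dset \<le> (\<Sum>i<n. r i - 1)"
    using assms(1) Dset_chain_bound by (intro vdim_leI) (auto simp: smooth_variety_def projective_variety_def)
  moreover have "card I \<le> cv.dim ?N + card ?S" by (rule dim_annihilator_ge[OF fin]) simp
  moreover have "card ?S \<le> 2 * (n - 1)"
  proof -
    have "card ?S \<le> card (?vec D0 ` ({..<n} - {i0})) + card (?vec D1 ` ({..<n} - {i0}))" by (rule card_Un_le)
    also have "\<dots> \<le> card ({..<n} - {i0}) + card ({..<n} - {i0})" by (intro add_mono card_image_le) auto
    finally show ?thesis using i0 by simp
  qed
  moreover have "card I = (\<Sum>i<n. r i - 1) + 2 * n"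
  proof -
    have "card I = (\<Sum>i<n. (r i - 1) + 2)" unfolding card_I
    proof (intro sum.cong refl)
      fix i assume "i \<in> {..<n}" then show "r i + 1 = (r i - 1) + 2" using r_pos[of i] by simp
    qed
    then show ?thesis by (simp only: sum.distrib) simp
  qed
  ultimately show False using i0 by linarith
qed

end

section \<open>Balanced rational normal scrolls\<close>

text \<open>If \<open>p = 0\<close>, all entries but the last vanish; otherwise consecutive entries
  have ratio q / p.\<close>

lemma geometric_progression:
  fixes x :: "nat \<Rightarrow> complex"
  assumes "p \<noteq> 0 \<or> q \<noteq> 0" "\<And>j. j < A \<Longrightarrow> p * x (Suc j) = q * x j"
  obtains u where "\<And>j. j \<le> A \<Longrightarrow> x j = u * (p ^ (A - j) * q ^ j)"
proof (cases "p = 0")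
  case True
  then have q: "q \<noteq> 0" using assms(1) by simp
  then have "x j = 0" if "j < A" for j using assms(2)[OF that] True by simp
  then have "x j = x A / q ^ A * (p ^ (A - j) * q ^ j)" if "j \<le> A" for j
    using that True q by (cases "j = A") (auto simp: power_0_left)
  then show ?thesis using that by blast
next
  case False
  have "x j = x 0 / p ^ A * (p ^ (A - j) * q ^ j)" if "j \<le> A" for j
    using that
  proof (induction j)
    case 0 then show ?case using False by simp
  next
    case (Suc j)
    have "p * x (Suc j) = q * (x 0 / p ^ A * (p ^ (A - j) * q ^ j))" using assms(2)[of j] Suc by simp
    also have "p ^ (A - j) = p * p ^ (A - Suc j)" using Suc.prems by (metis Suc_diff_Suc Suc_le_lessD power_Suc)
    finally have "p * x (Suc j) = p * (x 0 / p ^ A * (p ^ (A - Suc j) * q ^ Suc j))" by simp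
    then show ?case using False by (metis mult_left_cancel)
  qed
  then show ?thesis using that by blast
qed

text \<open>Replacing the variables by the forms \<open>g\<close> one factor at a time telescopes.
  Since \<open>d - 1\<close> is truncated, degree 0 is stated separately: there the coefficients are
  zero.\<close>

lemma hform_difference:
  assumes "finite I" "hform I d f" "\<And>k. k \<in> I \<Longrightarrow> hform I 1 (g k)"
  shows "\<exists>E. (\<forall>k\<in>I. hform I (d - 1) (E k)) \<and> (d = 0 \<longrightarrow> (\<forall>k\<in>I. \<forall>x. E k x = 0)) \<and>
    (\<forall>x. f x - f (restr I g x) = (\<Sum>k\<in>I. (x k - g k x) * E k x))"
  using assms(1,2)
proof (induction rule: hform_induct)
  case (zero d) then show ?case by (intro exI[of _ "\<lambda>_ _. 0"]) (simp add: hform_zero)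
next
  case one then show ?case by (intro exI[of _ "\<lambda>_ _. 0"]) (simp add: hform_zero)
next
  case (var d f i)
  then obtain E where E: "\<forall>k\<in>I. hform I (d - 1) (E k)" "d = 0 \<longrightarrow> (\<forall>k\<in>I. \<forall>x. E k x = 0)"
    "\<forall>x. f x - f (restr I g x) = (\<Sum>k\<in>I. (x k - g k x) * E k x)" by blast
  let ?E = "\<lambda>k x. (if k = i then f x else 0) + g i x * E k x"
  have "hform I d (?E k)" if k: "k \<in> I" for k
  proof (rule hform_add)
    show "hform I d (\<lambda>x. if k = i then f x else 0)" using var(2) hform_zero by (cases "k = i") auto
    show "hform I d (\<lambda>x. g i x * E k x)"
    proof (cases d)
      case 0 then show ?thesis using E(2) k hform_zero by simp
    next
      case (Suc d')
      then show ?thesis using hform_mult[OF assms(1) assms(3)[OF var(1)], of d' "E k"] E(1) k by simp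
    qed
  qed
  moreover have "x i * f x - restr I g x i * f (restr I g x) = (\<Sum>k\<in>I. (x k - g k x) * ?E k x)" for x
  proof -
    have "(\<Sum>k\<in>I. (x k - g k x) * ?E k x) = (\<Sum>k\<in>I. (if k = i then (x i - g i x) * f x else 0) + g i x * ((x k - g k x) * E k x))"
      by (intro sum.cong) (auto simp: algebra_simps)
    also have "\<dots> = (x i - g i x) * f x + g i x * (f x - f (restr I g x))"
      using assms(1) var(1) E(3) by (simp add: sum.distrib sum_distrib_left)
    finally show ?thesis using var(1) by (simp add: restr_def algebra_simps)
  qed
  ultimately show ?case by (intro exI[of _ ?E]) auto
next
  case (add d f1 f2)
  obtain E1 where E1: "\<forall>k\<in>I. hform I (d - 1) (E1 k)" "d = 0 \<longrightarrow> (\<forall>k\<in>I. \<forall>x. E1 k x = 0)"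
    "\<forall>x. f1 x - f1 (restr I g x) = (\<Sum>k\<in>I. (x k - g k x) * E1 k x)" using add(3) by blast
  obtain E2 where E2: "\<forall>k\<in>I. hform I (d - 1) (E2 k)" "d = 0 \<longrightarrow> (\<forall>k\<in>I. \<forall>x. E2 k x = 0)"
    "\<forall>x. f2 x - f2 (restr I g x) = (\<Sum>k\<in>I. (x k - g k x) * E2 k x)" using add(4) by blast
  have "f1 x + f2 x - (f1 (restr I g x) + f2 (restr I g x)) = (\<Sum>k\<in>I. (x k - g k x) * (E1 k x + E2 k x))" for x
  proof -
    have "f1 x + f2 x - (f1 (restr I g x) + f2 (restr I g x)) = (f1 x - f1 (restr I g x)) + (f2 x - f2 (restr I g x))" by simp
    then show ?thesis unfolding E1(3)[rule_format] E2(3)[rule_format] by (simp add: distrib_left sum.distrib)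
  qed
  then show ?case using E1 E2 by (intro exI[of _ "\<lambda>k x. E1 k x + E2 k x"]) (auto intro: hform_add)
next
  case (cmult d f c)
  then obtain E where E: "\<forall>k\<in>I. hform I (d - 1) (E k)" "d = 0 \<longrightarrow> (\<forall>k\<in>I. \<forall>x. E k x = 0)"
    "\<forall>x. f x - f (restr I g x) = (\<Sum>k\<in>I. (x k - g k x) * E k x)" by blast
  have "c * f x - c * f (restr I g x) = (\<Sum>k\<in>I. (x k - g k x) * (c * E k x))" for x
    using E(3)[rule_format, of x] by (simp add: right_diff_distrib[symmetric] sum_distrib_left mult.left_commute)
  then show ?case using E by (intro exI[of _ "\<lambda>k x. c * E k x"]) (auto intro: hform_cmult)
qed

text \<open>A scroll generated by curves of one common degree \<open>A\<close>, placed in an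
  arbitrary ambient space by independent vectors \<open>b\<close> with dual linear forms
  \<open>c\<close>. The projective line, scrolls of lines and the conic case of the dual set are
  instances.\<close>

locale scroll_frame =
  fixes I :: "'i set" and S :: "nat set" and A :: nat and b c :: "nat \<Rightarrow> nat \<Rightarrow> 'i vec"
  assumes finI: "finite I" and finS: "finite S" and neS: "S \<noteq> {}" and A_pos: "A \<ge> 1"
    and b_in: "\<And>i j. i \<in> S \<Longrightarrow> j \<le> A \<Longrightarrow> b i j \<in> vecs I"
    and c_in: "\<And>i j. i \<in> S \<Longrightarrow> j \<le> A \<Longrightarrow> c i j \<in> vecs I"
    and dual: "\<And>i j k l. i \<in> S \<Longrightarrow> j \<le> A \<Longrightarrow> k \<in> S \<Longrightarrow> l \<le> A \<Longrightarrow> pair I (c i j) (b k l) = (if i = k \<and> j = l then 1 else 0)"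
begin

definition comb :: "(nat \<Rightarrow> nat \<Rightarrow> complex) \<Rightarrow> 'i vec" where
  "comb x = (\<Sum>i\<in>S. \<Sum>j\<le>A. cscale (x i j) (b i j))"

abbreviation X where "X i j w \<equiv> pair I (c i j) w"

definition sv :: "(nat \<Rightarrow> complex) \<Rightarrow> complex \<Rightarrow> complex \<Rightarrow> 'i vec" where
  "sv u p q = comb (\<lambda>i j. u i * (p ^ (A - j) * q ^ j))"

definition Y :: "'i point set" where
  "Y = {cv.span {sv u p q} | u p q. sv u p q \<noteq> 0}"

lemma comb_in [simp]: "comb x \<in> vecs I"
  unfolding comb_def by (intro cv.subspace_sum[OF subspace_vecs] cv.subspace_scale[OF subspace_vecs] b_in) auto

lemma sv_in [simp]: "sv u p q \<in> vecs I"
  by (simp add: sv_def)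

lemma comb_apply: "comb x k = (\<Sum>i\<in>S. \<Sum>j\<le>A. x i j * b i j k)"
  by (simp add: comb_def sum_fun_apply cscale_apply)

lemma comb_add: "comb x + comb y = comb (\<lambda>i j. x i j + y i j)"
  by (auto simp: fun_eq_iff plus_fun_apply comb_apply sum.distrib algebra_simps)

lemma comb_scale: "cscale t (comb x) = comb (\<lambda>i j. t * x i j)"
  by (auto simp: fun_eq_iff cscale_apply comb_apply sum_distrib_left mult_ac)

lemma comb_cong: "(\<And>i j. i \<in> S \<Longrightarrow> j \<le> A \<Longrightarrow> x i j = y i j) \<Longrightarrow> comb x = comb y"
  unfolding comb_def by (intro sum.cong) auto

lemma X_comb:
  assumes "i \<in> S" "j \<le> A" shows "X i j (comb x) = x i j"
proof -
  have "X i j (comb x) = (\<Sum>k\<in>S. \<Sum>l\<le>A. x k l * (if i = k \<and> j = l then 1 else 0))"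
    unfolding comb_def pair_sum_right pair_scale_right using assms dual by (intro sum.cong) auto
  also have "\<dots> = (\<Sum>k\<in>S. if k = i then x i j else 0)"
  proof (intro sum.cong refl)
    fix k
    show "(\<Sum>l\<le>A. x k l * (if i = k \<and> j = l then 1 else 0)) = (if k = i then x i j else 0)"
      using assms(2) by (cases "i = k") (simp_all add: if_distrib cong: if_cong)
  qed
  finally show ?thesis using assms(1) finS by simp
qed

lemma X_sv: "i \<in> S \<Longrightarrow> j \<le> A \<Longrightarrow> X i j (sv u p q) = u i * (p ^ (A - j) * q ^ j)"
  unfolding sv_def by (rule X_comb)

lemma sv_scale: "cscale t (sv u p q) = sv (\<lambda>i. t * u i) p q"
  unfolding sv_def comb_scale by (simp add: mult.assoc)

lemma sv_add: "sv u p q + sv u' p q = sv (\<lambda>i. u i + u' i) p q"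
  unfolding sv_def comb_add by (simp add: distrib_right)

lemma sv_cong: "(\<And>i. i \<in> S \<Longrightarrow> u i = u' i) \<Longrightarrow> sv u p q = sv u' p q"
  unfolding sv_def by (rule comb_cong) simp

lemma sv_homog: "sv u (t * p) (t * q) = cscale (t ^ A) (sv u p q)"
  unfolding sv_def comb_scale
proof (rule comb_cong)
  fix i j assume "j \<le> A"
  then have "t ^ A = t ^ (A - j) * t ^ j" by (simp add: power_add[symmetric])
  then show "u i * ((t * p) ^ (A - j) * (t * q) ^ j) = t ^ A * (u i * (p ^ (A - j) * q ^ j))"
    by (simp add: power_mult_distrib)
qed

lemma sv_nonzero_point: "sv u p q \<noteq> 0 \<Longrightarrow> p \<noteq> 0 \<or> q \<noteq> 0"
proof (rule ccontr)
  assume "sv u p q \<noteq> 0" "\<not> (p \<noteq> 0 \<or> q \<noteq> 0)"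
  moreover from this have "sv u p q = cscale (0 ^ A) (sv u 0 0)" using sv_homog[of u 0 0 0] by simp
  ultimately show False using A_pos by (simp add: power_0_left)
qed

lemma sv_eq_0_iff:
  assumes "p \<noteq> 0 \<or> q \<noteq> 0" shows "sv u p q = 0 \<longleftrightarrow> (\<forall>i\<in>S. u i = 0)"
proof
  assume z: "sv u p q = 0"
  show "\<forall>i\<in>S. u i = 0"
  proof
    fix i assume i: "i \<in> S"
    have "u i * p ^ A = 0" "u i * q ^ A = 0" using X_sv[OF i, of 0 u p q] X_sv[OF i, of A u p q] z by auto
    then show "u i = 0" using assms by auto
  qed
next
  assume "\<forall>i\<in>S. u i = 0"
  then have "sv u p q = sv (\<lambda>i. 0) p q" by (intro sv_cong) auto
  then show "sv u p q = 0" by (simp add: sv_def comb_def)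
qed

lemma Y_subset: "Y \<subseteq> proj_space I"
  unfolding Y_def using PP_I[OF sv_in] by blast

lemma Y_I: "sv u p q \<noteq> 0 \<Longrightarrow> cv.span {sv u p q} \<in> Y"
  unfolding Y_def by blast

lemma span_in_Y_iff:
  assumes "w \<noteq> 0" shows "cv.span {w} \<in> Y \<longleftrightarrow> (\<exists>u p q. w = sv u p q)"
proof
  assume "cv.span {w} \<in> Y"
  then obtain u p q where u: "cv.span {w} = cv.span {sv u p q}" "sv u p q \<noteq> 0" unfolding Y_def by blast
  obtain t where "w = cscale t (sv u p q)" by (rule span_single_eqD[OF u(1)[symmetric] assms])
  then show "\<exists>u p q. w = sv u p q" unfolding sv_scale by blast
qed (use assms Y_I in blast)

lemma Y_rep:
  assumes "y \<in> Y"
  obtains u p q where "rep y = sv u p q" "sv u p q \<noteq> 0" "p \<noteq> 0 \<or> q \<noteq> 0" "y = cv.span {sv u p q}"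
proof -
  have yp: "y \<in> proj_space I" using assms Y_subset by blast
  then obtain u p q where "rep y = sv u p q" using span_in_Y_iff[OF proj_rep(2)[OF yp]] proj_rep(3)[OF yp] assms by auto
  then show ?thesis using that proj_rep(2,3)[OF yp] sv_nonzero_point by metis
qed

text \<open>\<open>?F1\<close> cuts out the span of the vectors \<open>b\<close>; \<open>?F2\<close>
  consists of the 2 by 2 minors of the two-row matrix with columns (X i j, X i (j + 1)), over all
  blocks together.\<close>

lemma zclosed_Y: "zclosed I Y"
proof (rule zclosedI[OF finI Y_subset])
  let ?F1 = "{\<lambda>w. w k - (\<Sum>i\<in>S. \<Sum>j\<le>A. b i j k * X i j w) | k. k \<in> I}"
  let ?F2 = "{\<lambda>w. X i j w * X k (Suc l) w - X i (Suc j) w * X k l w | i j k l. i \<in> S \<and> k \<in> S \<and> j < A \<and> l < A}"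
  show "\<exists>d. hform I d f" if "f \<in> ?F1 \<union> ?F2" for f
  proof -
    have "hform I 1 (\<lambda>w. w k - (\<Sum>i\<in>S. \<Sum>j\<le>A. b i j k * X i j w))" if "k \<in> I" for k
      using that by (intro hform_diff hform_var hform_sum hform_cmult hform_pair finI)
    moreover have "hform I (1 + 1) (\<lambda>w. X i j w * X k (Suc l) w - X i (Suc j) w * X k l w)" for i j k l
      by (intro hform_diff hform_mult hform_pair finI)
    ultimately show ?thesis using that by blast
  qed
  show "cv.span {w} \<in> Y \<longleftrightarrow> (\<forall>f\<in>?F1 \<union> ?F2. f w = 0)" if w: "w \<in> vecs I" "w \<noteq> 0" for w
  proof
    assume "cv.span {w} \<in> Y"
    then obtain u p q where wv: "w = sv u p q" using span_in_Y_iff[OF w(2)] by blast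
    have "f w = 0" if fF: "f \<in> ?F1" for f
    proof -
      obtain k where f: "f = (\<lambda>w. w k - (\<Sum>i\<in>S. \<Sum>j\<le>A. b i j k * X i j w))" using fF by blast
      have "(\<Sum>i\<in>S. \<Sum>j\<le>A. b i j k * X i j w) = w k"
        unfolding wv by (subst (2) sv_def, subst comb_apply) (auto simp: X_sv mult.commute intro!: sum.cong)
      then show ?thesis using f by simp
    qed
    moreover have "f w = 0" if fF: "f \<in> ?F2" for f
    proof -
      obtain i j k l where f: "f = (\<lambda>w. X i j w * X k (Suc l) w - X i (Suc j) w * X k l w)" and ij: "i \<in> S" "k \<in> S" "j < A" "l < A"
        using fF by blast
      have s: "p ^ (A - j) = p * p ^ (A - Suc j)" if "j < A" for j using that by (metis Suc_diff_Suc power_Suc)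
      show ?thesis unfolding f wv using ij by (simp add: X_sv s[OF ij(3)] s[OF ij(4)])
    qed
    ultimately show "\<forall>f\<in>?F1 \<union> ?F2. f w = 0" by blast
  next
    assume *: "\<forall>f\<in>?F1 \<union> ?F2. f w = 0"
    have wc: "w = comb (\<lambda>i j. X i j w)"
    proof
      fix k
      show "w k = comb (\<lambda>i j. X i j w) k"
      proof (cases "k \<in> I")
        case True
        then have "(\<lambda>w. w k - (\<Sum>i\<in>S. \<Sum>j\<le>A. b i j k * X i j w)) \<in> ?F1 \<union> ?F2"
          by (intro UnI1 CollectI exI[of _ k] conjI refl)
        from bspec[OF * this] have "w k - (\<Sum>i\<in>S. \<Sum>j\<le>A. b i j k * X i j w) = 0" .
        then show ?thesis by (simp add: comb_apply mult.commute)
      next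
        case False
        moreover have "comb (\<lambda>i j. X i j w) k = 0" using comb_in False unfolding vecs_def by blast
        ultimately show ?thesis using w(1) unfolding vecs_def by auto
      qed
    qed
    have mn: "X i j w * X k (Suc l) w = X i (Suc j) w * X k l w" if "i \<in> S" "k \<in> S" "j < A" "l < A" for i j k l
    proof -
      have "(\<lambda>w. X i j w * X k (Suc l) w - X i (Suc j) w * X k l w) \<in> ?F1 \<union> ?F2" using that
        by (intro UnI2 CollectI exI[of _ i] exI[of _ j] exI[of _ k] exI[of _ l] conjI refl)
      from bspec[OF * this] show ?thesis by simp
    qed
    have "\<exists>k l. k \<in> S \<and> l \<le> A \<and> X k l w \<noteq> 0"
    proof (rule ccontr)
      assume "\<not> ?thesis"
      then have "comb (\<lambda>i j. X i j w) = comb (\<lambda>i j. 0)" by (intro comb_cong) auto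
      also have "\<dots> = 0" by (simp add: comb_def)
      finally show False using wc w(2) by simp
    qed
    then obtain k l where kl: "k \<in> S" "l \<le> A" "X k l w \<noteq> 0" by blast
    \<comment> \<open>Some column of the matrix is nonzero. It gives the base point (p : q), and the
      minors make every block a geometric progression belonging to it.\<close>
    obtain l' where l': "l' < A" "X k l' w \<noteq> 0 \<or> X k (Suc l') w \<noteq> 0"
    proof (cases "l < A")
      case True then show ?thesis using that kl by blast
    next
      case False
      then have "l = Suc (A - 1)" using kl A_pos by simp
      then show ?thesis using that[of "A - 1"] kl A_pos by simp
    qed
    define p where "p = X k l' w"
    define q where "q = X k (Suc l') w"
    have pq: "p \<noteq> 0 \<or> q \<noteq> 0" using l' by (simp add: p_def q_def)
    have "\<exists>u. \<forall>j\<le>A. X i j w = u * (p ^ (A - j) * q ^ j)" if i: "i \<in> S" for i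
      using geometric_progression[OF pq, of A "\<lambda>j. X i j w"] mn[OF i kl(1) _ l'(1)] unfolding p_def q_def
      by (metis mult.commute)
    then obtain u where "\<And>i j. i \<in> S \<Longrightarrow> j \<le> A \<Longrightarrow> X i j w = u i * (p ^ (A - j) * q ^ j)" by metis
    then have "comb (\<lambda>i j. X i j w) = sv u p q" unfolding sv_def by (intro comb_cong) auto
    then show "cv.span {w} \<in> Y" using span_in_Y_iff[OF w(2)] wc by metis
  qed
qed

lemma sv_polycurve:
  assumes "\<And>i. polyfun (\<lambda>z. u z i)" "polyfun p" "polyfun q" shows "polycurve (\<lambda>z. sv (u z) (p z) (q z))"
  unfolding polycurve_def sv_def comb_apply by (intro allI polyfun_intros assms)

lemma zirreducible_Y: "zirreducible I Y"
proof (rule zirreducible_if_curves[OF finI Y_subset])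
  obtain i where i: "i \<in> S" using neS by blast
  have "sv (\<lambda>_. 1) 1 0 \<noteq> 0" using sv_eq_0_iff[of 1 0] i by auto
  then show "Y \<noteq> {}" using Y_I by blast
  fix x y assume "x \<in> Y" "y \<in> Y"
  then obtain u p q u' p' q' where x: "x = cv.span {sv u p q}" "sv u p q \<noteq> 0" and y: "y = cv.span {sv u' p' q'}" "sv u' p' q' \<noteq> 0"
    unfolding Y_def by blast
  let ?g = "\<lambda>z. sv (\<lambda>i. u i + z * (u' i - u i)) (p + z * (p' - p)) (q + z * (q' - q))"
  have "polycurve ?g" by (intro sv_polycurve polyfun_intros)
  moreover have "?g 0 = sv u p q" "?g 1 = sv u' p' q'" by simp_all
  ultimately show "\<exists>\<gamma>. polycurve \<gamma> \<and> (\<forall>z. \<gamma> z \<in> vecs I) \<and> \<gamma> 0 \<noteq> 0 \<and> \<gamma> 1 \<noteq> 0 \<and>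
      x = cv.span {\<gamma> 0} \<and> y = cv.span {\<gamma> 1} \<and> (\<forall>z. \<gamma> z \<noteq> 0 \<longrightarrow> cv.span {\<gamma> z} \<in> Y)"
    using x y Y_I by (intro exI[of _ ?g]) simp
qed

text \<open>One fibre coordinate is scaled to 1 and the base point is taken in one of two charts:
  \<open>card S - 1\<close> fibre parameters and one for the base, stored as parameter 0.\<close>

lemma chain_bound_Y: assumes "proj_chain I Y k Z" shows "k \<le> card S"
proof -
  have "\<exists>f. inj_on f (S - {i}) \<and> (\<forall>y\<in>S - {i}. f y < card (S - {i}))" for i
  proof -
    from ex_bij_betw_finite_nat[of "S - {i}"] finS obtain f where "bij_betw f (S - {i}) {0..<card (S - {i})}" by blast
    then show ?thesis by (intro exI[of _ f]) (auto simp: bij_betw_def)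
  qed
  then obtain en where en: "\<And>i. inj_on (en i) (S - {i})" "\<And>i y. y \<in> S - {i} \<Longrightarrow> en i y < card (S - {i})" by metis
  define G where "G a z = sv (\<lambda>i. if i = fst a then 1 else z (Suc (en (fst a) i))) (if snd a then 1 else z 0) (if snd a then z 0 else 1)"
    for a :: "nat \<times> bool" and z
  have cS: "card S \<ge> 1" using finS neS by (simp add: Suc_leI card_gt_0_iff)
  have "\<exists>E. patched I Y (card S) E (S \<times> UNIV) G"
  proof -
    have pol: "polyparam (card S) (\<lambda>z. G a z k)" if a: "a \<in> S \<times> UNIV" and "k \<in> I" for a k
    proof -
      have pv: "polyparam (card S) (\<lambda>z. z (Suc (en (fst a) i)))" if "i \<in> S" "i \<noteq> fst a" for i
        using en(2)[of i "fst a"] that a finS cS by (intro polyparam_var) auto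
      have p0: "polyparam (card S) (\<lambda>z. z 0)" using cS by (intro polyparam_var) auto
      show ?thesis unfolding G_def sv_def comb_apply
        by (intro polyparam_sum polyparam_mult polyparam_if polyparam_const polyparam_power p0 pv) auto
    qed
    have cov: "\<exists>a\<in>S \<times> UNIV. \<exists>z. G a z \<noteq> 0 \<and> y = cv.span {G a z}" if yY: "y \<in> Y" for y
    proof -
      obtain u p q where y: "y = cv.span {sv u p q}" "sv u p q \<noteq> 0" "p \<noteq> 0 \<or> q \<noteq> 0" using Y_rep[OF yY] by metis
      obtain i where i: "i \<in> S" "u i \<noteq> 0" using sv_eq_0_iff[OF y(3)] y(2) by blast
      define ch where "ch \<longleftrightarrow> p \<noteq> 0"
      define s where "s = (if ch then p else q)"
      have s: "s \<noteq> 0" using y(3) by (auto simp: s_def ch_def)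
      define t where "t = (if ch then q / p else 0)"
      have pq: "p = s * (if ch then 1 else t)" "q = s * (if ch then t else 1)" using y(3) by (auto simp: s_def t_def ch_def)
      define z where "z k = (if k = 0 then t else u (the_inv_into (S - {i}) (en i) (k - 1)) / u i)" for k
      have "G (i, ch) z = sv (\<lambda>j. u j / u i) (if ch then 1 else t) (if ch then t else 1)"
        unfolding G_def using i the_inv_into_f_f[OF en(1)[of i]]
        by (auto simp: z_def intro!: sv_cong)
      then have G: "cscale (u i * s ^ A) (G (i, ch) z) = sv u p q"
      proof -
        assume Ge: "G (i, ch) z = sv (\<lambda>j. u j / u i) (if ch then 1 else t) (if ch then t else 1)"
        have "cscale (u i * s ^ A) (G (i, ch) z) = cscale (u i) (sv (\<lambda>j. u j / u i) p q)"
          unfolding Ge by (simp add: sv_homog[symmetric] pq[symmetric] flip: cv.scale_scale)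
        also have "\<dots> = sv u p q" unfolding sv_scale using i by (intro sv_cong) simp
        finally show ?thesis .
      qed
      then have nz: "G (i, ch) z \<noteq> 0" using y(2) by auto
      have "y = cv.span {G (i, ch) z}" using y(1) G i s span_single_scale[of "u i * s ^ A" "G (i, ch) z"] by simp
      then show ?thesis using nz i by blast
    qed
    have "finite (S \<times> (UNIV :: bool set))" using finS by simp
    from patchedI[OF finI this pol cov] show ?thesis by blast
  qed
  then show ?thesis using patched_chain_bound[OF finI _ assms] by blast
qed

definition fib :: "complex \<Rightarrow> complex \<Rightarrow> 'i vec set" where
  "fib p q = {sv u p q | u. True}"

lemma subspace_fib: "cv.subspace (fib p q)"
  unfolding cv.subspace_def
proof (intro conjI ballI allI)
  have "sv (\<lambda>_. 0) p q = 0" by (simp add: sv_def comb_def)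
  then show "0 \<in> fib p q" unfolding fib_def by (metis (mono_tags, lifting) mem_Collect_eq)
  show "x + y \<in> fib p q" if "x \<in> fib p q" "y \<in> fib p q" for x y
    using that sv_add unfolding fib_def by blast
  show "cscale t x \<in> fib p q" if "x \<in> fib p q" for t x
    using that sv_scale unfolding fib_def by blast
qed

abbreviation delta :: "nat \<Rightarrow> nat \<Rightarrow> complex" where "delta i k \<equiv> (if k = i then 1 else 0)"

lemma sv_expand: "sv u p q = (\<Sum>i\<in>S. cscale (u i) (sv (delta i) p q))"
proof -
  have "(\<Sum>i\<in>T. cscale (u i) (sv (delta i) p q)) = sv (\<lambda>k. if k \<in> T then u k else 0) p q" if "finite T" for T
    using that
  proof (induction T rule: finite_induct)
    case empty then show ?case by (simp add: sv_def comb_def)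
  next
    case (insert i T)
    then show ?case by (simp add: sv_scale sv_add) (auto intro!: sv_cong)
  qed
  from this[OF finS] show ?thesis using sv_cong[of u "\<lambda>k. if k \<in> S then u k else 0"] by simp
qed

lemma fib_span: "fib p q = cv.span ((\<lambda>i. sv (delta i) p q) ` S)"
proof
  show "fib p q \<subseteq> cv.span ((\<lambda>i. sv (delta i) p q) ` S)"
  proof
    fix x assume "x \<in> fib p q"
    then obtain u where "x = sv u p q" unfolding fib_def by blast
    then show "x \<in> cv.span ((\<lambda>i. sv (delta i) p q) ` S)"
      by (subst \<open>x = _\<close>, subst sv_expand) (intro cv.span_sum cv.span_scale cv.span_base imageI)
  qed
  show "cv.span ((\<lambda>i. sv (delta i) p q) ` S) \<subseteq> fib p q"
    by (rule cv.span_minimal[OF _ subspace_fib]) (auto simp: fib_def)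
qed

lemma dim_fib: assumes "p \<noteq> 0 \<or> q \<noteq> 0" shows "cv.dim (fib p q) = card S"
  unfolding fib_span
proof (rule dim_span_family[OF finS])
  fix t assume "(\<Sum>i\<in>S. cscale (t i) (sv (delta i) p q)) = 0"
  then show "\<forall>i\<in>S. t i = 0" using sv_expand[of t p q] sv_eq_0_iff[OF assms] by simp
qed

lemma fib_vecs: "fib p q \<subseteq> vecs I"
  by (auto simp: fib_def)

lemma PP_fib: "PP (fib p q) \<subseteq> Y"
  unfolding PP_def fib_def using Y_I by blast

lemma sv_point_unique:
  assumes "sv u p q = sv u' p' q'" "sv u p q \<noteq> 0" shows "p * q' = q * p'"
proof -
  have pq: "p \<noteq> 0 \<or> q \<noteq> 0" "p' \<noteq> 0 \<or> q' \<noteq> 0" using sv_nonzero_point assms by metis+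
  obtain i where i: "i \<in> S" "u i \<noteq> 0" using sv_eq_0_iff[OF pq(1)] assms(2) by blast
  have e: "u i * (p ^ (A - j) * q ^ j) = u' i * (p' ^ (A - j) * q' ^ j)" if "j \<le> A" for j
    using X_sv[OF i(1) that, of u p q] X_sv[OF i(1) that, of u' p' q'] assms(1) by simp
  \<comment> \<open>Two consecutive monomials are needed whose common factor is nonzero at (p, q);
    their ratio determines the base point.\<close>
  define l where "l = (if p \<noteq> 0 then 0 else A - 1)"
  have l: "l < A" "p ^ (A - 1 - l) * q ^ l \<noteq> 0" using A_pos pq(1) by (auto simp: l_def)
  have s: "x ^ (A - l) = x * x ^ (A - 1 - l)" for x :: complex using l(1) by (metis Suc_diff_Suc diff_Suc_eq_diff_pred One_nat_def power_Suc)
  define k where "k = p ^ (A - 1 - l) * q ^ l"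
  define k' where "k' = p' ^ (A - 1 - l) * q' ^ l"
  have e1: "(u i * k) * p = (u' i * k') * p'" using e[of l] l(1) s[of p] s[of p'] by (simp add: k_def k'_def mult_ac)
  have e2: "(u i * k) * q = (u' i * k') * q'" using e[of "Suc l"] l(1) by (simp add: k_def k'_def mult_ac)
  have "(u i * k) * (p * q') = (u i * k) * (q * p')" using e1 e2 by algebra
  moreover have "k \<noteq> 0" unfolding k_def by (rule l(2))
  then have "u i * k \<noteq> 0" using i(2) by simp
  ultimately show ?thesis by (metis mult_left_cancel)
qed

text \<open>A flag in one linear fibre, extended by \<open>Y\<close> itself, attains the
  bound.\<close>

lemma vdim_Y: "vdim I Y = card S"
proof -
  obtain D where D: "card S = Suc D" using finS neS by (metis card_0_eq not0_implies_Suc)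
  obtain Z where Z: "proj_chain I (PP (fib 1 0)) D Z" "Z D = PP (fib 1 0)"
    using linear_chain[OF finI subspace_fib fib_vecs, of 1 0 D] dim_fib[of 1 0] D by auto
  have n0: "sv (\<lambda>_. 1) 0 1 \<noteq> 0" using sv_eq_0_iff[of 0 1] neS by auto
  have "cv.span {sv (\<lambda>_. 1) 0 1} \<notin> PP (fib 1 0)"
  proof
    assume "cv.span {sv (\<lambda>_. 1) 0 1} \<in> PP (fib 1 0)"
    then have "sv (\<lambda>_. 1) 0 1 \<in> fib 1 0" using PP_span_iff[OF subspace_fib n0] by blast
    then obtain u where "sv (\<lambda>_. 1) 0 1 = sv u 1 0" unfolding fib_def by blast
    then show False using sv_point_unique[of "\<lambda>_. 1" 0 1 u 1 0] n0 by simp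
  qed
  then have "PP (fib 1 0) \<subset> Y" using PP_fib Y_I[OF n0] by blast
  then have "proj_chain I Y (Suc D) (Z(Suc D := Y))"
    using Z zclosed_Y zirreducible_Y by (intro proj_chain_extend[OF Z(1)]) auto
  then show ?thesis using chain_bound_Y D by (intro vdim_eqI) auto
qed

end

context scroll_frame begin

text \<open>The tangent cone is the fibre together with one vector \<open>w\<close>, the velocity of
  moving the base point. \<open>T1\<close> obtains these vectors from curves in \<open>Y\<close>;
  \<open>T2\<close> excludes all others by differentiating the equations of
  \<open>Y\<close>.\<close>

lemma smooth_Y: "smooth_variety I Y"
proof -
  have "cv.dim (tangent_cone I Y y) = vdim I Y + 1" if y: "y \<in> Y" for y
  proof -
    obtain u p q where y': "rep y = sv u p q" "sv u p q \<noteq> 0" "p \<noteq> 0 \<or> q \<noteq> 0" "y = cv.span {sv u p q}" by (rule Y_rep[OF y])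
    obtain r1 r0 where r: "p * r1 - q * r0 = 1" using complementary_vector[OF y'(3)] by blast
    define ph where "ph j z = (p + z * r0) ^ (A - j) * (q + z * r1) ^ j" for j z
    define dp where "dp j = of_nat (A - j) * p ^ (A - j - 1) * r0 * q ^ j + p ^ (A - j) * (of_nat j * q ^ (j - 1) * r1)" for j
    have dph: "((\<lambda>z. ph j (t * z)) has_field_derivative t * dp j) (at 0)" for j t
      unfolding ph_def dp_def by (auto intro!: derivative_eq_intros simp: algebra_simps)
    have dph1: "((\<lambda>z. ph j z) has_field_derivative dp j) (at 0)" for j using dph[of j 1] by simp
    \<comment> \<open>The derivative at 0 of (p + z r0) \<open>ph (Suc j) z\<close> = (q + z r1)
      \<open>ph j z\<close>; the normalisation p r1 - q r0 = 1 makes the coefficient equal to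
      1.\<close>
    have dp_rel: "p * dp (Suc j) - q * dp j = p ^ (A - 1 - j) * q ^ j" if j: "j < A" for j
    proof -
      have e: "(p + z * r0) * ph (Suc j) z = (q + z * r1) * ph j z" for z
      proof -
        have "A - j = Suc (A - Suc j)" using j by simp
        then show ?thesis by (simp add: ph_def)
      qed
      have d1: "((\<lambda>z. (p + z * r0) * ph (Suc j) z) has_field_derivative r0 * ph (Suc j) 0 + dp (Suc j) * p) (at 0)"
      proof -
        have "((\<lambda>z. p + z * r0) has_field_derivative r0) (at 0)" by (auto intro!: derivative_eq_intros)
        from DERIV_mult[OF this dph1[of "Suc j"]] show ?thesis by simp
      qed
      have d2: "((\<lambda>z. (q + z * r1) * ph j z) has_field_derivative r1 * ph j 0 + dp j * q) (at 0)"
      proof -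
        have "((\<lambda>z. q + z * r1) has_field_derivative r1) (at 0)" by (auto intro!: derivative_eq_intros)
        from DERIV_mult[OF this dph1[of j]] show ?thesis by simp
      qed
      have "r0 * ph (Suc j) 0 + dp (Suc j) * p = r1 * ph j 0 + dp j * q"
        using DERIV_unique[OF d1] d2 e by simp
      moreover have "ph (Suc j) 0 = q * (p ^ (A - 1 - j) * q ^ j)" "ph j 0 = p * (p ^ (A - 1 - j) * q ^ j)"
      proof -
        have "A - j = Suc (A - 1 - j)" "A - Suc j = A - 1 - j" using j by auto
        then show "ph (Suc j) 0 = q * (p ^ (A - 1 - j) * q ^ j)" "ph j 0 = p * (p ^ (A - 1 - j) * q ^ j)"
          by (simp_all only: ph_def power_Suc mult_ac mult_zero_left mult_zero_right add_0_right)
      qed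
      ultimately have "p * dp (Suc j) - q * dp j = (p * r1 - q * r0) * (p ^ (A - 1 - j) * q ^ j)" by (simp add: algebra_simps)
      then show ?thesis using r by simp
    qed
    define w where "w = comb (\<lambda>i j. u i * dp j)"
    have T1: "sv u' p q + cscale t w \<in> tangent_cone I Y y" for u' t
    proof -
      let ?k = "sv u' p q + cscale t w"
      have kI: "?k \<in> vecs I" by (intro cv.subspace_add[OF subspace_vecs] cv.subspace_scale[OF subspace_vecs]) (auto simp: w_def)
      have "deriv (\<lambda>z. f (rep y + cscale z ?k)) 0 = 0" if f: "hform I d f" "\<forall>q\<in>Y. f (rep q) = 0" for d f
      proof -
        obtain g where g: "\<forall>\<gamma> \<gamma>'. (\<forall>i\<in>I. \<gamma> 0 i = sv u p q i \<and> ((\<lambda>z. \<gamma> z i) has_field_derivative \<gamma>' i) (at 0)) \<longrightarrow>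
          ((\<lambda>z. f (\<gamma> z)) has_field_derivative (\<Sum>i\<in>I. g i * \<gamma>' i)) (at 0)"
          using hform_gradient[OF finI f(1), of "sv u p q"] by blast
        let ?\<gamma> = "\<lambda>z. sv (\<lambda>i. u i + z * u' i) (p + t * z * r0) (q + t * z * r1)"
        have "((\<lambda>z. ?\<gamma> z i) has_field_derivative ?k i) (at 0)" for i
        proof -
          have "((\<lambda>z. \<Sum>k\<in>S. \<Sum>j\<le>A. (u k + z * u' k) * ph j (t * z) * b k j i) has_field_derivative
              (\<Sum>k\<in>S. \<Sum>j\<le>A. (u' k * ph j 0 + (t * dp j) * u k) * b k j i)) (at 0)"
          proof (intro DERIV_sum DERIV_cmult_right)
            fix k j
            have "((\<lambda>z. u k + z * u' k) has_field_derivative u' k) (at 0)" by (auto intro!: derivative_eq_intros)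
            from DERIV_mult[OF this dph[of j t]]
            show "((\<lambda>z. (u k + z * u' k) * ph j (t * z)) has_field_derivative u' k * ph j 0 + t * dp j * u k) (at 0)" by simp
          qed
          moreover have "?\<gamma> z i = (\<Sum>k\<in>S. \<Sum>j\<le>A. (u k + z * u' k) * ph j (t * z) * b k j i)" for z
            by (simp add: sv_def comb_apply ph_def mult.assoc)
          moreover have "?k i = (\<Sum>k\<in>S. \<Sum>j\<le>A. (u' k * ph j 0 + (t * dp j) * u k) * b k j i)"
            by (simp add: vec_apply sv_def w_def comb_apply ph_def sum_distrib_left sum.distrib[symmetric] algebra_simps)
          ultimately show ?thesis by simp
        qed
        then have d1: "((\<lambda>z. f (?\<gamma> z)) has_field_derivative (\<Sum>i\<in>I. g i * ?k i)) (at 0)" using g by simp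
        have pc: "polycurve ?\<gamma>" by (intro sv_polycurve polyfun_intros)
        have "\<forall>\<^sub>F z in nhds 0. ?\<gamma> z \<noteq> 0" using polycurve_nonzero(1)[OF pc, of 0] y'(2) by simp
        then have "\<forall>\<^sub>F z in nhds 0. f (?\<gamma> z) = 0"
          by (rule eventually_mono) (use f Y_I hform_rep_span[OF finI f(1)] in blast)
        then have "((\<lambda>z. f (?\<gamma> z)) has_field_derivative 0) (at 0)"
          using DERIV_cong_ev[OF refl, of "\<lambda>z. f (?\<gamma> z)" "\<lambda>_. 0" 0 0 0] by simp
        then have "(\<Sum>i\<in>I. g i * ?k i) = 0" using d1 DERIV_unique by blast
        moreover have "((\<lambda>z. f (sv u p q + cscale z ?k)) has_field_derivative (\<Sum>i\<in>I. g i * ?k i)) (at 0)"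
        proof (rule g[rule_format], intro conjI)
          fix i
          show "(sv u p q + cscale 0 ?k) i = sv u p q i" by (simp add: vec_apply)
          show "((\<lambda>z. (sv u p q + cscale z ?k) i) has_field_derivative ?k i) (at 0)"
            unfolding plus_fun_apply[of "sv u p q"] cscale_apply[of _ ?k] by (auto intro!: derivative_eq_intros)
        qed
        ultimately show ?thesis using y'(1) by (simp add: DERIV_imp_deriv)
      qed
      then show ?thesis unfolding tangent_cone_def using kI by blast
    qed
    have Xw: "X i j w = u i * dp j" if "i \<in> S" "j \<le> A" for i j using that by (simp add: w_def X_comb)
    have Xrel: "p * X i (Suc j) (sv u' p q) - q * X i j (sv u' p q) = 0" if "i \<in> S" "j < A" for i j u'
    proof -
      have "A - j = Suc (A - Suc j)" using that by simp
      then show ?thesis using that by (simp add: X_sv)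
    qed
    obtain i0 where i0: "i0 \<in> S" "u i0 \<noteq> 0" using sv_eq_0_iff[OF y'(3)] y'(2) by blast
    define l where "l = (if p \<noteq> 0 then 0 else A - 1)"
    define \<kappa> where "\<kappa> j = p ^ (A - 1 - j) * q ^ j" for j
    have l: "l < A" "\<kappa> l \<noteq> 0" using A_pos y'(3) by (auto simp: l_def \<kappa>_def)
    have T2: "\<exists>u' t. k = sv u' p q + cscale t w" if k: "k \<in> tangent_cone I Y y" for k
    proof -
      have kI: "k \<in> vecs I" using k by (simp add: tangent_cone_def)
      have kd: "deriv (\<lambda>t. f (sv u p q + cscale t k)) 0 = 0" if "hform I d f" "\<And>v. v \<noteq> 0 \<Longrightarrow> cv.span {v} \<in> Y \<Longrightarrow> f v = 0" for d f
      proof -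
        have "\<forall>q\<in>Y. f (rep q) = 0" using that(2) Y_rep by metis
        then show ?thesis using k that(1) y'(1) unfolding tangent_cone_def by auto
      qed
      have lin: "X i j (sv u p q + cscale t k) = X i j (sv u p q) + t * X i j k" for i j t by (simp add: pair_add_right pair_scale_right)
      have kc: "k = comb (\<lambda>i j. X i j k)"
      proof
        fix m
        show "k m = comb (\<lambda>i j. X i j k) m"
        proof (cases "m \<in> I")
          case True
          let ?f = "\<lambda>w. w m - (\<Sum>i\<in>S. \<Sum>j\<le>A. b i j m * X i j w)"
          have hf: "hform I 1 ?f" using True by (intro hform_diff hform_var hform_sum hform_cmult hform_pair finI)
          have "?f v = 0" if v: "v \<noteq> 0" "cv.span {v} \<in> Y" for v
          proof -
            obtain u p q where "v = sv u p q" using span_in_Y_iff[OF v(1)] v(2) by blast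
            then show ?thesis by (subst (1) \<open>v = _\<close>, simp add: sv_def comb_apply X_comb mult.commute)
          qed
          then have "deriv (\<lambda>t. ?f (sv u p q + cscale t k)) 0 = 0" by (rule kd[OF hf])
          moreover have "?f (sv u p q + cscale t k) = ?f (sv u p q) + t * ?f k" for t
            unfolding lin by (simp add: vec_apply algebra_simps sum.distrib sum_distrib_left)
          moreover have "((\<lambda>t. ?f (sv u p q) + t * ?f k) has_field_derivative ?f k) (at 0)"
            by (rule derivative_eq_intros refl | simp)+
          ultimately have "?f k = 0" using DERIV_imp_deriv by fastforce
          then show ?thesis by (simp add: comb_apply mult.commute)
        next
          case False
          moreover have "comb (\<lambda>i j. X i j k) m = 0" using comb_in False unfolding vecs_def by blast
          ultimately show ?thesis using kI unfolding vecs_def by auto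
        qed
      qed
      \<comment> \<open>The linearised minors: the deviation of each column from the ratio (p : q)
        is proportional to that of the reference column \<open>l\<close> of block
        \<open>i0\<close>.\<close>
      have mn: "q * X i j k - p * X i (Suc j) k = - (u i * \<kappa> j * ((p * X i0 (Suc l) k - q * X i0 l k) / (u i0 * \<kappa> l)))"
        if ij: "i \<in> S" "j < A" for i j
      proof -
        let ?f = "\<lambda>w. X i j w * X i0 (Suc l) w - X i (Suc j) w * X i0 l w"
        have hf: "hform I (1 + 1) ?f" by (intro hform_diff hform_mult hform_pair finI)
        have s: "x ^ (A - j) = x * x ^ (A - 1 - j)" if "j < A" for j and x :: complex
        proof -
          have "A - j = Suc (A - 1 - j)" using that by simp
          then show ?thesis by simp
        qed
        have "?f v = 0" if v: "v \<noteq> 0" "cv.span {v} \<in> Y" for v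
        proof -
          obtain u p q where vv: "v = sv u p q" using span_in_Y_iff[OF v(1)] v(2) by blast
          show ?thesis unfolding vv using ij i0(1) l(1) by (simp add: X_sv s[OF ij(2)] s[OF l(1)])
        qed
        then have d0: "deriv (\<lambda>t. ?f (sv u p q + cscale t k)) 0 = 0" by (rule kd[OF hf])
        have x: "X i j (sv u p q) = u i * \<kappa> j * p" "X i (Suc j) (sv u p q) = u i * \<kappa> j * q"
          "X i0 l (sv u p q) = u i0 * \<kappa> l * p" "X i0 (Suc l) (sv u p q) = u i0 * \<kappa> l * q"
          using ij i0(1) l(1) by (simp_all add: X_sv s[OF ij(2)] s[OF l(1)] \<kappa>_def)
        have "((\<lambda>t. ?f (sv u p q + cscale t k)) has_field_derivative
          (u i * \<kappa> j * p * X i0 (Suc l) k + X i j k * (u i0 * \<kappa> l * q)) - (u i * \<kappa> j * q * X i0 l k + X i (Suc j) k * (u i0 * \<kappa> l * p))) (at 0)"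
          unfolding lin x by (auto intro!: derivative_eq_intros)
        then have e0: "(u i * \<kappa> j * p * X i0 (Suc l) k + X i j k * (u i0 * \<kappa> l * q)) - (u i * \<kappa> j * q * X i0 l k + X i (Suc j) k * (u i0 * \<kappa> l * p)) = 0"
          using d0 DERIV_imp_deriv by fastforce
        have C0: "u i0 * \<kappa> l \<noteq> 0" using i0 l by simp
        have "(u i0 * \<kappa> l) * (q * X i j k - p * X i (Suc j) k) = - (u i * \<kappa> j * (p * X i0 (Suc l) k - q * X i0 l k))"
          using e0 by algebra
        moreover have "x = - (y / c)" if "c \<noteq> 0" "c * x = - y" for c x y :: complex using that by (simp add: field_simps)
        ultimately have "q * X i j k - p * X i (Suc j) k = - (u i * \<kappa> j * (p * X i0 (Suc l) k - q * X i0 l k) / (u i0 * \<kappa> l))" using C0 by blast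
        then show ?thesis by simp
      qed
      \<comment> \<open>The amount of \<open>w\<close> contained in \<open>k\<close>, read off from
        the reference column; after its subtraction every block is a geometric progression belonging
        to (p : q), that is, a vector of the fibre.\<close>
      define t where "t = (p * X i0 (Suc l) k - q * X i0 l k) / (u i0 * \<kappa> l)"
      have rel: "p * (X i (Suc j) k - t * (u i * dp (Suc j))) = q * (X i j k - t * (u i * dp j))" if "i \<in> S" "j < A" for i j
      proof -
        have "q * X i j k - p * X i (Suc j) k = - (u i * \<kappa> j * t)" using mn[OF that] by (simp only: t_def)
        moreover have "p * dp (Suc j) - q * dp j = \<kappa> j" using dp_rel[OF that(2)] by (simp add: \<kappa>_def)
        ultimately show ?thesis by algebra
      qed
      have "\<exists>v. \<forall>j\<le>A. X i j k - t * (u i * dp j) = v * (p ^ (A - j) * q ^ j)" if "i \<in> S" for i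
        using geometric_progression[OF y'(3), of A "\<lambda>j. X i j k - t * (u i * dp j)"] rel[OF that] by metis
      then obtain u' where u': "\<And>i j. i \<in> S \<Longrightarrow> j \<le> A \<Longrightarrow> X i j k - t * (u i * dp j) = u' i * (p ^ (A - j) * q ^ j)" by metis
      have "k = sv u' p q + cscale t w"
      proof -
        have "sv u' p q + cscale t w = comb (\<lambda>i j. u' i * (p ^ (A - j) * q ^ j) + t * (u i * dp j))"
          by (simp add: sv_def w_def comb_scale comb_add)
        also have "\<dots> = comb (\<lambda>i j. X i j k)"
          by (rule comb_cong) (metis u' diff_add_cancel)
        finally show ?thesis using kc by simp
      qed
      then show ?thesis by blast
    qed
    have Teq: "tangent_cone I Y y = cv.span (insert w ((\<lambda>i. sv (delta i) p q) ` S))"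
    proof
      show "tangent_cone I Y y \<subseteq> cv.span (insert w ((\<lambda>i. sv (delta i) p q) ` S))"
      proof
        fix k assume "k \<in> tangent_cone I Y y"
        then obtain u' t where k: "k = sv u' p q + cscale t w" using T2 by blast
        have "sv u' p q \<in> cv.span ((\<lambda>i. sv (delta i) p q) ` S)" unfolding fib_span[symmetric] fib_def by blast
        then have "sv u' p q \<in> cv.span (insert w ((\<lambda>i. sv (delta i) p q) ` S))" using cv.span_mono by blast
        then show "k \<in> cv.span (insert w ((\<lambda>i. sv (delta i) p q) ` S))"
          unfolding k by (intro cv.span_add cv.span_scale[OF cv.span_base[OF insertI1]])
      qed
      show "cv.span (insert w ((\<lambda>i. sv (delta i) p q) ` S)) \<subseteq> tangent_cone I Y y"
      proof
        fix k assume "k \<in> cv.span (insert w ((\<lambda>i. sv (delta i) p q) ` S))"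
        then obtain t where "k - cscale t w \<in> cv.span ((\<lambda>i. sv (delta i) p q) ` S)" using cv.span_breakdown_eq by blast
        then obtain u' where "k - cscale t w = sv u' p q" unfolding fib_span[symmetric] fib_def by blast
        then have "k = sv u' p q + cscale t w" by (metis diff_add_cancel)
        then show "k \<in> tangent_cone I Y y" using T1 by simp
      qed
    qed
    have ind: "inj_on (\<lambda>i. sv (delta i) p q) S" "cv.independent ((\<lambda>i. sv (delta i) p q) ` S)"
    proof -
      have "\<forall>i\<in>S. t i = 0" if "(\<Sum>i\<in>S. cscale (t i) (sv (delta i) p q)) = 0" for t
        using that sv_expand[of t p q] sv_eq_0_iff[OF y'(3)] by simp
      then show "inj_on (\<lambda>i. sv (delta i) p q) S" "cv.independent ((\<lambda>i. sv (delta i) p q) ` S)"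
        using independent_family[OF finS, of "\<lambda>i. sv (delta i) p q"] by auto
    qed
    \<comment> \<open>Vectors of the fibre satisfy \<open>Xrel\<close>, while \<open>w\<close>
      violates it at the reference column by \<open>dp_rel\<close>.\<close>
    have wn: "w \<notin> cv.span ((\<lambda>i. sv (delta i) p q) ` S)"
    proof
      assume "w \<in> cv.span ((\<lambda>i. sv (delta i) p q) ` S)"
      then obtain u' where wu: "w = sv u' p q" unfolding fib_span[symmetric] fib_def by blast
      have "p * X i0 (Suc l) w - q * X i0 l w = u i0 * (p * dp (Suc l) - q * dp l)"
        using Xw[OF i0(1)] l(1) by (simp add: algebra_simps)
      also have "\<dots> \<noteq> 0" using dp_rel[OF l(1)] l(2) i0(2) by (simp add: \<kappa>_def)
      finally show False using Xrel[OF i0(1) l(1), of u'] wu by simp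
    qed
    have "cv.dim (tangent_cone I Y y) = card (insert w ((\<lambda>i. sv (delta i) p q) ` S))"
      unfolding Teq by (rule cv.dim_span_eq_card_independent) (use wn ind in \<open>simp add: cv.independent_insertI\<close>)
    also have "\<dots> = card S + 1"
    proof -
      have "w \<notin> (\<lambda>i. sv (delta i) p q) ` S" using wn cv.span_base[of w "(\<lambda>i. sv (delta i) p q) ` S"] by (rule contrapos_nn)
      then show ?thesis using finS card_image[OF ind(1)] by simp
    qed
    finally show ?thesis using vdim_Y by simp
  qed
  then show ?thesis using zclosed_Y zirreducible_Y finI by (simp add: smooth_variety_def projective_variety_def)
qed

section \<open>Projection to the base, reducedness of its fibres, and the isomorphism for
  curves\<close>

definition pr :: "'i point \<Rightarrow> nat point" where
  "pr y = (SOME s. \<exists>u p q. y = cv.span {sv u p q} \<and> sv u p q \<noteq> 0 \<and> s = cv.span {bv p q})"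

lemma pr_eq: assumes "sv u p q \<noteq> 0" shows "pr (cv.span {sv u p q}) = cv.span {bv p q}"
proof -
  have "\<exists>s. \<exists>u' p' q'. cv.span {sv u p q} = cv.span {sv u' p' q'} \<and> sv u' p' q' \<noteq> 0 \<and> s = cv.span {bv p' q'}"
    using assms by blast
  from someI_ex[OF this, folded pr_def] obtain u' p' q' where
    *: "cv.span {sv u p q} = cv.span {sv u' p' q'}" "sv u' p' q' \<noteq> 0" "pr (cv.span {sv u p q}) = cv.span {bv p' q'}" by blast
  obtain t where t: "t \<noteq> 0" "sv u' p' q' = cscale t (sv u p q)" by (rule span_single_eqD[OF *(1,2)])
  then have e: "sv u' p' q' = sv (\<lambda>i. t * u i) p q" by (simp add: sv_scale)
  have "p' * q = q' * p" using sv_point_unique[OF e *(2)] .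
  then have "cv.span {bv p' q'} = cv.span {bv p q}"
    using span_bv_eq_iff[OF sv_nonzero_point[OF *(2)] sv_nonzero_point[OF assms]] by simp
  then show ?thesis using *(3) by simp
qed

text \<open>The base point is read off two consecutive coordinates of one block. The index depends
  on the point, because the pair may vanish elsewhere.\<close>

lemma pr_morphism: "morphism I Y {..1::nat} (proj_space {..1}) pr"
  unfolding morphism_def
proof (intro conjI ballI)
  show "pr ` Y \<subseteq> proj_space {..1}"
  proof
    fix s assume "s \<in> pr ` Y"
    then obtain y where y: "y \<in> Y" "s = pr y" by blast
    obtain u p q where "sv u p q \<noteq> 0" "p \<noteq> 0 \<or> q \<noteq> 0" "y = cv.span {sv u p q}" by (rule Y_rep[OF y(1)])
    then show "s \<in> proj_space {..1}" using y(2) pr_eq proj1_points by auto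
  qed
  fix y assume y: "y \<in> Y"
  obtain u p q where y': "rep y = sv u p q" "sv u p q \<noteq> 0" "p \<noteq> 0 \<or> q \<noteq> 0" "y = cv.span {sv u p q}" by (rule Y_rep[OF y])
  obtain i where i: "i \<in> S" "u i \<noteq> 0" using sv_eq_0_iff[OF y'(3)] y'(2) by blast
  define l where "l = (if p \<noteq> 0 then 0 else A - 1)"
  \<comment> \<open>The index of the pair whose coordinate is nonzero at \<open>y\<close>; this
    coordinate defines the neighbourhood.\<close>
  define l' where "l' = (if p \<noteq> 0 then 0 else A)"
  have l: "l < A" "l' = l \<or> l' = Suc l" using A_pos by (auto simp: l_def l'_def)
  let ?F = "\<lambda>k::nat. if k = 0 then pair I (c i l) else pair I (c i (Suc l))"
  have hF: "\<forall>k\<in>{..1::nat}. hform I 1 (?F k)" using hform_pair[OF finI] by auto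
  have nz: "X i l' (rep y) \<noteq> 0" using i y'(1,3) A_pos by (auto simp: X_sv l'_def)
  have "nearby I Y y (\<lambda>s. pr s = cv.span {\<lambda>k. if k \<in> {..1} then ?F k (rep s) else 0})"
  proof (rule nearbyI_form[OF finI hform_pair[OF finI] _ nz _ Y_subset])
    show "y \<in> proj_space I" using y Y_subset by blast
    fix s assume s: "s \<in> Y" "X i l' (rep s) \<noteq> 0"
    obtain v x x' where s': "rep s = sv v x x'" "sv v x x' \<noteq> 0" "x \<noteq> 0 \<or> x' \<noteq> 0" "s = cv.span {sv v x x'}" by (rule Y_rep[OF s(1)])
    have e: "x ^ (A - l) = x * x ^ (A - Suc l)"
    proof -
      have "A - l = Suc (A - Suc l)" using l(1) by simp
      then show ?thesis by simp
    qed
    let ?k = "v i * (x ^ (A - Suc l) * x' ^ l)"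
    have X2: "X i l (rep s) = ?k * x" "X i (Suc l) (rep s) = ?k * x'"
      using s'(1) i(1) l(1) e by (simp_all add: X_sv)
    then have k0: "?k \<noteq> 0" using s(2) l(2) by auto
    have "(\<lambda>k. if k \<in> {..1} then ?F k (rep s) else 0) = bv (X i l (rep s)) (X i (Suc l) (rep s))"
      by (auto simp: fun_eq_iff bv_def)
    also have "\<dots> = cscale ?k (bv x x')" unfolding X2 by (simp add: bv_scale)
    finally have "cv.span {\<lambda>k. if k \<in> {..1} then ?F k (rep s) else 0} = cv.span {bv x x'}"
      using span_single_scale[OF k0, of "bv x x'"] by simp
    then show "pr s = cv.span {\<lambda>k. if k \<in> {..1} then ?F k (rep s) else 0}" using pr_eq[OF s'(2)] s'(4) by simp
  qed
  moreover have "\<exists>k\<in>{..1::nat}. ?F k (rep y) \<noteq> 0"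
  proof (cases "l' = l")
    case True then show ?thesis using nz by (intro bexI[of _ 0]) auto
  next
    case False then show ?thesis using nz l(2) by (intro bexI[of _ 1]) auto
  qed
  ultimately show "\<exists>d F. (\<forall>k\<in>{..1::nat}. hform I d (F k)) \<and> (\<exists>k\<in>{..1}. F k (rep y) \<noteq> 0) \<and>
      nearby I Y y (\<lambda>q. pr q = cv.span {\<lambda>k. if k \<in> {..1} then F k (rep q) else 0})"
    using hF by (intro exI[of _ 1] exI[of _ ?F]) blast
qed

lemma fibre_eq:
  assumes "p \<noteq> 0 \<or> q \<noteq> 0" shows "{y \<in> Y. pr y = cv.span {bv p q}} = PP (fib p q)"
proof (intro set_eqI iffI)
  fix y assume y: "y \<in> {y \<in> Y. pr y = cv.span {bv p q}}"
  then have "y \<in> Y" by simp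
  then obtain u p' q' where y': "sv u p' q' \<noteq> 0" "p' \<noteq> 0 \<or> q' \<noteq> 0" "y = cv.span {sv u p' q'}" using Y_rep by metis
  then have "cv.span {bv p q} = cv.span {bv p' q'}" using y pr_eq by simp
  then obtain t where t: "t \<noteq> 0" "bv p' q' = cscale t (bv p q)" using span_single_eqD y'(2) by (metis bv_eq_0)
  then have "sv u p' q' = sv (\<lambda>i. t ^ A * u i) p q" by (simp add: bv_scale sv_homog sv_scale)
  then have "sv u p' q' \<in> fib p q" unfolding fib_def by blast
  then show "y \<in> PP (fib p q)" using y' PP_I by blast
next
  fix y assume "y \<in> PP (fib p q)"
  then obtain u where "y = cv.span {sv u p q}" "sv u p q \<noteq> 0" unfolding PP_def fib_def by blast
  then show "y \<in> {y \<in> Y. pr y = cv.span {bv p q}}" using pr_eq Y_I by simp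
qed

text \<open>Project linearly onto the fibre over (\<alpha>, \<beta>). A point differs from its projection by a multiple of the local
  parameter t of the base, so a form vanishing on the fibre is t times a form on the scroll.\<close>

lemma reduced_fibre_Y:
  assumes "B \<in> proj_space {..1::nat}" shows "reduced_fibre I Y {..1} (proj_space {..1}) pr B"
  unfolding reduced_fibre_def
proof (intro ballI impI allI)
  fix y g assume y: "y \<in> Y" "pr y = B" and g: "regular_at I Y y g \<and> nearby I Y y (\<lambda>q. pr q = B \<longrightarrow> g q = 0)"
  obtain \<alpha> \<beta> where \<alpha>\<beta>: "\<alpha> \<noteq> 0 \<or> \<beta> \<noteq> 0" "B = cv.span {bv \<alpha> \<beta>}" using assms proj1_points by auto
  have "y \<in> PP (fib \<alpha> \<beta>)" using y \<alpha>\<beta>(2) unfolding fibre_eq[OF \<alpha>\<beta>(1), symmetric] by simp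
  then obtain u where u: "rep y = sv u \<alpha> \<beta>" "rep y \<noteq> 0" using PP_rep[OF _ subspace_fib] unfolding fib_def by blast
  have yp: "y \<in> proj_space I" using y Y_subset by blast
  obtain i0 where i0: "i0 \<in> S" "u i0 \<noteq> 0" using sv_eq_0_iff[OF \<alpha>\<beta>(1)] u by auto
  obtain r1 r0 where r: "\<alpha> * r1 - \<beta> * r0 = 1" using complementary_vector[OF \<alpha>\<beta>(1)] by blast
  \<comment> \<open>\<open>?l / ?m\<close> is a local parameter of the base at (\<alpha> : \<beta>):
    \<open>?l\<close> vanishes there and \<open>?m\<close> takes the value 1.\<close>
  let ?m = "\<lambda>p q. r1 * p - r0 * q" and ?l = "\<lambda>p q. \<alpha> * q - \<beta> * p"
  have bm: "bform 1 ?m" by (intro bform_diff bform_cmult bform_fst bform_snd)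
  have bl: "bform 1 ?l" by (intro bform_diff bform_cmult bform_fst bform_snd)
  have m1: "?m \<alpha> \<beta> = 1" using r by (simp add: algebra_simps)
  obtain A' where A': "A = Suc A'" using A_pos by (cases A) auto
  have bpow: "bform d (\<lambda>p q. f p q ^ d)" if "bform 1 f" for f d
  proof (induction d)
    case 0 then show ?case using bform_const[of 1] by simp
  next
    case (Suc d) then show ?case using bform_mult[OF that Suc] by simp
  qed
  have "\<exists>h. bform A' h \<and> (\<forall>p q. p ^ (A - j) * q ^ j - ?m p q ^ A * (\<alpha> ^ (A - j) * \<beta> ^ j) = ?l p q * h p q)" if j: "j \<le> A" for j
  proof -
    have "bform A (\<lambda>p q. p ^ (A - j) * q ^ j)" using bform_monom[of "A - j" j] j by simp
    moreover have "bform A (\<lambda>p q. (\<alpha> ^ (A - j) * \<beta> ^ j) * ?m p q ^ A)" by (rule bform_cmult[OF bpow[OF bm]])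
    ultimately have bf': "bform (Suc A') (\<lambda>p q. p ^ (A - j) * q ^ j - (\<alpha> ^ (A - j) * \<beta> ^ j) * ?m p q ^ A)" unfolding A'[symmetric] by (rule bform_diff)
    have "\<alpha> ^ (A - j) * \<beta> ^ j - (\<alpha> ^ (A - j) * \<beta> ^ j) * ?m \<alpha> \<beta> ^ A = 0" using m1 by simp
    from bform_root_factor[OF bf' this \<alpha>\<beta>(1)] show ?thesis by (metis mult.commute)
  qed
  then obtain h where h: "\<And>j. j \<le> A \<Longrightarrow> bform A' (h j)"
    "\<And>j p q. j \<le> A \<Longrightarrow> p ^ (A - j) * q ^ j - ?m p q ^ A * (\<alpha> ^ (A - j) * \<beta> ^ j) = ?l p q * h j p q" by metis
  \<comment> \<open>A binary form of degree \<open>A\<close> in the base point times a fibre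
    coordinate is a linear form on the scroll; in this way \<open>?m ^ A\<close> and
    \<open>h j * ?m\<close> become the linear forms \<open>M\<close> and \<open>N\<close>.\<close>
  obtain \<mu> where \<mu>: "\<And>p q. ?m p q ^ A = (\<Sum>l\<le>A. \<mu> l * p ^ (A - l) * q ^ l)" using bpow[OF bm, of A] unfolding bform_coeffs by blast
  have "\<exists>\<nu>. \<forall>p q. h j p q * ?m p q = (\<Sum>l\<le>A. \<nu> l * p ^ (A - l) * q ^ l)" if "j \<le> A" for j
    using bform_mult[OF h(1)[OF that] bm] unfolding bform_coeffs A' by simp
  then obtain \<nu> where \<nu>: "\<And>j p q. j \<le> A \<Longrightarrow> h j p q * ?m p q = (\<Sum>l\<le>A. \<nu> j l * p ^ (A - l) * q ^ l)" by metis
  define M where "M i x = (\<Sum>l\<le>A. \<mu> l * X i l x)" for i x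
  define G where "G k x = (\<Sum>i\<in>S. \<Sum>j\<le>A. (\<alpha> ^ (A - j) * \<beta> ^ j * b i j k) * M i x)" for k x
  define N where "N k x = (\<Sum>i\<in>S. \<Sum>j\<le>A. b i j k * (\<Sum>l\<le>A. \<nu> j l * X i l x))" for k x
  have hM: "hform I 1 (M i)" for i unfolding M_def[abs_def] by (intro hform_sum hform_cmult hform_pair finI)
  have hG: "hform I 1 (G k)" for k unfolding G_def[abs_def] by (intro hform_sum hform_cmult hM)
  have hN: "hform I 1 (N k)" for k unfolding N_def[abs_def] by (intro hform_sum hform_cmult hform_pair finI)
  have Msv: "M i (sv v p q) = v i * ?m p q ^ A" if "i \<in> S" for i v p q
    unfolding M_def \<mu> sum_distrib_left using that by (intro sum.cong) (auto simp: X_sv mult_ac)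
  have Gsv: "restr I G (sv v p q) = sv (\<lambda>i. v i * ?m p q ^ A) \<alpha> \<beta>" for v p q
  proof
    fix k
    show "restr I G (sv v p q) k = sv (\<lambda>i. v i * ?m p q ^ A) \<alpha> \<beta> k"
    proof (cases "k \<in> I")
      case True
      then show ?thesis unfolding restr_def G_def sv_def[of "\<lambda>i. v i * ?m p q ^ A"] comb_apply
        by (auto simp: Msv mult_ac intro!: sum.cong)
    next
      case False
      then show ?thesis using sv_in unfolding vecs_def restr_def by simp
    qed
  qed
  have dsv: "?m p q * (sv v p q k - G k (sv v p q)) = ?l p q * N k (sv v p q)" if "k \<in> I" for v p q k
  proof -
    have "G k (sv v p q) = sv (\<lambda>i. v i * ?m p q ^ A) \<alpha> \<beta> k" using Gsv[of v p q] that by (metis restr_def)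
    then have "sv v p q k - G k (sv v p q) = (\<Sum>i\<in>S. \<Sum>j\<le>A. (v i * (p ^ (A - j) * q ^ j) - v i * ?m p q ^ A * (\<alpha> ^ (A - j) * \<beta> ^ j)) * b i j k)"
      by (simp add: sv_def comb_apply sum_subtractf left_diff_distrib)
    also have "\<dots> = (\<Sum>i\<in>S. \<Sum>j\<le>A. (v i * (?l p q * h j p q)) * b i j k)"
    proof (intro sum.cong refl)
      fix i j assume "j \<in> {..A}"
      then have "v i * (p ^ (A - j) * q ^ j) - v i * ?m p q ^ A * (\<alpha> ^ (A - j) * \<beta> ^ j) = v i * (?l p q * h j p q)"
        using h(2)[of j p q, symmetric] by (simp add: right_diff_distrib mult.assoc)
      then show "(v i * (p ^ (A - j) * q ^ j) - v i * ?m p q ^ A * (\<alpha> ^ (A - j) * \<beta> ^ j)) * b i j k = (v i * (?l p q * h j p q)) * b i j k" by simp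
    qed
    finally have "?m p q * (sv v p q k - G k (sv v p q)) = (\<Sum>i\<in>S. \<Sum>j\<le>A. ?l p q * (b i j k * (v i * (h j p q * ?m p q))))"
      by (simp only: sum_distrib_left) (intro sum.cong refl, simp only: mult_ac)
    also have "\<dots> = (\<Sum>i\<in>S. \<Sum>j\<le>A. ?l p q * (b i j k * (\<Sum>l\<le>A. \<nu> j l * X i l (sv v p q))))"
    proof (intro sum.cong refl)
      fix i j assume ij: "i \<in> S" "j \<in> {..A}"
      have "v i * (h j p q * ?m p q) = (\<Sum>l\<le>A. \<nu> j l * X i l (sv v p q))"
        using \<nu>[of j p q] ij by (auto simp: X_sv sum_distrib_left mult_ac intro!: sum.cong)
      then show "?l p q * (b i j k * (v i * (h j p q * ?m p q))) = ?l p q * (b i j k * (\<Sum>l\<le>A. \<nu> j l * X i l (sv v p q)))" by (simp only:)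
    qed
    also have "\<dots> = ?l p q * N k (sv v p q)" unfolding N_def sum_distrib_left[of "?l p q"] ..
    finally show ?thesis .
  qed
  obtain d a a' where a: "hform I d a" "hform I d a'" "a' (rep y) \<noteq> 0" "nearby I Y y (\<lambda>q. g q = a (rep q) / a' (rep q))"
    using g unfolding regular_at_def by blast
  have nb: "nearby I Y y (\<lambda>q. (pr q = B \<longrightarrow> g q = 0) \<and> g q = a (rep q) / a' (rep q))"
    using g a(4) by (intro nearby_conj finI yp Y_subset) auto
  obtain e \<theta> where \<theta>: "hform I e \<theta>" "\<theta> (rep y) \<noteq> 0"
    "\<And>q. q \<in> Y \<Longrightarrow> \<theta> (rep q) \<noteq> 0 \<Longrightarrow> (pr q = B \<longrightarrow> g q = 0) \<and> g q = a (rep q) / a' (rep q)"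
    by (rule nearbyE_form[OF nb finI yp Y_subset]) (rule that, assumption+)
  have fibV: "fib \<alpha> \<beta> \<noteq> {0}" using u unfolding fib_def by auto
  have yf: "y \<in> PP (fib \<alpha> \<beta>)" by fact
  \<comment> \<open>The vanishing is known only near \<open>y\<close>; irreducibility of the linear
    fibre extends it to the whole fibre, where the projected points lie.\<close>
  have afib: "a (rep q) = 0" if q: "q \<in> PP (fib \<alpha> \<beta>)" for q
  proof (rule zirreducible_mult_zero[OF finI zirreducible_PP[OF finI subspace_fib fib_vecs fibV] hform_mult[OF finI \<theta>(1) a(2)] a(1) _ yf _ q])
    show "\<forall>q\<in>PP (fib \<alpha> \<beta>). \<theta> (rep q) * a' (rep q) * a (rep q) = 0"
    proof
      fix q assume q: "q \<in> PP (fib \<alpha> \<beta>)"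
      then have "q \<in> Y" "pr q = B" using fibre_eq[OF \<alpha>\<beta>(1)] \<alpha>\<beta>(2) by auto
      then show "\<theta> (rep q) * a' (rep q) * a (rep q) = 0" using \<theta>(3)[of q] by (cases "\<theta> (rep q) = 0") auto
    qed
    show "\<theta> (rep y) * a' (rep y) \<noteq> 0" using \<theta>(2) a(3) by simp
  qed
  have a0: "a (sv v \<alpha> \<beta>) = 0" if "sv v \<alpha> \<beta> \<noteq> 0" for v
  proof -
    have "cv.span {sv v \<alpha> \<beta>} \<in> PP (fib \<alpha> \<beta>)" using that by (intro PP_I) (auto simp: fib_def)
    then show ?thesis using afib hform_rep_span[OF finI a(1) that] by blast
  qed
  obtain E where E: "\<forall>k\<in>I. hform I (d - 1) (E k)" "d = 0 \<longrightarrow> (\<forall>k\<in>I. \<forall>x. E k x = 0)"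
    "\<forall>x. a x - a (restr I G x) = (\<Sum>k\<in>I. (x k - G k x) * E k x)"
    using hform_difference[OF finI a(1), of G] hG by blast
  let ?n = "\<lambda>x. \<Sum>k\<in>I. N k x * E k x"
  have hn: "hform I d ?n"
  proof (rule hform_sum)
    fix k assume k: "k \<in> I"
    show "hform I d (\<lambda>x. N k x * E k x)"
    proof (cases d)
      case 0 then show ?thesis using E(2) k hform_zero by simp
    next
      case (Suc d') then show ?thesis using hform_mult[OF finI hN, of d' "E k" k] E(1) k by simp
    qed
  qed
  define C where "C = (\<lambda>i::nat. \<lambda>q. ?n (rep q) / a' (rep q))"
  define U where "U = (\<lambda>i::nat. \<lambda>s :: nat point. ?l (rep s 0) (rep s 1) / ?m (rep s 0) (rep s 1))"
  have Bp: "B \<in> proj_space {..1::nat}" by fact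
  obtain c0 where c0: "c0 \<noteq> 0" "rep B = cscale c0 (bv \<alpha> \<beta>)"
    unfolding \<alpha>\<beta>(2) by (rule rep_span[of "bv \<alpha> \<beta>"]) (use \<alpha>\<beta>(1) in auto)
  have repB: "rep B 0 = c0 * \<alpha>" "rep B 1 = c0 * \<beta>" using c0 by (simp_all add: cscale_apply)
  have mB: "?m (rep B 0) (rep B 1) \<noteq> 0"
  proof -
    have "?m (rep B 0) (rep B 1) = c0 * ?m \<alpha> \<beta>" unfolding repB by (simp add: algebra_simps)
    then show ?thesis using c0 m1 by simp
  qed
  have Uval: "U 0 (cv.span {bv p q}) = ?l p q / ?m p q" if pq: "p \<noteq> 0 \<or> q \<noteq> 0" for p q
  proof -
    obtain t where t: "t \<noteq> 0" "rep (cv.span {bv p q}) = cscale t (bv p q)"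
      by (rule rep_span[of "bv p q"]) (use pq in auto)
    have "U 0 (cv.span {bv p q}) = (t * ?l p q) / (t * ?m p q)" unfolding U_def t(2) by (simp add: cscale_apply algebra_simps)
    then show ?thesis using t(1) by simp
  qed
  show "\<exists>(m::nat) c u. (\<forall>i<m. regular_at I Y y (c i) \<and> regular_at {..1::nat} (proj_space {..1}) B (u i) \<and> u i B = 0) \<and>
      nearby I Y y (\<lambda>q. g q = (\<Sum>i<m. c i q * u i (pr q)))"
  proof (intro exI[of _ "1::nat"] exI[of _ C] exI[of _ U] conjI allI impI)
    fix i :: nat
    show "regular_at I Y y (C i)" unfolding regular_at_def C_def
      using hn a(2,3) by (intro exI[of _ d] exI[of _ ?n] exI[of _ a'] conjI nearbyI_always[OF finI yp _ Y_subset]) auto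
    show "regular_at {..1::nat} (proj_space {..1}) B (U i)" unfolding regular_at_def U_def
      using bm bl mB unfolding bform_def
      by (intro exI[of _ "1::nat"] exI[of _ "\<lambda>v. ?l (v 0) (v 1)"] exI[of _ "\<lambda>v. ?m (v 0) (v 1)"] conjI nearbyI_always[OF finite_atMost Bp _ subset_refl]) auto
    show "U i B = 0" unfolding U_def repB by simp
    show "nearby I Y y (\<lambda>q. g q = (\<Sum>i<1. C i q * U i (pr q)))"
    proof (rule nearbyI_form[OF finI hform_mult[OF finI \<theta>(1) hM[of i0]] yp _ _ Y_subset])
      show "\<theta> (rep y) * M i0 (rep y) \<noteq> 0" using \<theta>(2) u(1) Msv[OF i0(1), of u \<alpha> \<beta>] m1 i0(2) by simp
      fix s assume s: "s \<in> Y" "\<theta> (rep s) * M i0 (rep s) \<noteq> 0"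
      obtain v p q where s': "rep s = sv v p q" "sv v p q \<noteq> 0" "p \<noteq> 0 \<or> q \<noteq> 0" "s = cv.span {sv v p q}" by (rule Y_rep[OF s(1)])
      have vm: "v i0 \<noteq> 0" "?m p q ^ A \<noteq> 0" using s(2) s'(1) Msv[OF i0(1), of v p q] by auto
      then have mpq: "?m p q \<noteq> 0" using A_pos by (metis power_eq_0_iff not_one_le_zero gr0I)
      have "sv (\<lambda>i. v i * ?m p q ^ A) \<alpha> \<beta> \<noteq> 0" using sv_eq_0_iff[OF \<alpha>\<beta>(1)] i0(1) vm by auto
      then have "a (restr I G (rep s)) = 0" unfolding s'(1) Gsv by (rule a0)
      then have "?m p q * a (rep s) = (\<Sum>k\<in>I. (?m p q * (rep s k - G k (rep s))) * E k (rep s))"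
        using E(3)[rule_format, of "rep s"] by (simp add: sum_distrib_left mult.assoc)
      also have "\<dots> = (\<Sum>k\<in>I. (?l p q * N k (rep s)) * E k (rep s))"
        unfolding s'(1) by (intro sum.cong refl) (simp only: dsv)
      also have "\<dots> = ?l p q * ?n (rep s)" by (simp add: sum_distrib_left mult.assoc)
      finally have "a (rep s) = ?l p q / ?m p q * ?n (rep s)" using mpq by (simp add: field_simps)
      moreover have "g s = a (rep s) / a' (rep s)" using \<theta>(3)[OF s(1)] s(2) by auto
      moreover have "pr s = cv.span {bv p q}" using pr_eq[OF s'(2)] s'(4) by simp
      ultimately show "g s = (\<Sum>i<1. C i s * U i (pr s))" using Uval[OF s'(3)] by (simp add: C_def mult_ac)
    qed
  qed
qed

text \<open>With a single fibre coordinate, scaling it to 1 gives an inverse by forms of degree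
  \<open>A\<close>.\<close>

lemma pr_isomorphism:
  assumes "card S = 1" shows "isomorphism I Y {..1::nat} (proj_space {..1}) pr"
proof -
  obtain i where S: "S = {i}" using assms card_1_singletonE by blast
  let ?\<psi> = "\<lambda>s :: nat point. cv.span {sv (\<lambda>_. 1) (rep s 0) (rep s 1)}"
  have nz: "sv (\<lambda>_. 1) p q \<noteq> 0" if "p \<noteq> 0 \<or> q \<noteq> 0" for p q using sv_eq_0_iff[OF that] S by auto
  have \<psi>: "?\<psi> (cv.span {bv p q}) = cv.span {sv (\<lambda>_. 1) p q}" if pq: "p \<noteq> 0 \<or> q \<noteq> 0" for p q
  proof -
    obtain t where t: "t \<noteq> 0" "rep (cv.span {bv p q}) = cscale t (bv p q)" using rep_span pq by (metis bv_eq_0)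
    then show ?thesis using span_single_scale[of "t ^ A"] by (simp add: cscale_apply sv_homog)
  qed
  have "morphism {..1::nat} (proj_space {..1}) I Y ?\<psi>"
    unfolding morphism_def
  proof (intro conjI ballI)
    show "?\<psi> ` proj_space {..1} \<subseteq> Y" unfolding proj1_points using \<psi> nz Y_I by fastforce
    fix s :: "nat point" assume s: "s \<in> proj_space {..1}"
    let ?F = "\<lambda>k v. sv (\<lambda>_. 1) (v 0) (v (1::nat)) k"
    have hF: "\<forall>k\<in>I. hform {..1::nat} A (?F k)"
    proof
      fix k
      have "bform A (\<lambda>p q. \<Sum>i\<in>S. \<Sum>j\<le>A. b i j k * (p ^ (A - j) * q ^ j))"
      proof (intro bform_sum bform_cmult)
        fix j assume "j \<in> {..A}" then show "bform A (\<lambda>p q. p ^ (A - j) * q ^ j)" using bform_monom[of "A - j" j] by simp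
      qed
      then show "hform {..1::nat} A (?F k)" unfolding bform_def by (simp add: sv_def comb_apply mult.commute)
    qed
    have ve: "(\<lambda>k. if k \<in> I then ?F k v else 0) = sv (\<lambda>_. 1) (v 0) (v 1)" for v :: "nat vec"
      using sv_in unfolding vecs_def by (auto simp: fun_eq_iff)
    have "nearby {..1::nat} (proj_space {..1}) s (\<lambda>q. ?\<psi> q = cv.span {\<lambda>k. if k \<in> I then ?F k (rep q) else 0})"
      unfolding ve by (rule nearbyI_always[OF finite_atMost s _ subset_refl]) simp
    moreover have "\<exists>k\<in>I. ?F k (rep s) \<noteq> 0"
    proof -
      have "rep s 0 \<noteq> 0 \<or> rep s 1 \<noteq> 0" using proj_rep(1,2)[OF s] bv_eta[of "rep s"] bv_eq_0[of "rep s 0" "rep s 1"] by auto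
      then have "sv (\<lambda>_. 1) (rep s 0) (rep s 1) \<noteq> 0" by (rule nz)
      then obtain k where "sv (\<lambda>_. 1) (rep s 0) (rep s 1) k \<noteq> 0" by (auto simp: fun_eq_iff vec_apply)
      moreover from this have "k \<in> I" using sv_in unfolding vecs_def by blast
      ultimately show ?thesis by blast
    qed
    ultimately show "\<exists>d F. (\<forall>k\<in>I. hform {..1::nat} d (F k)) \<and> (\<exists>k\<in>I. F k (rep s) \<noteq> 0) \<and>
        nearby {..1} (proj_space {..1}) s (\<lambda>q. ?\<psi> q = cv.span {\<lambda>k. if k \<in> I then F k (rep q) else 0})"
      using hF by (intro exI[of _ A] exI[of _ ?F]) blast
  qed
  moreover have "?\<psi> (pr y) = y" if y: "y \<in> Y" for y
  proof -
    obtain u p q where y': "sv u p q \<noteq> 0" "p \<noteq> 0 \<or> q \<noteq> 0" "y = cv.span {sv u p q}" using Y_rep[OF y] by metis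
    have ui: "u i \<noteq> 0" using sv_eq_0_iff[OF y'(2)] y'(1) S by simp
    have e: "sv u p q = cscale (u i) (sv (\<lambda>_. 1) p q)" unfolding sv_scale by (rule sv_cong) (simp add: S)
    have "pr y = cv.span {bv p q}" unfolding y'(3) by (rule pr_eq[OF y'(1)])
    then have "?\<psi> (pr y) = cv.span {sv (\<lambda>_. 1) p q}" by (simp only: \<psi>[OF y'(2)])
    also have "\<dots> = y" unfolding y'(3) e by (rule span_single_scale[OF ui, symmetric])
    finally show ?thesis .
  qed
  moreover have "pr (?\<psi> s) = s" if s: "s \<in> proj_space {..1::nat}" for s
  proof -
    obtain p q where pq: "p \<noteq> 0 \<or> q \<noteq> 0" "s = cv.span {bv p q}" using s proj1_points by auto
    then show ?thesis using \<psi> pr_eq[OF nz] by simp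
  qed
  ultimately show ?thesis unfolding isomorphism_def using pr_morphism by blast
qed

end

text \<open>A global section of the hyperplane bundle restricts to an entire function of linear growth along lines in a
  fibre and of growth A along the base, so Liouville's theorem makes it a linear form.\<close>

context scroll_frame begin

lemma section_curve:
  assumes s: "section_O1 I Y \<sigma>" and \<gamma>: "polycurve \<gamma>" "\<And>z. \<gamma> z \<in> vecs I" "\<gamma> a \<noteq> 0" "\<And>z. \<gamma> z \<noteq> 0 \<Longrightarrow> cv.span {\<gamma> z} \<in> Y"
  shows "(\<lambda>z. \<sigma> (\<gamma> z)) field_differentiable at a"
proof -
  have "cv.span {\<gamma> a} \<in> Y" using \<gamma> by blast
  then obtain d f g where fg: "hform I (Suc d) f" "hform I d g" "g (rep (cv.span {\<gamma> a})) \<noteq> 0"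
    "nearby I Y (cv.span {\<gamma> a}) (\<lambda>q. \<forall>v\<in>q - {0}. \<sigma> v = f v / g v)"
    using s unfolding section_O1_def by blast
  have ga: "g (\<gamma> a) \<noteq> 0" using fg(3) hform_rep_span[OF finI fg(2) \<gamma>(3)] by simp
  have "\<forall>\<^sub>F z in nhds a. \<gamma> z \<noteq> 0 \<and> (\<forall>v\<in>cv.span {\<gamma> z} - {0}. \<sigma> v = f v / g v)"
    by (rule nearby_curve[OF fg(4) finI \<gamma>])
  then have ev: "\<forall>\<^sub>F z in nhds a. f (\<gamma> z) / g (\<gamma> z) = \<sigma> (\<gamma> z)"
  proof eventually_elim
    case (elim z)
    then show ?case using cv.span_base[of "\<gamma> z" "{\<gamma> z}"] by auto
  qed
  have "(\<lambda>z. f (\<gamma> z)) field_differentiable at a" "(\<lambda>z. g (\<gamma> z)) field_differentiable at a"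
    using polyfun_holomorphic[OF hform_polycurve[OF finI fg(1) \<gamma>(1)], of UNIV]
      polyfun_holomorphic[OF hform_polycurve[OF finI fg(2) \<gamma>(1)], of UNIV] by (auto simp: holomorphic_on_def)
  then have "(\<lambda>z. f (\<gamma> z) / g (\<gamma> z)) field_differentiable at a" using ga by (intro derivative_intros) auto
  then obtain D where "((\<lambda>z. f (\<gamma> z) / g (\<gamma> z)) has_field_derivative D) (at a)" unfolding field_differentiable_def by blast
  then have "((\<lambda>z. \<sigma> (\<gamma> z)) has_field_derivative D) (at a)" using DERIV_cong_ev[OF refl ev refl] by simp
  then show ?thesis unfolding field_differentiable_def by blast
qed

lemma section_scale:
  assumes s: "section_O1 I Y \<sigma>" and v: "v \<noteq> 0" "cv.span {v} \<in> Y" and t: "t \<noteq> 0"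
  shows "\<sigma> (cscale t v) = t * \<sigma> v"
proof -
  obtain d f g where fg: "hform I (Suc d) f" "hform I d g" "g (rep (cv.span {v})) \<noteq> 0"
    "nearby I Y (cv.span {v}) (\<lambda>q. \<forall>v\<in>q - {0}. \<sigma> v = f v / g v)"
    using s v unfolding section_O1_def by blast
  have gv: "g v \<noteq> 0" using fg(3) hform_rep_span[OF finI fg(2) v(1)] by simp
  have *: "\<forall>w\<in>cv.span {v} - {0}. \<sigma> w = f w / g w" using nearby_self[OF fg(4) v(2)] .
  have "\<sigma> v = f v / g v" "\<sigma> (cscale t v) = f (cscale t v) / g (cscale t v)"
    using * v(1) t by (auto simp: cv.span_base cv.span_scale)
  then show ?thesis using gv t by (simp add: hform_homogeneous[OF finI fg(1)] hform_homogeneous[OF finI fg(2)])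
qed

lemma bounded_near: assumes "isCont k (0::complex)" obtains \<delta> B where "\<delta> > 0" "\<And>z. cmod z < \<delta> \<Longrightarrow> cmod (k z) \<le> B"
proof -
  have "\<forall>\<^sub>F z in nhds 0. dist (k z) (k 0) < 1"
    using assms unfolding continuous_at tendsto_iff by (simp add: eventually_nhds_conv_at)
  then obtain \<delta> where d: "\<delta> > 0" "\<forall>z. dist z 0 < \<delta> \<longrightarrow> dist (k z) (k 0) < 1" unfolding eventually_nhds_metric by blast
  have "cmod (k z) \<le> cmod (k 0) + 1" if "cmod z < \<delta>" for z
    using d(2) that norm_triangle_ineq2[of "k z" "k 0"] by (force simp: dist_norm)
  then show ?thesis using that d(1) by blast
qed

text \<open>Continuity at infinity in the coordinate 1 / z bounds \<open>h\<close> by a multiple of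
  the m-th power of the modulus, the input for Liouville's theorem.\<close>

lemma growth_bound:
  assumes "isCont k (0::complex)" "\<And>z. z \<noteq> 0 \<Longrightarrow> h z = z ^ m * k (1 / z)"
  obtains R B where "\<And>z. R \<le> cmod z \<Longrightarrow> cmod (h z) \<le> B * cmod z ^ m"
proof -
  obtain \<delta> B where d: "\<delta> > 0" "\<And>z. cmod z < \<delta> \<Longrightarrow> cmod (k z) \<le> B" by (rule bounded_near[OF assms(1)]) (rule that, assumption+)
  have "cmod (h z) \<le> B * cmod z ^ m" if z: "2 / \<delta> \<le> cmod z" for z
  proof -
    have z0: "cmod z > 0" using z d(1) by (meson divide_pos_pos less_le_trans zero_less_numeral)
    have "cmod (1 / z) < \<delta>"
    proof -
      have "2 \<le> cmod z * \<delta>" using z d(1) by (simp add: pos_divide_le_eq)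
      then have "1 < cmod z * \<delta>" by simp
      then show ?thesis using z0 by (simp add: norm_divide divide_less_eq mult.commute)
    qed
    then have "cmod (k (1 / z)) \<le> B" by (rule d(2))
    moreover have "cmod (h z) = cmod z ^ m * cmod (k (1 / z))" using assms(2)[of z] z0 by (simp add: norm_mult norm_power)
    ultimately show ?thesis using mult_left_mono[of "cmod (k (1 / z))" B "cmod z ^ m"] by (simp add: mult.commute)
  qed
  then show ?thesis using that by blast
qed

text \<open>On the line \<open>w0 + cscale z w1\<close> the section is entire of linear growth,
  hence affine in z: its constant term is the value at \<open>w0\<close>, and its slope, the limit
  at infinity, is the value at \<open>w1\<close>. The line has to avoid 0, where \<sigma> is
  unrestricted.\<close>

lemma section_add:
  assumes s: "section_O1 I Y \<sigma>" and w: "w0 \<in> fib p q" "w1 \<in> fib p q" "w1 \<noteq> 0" and ind: "\<And>z. w0 + cscale z w1 \<noteq> 0"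
  shows "\<sigma> (w0 + w1) = \<sigma> w0 + \<sigma> w1"
proof -
  have inY: "cv.span {w} \<in> Y" if "w \<in> fib p q" "w \<noteq> 0" for w using that PP_fib PP_I by blast
  have in1: "w0 + cscale z w1 \<in> fib p q" "w1 + cscale z w0 \<in> fib p q" for z
    using w by (auto intro!: cv.subspace_add cv.subspace_scale subspace_fib)
  define h where "h z = \<sigma> (w0 + cscale z w1)" for z
  define k where "k z = \<sigma> (w1 + cscale z w0)" for z
  have hd: "h field_differentiable at z" for z unfolding h_def
    by (rule section_curve[OF s polycurve_line]) (use in1 ind inY fib_vecs in blast)+
  have kd: "k field_differentiable at 0" unfolding k_def
  proof (rule section_curve[OF s polycurve_line])
    show "w1 + cscale z w0 \<in> vecs I" for z using in1(2)[of z] fib_vecs by blast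
    show "w1 + cscale 0 w0 \<noteq> 0" using w(3) by simp
    show "cv.span {w1 + cscale z w0} \<in> Y" if "w1 + cscale z w0 \<noteq> 0" for z by (rule inY[OF in1(2) that])
  qed
  have hk: "h z = z ^ 1 * k (1 / z)" if "z \<noteq> 0" for z
  proof -
    have e: "w0 + cscale z w1 = cscale z (w1 + cscale (1 / z) w0)" using that by (auto simp: fun_eq_iff vec_apply field_simps)
    then have nz: "w1 + cscale (1 / z) w0 \<noteq> 0" using ind[of z] by auto
    show ?thesis unfolding h_def k_def e using section_scale[OF s nz inY[OF in1(2) nz] that] by simp
  qed
  have kc: "isCont k 0" using kd field_differentiable_imp_continuous_at by blast
  obtain R B where B: "\<And>z. R \<le> cmod z \<Longrightarrow> cmod (h z) \<le> B * cmod z ^ 1" using growth_bound[OF kc hk] by metis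
  have "h holomorphic_on UNIV" using hd by (simp add: holomorphic_on_def)
  then have L: "h z = (\<Sum>j\<le>1. (deriv ^^ j) h 0 / fact j * z ^ j)" for z by (rule Liouville_polynomial[OF _ B])
  define t where "t = (deriv ^^ 1) h 0 / fact 1"
  have hc: "h z = h 0 + t * z" for z using L[of z] by (simp add: t_def)
  have "k z = z * h 0 + t" if "z \<noteq> 0" for z
  proof -
    have "h (1 / z) = (1 / z) * k z" using hk[of "1 / z"] that by simp
    then show ?thesis using hc[of "1 / z"] that by (simp add: field_simps)
  qed
  then have "\<forall>\<^sub>F z in at 0. k z = z * h 0 + t" by (simp add: eventually_at_filter)
  moreover have "((\<lambda>z. z * h 0 + t) \<longlongrightarrow> 0 * h 0 + t) (at 0)" by (intro tendsto_intros)
  ultimately have "(k \<longlongrightarrow> t) (at 0)" by (simp add: tendsto_cong)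
  then have "k 0 = t" using kc unfolding isCont_def using LIM_unique by blast
  then show ?thesis using hc[of 1] by (simp add: h_def k_def)
qed

lemma linearly_normal_Y: "linearly_normal I Y"
  unfolding linearly_normal_def
proof (intro allI impI)
  fix \<sigma> assume s: "section_O1 I Y \<sigma>"
  have inY: "cv.span {w} \<in> Y" if "w \<in> fib p q" "w \<noteq> 0" for w p q using that PP_fib PP_I by blast
  \<comment> \<open>Sections are not constrained at the zero vector; \<tau> assigns 0 there, as
    linearity on the fibres requires.\<close>
  define \<tau> where "\<tau> w = (if w = 0 then 0 else \<sigma> w)" for w
  have \<tau>scale: "\<tau> (cscale c w) = c * \<tau> w" if "w \<in> fib p q" for c w p q
    using section_scale[OF s _ inY[OF that], of c] by (auto simp: \<tau>_def)
  have \<tau>add: "\<tau> (w0 + w1) = \<tau> w0 + \<tau> w1" if w: "w0 \<in> fib p q" "w1 \<in> fib p q" for w0 w1 p q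
  proof (cases "w1 = 0")
    case True then show ?thesis by (simp add: \<tau>_def)
  next
    case False
    show ?thesis
    proof (cases "\<exists>z. w0 + cscale z w1 = 0")
      case True
      then obtain z where "w0 + cscale z w1 = 0" by blast
      then have e: "w0 = cscale (- z) w1" by (metis add_eq_0_iff cv.scale_minus_left minus_minus)
      then have e': "w0 + w1 = cscale (1 - z) w1" by (auto simp: fun_eq_iff vec_apply algebra_simps)
      have "\<tau> (w0 + w1) = (1 - z) * \<tau> w1" unfolding e' by (rule \<tau>scale[OF w(2)])
      moreover have "\<tau> w0 = - z * \<tau> w1" unfolding e by (rule \<tau>scale[OF w(2)])
      ultimately show ?thesis by (simp add: algebra_simps)
    next
      case nz: False
      then have n0: "w0 \<noteq> 0" "w0 + w1 \<noteq> 0" using cv.scale_zero_left[of w1] cv.scale_one[of w1] by (metis add.right_neutral)+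
      have "\<sigma> (w0 + w1) = \<sigma> w0 + \<sigma> w1" by (rule section_add[OF s w False]) (use nz in blast)
      then show ?thesis using n0 False by (simp add: \<tau>_def)
    qed
  qed
  have d_in: "sv u p q \<in> fib p q" for u p q by (auto simp: fib_def)
  have lin: "\<tau> (sv u p q) = (\<Sum>i\<in>S. u i * \<tau> (sv (delta i) p q))" for u p q
  proof -
    have "\<tau> (\<Sum>i\<in>T. cscale (u i) (sv (delta i) p q)) = (\<Sum>i\<in>T. u i * \<tau> (sv (delta i) p q))" if "finite T" for T
      using that
    proof (induction T rule: finite_induct)
      case empty then show ?case by (simp add: \<tau>_def)
    next
      case (insert i T)
      have "cscale (u i) (sv (delta i) p q) \<in> fib p q" "(\<Sum>i\<in>T. cscale (u i) (sv (delta i) p q)) \<in> fib p q"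
        using d_in by (auto intro!: cv.subspace_sum cv.subspace_scale subspace_fib)
      then show ?case using insert by (simp add: \<tau>add \<tau>scale[OF d_in])
    qed
    from this[OF finS] show ?thesis using sv_expand[of u p q] by simp
  qed
  have "\<exists>C. \<forall>p q. (p \<noteq> 0 \<or> q \<noteq> 0) \<longrightarrow> \<tau> (sv (delta i) p q) = (\<Sum>j\<le>A. C j * (p ^ (A - j) * q ^ j))" if i: "i \<in> S" for i
  proof -
    have nz: "sv (delta i) p q \<noteq> 0" if "p \<noteq> 0 \<or> q \<noteq> 0" for p q using sv_eq_0_iff[OF that] i by auto
    have hom: "\<tau> (sv (delta i) (t * p) (t * q)) = t ^ A * \<tau> (sv (delta i) p q)" for t p q
      unfolding sv_homog by (rule \<tau>scale[OF d_in])
    define h where "h z = \<sigma> (sv (delta i) 1 z)" for z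
    define k where "k z = \<sigma> (sv (delta i) z 1)" for z
    have pc: "polycurve (\<lambda>z. sv (delta i) 1 z)" "polycurve (\<lambda>z. sv (delta i) z 1)" by (intro sv_polycurve polyfun_intros)+
    have hd: "h field_differentiable at z" for z unfolding h_def
      by (rule section_curve[OF s pc(1)]) (use nz Y_I in auto)
    have kd: "k field_differentiable at 0" unfolding k_def
      by (rule section_curve[OF s pc(2)]) (use nz Y_I in auto)
    have th: "h z = \<tau> (sv (delta i) 1 z)" "k z = \<tau> (sv (delta i) z 1)" for z using nz[of 1 z] nz[of z 1] by (simp_all add: h_def k_def \<tau>_def)
    have hk: "h z = z ^ A * k (1 / z)" if "z \<noteq> 0" for z
      using hom[of z "1 / z" 1] that by (simp add: th)
    have kc: "isCont k 0" using kd field_differentiable_imp_continuous_at by blast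
    obtain R B where B: "\<And>z. R \<le> cmod z \<Longrightarrow> cmod (h z) \<le> B * cmod z ^ A" using growth_bound[OF kc hk] by metis
    have "h holomorphic_on UNIV" using hd by (simp add: holomorphic_on_def)
    then have L: "h z = (\<Sum>j\<le>A. (deriv ^^ j) h 0 / fact j * z ^ j)" for z by (rule Liouville_polynomial[OF _ B])
    define C where "C j = (deriv ^^ j) h 0 / fact j" for j
    have hC: "h z = (\<Sum>j\<le>A. C j * z ^ j)" for z using L by (simp add: C_def)
    have homC: "x ^ A * (\<Sum>j\<le>A. C j * (y / x) ^ j) = (\<Sum>j\<le>A. C j * (x ^ (A - j) * y ^ j))" if "x \<noteq> 0" for x y :: complex
      unfolding sum_distrib_left
    proof (intro sum.cong refl)
      fix j assume "j \<in> {..A}"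
      then have "x ^ A = x ^ (A - j) * x ^ j" by (simp add: power_add[symmetric])
      then show "x ^ A * (C j * (y / x) ^ j) = C j * (x ^ (A - j) * y ^ j)" using that by (simp add: power_divide)
    qed
    have p1: "\<tau> (sv (delta i) p q) = (\<Sum>j\<le>A. C j * (p ^ (A - j) * q ^ j))" if "p \<noteq> 0" for p q
    proof -
      have "\<tau> (sv (delta i) p q) = p ^ A * h (q / p)" using hom[of p 1 "q / p"] that by (simp add: th)
      then show ?thesis using homC[OF that] hC by simp
    qed
    have "k z = (\<Sum>j\<le>A. C j * (z ^ (A - j) * 1 ^ j))" if "z \<noteq> 0" for z using p1[OF that, of 1] th(2) by simp
    then have "\<forall>\<^sub>F z in at 0. k z = (\<Sum>j\<le>A. C j * (z ^ (A - j) * 1 ^ j))" by (simp add: eventually_at_filter)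
    moreover have "((\<lambda>z. \<Sum>j\<le>A. C j * (z ^ (A - j) * 1 ^ j)) \<longlongrightarrow> (\<Sum>j\<le>A. C j * (0 ^ (A - j) * 1 ^ j))) (at 0)" by (intro tendsto_intros)
    ultimately have "(k \<longlongrightarrow> (\<Sum>j\<le>A. C j * (0 ^ (A - j) * 1 ^ j))) (at 0)" by (simp add: tendsto_cong)
    then have k0: "k 0 = (\<Sum>j\<le>A. C j * (0 ^ (A - j) * 1 ^ j))" using kc unfolding isCont_def using LIM_unique by blast
    \<comment> \<open>The formula reaches the point at infinity (0 : 1) by continuity of
      \<open>k\<close> at 0.\<close>
    have p2: "\<tau> (sv (delta i) 0 q) = (\<Sum>j\<le>A. C j * (0 ^ (A - j) * q ^ j))" for q
    proof -
      have "\<tau> (sv (delta i) 0 q) = q ^ A * k 0" using hom[of q 0 1] by (simp add: th)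
      also have "\<dots> = (\<Sum>j\<le>A. C j * (0 ^ (A - j) * q ^ j))" unfolding k0 sum_distrib_left
        by (intro sum.cong refl) (auto simp: power_0_left)
      finally show ?thesis .
    qed
    show ?thesis
    proof (intro exI[of _ C] allI impI)
      fix p q :: complex
      show "\<tau> (sv (delta i) p q) = (\<Sum>j\<le>A. C j * (p ^ (A - j) * q ^ j))" using p1[of p q] p2[of q] by (cases "p = 0") auto
    qed
  qed
  then obtain C where C: "\<And>i p q. i \<in> S \<Longrightarrow> p \<noteq> 0 \<or> q \<noteq> 0 \<Longrightarrow> \<tau> (sv (delta i) p q) = (\<Sum>j\<le>A. C i j * (p ^ (A - j) * q ^ j))" by metis
  define h where "h = (\<Sum>i\<in>S. \<Sum>j\<le>A. cscale (C i j) (c i j))"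
  have "h \<in> vecs I" unfolding h_def
    by (intro cv.subspace_sum[OF subspace_vecs] cv.subspace_scale[OF subspace_vecs] c_in) auto
  moreover have "\<sigma> v = pair I h v" if v: "q \<in> Y" "v \<in> q - {0}" for q v
  proof -
    obtain u p p' where q: "q = cv.span {sv u p p'}" "sv u p p' \<noteq> 0" using v(1) unfolding Y_def by blast
    obtain t where "v = cscale t (sv u p p')" using v(2) q(1) by (auto simp: span_single)
    then have ve: "v = sv (\<lambda>i. t * u i) p p'" by (simp add: sv_scale)
    have v0: "v \<noteq> 0" using v(2) by simp
    have "\<sigma> v = \<tau> v" using v0 by (simp add: \<tau>_def)
    also have "\<dots> = (\<Sum>i\<in>S. (t * u i) * (\<Sum>j\<le>A. C i j * (p ^ (A - j) * p' ^ j)))"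
    proof -
      have "p \<noteq> 0 \<or> p' \<noteq> 0" using v0 unfolding ve by (rule sv_nonzero_point)
      then show ?thesis unfolding ve by (subst lin, intro sum.cong refl) (simp only: C)
    qed
    also have "\<dots> = pair I h v" unfolding h_def ve pair_sum_left pair_scale_left
      by (auto simp: X_sv sum_distrib_left mult_ac intro!: sum.cong)
    finally show ?thesis .
  qed
  ultimately show "\<exists>h\<in>vecs I. \<forall>q\<in>Y. \<forall>v\<in>q - {0}. \<sigma> v = pair I h v" by blast
qed

end

text \<open>The projective line is the scroll with one fibre coordinate and degree 1, so its
  smoothness and dimension are special cases.\<close>

interpretation P1: scroll_frame "{..1::nat}" "{0}" 1 "\<lambda>_ j. unitv j" "\<lambda>_ j. unitv j"
proof
  fix i j k l :: nat assume "j \<le> 1" "k \<in> {0}" "l \<le> 1" "i \<in> {0}"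
  then show "pair {..1} (unitv j) (unitv l) = (if i = k \<and> j = l then 1 else 0)"
    using pair_unitv[of "{..1::nat}" l "unitv j"] by (simp add: unitv_apply)
qed (auto intro!: unitv_in_vecs)

lemma P1_sv: "P1.sv u p q = cscale (u 0) (bv p q)"
  by (rule ext) (unfold P1.sv_def P1.comb_apply, auto simp: vec_apply unitv_def bv_def)

lemma P1_Y: "P1.Y = proj_space {..1::nat}"
proof
  show "P1.Y \<subseteq> proj_space {..1}" by (rule P1.Y_subset)
  show "proj_space {..1} \<subseteq> P1.Y"
  proof
    fix y assume "y \<in> proj_space {..1::nat}"
    then obtain a b where "a \<noteq> 0 \<or> b \<noteq> 0" "y = cv.span {bv a b}" using proj1_points by auto
    then show "y \<in> P1.Y" using P1.Y_I[of "\<lambda>_. 1" a b] by (simp add: P1_sv del: One_nat_def)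
  qed
qed

lemma smooth_curve_P1: "smooth_curve {..1} (proj_space {..1::nat})"
  using P1.smooth_Y P1.vdim_Y unfolding P1_Y smooth_curve_def by simp

lemma is_P1_P1: "is_P1 {..1} (proj_space {..1::nat})"
proof -
  have m: "morphism {..1} (proj_space {..1::nat}) {..1} (proj_space {..1}) id"
    unfolding morphism_def
  proof (intro conjI ballI)
    fix y assume y: "y \<in> proj_space {..1::nat}"
    have "hform {..1::nat} 1 (\<lambda>v. v k)" if "k \<in> {..1}" for k using that by (intro hform_var) auto
    moreover have "(\<lambda>k. if k \<in> {..1} then rep q k else 0) = rep q" if "q \<in> proj_space {..1::nat}" for q
      using proj_rep(1)[OF that] by (auto simp: vecs_def fun_eq_iff)
    then have "nearby {..1} (proj_space {..1}) y (\<lambda>q. id q = cv.span {\<lambda>k. if k \<in> {..1} then rep q k else 0})"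
      using proj_rep(3) by (intro nearbyI_always[OF finite_atMost y _ subset_refl]) simp
    moreover have "\<exists>k\<in>{..1}. rep y k \<noteq> 0" using proj_rep(1,2)[OF y] by (auto simp: vecs_def fun_eq_iff vec_apply)
    ultimately show "\<exists>d F. (\<forall>k\<in>{..1}. hform {..1::nat} d (F k)) \<and> (\<exists>k\<in>{..1}. F k (rep y) \<noteq> 0) \<and>
        nearby {..1} (proj_space {..1}) y (\<lambda>q. id q = cv.span {\<lambda>k. if k \<in> {..1} then F k (rep q) else 0})"
      by (intro exI[of _ 1] exI[of _ "\<lambda>k v. v k"]) simp
  qed simp
  then show ?thesis unfolding is_P1_def isomorphism_def by (metis id_apply)
qed

context scroll_frame begin

theorem rational_normal_scroll_Y: "rational_normal_scroll I Y"
proof -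
  have "scroll_over I Y {..1::nat} (proj_space {..1}) pr"
    unfolding scroll_over_def
  proof (intro conjI ballI impI)
    show "vdim I Y \<ge> 1" using vdim_Y finS neS by (simp add: Suc_le_eq card_gt_0_iff)
    show "isomorphism I Y {..1} (proj_space {..1}) pr" if "vdim I Y = 1" using that pr_isomorphism vdim_Y by simp
    fix B assume B: "B \<in> proj_space {..1::nat}"
    show "reduced_fibre I Y {..1} (proj_space {..1}) pr B" by (rule reduced_fibre_Y[OF B])
    obtain p q where pq: "p \<noteq> 0 \<or> q \<noteq> 0" "B = cv.span {bv p q}" using B proj1_points by auto
    show "\<exists>U. cv.subspace U \<and> cv.dim U = vdim I Y \<and> {y \<in> Y. pr y = B} = PP U"
      using subspace_fib[of p q] dim_fib[OF pq(1)] vdim_Y fibre_eq[OF pq(1)] pq(2) by (intro exI[of _ "fib p q"]) simp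
  qed (use smooth_Y smooth_curve_P1 pr_morphism in auto)
  then show ?thesis unfolding rational_normal_scroll_def using is_P1_P1 linearly_normal_Y by blast
qed

end

section \<open>Lines and conics\<close>

context rational_curves begin

text \<open>The linear inverses from \<open>line_inverse\<close> are the dual forms of a frame with
  \<open>A = 1\<close>, which supplies the Krull dimension.\<close>

lemma lines_frame:
  assumes "\<And>i. i < n \<Longrightarrow> e i = 1 \<and> r i = 1" shows "vdim I (sset {..<n}) = n"
proof -
  have "\<exists>\<alpha> \<beta>. \<alpha> \<in> vecs I \<and> \<beta> \<in> vecs I \<and> (\<forall>u p q. pair I \<alpha> (xv u p q) = u i * p) \<and> (\<forall>u p q. pair I \<beta> (xv u p q) = u i * q)"
    if "i < n" for i using line_inverse[of i] assms[OF that] that by metis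
  then obtain \<alpha> \<beta> where \<alpha>\<beta>: "\<And>i. i < n \<Longrightarrow> \<alpha> i \<in> vecs I \<and> \<beta> i \<in> vecs I"
    "\<And>i u p q. i < n \<Longrightarrow> pair I (\<alpha> i) (xv u p q) = u i * p" "\<And>i u p q. i < n \<Longrightarrow> pair I (\<beta> i) (xv u p q) = u i * q" by metis
  let ?d = "\<lambda>i k. if k = i then 1 else 0 :: complex"
  define bb where "bb i j = (if j = 0 then xv (?d i) 1 0 else xv (?d i) 0 1)" for i and j :: nat
  define cc where "cc i j = (if j = 0 then \<alpha> i else \<beta> i)" for i and j :: nat
  interpret sf: scroll_frame I "{..<n}" 1 bb cc
  proof
    show "{..<n} \<noteq> {}" using n_pos by (simp add: lessThan_empty_iff)
    fix i j k l :: nat assume "i \<in> {..<n}" "j \<le> 1" "k \<in> {..<n}" "l \<le> 1"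
    then show "pair I (cc i j) (bb k l) = (if i = k \<and> j = l then 1 else 0)"
      by (auto simp: cc_def bb_def \<alpha>\<beta>)
  qed (use \<alpha>\<beta>(1) in \<open>auto simp: bb_def cc_def\<close>)
  have "F (i, j) p q = F (i, j) 1 0 * p + F (i, j) 0 1 * q" if "i < n" "j \<le> r i" for i j p q
  proof -
    have "bform 1 (F (i, j))" using bf[OF that] assms[OF that(1)] by simp
    then obtain c where "\<forall>a b. F (i, j) a b = (\<Sum>k\<le>1. c k * a ^ (1 - k) * b ^ k)" unfolding bform_coeffs by blast
    then show ?thesis by simp
  qed
  note F1 = this
  have sv: "sf.sv u p q = xv u p q" for u p q
  proof
    fix x :: "nat \<times> nat"
    obtain k j where x: "x = (k, j)" by fastforce
    have "sf.sv u p q x = (\<Sum>i<n. u i * (p * bb i 0 x + q * bb i 1 x))"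
      unfolding sf.sv_def sf.comb_apply by (simp add: ring_distribs mult.assoc)
    also have "\<dots> = (\<Sum>i<n. if i = k then xv u p q x else 0)"
    proof (intro sum.cong refl)
      fix i assume "i \<in> {..<n}"
      show "u i * (p * bb i 0 x + q * bb i 1 x) = (if i = k then xv u p q x else 0)"
      proof (cases "i = k \<and> x \<in> I")
        case True
        then show ?thesis using F1[of k j p q] by (simp add: bb_def xv_def x mult_ac)
      next
        case False then show ?thesis by (auto simp: bb_def xv_def x)
      qed
    qed
    also have "\<dots> = xv u p q x" by (auto simp: xv_def x)
    finally show "sf.sv u p q x = xv u p q x" .
  qed
  have "sf.Y = sset {..<n}"
  proof
    show "sset {..<n} \<subseteq> sf.Y" unfolding sf.Y_def sset_def sv by blast
    show "sf.Y \<subseteq> sset {..<n}"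
    proof
      fix y assume "y \<in> sf.Y"
      then obtain u p q where y: "y = cv.span {xv u p q}" "xv u p q \<noteq> 0" unfolding sf.Y_def sv by blast
      have "xv u p q = xv (\<lambda>i. if i < n then u i else 0) p q" by (rule xv_cong) simp
      then show "y \<in> sset {..<n}" using y unfolding sset_def
        by (intro CollectI exI[of _ "\<lambda>i. if i < n then u i else 0"] exI[of _ p] exI[of _ q]) simp
    qed
  qed
  then show ?thesis using sf.vdim_Y by simp
qed

text \<open>There are \<open>2 * n\<close> coordinates, so an osculating space has dimension at most
  \<open>2 * n - 1\<close>, below the generic value \<open>2 * n\<close>.\<close>

lemma inflectional_locus_lines:
  assumes "\<And>i. i < n \<Longrightarrow> e i = 1 \<and> r i = 1" shows "inflectional_locus I (sset {..<n}) 2 = sset {..<n}"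
proof -
  have "ldim (Osc I (sset {..<n}) 2 y) < int (vdim I (sset {..<n}) * 2)" for y
  proof -
    have "\<Union>(Osc I (sset {..<n}) 2 y) \<subseteq> vecs I"
      unfolding Osc_def PP_def by (auto simp: span_single cv.subspace_scale[OF subspace_vecs])
    then have "cv.dim (\<Union>(Osc I (sset {..<n}) 2 y)) \<le> card I"
      using dim_mono_vecs[OF fin subset_refl] dim_vecs[OF fin] by metis
    moreover have "card I = 2 * n" unfolding card_I using assms by simp
    ultimately show ?thesis using lines_frame[OF assms] unfolding ldim_def by simp
  qed
  then show ?thesis unfolding inflectional_locus_def by auto
qed

lemma pf_injective:
  assumes "i < n" "\<And>a b. pf i h a b = pf i k a b" "j \<le> r i" shows "h (i, j) = k (i, j)"
proof -
  have "(\<Sum>j\<le>r i. (h (i, j) - k (i, j)) * F (i, j) a b) = 0" for a b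
    using assms(2)[of a b] by (simp add: pf_def sum_subtractf left_diff_distrib)
  then show ?thesis using nd[OF assms(1), of "\<lambda>j. h (i, j) - k (i, j)"] assms(3) by simp
qed

text \<open>Two conditions on three coefficients leave a nonzero \<open>h\<close> with a double
  root; its cofactor is a nonzero constant, which is scaled to 1.\<close>

lemma conic_vector:
  assumes i: "i < n" "e i = 2" "r i = 2" and ab: "a \<noteq> 0 \<or> b \<noteq> 0"
  shows "\<exists>h\<in>vecs (blk r i). \<forall>x y. pf i h x y = (a * y - b * x)\<^sup>2"
proof -
  let ?J = "blk r i"
  have J: "finite ?J" "card ?J = 3" using i(3) by (auto simp: blk_def)
  let ?v = "\<lambda>D. (\<lambda>x. if x \<in> ?J then D (F x) a b else 0) :: (nat \<times> nat) vec"
  have cS: "card {?v D0, ?v D1} < card ?J" using J(2) card_insert_le_m1[of 2 "{?v D1}" "?v D0"] by simp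
  have fS: "finite {?v D0, ?v D1}" by simp
  obtain h where h: "h \<in> vecs ?J" "h \<noteq> 0" "\<forall>v\<in>{?v D0, ?v D1}. pair ?J v h = 0"
    by (rule exists_nonzero_in_annihilator[OF J(1) fS cS])
  have pr: "pair ?J (\<lambda>x. if x \<in> ?J then D (F x) a b else 0) h = (\<Sum>j\<le>r i. h (i, j) * D (F (i, j)) a b)"
    for D :: "(complex \<Rightarrow> complex \<Rightarrow> complex) \<Rightarrow> complex \<Rightarrow> complex \<Rightarrow> complex"
  proof -
    have "pair ?J (\<lambda>x. if x \<in> ?J then D (F x) a b else 0) h = (\<Sum>x\<in>Pair i ` {..r i}. h x * D (F x) a b)"
      unfolding pair_def by (rule sum.cong) (auto simp: blk_def)
    then show ?thesis by (simp add: sum.reindex inj_on_def)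
  qed
  have "droot (pf i h) a b" unfolding droot_iff[OF i(1)] D0_pf[OF i(1)] D1_pf[OF i(1)]
    using h(3) pr[of D0] pr[of D1] by simp
  then obtain g where g: "bform (e i - 2) g" "\<And>x y. pf i h x y = (a * y - b * x)\<^sup>2 * g x y"
    using droot_factor[OF bform_pf[OF i(1)] _ ab] by blast
  then obtain t where t: "\<And>x y. g x y = t" using bform_coeffs[of 0 g] i(2) by auto
  have "t \<noteq> 0"
  proof
    assume "t = 0"
    then have "pf i h x y = pf i 0 x y" for x y using g(2) t by (simp add: pf_def vec_apply)
    then have "h (i, j) = 0" if "j \<le> r i" for j using pf_injective[OF i(1), of h 0 j] that by (simp add: vec_apply)
    moreover have "h x = 0" if "x \<notin> ?J" for x using h(1) that unfolding vecs_def by blast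
    ultimately have "h x = 0" for x by (cases "x \<in> ?J") (auto simp: blk_def)
    then show False using h(2) by (simp add: fun_eq_iff zero_fun_apply)
  qed
  then have "\<forall>x y. pf i (cscale (1 / t) h) x y = (a * y - b * x)\<^sup>2" using g(2) t by (simp add: pf_scale)
  moreover have "cscale (1 / t) h \<in> vecs ?J" using h(1) by (rule cv.subspace_scale[OF subspace_vecs])
  ultimately show ?thesis by blast
qed

text \<open>The quadratic form with a double root at (a, b) is (a y - b x)^2 = a^2 y^2 + a b (-2 x y) + b^2 x^2; the dual
  frame reads off these coefficients by evaluation at three points.\<close>

lemma Dset_conics:
  assumes e12: "\<And>i. i < n \<Longrightarrow> (e i = 1 \<and> r i = 1) \<or> (e i = 2 \<and> r i = 2)" and ex: "\<exists>i<n. e i = 2"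
  shows "rational_normal_scroll I Dset"
proof -
  define S where "S = {i. i < n \<and> e i = 2}"
  have S: "i < n" "e i = 2" "r i = 2" if "i \<in> S" for i using that e12[of i] by (auto simp: S_def)
  have "\<exists>h. h \<in> vecs (blk r i) \<and> (\<forall>x y. pf i h x y = (a * y - b * x)\<^sup>2)" if "i \<in> S" "a \<noteq> 0 \<or> b \<noteq> 0" for i a b
    using conic_vector[OF S[OF that(1)] that(2)] by blast
  then obtain H where H: "\<And>i a b. i \<in> S \<Longrightarrow> a \<noteq> 0 \<or> b \<noteq> 0 \<Longrightarrow> H i a b \<in> vecs (blk r i) \<and> (\<forall>x y. pf i (H i a b) x y = (a * y - b * x)\<^sup>2)"
    by metis
  define bb where "bb i j = (if j = 0 then H i 1 0 else if j = 1 then H i 1 1 - H i 1 0 - H i 0 1 else H i 0 1)" for i and j :: nat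
  let ?d = "\<lambda>i k. if k = i then 1 else 0 :: complex"
  \<comment> \<open>The value at (1, 1) minus those at (1, 0) and (0, 1) is the coefficient of x y;
    the factor - 1 / 2 turns it into the coefficient of - 2 x y.\<close>
  define cc where "cc i j = (if j = 0 then xv (?d i) 0 1
    else if j = 1 then cscale (- 1 / 2) (xv (?d i) 1 1 - xv (?d i) 1 0 - xv (?d i) 0 1) else xv (?d i) 1 0)" for i and j :: nat
  have pfd: "pf i (h - k) x y = pf i h x y - pf i k x y" for i h k x y
    by (simp add: pf_def sum_subtractf left_diff_distrib)
  have pfa: "pf i (h + k) x y = pf i h x y + pf i k x y" for i h k x y
    by (simp add: pf_def vec_apply sum.distrib ring_distribs)
  have bbv: "bb i j \<in> vecs (blk r i)" if "i \<in> S" for i j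
    using H[OF that, of 1 0] H[OF that, of 0 1] H[OF that, of 1 1]
    by (auto simp: bb_def intro!: cv.subspace_diff subspace_vecs)
  have pbb: "pf i (bb i j) x y = (if j = 0 then y\<^sup>2 else if j = 1 then - 2 * x * y else x\<^sup>2)" if "i \<in> S" for i j x y
    using H[OF that, of 1 0] H[OF that, of 0 1] H[OF that, of 1 1]
    by (auto simp: bb_def pfd pfa power2_eq_square algebra_simps)
  have pbb0: "pf k (bb i j) x y = 0" if "i \<in> S" "k \<noteq> i" for i j k x y
  proof -
    have "(k, l) \<notin> blk r i" for l using that(2) by (auto simp: blk_def)
    then have "bb i j (k, l) = 0" for l using bbv[OF that(1), of j] unfolding vecs_def by blast
    then show ?thesis by (simp add: pf_def)
  qed
  have pd: "pair I (xv (?d i) p q) h = pf i h p q" if "i < n" for i p q h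
    using that unfolding pair_commute[of I "xv _ _ _"] pair_xv by (simp add: if_distrib[of "\<lambda>c. c * _"] cong: if_cong)
  interpret sf: scroll_frame I S 2 bb cc
  proof
    show "S \<noteq> {}" using ex by (auto simp: S_def)
    show "finite S" by (simp add: S_def)
    show "bb i j \<in> vecs I" if "i \<in> S" for i j using bbv[OF that] blk_subset[OF S(1)[OF that]] by blast
    show "cc i j \<in> vecs I" for i j by (auto simp: cc_def intro!: cv.subspace_neg cv.subspace_diff cv.subspace_scale subspace_vecs)
    fix i j k l :: nat assume i: "i \<in> S" and j: "j \<le> 2" and k: "k \<in> S" and l: "l \<le> 2"
    have c: "pair I (cc i j) h = (if j = 0 then pf i h 0 1 else if j = 1 then - 1 / 2 * (pf i h 1 1 - pf i h 1 0 - pf i h 0 1) else pf i h 1 0)" for h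
      unfolding cc_def by (simp only: if_distrib[of "\<lambda>v. pair I v h"] pair_scale_left pair_diff_left pd[OF S(1)[OF i]])
    show "pair I (cc i j) (bb k l) = (if i = k \<and> j = l then 1 else 0)"
    proof (cases "i = k")
      case True
      then show ?thesis unfolding c using pbb[OF i] j l by (auto simp: le_Suc_eq numeral_2_eq_2)
    next
      case False
      then show ?thesis unfolding c using pbb0[OF k] by simp
    qed
  qed simp_all
  have psv: "pf i (sf.sv u a b) x y = (if i \<in> S then u i * (a * y - b * x)\<^sup>2 else 0)" if "i < n" for i u a b x y
  proof -
    have sp: "pf i (\<Sum>k\<in>T. f k) x y = (\<Sum>k\<in>T. pf i (f k) x y)" for T :: "nat set" and f
      by (induction T rule: infinite_finite_induct) (simp_all add: pf_add, simp_all add: pf_def vec_apply)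
    have "pf i (sf.sv u a b) x y = (\<Sum>k\<in>S. \<Sum>j\<le>2. u k * (a ^ (2 - j) * b ^ j) * pf i (bb k j) x y)"
      unfolding sf.sv_def sf.comb_def by (simp only: sp pf_scale)
    also have "\<dots> = (\<Sum>k\<in>S. if k = i then u i * (a * y - b * x)\<^sup>2 else 0)"
    proof (intro sum.cong refl)
      fix k assume k: "k \<in> S"
      show "(\<Sum>j\<le>2. u k * (a ^ (2 - j) * b ^ j) * pf i (bb k j) x y) = (if k = i then u i * (a * y - b * x)\<^sup>2 else 0)"
      proof (cases "k = i")
        case True
        then show ?thesis using pbb[OF k] by (simp add: numeral_2_eq_2 power2_eq_square algebra_simps)
      next
        case False
        then show ?thesis using pbb0[OF k, of i] by simp
      qed
    qed
    also have "\<dots> = (if i \<in> S then u i * (a * y - b * x)\<^sup>2 else 0)" using sf.finS by simp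
    finally show ?thesis .
  qed
  have "Dset = sf.Y"
  proof (intro set_eqI iffI)
    fix \<eta> assume "\<eta> \<in> Dset"
    then obtain a b where \<eta>: "\<eta> \<in> proj_space I" "a \<noteq> 0 \<or> b \<noteq> 0" "\<And>i. i < n \<Longrightarrow> droot (pf i (rep \<eta>)) a b" unfolding Dset_def by blast
    have h: "rep \<eta> \<in> vecs I" "rep \<eta> \<noteq> 0" "\<eta> = cv.span {rep \<eta>}" using proj_rep[OF \<eta>(1)] by auto
    have "\<exists>t. \<forall>x y. pf i (rep \<eta>) x y = t * (a * y - b * x)\<^sup>2" if i: "i \<in> S" for i
    proof -
      obtain g where g: "bform (e i - 2) g" "\<And>x y. pf i (rep \<eta>) x y = (a * y - b * x)\<^sup>2 * g x y"
        using droot_factor[OF bform_pf[OF S(1)[OF i]] \<eta>(3)[OF S(1)[OF i]] \<eta>(2)] by blast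
      then obtain t where "\<And>x y. g x y = t" using bform_coeffs[of 0 g] S(2)[OF i] by auto
      then show ?thesis using g(2) by (auto simp: mult.commute)
    qed
    then obtain u where u: "\<And>i x y. i \<in> S \<Longrightarrow> pf i (rep \<eta>) x y = u i * (a * y - b * x)\<^sup>2" by metis
    have "pf i (rep \<eta>) x y = pf i (sf.sv u a b) x y" if i: "i < n" for i x y
    proof (cases "i \<in> S")
      case True then show ?thesis using u psv[OF i] by simp
    next
      case False
      then have "e i = 1" using e12[OF i] i by (auto simp: S_def)
      \<comment> \<open>On a line, the double root makes the pulled back linear form zero.\<close>
      then have "pf i (rep \<eta>) x y = 0" using droot_linear[of "pf i (rep \<eta>)"] bform_pf[OF i] \<eta>(3)[OF i] by simp
      then show ?thesis using psv[OF i] False by simp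
    qed
    then have "rep \<eta> (i, j) = sf.sv u a b (i, j)" if "i < n" "j \<le> r i" for i j using pf_injective[OF that(1) _ that(2)] that by blast
    then have "rep \<eta> x = sf.sv u a b x" if "x \<in> I" for x using that by (cases x) auto
    moreover have "rep \<eta> x = sf.sv u a b x" if "x \<notin> I" for x using h(1) sf.sv_in[of u a b] that unfolding vecs_def by (cases x) simp
    ultimately have "rep \<eta> = sf.sv u a b" by (intro ext) blast
    then show "\<eta> \<in> sf.Y" using sf.Y_I[of u a b] h by simp
  next
    fix \<eta> assume "\<eta> \<in> sf.Y"
    then obtain u a b where \<eta>: "\<eta> = cv.span {sf.sv u a b}" "sf.sv u a b \<noteq> 0" unfolding sf.Y_def by blast
    have "droot (pf i (sf.sv u a b)) a b" if "i < n" for i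
    proof (rule droot_of_factor[of 0 "\<lambda>_ _. if i \<in> S then u i else 0"])
      show "bform 0 (\<lambda>_ _. if i \<in> S then u i else 0)" by (rule bform_const)
      show "pf i (sf.sv u a b) x y = (a * y - b * x)\<^sup>2 * (if i \<in> S then u i else 0)" for x y using psv[OF that] by simp
    qed
    then show "\<eta> \<in> Dset" using in_Dset_iff[OF sf.sv_in \<eta>(2)] sf.sv_nonzero_point[OF \<eta>(2)] \<eta>(1) by blast
  qed
  then show ?thesis using sf.rational_normal_scroll_Y by simp
qed

end

text \<open>Packages the conclusions of \<open>embedding_param\<close>, so that the degree and the
  forms can be chosen for all blocks at once.\<close>

definition parametrized :: "'k set \<Rightarrow> (nat point \<Rightarrow> 'k point) \<Rightarrow> nat \<Rightarrow> ('k \<Rightarrow> complex \<Rightarrow> complex \<Rightarrow> complex) \<Rightarrow> bool" where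
  "parametrized J \<theta> e F \<longleftrightarrow> (\<forall>j\<in>J. bform e (F j)) \<and>
    (\<forall>a b. a \<noteq> 0 \<or> b \<noteq> 0 \<longrightarrow> bvec J F a b \<noteq> 0) \<and>
    (\<forall>a b. a \<noteq> 0 \<or> b \<noteq> 0 \<longrightarrow> \<theta> (cv.span {bv a b}) = cv.span {bvec J F a b}) \<and>
    (\<forall>a b c d. a \<noteq> 0 \<or> b \<noteq> 0 \<longrightarrow> c \<noteq> 0 \<or> d \<noteq> 0 \<longrightarrow> cv.span {bvec J F a b} = cv.span {bvec J F c d}
       \<longrightarrow> cv.span {bv a b} = cv.span {bv c d}) \<and>
    (\<forall>a b x y. a \<noteq> 0 \<or> b \<noteq> 0 \<longrightarrow> (\<forall>j\<in>J. x * D0 (F j) a b + y * D1 (F j) a b = 0) \<longrightarrow> x = 0 \<and> y = 0) \<and>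
    (\<forall>h. (\<forall>a b. pair J h (bvec J F a b) = 0) \<longrightarrow> (\<forall>j\<in>J. h j = 0))"

theorem theorem4p7:
  fixes n :: nat and r d :: "nat \<Rightarrow> nat" and K :: "nat set" and C :: "nat point set"
    and \<phi> :: "nat \<Rightarrow> nat point \<Rightarrow> (nat \<times> nat) point" and X G :: "(nat \<times> nat) point set"
  assumes "decomposable_scroll_data K C n r \<phi>"
    and "X = generated_scroll C \<phi> {..<n}"
    and "inflectional_locus (amb n r) X 2 \<noteq> X"
    and "\<And>i. i < n \<Longrightarrow> d i = curve_degree (blk r i) (\<phi> i ` C)"
    and "type2_component K C n r \<phi> G"
  shows "rational_normal_scroll (amb n r) (osculating_hyperplanes (amb n r) X G) \<longleftrightarrow>
    (\<exists>\<tau> s. \<tau> permutes {..<n} \<and> 1 \<le> s \<and> s \<le> n \<and>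
       (\<forall>i<s. d (\<tau> i) = 1) \<and> (\<forall>i\<in>{s..<n}. d (\<tau> i) = 2))"
proof -
  have n1: "n \<ge> 1" and sc: "smooth_curve K C" and emb: "\<And>i. i < n \<Longrightarrow> closed_embedding K C (blk r i) (\<phi> i)"
    and nondeg: "\<And>i. i < n \<Longrightarrow> lspan (\<phi> i ` C) = proj_space (blk r i)"
    using assms(1) by (auto simp: decomposable_scroll_data_def)
  have finK: "finite K" and CK: "C \<subseteq> proj_space K"
    using sc by (auto simp: smooth_curve_def smooth_variety_def projective_variety_def zirreducible_def)
  have "is_P1 K C" using assms(5) by (simp add: type2_component_def)
  then obtain \<xi> \<psi> where m: "morphism K C {..1::nat} (proj_space {..1}) \<xi>" "morphism {..1} (proj_space {..1}) K C \<psi>"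
    and inv: "\<forall>y\<in>C. \<psi> (\<xi> y) = y" "\<forall>z\<in>proj_space {..1}. \<xi> (\<psi> z) = z"
    unfolding is_P1_def isomorphism_def by blast
  note \<xi> = m inv[rule_format]
  have C_eq: "C = \<psi> ` proj_space {..1}"
  proof
    show "C \<subseteq> \<psi> ` proj_space {..1}"
    proof
      fix y assume "y \<in> C"
      then have "\<xi> y \<in> proj_space {..1}" "y = \<psi> (\<xi> y)" using \<xi>(1,3) by (auto simp: morphism_def)
      then show "y \<in> \<psi> ` proj_space {..1}" by blast
    qed
    show "\<psi> ` proj_space {..1} \<subseteq> C" using \<xi>(2) by (simp add: morphism_def)
  qed
  have finJ: "finite (blk r i)" for i by (simp add: blk_def)
  have "\<exists>e F. parametrized (blk r i) (\<lambda>z. \<phi> i (\<psi> z)) e F" if i: "i < n" for i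
  proof -
    obtain e F where eF: "\<And>j. j \<in> blk r i \<Longrightarrow> bform e (F j)"
      "\<And>a b. a \<noteq> 0 \<or> b \<noteq> 0 \<Longrightarrow> bvec (blk r i) F a b \<noteq> 0"
      "\<And>a b. a \<noteq> 0 \<or> b \<noteq> 0 \<Longrightarrow> \<phi> i (\<psi> (cv.span {bv a b})) = cv.span {bvec (blk r i) F a b}"
      "\<And>a b c d. a \<noteq> 0 \<or> b \<noteq> 0 \<Longrightarrow> c \<noteq> 0 \<or> d \<noteq> 0 \<Longrightarrow> cv.span {bvec (blk r i) F a b} = cv.span {bvec (blk r i) F c d}
         \<Longrightarrow> cv.span {bv a b} = cv.span {bv c d}"
      "\<And>a b x y. a \<noteq> 0 \<or> b \<noteq> 0 \<Longrightarrow> (\<forall>j\<in>blk r i. x * D0 (F j) a b + y * D1 (F j) a b = 0) \<Longrightarrow> x = 0 \<and> y = 0"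
      "\<And>h. (\<forall>a b. pair (blk r i) h (bvec (blk r i) F a b) = 0) \<Longrightarrow> \<forall>j\<in>blk r i. h j = 0"
      by (rule embedding_param[OF finK finJ CK \<xi> emb[OF i] nondeg[OF i]]) (assumption, assumption, rule that, assumption+)
    have "parametrized (blk r i) (\<lambda>z. \<phi> i (\<psi> z)) e F"
      unfolding parametrized_def
    proof (intro conjI)
      show "\<forall>j\<in>blk r i. bform e (F j)" using eF(1) by simp
      show "\<forall>a b. a \<noteq> 0 \<or> b \<noteq> 0 \<longrightarrow> bvec (blk r i) F a b \<noteq> 0" by (intro allI impI eF(2))
      show "\<forall>a b. a \<noteq> 0 \<or> b \<noteq> 0 \<longrightarrow> \<phi> i (\<psi> (cv.span {bv a b})) = cv.span {bvec (blk r i) F a b}" by (intro allI impI eF(3))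
      show "\<forall>a b c d. a \<noteq> 0 \<or> b \<noteq> 0 \<longrightarrow> c \<noteq> 0 \<or> d \<noteq> 0 \<longrightarrow> cv.span {bvec (blk r i) F a b} = cv.span {bvec (blk r i) F c d}
         \<longrightarrow> cv.span {bv a b} = cv.span {bv c d}" by (intro allI impI) (rule eF(4))
      show "\<forall>a b x y. a \<noteq> 0 \<or> b \<noteq> 0 \<longrightarrow> (\<forall>j\<in>blk r i. x * D0 (F j) a b + y * D1 (F j) a b = 0) \<longrightarrow> x = 0 \<and> y = 0"
        by (intro allI impI) (rule eF(5))
      show "\<forall>h. (\<forall>a b. pair (blk r i) h (bvec (blk r i) F a b) = 0) \<longrightarrow> (\<forall>j\<in>blk r i. h j = 0)" by (intro allI impI) (rule eF(6))
    qed
    then show ?thesis by blast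
  qed
  then obtain e F' where par: "\<And>i. i < n \<Longrightarrow> parametrized (blk r i) (\<lambda>z. \<phi> i (\<psi> z)) (e i) (F' i)" by metis
  note E = par[unfolded parametrized_def]
  \<comment> \<open>The locale takes one family indexed by all coordinates; the first component of
    an index names its block.\<close>
  define F where "F x = F' (fst x) x" for x :: "nat \<times> nat"
  have Fi: "bvec (blk r i) (F' i) = bvec (blk r i) F" for i
    by (auto simp: bvec_def F_def blk_def fun_eq_iff)
  have E1: "bform (e i) (F' i j)" if "i < n" "j \<in> blk r i" for i j using E[OF that(1)] that(2) by (elim conjE) blast
  have E2: "bvec (blk r i) F a b \<noteq> 0" if "i < n" "a \<noteq> 0 \<or> b \<noteq> 0" for i a b
    unfolding Fi[symmetric] using E[OF that(1)] that(2) by (elim conjE) blast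
  have \<phi>F: "\<phi> i (\<psi> (cv.span {bv a b})) = cv.span {bvec (blk r i) F a b}" if "i < n" "a \<noteq> 0 \<or> b \<noteq> 0" for i a b
    unfolding Fi[symmetric] using E[OF that(1)] that(2) by (elim conjE) blast
  have E4: "cv.span {bv a b} = cv.span {bv c d}" if "i < n" "a \<noteq> 0 \<or> b \<noteq> 0" "c \<noteq> 0 \<or> d \<noteq> 0"
    "cv.span {bvec (blk r i) F a b} = cv.span {bvec (blk r i) F c d}" for i a b c d
    by (rule E[OF that(1), THEN conjunct2, THEN conjunct2, THEN conjunct2, THEN conjunct1, THEN spec, THEN spec, THEN spec, THEN spec, THEN mp, THEN mp, THEN mp, OF that(2,3)])
      (use that(4) in \<open>simp only: Fi\<close>)
  have E5: "x = 0 \<and> y = 0" if "i < n" "a \<noteq> 0 \<or> b \<noteq> 0" "\<forall>j\<in>blk r i. x * D0 (F' i j) a b + y * D1 (F' i j) a b = 0" for i a b x y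
    by (rule E[OF that(1), THEN conjunct2, THEN conjunct2, THEN conjunct2, THEN conjunct2, THEN conjunct1, THEN spec, THEN spec, THEN spec, THEN spec, THEN mp, THEN mp, OF that(2,3)])
  have E6: "\<forall>j\<in>blk r i. h j = 0" if "i < n" "\<forall>a b. pair (blk r i) h (bvec (blk r i) F a b) = 0" for i h
    by (rule E[OF that(1), THEN conjunct2, THEN conjunct2, THEN conjunct2, THEN conjunct2, THEN conjunct2, THEN spec, THEN mp])
      (unfold Fi, rule that(2))
  interpret rational_curves n r e F
  proof
    show "n \<ge> 1" by (rule n1)
    fix i assume i: "i < n"
    show "bform (e i) (F (i, j))" if "j \<le> r i" for j using E1[OF i, of "(i, j)"] that by (simp add: F_def blk_def)
    show "\<exists>j\<le>r i. F (i, j) a b \<noteq> 0" if "a \<noteq> 0 \<or> b \<noteq> 0" for a b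
      using E2[OF i that] by (auto simp: bvec_eq_0 blk_def)
    show "cv.span {bv a b} = cv.span {bv c d}" if "a \<noteq> 0 \<or> b \<noteq> 0" "c \<noteq> 0 \<or> d \<noteq> 0"
      "cv.span {bvec (blk r i) F a b} = cv.span {bvec (blk r i) F c d}" for a b c d
      by (rule E4[OF i that])
    show "x = 0 \<and> y = 0" if "a \<noteq> 0 \<or> b \<noteq> 0" "\<forall>j\<le>r i. x * D0 (F (i, j)) a b + y * D1 (F (i, j)) a b = 0" for a b x y
      by (rule E5[OF i that(1)]) (use that(2) in \<open>auto simp: blk_def F_def\<close>)
    show "\<forall>j\<le>r i. h j = 0" if h: "\<forall>a b. (\<Sum>j\<le>r i. h j * F (i, j) a b) = 0" for h
    proof -
      have "pair (blk r i) (\<lambda>x. h (snd x)) (bvec (blk r i) F a b) = 0" for a b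
      proof -
        have "pair (blk r i) (\<lambda>x. h (snd x)) (bvec (blk r i) F a b) = (\<Sum>x\<in>Pair i ` {..r i}. h (snd x) * F x a b)"
          unfolding pair_def by (rule sum.cong) (auto simp: blk_def bvec_def)
        also have "\<dots> = (\<Sum>j\<le>r i. h j * F (i, j) a b)" by (simp add: sum.reindex inj_on_def)
        finally show ?thesis using h by simp
      qed
      then have "\<forall>x\<in>blk r i. h (snd x) = 0" using E6[OF i, of "\<lambda>x. h (snd x)"] by blast
      then show ?thesis by (auto simp: blk_def)
    qed
  qed
  have gs: "generated_scroll C \<phi> T = sset T" if "T \<subseteq> {..<n}" for T
    by (rule generated_scroll_eq[OF that C_eq \<phi>F])
  have \<phi>C: "\<phi> i ` C = {cv.span {bvec (blk r i) F a b} | a b. a \<noteq> 0 \<or> b \<noteq> 0}" if i: "i < n" for i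
  proof -
    have "\<phi> i ` C = {\<phi> i (\<psi> (cv.span {bv a b})) | a b. a \<noteq> 0 \<or> b \<noteq> 0}" unfolding C_eq proj1_points by blast
    also have "\<dots> = {cv.span {bvec (blk r i) F a b} | a b. a \<noteq> 0 \<or> b \<noteq> 0}" using \<phi>F[OF i] by (intro Collect_cong) metis
    finally show ?thesis .
  qed
  have deg: "curve_degree (blk r i) (\<phi> i ` C) = e i" if "i < n" for i by (rule curve_degree_eq[OF that \<phi>C[OF that]])
  have d_eq: "d i = e i" if "i < n" for i using assms(4)[OF that] deg[OF that] by simp
  obtain \<tau> s where \<tau>: "\<tau> permutes {..<n}" "1 \<le> s" "s \<le> n" "\<forall>i<s. is_line (\<phi> (\<tau> i) ` C)"
    "\<forall>i\<in>{s..<n}. curve_degree (blk r (\<tau> i)) (\<phi> (\<tau> i) ` C) \<ge> 2" "G = generated_scroll C \<phi> (\<tau> ` {..<s})"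
    using assms(5) unfolding type2_component_def by blast
  have \<tau>n: "\<tau> i < n" if "i < n" for i using permutes_in_image[OF \<tau>(1)] that by (metis lessThan_iff)
  define S where "S = \<tau> ` {..<s}"
  have Sn: "S \<subseteq> {..<n}" using \<tau>n \<tau>(3) by (auto simp: S_def)
  have S0: "S \<noteq> {}" using \<tau>(2) by (auto simp: S_def lessThan_empty_iff)
  \<comment> \<open>A nondegenerate line spans, hence fills, its ambient space. This forces
    \<open>r i = 1\<close>, and then degree 1.\<close>
  have line: "e i = 1 \<and> r i = 1" if "i \<in> S" for i
  proof -
    have i: "i < n" "is_line (\<phi> i ` C)" using that Sn \<tau>(4) by (auto simp: S_def)
    obtain U where U: "cv.subspace U" "cv.dim U = 2" "\<phi> i ` C = PP U" using i(2) unfolding is_line_def by blast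
    have "U \<noteq> {0}" using U(2) by (auto simp: dim_singleton_zero)
    then have "\<Union>(\<phi> i ` C) = U" using Union_PP[OF U(1)] U(3) by simp
    moreover have "cv.span U = U" using U(1) by (simp only: cv.span_eq_iff)
    ultimately have "PP U = proj_space (blk r i)" using nondeg[OF i(1)] unfolding lspan_def by (simp del: cv.span_eq_iff)
    then have "U = vecs (blk r i)" using PP_inj[OF U(1) subspace_vecs] by blast
    then have "card (blk r i) = 2" using U(2) dim_vecs[OF finJ, of i] by simp
    then have "r i = 1" by (simp add: blk_def)
    then show ?thesis using r_eq_1[OF i(1)] by simp
  qed
  have nonline: "e i \<ge> 2" if "i < n" "i \<notin> S" for i
  proof -
    have "i \<in> \<tau> ` {..<n}" using permutes_image[OF \<tau>(1)] that(1) by simp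
    then obtain k where k: "k < n" "i = \<tau> k" by auto
    then have "k \<ge> s" using that(2) by (force simp: S_def)
    then show ?thesis using \<tau>(5)[rule_format, of k] k deg[OF that(1)] by simp
  qed
  have DG: "osculating_hyperplanes (amb n r) X G = Dset"
    unfolding assms(2) \<tau>(6) gs[OF subset_refl] S_def[symmetric] gs[OF Sn]
    by (rule osculating_hyperplanes_eq[OF Sn S0 line nonline])
  \<comment> \<open>If every block were a line, the inflectional locus would be all of
    \<open>X\<close>; the hypothesis against this supplies a block of degree at least 2.\<close>
  have exnl: "\<exists>i<n. i \<notin> S"
  proof (rule ccontr)
    assume "\<not> ?thesis"
    then have "\<And>i. i < n \<Longrightarrow> e i = 1 \<and> r i = 1" using line by blast
    from inflectional_locus_lines[OF this] show False using assms(2,3) gs[OF subset_refl] by simp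
  qed
  \<comment> \<open>The permutation that comes with the component already puts the lines in front,
    and the other degrees are at least 2; what is left to decide is the upper bound 2.\<close>
  have small: "(\<exists>\<tau> s. \<tau> permutes {..<n} \<and> 1 \<le> s \<and> s \<le> n \<and> (\<forall>i<s. d (\<tau> i) = 1) \<and> (\<forall>i\<in>{s..<n}. d (\<tau> i) = 2)) \<longleftrightarrow> (\<forall>i<n. e i \<le> 2)"
  proof
    assume "\<exists>\<tau> s. \<tau> permutes {..<n} \<and> 1 \<le> s \<and> s \<le> n \<and> (\<forall>i<s. d (\<tau> i) = 1) \<and> (\<forall>i\<in>{s..<n}. d (\<tau> i) = 2)"
    then obtain \<tau>' s' where t: "\<tau>' permutes {..<n}" "\<forall>i<s'. d (\<tau>' i) = 1" "\<forall>i\<in>{s'..<n}. d (\<tau>' i) = 2" by blast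
    show "\<forall>i<n. e i \<le> 2"
    proof (intro allI impI)
      fix i assume i: "i < n"
      have "i \<in> \<tau>' ` {..<n}" using permutes_image[OF t(1)] i by simp
      then obtain k where k: "k < n" "i = \<tau>' k" by auto
      then have "d i = 1 \<or> d i = 2" using t(2,3) by (cases "k < s'") auto
      then show "e i \<le> 2" using d_eq[OF i] by auto
    qed
  next
    assume le: "\<forall>i<n. e i \<le> 2"
    have "d (\<tau> i) = 1" if "i < s" for i
    proof -
      have "\<tau> i \<in> S" "\<tau> i < n" using that \<tau>n \<tau>(3) by (auto simp: S_def)
      then show ?thesis using line d_eq by simp
    qed
    moreover have "d (\<tau> i) = 2" if "i \<in> {s..<n}" for i
    proof -
      have "\<tau> i < n" using that \<tau>n by simp
      moreover have "e (\<tau> i) \<ge> 2" using \<tau>(5)[rule_format, OF that] deg[OF \<open>\<tau> i < n\<close>] by simp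
      ultimately show ?thesis using le d_eq by (metis le_antisym)
    qed
    ultimately show "\<exists>\<tau> s. \<tau> permutes {..<n} \<and> 1 \<le> s \<and> s \<le> n \<and> (\<forall>i<s. d (\<tau> i) = 1) \<and> (\<forall>i\<in>{s..<n}. d (\<tau> i) = 2)"
      using \<tau>(1-3) by blast
  qed
  show ?thesis unfolding DG small
  proof
    assume "rational_normal_scroll (amb n r) Dset"
    then have "smooth_variety (amb n r) Dset" unfolding rational_normal_scroll_def scroll_over_def by blast
    then show "\<forall>i<n. e i \<le> 2" using smooth_Dset_imp_e_le_2 by blast
  next
    assume le: "\<forall>i<n. e i \<le> 2"
    show "rational_normal_scroll (amb n r) Dset"
    proof (rule Dset_conics)
      show "(e i = 1 \<and> r i = 1) \<or> (e i = 2 \<and> r i = 2)" if i: "i < n" for i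
      proof (cases "i \<in> S")
        case True then show ?thesis using line by blast
      next
        case False
        then have "e i = 2" using nonline[OF i] le i by (metis le_antisym)
        moreover have "r i \<noteq> 1" using r_eq_1[OF i] \<open>e i = 2\<close> by auto
        ultimately show ?thesis using r_pos[OF i] r_le_e[OF i] by auto
      qed
      show "\<exists>i<n. e i = 2" using exnl nonline le by (metis le_antisym)
    qed
  qed
qed

end
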